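(* Let $n=2$ and let $V=V_0\oplus V_1$ be a $2$-colored vector space over a field $\mathbb F$. Then the orbits in $K\backslash(\widetilde V\times\mathcal N)$ are parametrized by signed $2$-bipartitions (that is, the map $\Psi$ induces a bijection $\widetilde{\mathcal Q}_{\xi(V)}\to K\backslash(\widetilde V\times\mathcal N)$). If $(\lambda,\epsilon,\mu)$ is a signed $2$-bipartition of signature $\xi(V)$, then $$\dim\mathcal O_{\lambda,\epsilon}=\binom{\dim V}{2}-\eta(\lambda),$$ $$\dim\mathcal O_{\lambda,\epsilon,\mu}=\binom{\dim V}{2}-\eta(\lambda)+\sum_{i=1}^{l(\lambda)}\left\lceil\frac{\mu_i}{2}\right\rceil,$$ where $\eta(\lambda)=\sum_{i=1}^{l(\lambda)}(i-1)\lambda_i$.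
   Context: Write $[a]$ for the class of $a\in\mathbb Z$ in $\mathbb Z/2\mathbb Z$. A $2$-colored vector space is a finite-dimensional vector space over a field $\mathbb F$ with a decomposition $V=V_0\oplus V_1$ (indices in $\mathbb Z/2\mathbb Z$). Its signature is $\xi(V)=(\dim V_0,\dim V_1)$. Put $\widetilde V=V_0\cup V_1$, $K=GL(V_0)\times GL(V_1)$ and $\mathcal N=\{x\in\mathrm{End}(V): x\text{ nilpotent},\ xV_0\subset V_1,\ xV_1\subset V_0\}$. $K$ acts on $\mathcal N$ by conjugation and on $V\times\mathcal N$ by $k\cdot(v,x)=(kv,kxk^{-1})$. A partition is a weakly decreasing $\lambda:\mathbb N=\{1,2,\dots\}\to\mathbb Z^{\ge0}$ that is eventually $0$; $l(\lambda)=\#\{i:\lambda_i>0\}$. A ($2$-)colored partition is $(\lambda,\epsilon)$ with $\lambda$ a partition and $\epsilon:\mathbb N\to\mathbb Z/2\mathbb Z$ taking each value infinitely often. Its signature is $\xi_m(\lambda,\epsilon)=\#\{(i,j):1\le j\le\lambda_i,\ \epsilon_i+[\lambda_i-j]=m\}$. For a colored partition of signature $\xi(V)$, a colored Jordan basis of type $(\lambda,\epsilon)$ for $x\in\mathcal N$ is a basis $\{v_{i,j}:1\le i\le l(\lambda),1\le j\le\lambda_i\}$ of $V$ with $v_{i,j}\in V_{\epsilon_i+[\lambda_i-j]}$, $xv_{i,j}=v_{i,j-1}$ for $j>1$ and $xv_{i,1}=0$. Convention: $v_{i,j}=0$ for $j\le0$. $\mathcal O_{\lambda,\epsilon}\subset\mathcal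 N$ is the $K$-orbit of all $x$ admitting such a basis. A marking of $\lambda$ is $\mu:\mathbb N\to\mathbb Z$ with $\mu_i\le\lambda_i$; put $\nu=\lambda-\mu$. The marked colored partition $(\lambda,\epsilon,\mu)$ (of signature $\xi(\lambda,\epsilon)$) is a signed $2$-bipartition (= striped $2$-bipartition) if $\mu_i>-2$ for all $i$, $\mu_j<\mu_i+2$ and $\nu_j<\nu_i+2$ for all $i<j$, and $\epsilon_i+[\nu_i]=\epsilon_j+[\nu_j]$ for all $i,j$. $\Psi(\lambda,\epsilon,\mu)=\mathcal O_{\lambda,\epsilon,\mu}$, for a marked colored partition of signature $\xi(V)$, is the $K$-orbit of $(v,x)$, where $x\in\mathcal N$ has a colored Jordan basis $\{v_{i,j}\}$ of type $(\lambda,\epsilon)$ and $v=\sum_{i=1}^{l(\lambda)}v_{i,\mu_i}$; it is independent of choices. Weak equivalence of marked colored partitions: $(\lambda,\epsilon,\mu)\sim(\alpha,\beta,\gamma)$ if there is a permutation $\sigma$ of $\mathbb N$ with $\alpha=\lambda\circ\sigma$, $\beta=\epsilon\circ\sigma$, and $\gamma_i=\mu_{\sigma(i)}$ whenever $\gamma_i>0$ or $\mu_{\sigma(i)}>0$. $\widetilde{\mathcal Q}_f$ is the set of weak equivalence classes of marked colored partitions of signature $f$ containing at least one signed $2$-bipartition. $\Psi$ is constant on these classes. *)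

theory Defs
  imports
    "HOL-Library.Z2"
    "HOL-Analysis.Abstract_Topology"
    "HOL-Algebra.Algebraic_Closure_Type"
begin

text \<open>
  The type \<open>bit\<close> is the field with two elements; it serves as \<open>\<int>/2\<int>\<close>, and the class of an
  integer is its image under \<open>of_int\<close> (or \<open>of_nat\<close>).

  Rows of partitions are indexed by \<open>i = 0, 1, 2, \<dots>\<close> instead of \<open>i = 1, 2, 3, \<dots>\<close>, so that
  \<open>lam i\<close> is the usual \<open>(i+1)\<close>-st part. Columns are indexed by \<open>j = 1, 2, \<dots>\<close>.
\<close>

definition is_partition :: "(nat \<Rightarrow> nat) \<Rightarrow> bool" where
  "is_partition lam \<longleftrightarrow> antimono lam \<and> (\<exists>N. \<forall>i\<ge>N. lam i = 0)"

definition part_length :: "(nat \<Rightarrow> nat) \<Rightarrow> nat" where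
  "part_length lam = card {i. lam i > 0}"

text \<open>The factor \<open>i\<close> is the usual \<open>i - 1\<close> because rows are indexed from \<open>0\<close>.\<close>

definition eta :: "(nat \<Rightarrow> nat) \<Rightarrow> nat" where
  "eta lam = (\<Sum>i<part_length lam. i * lam i)"

definition diagram :: "(nat \<Rightarrow> nat) \<Rightarrow> (nat \<times> nat) set" where
  "diagram lam = {(i, j). 1 \<le> j \<and> j \<le> lam i}"

definition box_color :: "(nat \<Rightarrow> nat) \<Rightarrow> (nat \<Rightarrow> bit) \<Rightarrow> nat \<Rightarrow> nat \<Rightarrow> bit" where
  "box_color lam eps i j = eps i + of_int (int (lam i) - int j)"

definition is_colored_partition :: "(nat \<Rightarrow> nat) \<Rightarrow> (nat \<Rightarrow> bit) \<Rightarrow> bool" where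
  "is_colored_partition lam eps \<longleftrightarrow> is_partition lam \<and> (\<forall>m. infinite {i. eps i = m})"

definition part_signature :: "(nat \<Rightarrow> nat) \<Rightarrow> (nat \<Rightarrow> bit) \<Rightarrow> bit \<Rightarrow> nat" where
  "part_signature lam eps m = card {(i, j) \<in> diagram lam. box_color lam eps i j = m}"

type_synonym marked_partition = "(nat \<Rightarrow> nat) \<times> (nat \<Rightarrow> bit) \<times> (nat \<Rightarrow> int)"

definition marked_colored_partitions :: "(bit \<Rightarrow> nat) \<Rightarrow> marked_partition set" where
  "marked_colored_partitions f =
     {(lam, eps, mu). is_colored_partition lam eps \<and> (\<forall>i. mu i \<le> int (lam i)) \<and>
        part_signature lam eps = f}"

definition signed_2_bipartitions :: "(bit \<Rightarrow> nat) \<Rightarrow> marked_partition set" where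
  "signed_2_bipartitions f =
     {(lam, eps, mu) \<in> marked_colored_partitions f.
        let nu = (\<lambda>i. int (lam i) - mu i) in
        (\<forall>i. mu i > - 2) \<and>
        (\<forall>i j. i < j \<longrightarrow> mu j < mu i + 2 \<and> nu j < nu i + 2) \<and>
        (\<forall>i j. eps i + of_int (nu i) = eps j + of_int (nu j))}"

definition weak_equivalence :: "(bit \<Rightarrow> nat) \<Rightarrow> (marked_partition \<times> marked_partition) set" where
  "weak_equivalence f =
     {((lam, eps, mu), (alpha, beta, gamma)).
        (lam, eps, mu) \<in> marked_colored_partitions f \<and>
        (alpha, beta, gamma) \<in> marked_colored_partitions f \<and>
        (\<exists>s. bij s \<and> alpha = lam \<circ> s \<and> beta = eps \<circ> s \<and>
           (\<forall>i. gamma i > 0 \<or> mu (s i) > 0 \<longrightarrow> gamma i = mu (s i)))}"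

definition signed_2_bipartition_classes :: "(bit \<Rightarrow> nat) \<Rightarrow> marked_partition set set" where
  "signed_2_bipartition_classes f =
     {C \<in> marked_colored_partitions f // weak_equivalence f. C \<inter> signed_2_bipartitions f \<noteq> {}}"


text \<open>
  Polynomial functions on affine space, in coordinates indexed by \<open>'i\<close>. Each of them involves
  only finitely many coordinates. They are only used over infinite (algebraically closed) fields.
\<close>

inductive_set polynomial_functions :: "(('i \<Rightarrow> 'e::field) \<Rightarrow> 'e) set" where
  const: "(\<lambda>_. c) \<in> polynomial_functions"
| coord: "(\<lambda>p. p i) \<in> polynomial_functions"
| add: "f \<in> polynomial_functions \<Longrightarrow> g \<in> polynomial_functions \<Longrightarrow>
    (\<lambda>p. f p + g p) \<in> polynomial_functions"
| mult: "f \<in> polynomial_functions \<Longrightarrow> g \<in> polynomial_functions \<Longrightarrow>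
    (\<lambda>p. f p * g p) \<in> polynomial_functions"

definition zariski_topology :: "('i \<Rightarrow> 'e::field) topology" where
  "zariski_topology = topology_generated_by {{p. f p \<noteq> 0} | f. f \<in> polynomial_functions}"

definition irreducible_closed :: "'p topology \<Rightarrow> 'p set \<Rightarrow> bool" where
  "irreducible_closed T Z \<longleftrightarrow> closedin T Z \<and> Z \<noteq> {} \<and>
     (\<forall>A B. closedin T A \<and> closedin T B \<and> Z \<subseteq> A \<union> B \<longrightarrow> Z \<subseteq> A \<or> Z \<subseteq> B)"

text \<open>
  Krull dimension. As a supremum of natural numbers it is meaningful for spaces in which the length
  of chains is bounded, such as subspaces of a finite-dimensional affine space.
\<close>

definition krull_dimension :: "'p topology \<Rightarrow> nat" where
  "krull_dimension T = Sup {n. \<exists>Z :: nat \<Rightarrow> 'p set.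
     (\<forall>i\<le>n. irreducible_closed T (Z i)) \<and> (\<forall>i<n. Z i \<subset> Z (Suc i))}"

definition variety_dimension :: "('i \<Rightarrow> 'e::field) set \<Rightarrow> nat" where
  "variety_dimension S = krull_dimension (subtopology zariski_topology S)"


locale two_colored_space = vector_space scale
  for scale :: "'a::field \<Rightarrow> 'v::ab_group_add \<Rightarrow> 'v" +
  fixes V :: "bit \<Rightarrow> 'v set"
  assumes finite_dimensional: "\<exists>B. finite B \<and> span B = UNIV"
    and subspace_V: "subspace (V m)"
    and V_sum: "\<exists>v0\<in>V 0. \<exists>v1\<in>V 1. v = v0 + v1"
    and V_disjoint: "V 0 \<inter> V 1 = {0}"
begin

definition space_signature :: "bit \<Rightarrow> nat" where
  "space_signature m = dim (V m)"

definition homogeneous_vectors :: "'v set" where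
  "homogeneous_vectors = V 0 \<union> V 1"

text \<open>\<open>GL(V\<^sub>0) \<times> GL(V\<^sub>1)\<close>, embedded block-diagonally in \<open>GL(V)\<close>.\<close>

definition K_group :: "('v \<Rightarrow> 'v) set" where
  "K_group = {k. Vector_Spaces.linear scale scale k \<and> bij k \<and> (\<forall>m. k ` V m = V m)}"

definition nilpotent_cone :: "('v \<Rightarrow> 'v) set" where
  "nilpotent_cone = {x. Vector_Spaces.linear scale scale x \<and> (\<exists>n. \<forall>v. (x ^^ n) v = 0) \<and>
     x ` V 0 \<subseteq> V 1 \<and> x ` V 1 \<subseteq> V 0}"

definition K_orbit :: "'v \<times> ('v \<Rightarrow> 'v) \<Rightarrow> ('v \<times> ('v \<Rightarrow> 'v)) set" where
  "K_orbit p = {(k (fst p), k \<circ> snd p \<circ> inv_into UNIV k) | k. k \<in> K_group}"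

definition orbit_space :: "('v \<times> ('v \<Rightarrow> 'v)) set set" where
  "orbit_space = K_orbit ` (homogeneous_vectors \<times> nilpotent_cone)"

definition colored_jordan_basis ::
    "(nat \<Rightarrow> nat) \<Rightarrow> (nat \<Rightarrow> bit) \<Rightarrow> ('v \<Rightarrow> 'v) \<Rightarrow> (nat \<Rightarrow> nat \<Rightarrow> 'v) \<Rightarrow> bool" where
  "colored_jordan_basis lam eps x b \<longleftrightarrow>
     inj_on (\<lambda>(i, j). b i j) (diagram lam) \<and>
     independent ((\<lambda>(i, j). b i j) ` diagram lam) \<and>
     span ((\<lambda>(i, j). b i j) ` diagram lam) = UNIV \<and>
     (\<forall>(i, j)\<in>diagram lam. b i j \<in> V (box_color lam eps i j) \<and>
        x (b i j) = (if j > 1 then b i (j - 1) else 0))"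

definition nilpotent_orbit :: "(nat \<Rightarrow> nat) \<Rightarrow> (nat \<Rightarrow> bit) \<Rightarrow> ('v \<Rightarrow> 'v) set" where
  "nilpotent_orbit lam eps = {x \<in> nilpotent_cone. \<exists>b. colored_jordan_basis lam eps x b}"

text \<open>The convention \<open>v\<^bsub>i,j\<^esub> = 0\<close> for \<open>j \<le> 0\<close> is made explicit.\<close>

definition marked_vector ::
    "(nat \<Rightarrow> nat) \<Rightarrow> (nat \<Rightarrow> int) \<Rightarrow> (nat \<Rightarrow> nat \<Rightarrow> 'v) \<Rightarrow> 'v" where
  "marked_vector lam mu b =
     (\<Sum>i<part_length lam. if mu i > 0 then b i (nat (mu i)) else 0)"

text \<open>
  The orbit of \<open>(v, x)\<close> does not depend on the choice of \<open>x\<close> and of the basis, so the union below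
  is a union of equal orbits.
\<close>

definition Psi :: "marked_partition \<Rightarrow> ('v \<times> ('v \<Rightarrow> 'v)) set" where
  "Psi = (\<lambda>(lam, eps, mu).
     \<Union>{K_orbit (marked_vector lam mu b, x) | x b.
         x \<in> nilpotent_cone \<and> colored_jordan_basis lam eps x b})"


text \<open>
  Dimensions of orbits. Over an arbitrary (possibly finite) field the dimension of an orbit as a
  variety is the dimension of its geometric orbit, that is, of the orbit of
  \<open>GL(V\<^sub>0 \<otimes> E) \<times> GL(V\<^sub>1 \<otimes> E)\<close> through its points, where \<open>E\<close> is the algebraic closure of the ground
  field. The space \<open>V \<otimes> E\<close> and its endomorphisms are written in coordinates with respect to a
  basis \<open>B\<close> of \<open>V\<close> adapted to the decomposition; a different basis changes the geometric orbit
  by a linear isomorphism only. All coordinates outside of \<open>B\<close> vanish.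
\<close>

definition adapted_basis :: "'v set \<Rightarrow> bool" where
  "adapted_basis B \<longleftrightarrow> independent B \<and> span B = UNIV \<and> B \<subseteq> V 0 \<union> V 1"

text \<open>Pairs \<open>(g, g\<^sup>-\<^sup>1)\<close> of block-diagonal matrices over \<open>E\<close>.\<close>

definition geometric_group ::
    "'v set \<Rightarrow> (('v \<Rightarrow> 'v \<Rightarrow> 'a alg_closure) \<times> ('v \<Rightarrow> 'v \<Rightarrow> 'a alg_closure)) set" where
  "geometric_group B = {(g, h).
     (\<forall>b c. g b c \<noteq> 0 \<or> h b c \<noteq> 0 \<longrightarrow> (\<exists>m. b \<in> B \<inter> V m \<and> c \<in> B \<inter> V m)) \<and>
     (\<forall>b\<in>B. \<forall>c\<in>B. (\<Sum>d\<in>B. g b d * h d c) = (if b = c then 1 else 0)) \<and>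
     (\<forall>b\<in>B. \<forall>c\<in>B. (\<Sum>d\<in>B. h b d * g d c) = (if b = c then 1 else 0))}"

definition geometric_vector ::
    "'v set \<Rightarrow> ('v \<Rightarrow> 'v \<Rightarrow> 'a alg_closure) \<Rightarrow> 'v \<Rightarrow> 'v \<Rightarrow> 'a alg_closure" where
  "geometric_vector B g v = (\<lambda>b. \<Sum>c\<in>B. g b c * to_ac (representation B v c))"

definition geometric_conjugate ::
    "'v set \<Rightarrow> ('v \<Rightarrow> 'v \<Rightarrow> 'a alg_closure) \<Rightarrow> ('v \<Rightarrow> 'v \<Rightarrow> 'a alg_closure) \<Rightarrow>
     ('v \<Rightarrow> 'v) \<Rightarrow> 'v \<times> 'v \<Rightarrow> 'a alg_closure" where
  "geometric_conjugate B g h x =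
     (\<lambda>(b, c). \<Sum>d\<in>B. \<Sum>e\<in>B. g b d * to_ac (representation B (x e) d) * h e c)"

definition cone_orbit_dimension :: "('v \<Rightarrow> 'v) set \<Rightarrow> nat" where
  "cone_orbit_dimension S = (let B = SOME B. adapted_basis B in
     variety_dimension
       {geometric_conjugate B g h x | g h x. (g, h) \<in> geometric_group B \<and> x \<in> S})"

definition enhanced_orbit_dimension :: "('v \<times> ('v \<Rightarrow> 'v)) set \<Rightarrow> nat" where
  "enhanced_orbit_dimension S = (let B = SOME B. adapted_basis B in
     variety_dimension
       {case_sum (geometric_vector B g v) (geometric_conjugate B g h x) | g h v x.
          (g, h) \<in> geometric_group B \<and> (v, x) \<in> S})"

end

end

theory Submission
  imports Defs "HOL-Library.FuncSet" "HOL-Library.Infinite_Set" "Jordan_Normal_Form.Determinant"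
begin

text \<open>
  A nilpotent \<open>x\<close> has a Jordan basis whose chains start at a basis of \<open>ker x\<close> that is adapted to the
  images of the powers of \<open>x\<close> and to the grading. Given a homogeneous \<open>v\<close>, let \<open>mu i\<close> be the highest box
  of row \<open>i\<close> occurring in \<open>v\<close>. As long as \<open>mu\<close> or \<open>nu\<close> violates the inequalities of a signed bipartition,
  a change of basis by an endomorphism commuting with \<open>x\<close> raises a mark; at the end, lower terms are absorbed
  into the basis vectors. Conversely \<open>lam\<close> and \<open>eps\<close> are recovered from the kernels of the powers of \<open>x\<close>, and the
  positive marks from the images of \<open>v\<close> under the graded commutant of \<open>x\<close>.

  The stabilizer of \<open>(v, x)\<close> is the group of units in an affine subspace \<open>1 + S\<close> with an explicit
  basis of \<open>S\<close> dual to some of the matrix entries. The remaining entries span a slice, whose coordinate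
  subspaces sweep out a strict chain of irreducible closed subsets of the orbit. A longer chain is impossible:
  choosing at each step a function that vanishes on the smaller set but not on the larger one gives more
  linearly independent monomials than there are polynomials of the corresponding degree on the slice.
  Counting boxes of equal color turns \<open>dim K - dim S\<close> into the stated formula.
\<close>

text \<open>Why the signature drops out: let d be the number of boxes and s the number of boxes of
  color 0 minus that of color 1. Twice the number of entries of a block matrix is d^2 + s^2, and
  twice the dimension of the graded commutant of x is d + 2 \<open>eta\<close> + s^2. The squares of
  s cancel, which leaves the binomial coefficient minus \<open>eta\<close>; fixing v lowers the
  dimension of the stabilizer by the sum of the ceilings. The orbit is known only as an image of a
  group, so functions on it are pulled back to block matrices, where a power of the determinant
  clears denominators. The functions found along a chain are constant on cosets of the stabilizer,
  while the entries at \<open>NP\<close> take arbitrary values along generic cosets. Hence both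
  kinds together are algebraically independent, on an affine space with
  \<open>card positions\<close> coordinates. The orbit of x alone is treated as the orbit of (0, x),
  that is, through the zero marking. This marking violates the color condition already on empty
  rows, so the stabilizer is computed under the weaker condition \<open>dominate\<close>, which both
  cases satisfy.\<close>

section \<open>Partitions, parity in \<open>bit\<close>, infinite fields\<close>

lemma partition_support:
  assumes "is_partition lam"
  shows "lam i > 0 \<longleftrightarrow> i < part_length lam"
proof -
  obtain M where M: "\<forall>i\<ge>M. lam i = 0" and anti: "antimono lam"
    using assms by (auto simp: is_partition_def)
  define m where "m = (LEAST m. lam m = 0)"
  have m0: "lam m = 0" unfolding m_def by (rule LeastI[of _ M]) (use M in simp)
  have "lam i > 0 \<longleftrightarrow> i < m" for i
  proof
    assume "lam i > 0"
    then show "i < m" using antimonoD[OF anti, of m i] m0 by (cases "m \<le> i") auto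
  next
    assume "i < m"
    then show "lam i > 0" using not_less_Least[of i "\<lambda>m. lam m = 0"] by (simp add: m_def)
  qed
  then have "{i. lam i > 0} = {..<m}" by auto
  then show ?thesis using \<open>lam i > 0 \<longleftrightarrow> i < m\<close> by (simp add: part_length_def)
qed

lemma diagram_Sigma:
  assumes "is_partition lam"
  shows "diagram lam = Sigma {..<part_length lam} (\<lambda>i. {1..lam i})"
  by (auto simp: diagram_def simp flip: partition_support[OF assms])

lemma finite_diagram: "is_partition lam \<Longrightarrow> finite (diagram lam)"
  by (simp add: diagram_Sigma)

lemma of_int_bit: "(of_int z :: bit) = (if even z then 0 else 1)"
proof (cases "even z")
  case True
  then obtain w where "z = w + w" by (metis dvdE mult_2)
  then have "(of_int z :: bit) = of_int w + of_int w" by (simp only: of_int_add)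
  also have "\<dots> = 0" by (cases "of_int w :: bit") simp_all
  finally show ?thesis using True by simp
next
  case False
  then obtain w where "z = w + w + 1" by (metis oddE mult_2)
  then have "(of_int z :: bit) = of_int w + of_int w + 1" by (simp only: of_int_add of_int_1)
  also have "\<dots> = 1" by (cases "of_int w :: bit") simp_all
  finally show ?thesis using False by simp
qed

text \<open>Over a finite field, 1 plus the product of all linear polynomials X - a is a
  non-constant polynomial without a root.\<close>

lemma infinite_UNIV_alg_closed_field: "infinite (UNIV :: 'e::alg_closed_field set)"
proof
  assume fin: "finite (UNIV :: 'e set)"
  define P :: "'e poly" where "P = (\<Prod>a\<in>UNIV. [:- a, 1:])"
  have degP: "degree P = card (UNIV :: 'e set)"
    unfolding P_def by (subst degree_prod_eq_sum_degree) auto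
  have "card (UNIV :: 'e set) > 0"
    using fin by (simp add: card_gt_0_iff)
  then have "degree (P + 1) > 0"
    using degP by (subst degree_add_eq_left) auto
  then obtain x where "poly (P + 1) x = 0"
    using alg_closed_imp_poly_has_root by blast
  moreover have "poly P x = 0"
    unfolding P_def poly_prod using fin by (intro prod_zero) auto
  ultimately show False
    by simp
qed

section \<open>Polynomial functions\<close>

lemma poly_fun_sum:
  assumes "\<And>a. a \<in> A \<Longrightarrow> f a \<in> polynomial_functions"
  shows "(\<lambda>p. \<Sum>a\<in>A. f a p) \<in> polynomial_functions"
proof (cases "finite A")
  case True
  then show ?thesis
    using assms
    by (induction A rule: finite_induct) (auto intro: polynomial_functions.intros)
qed (auto intro: polynomial_functions.intros)

lemma poly_fun_prod:
  assumes "\<And>a. a \<in> A \<Longrightarrow> f a \<in> polynomial_functions"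
  shows "(\<lambda>p. \<Prod>a\<in>A. f a p) \<in> polynomial_functions"
proof (cases "finite A")
  case True
  then show ?thesis
    using assms
    by (induction A rule: finite_induct) (auto intro: polynomial_functions.intros)
qed (auto intro: polynomial_functions.intros)

lemma poly_fun_power:
  "f \<in> polynomial_functions \<Longrightarrow> (\<lambda>p. f p ^ n) \<in> polynomial_functions"
  by (induction n) (auto intro: polynomial_functions.intros)

lemma poly_fun_uminus:
  assumes "f \<in> polynomial_functions"
  shows "(\<lambda>p. - f p) \<in> polynomial_functions"
  using polynomial_functions.mult[OF polynomial_functions.const[of "-1"] assms] by simp

lemma poly_fun_diff:
  assumes "f \<in> polynomial_functions" "g \<in> polynomial_functions"
  shows "(\<lambda>p. f p - g p) \<in> polynomial_functions"
  using polynomial_functions.add[OF assms(1) poly_fun_uminus[OF assms(2)]] by simp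

lemma poly_fun_If:
  assumes "b \<Longrightarrow> f \<in> polynomial_functions" "\<not> b \<Longrightarrow> g \<in> polynomial_functions"
  shows "(\<lambda>p. if b then f p else g p) \<in> polynomial_functions"
  using assms by (cases b) auto

lemmas poly_fun_intros =
  polynomial_functions.intros poly_fun_sum poly_fun_prod poly_fun_power poly_fun_uminus
  poly_fun_diff poly_fun_If

lemma poly_fun_compose:
  assumes "f \<in> polynomial_functions" "\<And>i. (\<lambda>p. F p i) \<in> polynomial_functions"
  shows "(\<lambda>p. f (F p)) \<in> polynomial_functions"
  using assms(1) by induction (auto intro: polynomial_functions.intros assms(2))

lemma poly_fun_line:
  assumes "f \<in> polynomial_functions"
  shows "\<exists>P. \<forall>s. f (\<lambda>i. p i + s * (q i - p i)) = poly P s"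
  using assms
proof induction
  case (const c)
  then show ?case by (intro exI[of _ "[:c:]"]) simp
next
  case (coord i)
  then show ?case by (intro exI[of _ "[:p i, q i - p i:]"]) simp
next
  case (add f g)
  then obtain P Q where "\<forall>s. f (\<lambda>i. p i + s * (q i - p i)) = poly P s"
    "\<forall>s. g (\<lambda>i. p i + s * (q i - p i)) = poly Q s" by blast
  then show ?case by (intro exI[of _ "P + Q"]) simp
next
  case (mult f g)
  then obtain P Q where "\<forall>s. f (\<lambda>i. p i + s * (q i - p i)) = poly P s"
    "\<forall>s. g (\<lambda>i. p i + s * (q i - p i)) = poly Q s" by blast
  then show ?case by (intro exI[of _ "P * Q"]) simp
qed

text \<open>Affine space is irreducible: restrict to the line through a non-zero of either factor.\<close>

lemma poly_fun_mult_nonzero: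
  fixes f g :: "('i \<Rightarrow> 'e::alg_closed_field) \<Rightarrow> 'e"
  assumes "f \<in> polynomial_functions" "g \<in> polynomial_functions" "f p \<noteq> 0" "g q \<noteq> 0"
  shows "\<exists>r. f r \<noteq> 0 \<and> g r \<noteq> 0"
proof -
  obtain P where P: "\<And>s. f (\<lambda>i. p i + s * (q i - p i)) = poly P s"
    using poly_fun_line[OF assms(1)] by blast
  obtain Q where Q: "\<And>s. g (\<lambda>i. p i + s * (q i - p i)) = poly Q s"
    using poly_fun_line[OF assms(2)] by blast
  have "P \<noteq> 0" "Q \<noteq> 0"
    using P[of 0] Q[of 1] assms(3,4) by auto
  then have "finite {s. poly (P * Q) s = 0}"
    by (intro poly_roots_finite) simp
  then have "{s. poly (P * Q) s = 0} \<noteq> UNIV"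
    using infinite_UNIV_alg_closed_field by metis
  then obtain s where "poly (P * Q) s \<noteq> 0"
    by blast
  then show ?thesis
    using P Q by (metis mult_eq_0_iff poly_mult)
qed

section \<open>The Zariski topology\<close>

lemma openin_zariski_basic:
  "f \<in> polynomial_functions \<Longrightarrow> openin zariski_topology {p. f p \<noteq> 0}"
  unfolding zariski_topology_def by (rule topology_generated_by_Basis) blast

lemma topspace_zariski [simp]: "topspace (zariski_topology :: ('i \<Rightarrow> 'e::field) topology) = UNIV"
proof -
  have "openin zariski_topology {p :: 'i \<Rightarrow> 'e. (1 :: 'e) \<noteq> 0}"
    by (rule openin_zariski_basic) (rule polynomial_functions.const)
  then show ?thesis
    using openin_subset by fastforce
qed

text \<open>Multiplying functions intersects their non-vanishing sets, so the generating family of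
  the topology is already a basis.\<close>

lemma openin_zariski_separate:
  assumes "openin zariski_topology U" "z \<in> U"
  shows "\<exists>f\<in>polynomial_functions. f z \<noteq> 0 \<and> {p. f p \<noteq> 0} \<subseteq> U"
proof -
  have "generate_topology_on {{p. f p \<noteq> 0} | f. f \<in> polynomial_functions} U"
    using assms(1) unfolding zariski_topology_def by (simp add: openin_topology_generated_by_iff)
  then show ?thesis
    using assms(2)
  proof (induction arbitrary: z)
    case (Int a b)
    obtain f where f: "f \<in> polynomial_functions" "f z \<noteq> 0" "{p. f p \<noteq> 0} \<subseteq> a"
      using Int.IH(1)[OF IntD1[OF Int.prems]] by (elim bexE conjE)
    obtain g where g: "g \<in> polynomial_functions" "g z \<noteq> 0" "{p. g p \<noteq> 0} \<subseteq> b"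
      using Int.IH(2)[OF IntD2[OF Int.prems]] by (elim bexE conjE)
    have "{p. f p * g p \<noteq> 0} \<subseteq> a \<inter> b" using f(3) g(3) by auto
    with f g show ?case
      by (intro bexI[of _ "\<lambda>p. f p * g p"] polynomial_functions.mult) simp_all
  next
    case (UN K)
    then obtain k where k: "k \<in> K" "z \<in> k" by blast
    obtain f where f: "f \<in> polynomial_functions" "f z \<noteq> 0" "{p. f p \<noteq> 0} \<subseteq> k"
      using UN.IH[OF k] by (elim bexE conjE)
    have "{p. f p \<noteq> 0} \<subseteq> \<Union>K" using f(3) k(1) by (rule order_trans[OF _ Union_upper])
    with f show ?case by (intro bexI[of _ f] conjI)
  next
    case (Basis s)
    then obtain f where f: "f \<in> polynomial_functions" "s = {p. f p \<noteq> 0}" by (auto simp only: mem_Collect_eq)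
    with Basis.prems show ?case by (intro bexI[of _ f]) simp_all
  qed simp
qed

lemma closedin_zariski_separate:
  assumes "closedin (subtopology zariski_topology S) C" "z \<in> S" "z \<notin> C"
  shows "\<exists>f\<in>polynomial_functions. f z \<noteq> 0 \<and> (\<forall>c\<in>C. f c = 0)"
proof -
  obtain T where T: "closedin zariski_topology T" "C = T \<inter> S"
    using assms(1) by (auto simp: closedin_subtopology)
  have "openin zariski_topology (- T)"
    using T(1) by (simp add: closedin_def Compl_eq_Diff_UNIV)
  moreover have "z \<in> - T"
    using assms T by blast
  ultimately obtain f where "f \<in> polynomial_functions" "f z \<noteq> 0" "{p. f p \<noteq> 0} \<subseteq> - T"
    using openin_zariski_separate by blast
  then show ?thesis
    using T(2) by blast
qed

lemma closedin_zariski_zeros: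
  assumes "F \<subseteq> polynomial_functions"
  shows "closedin (subtopology zariski_topology S) {y\<in>S. \<forall>f\<in>F. f y = 0}"
proof -
  have "closedin zariski_topology (UNIV - (\<Union>f\<in>F. {p. f p \<noteq> 0}))"
    by (rule closedin_diff[of zariski_topology UNIV, simplified])
      (use assms in \<open>auto intro!: openin_zariski_basic simp: closedin_def\<close>)
  moreover have "{y\<in>S. \<forall>f\<in>F. f y = 0} = (UNIV - (\<Union>f\<in>F. {p. f p \<noteq> 0})) \<inter> S"
    by auto
  ultimately show ?thesis
    by (auto simp: closedin_subtopology)
qed

text \<open>The zero sets of the two factors cover \<open>Z\<close>. This is irreducibility as
  primality of the vanishing ideal, the form in which \<open>mon_independent\<close> takes it; that
  lemma is later applied also to coordinate subspaces, for which primality is shown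
  directly.\<close>

lemma irreducible_closed_mult:
  assumes "irreducible_closed (subtopology zariski_topology S) Z"
    "f \<in> polynomial_functions" "g \<in> polynomial_functions" "\<forall>z\<in>Z. f z * g z = 0"
  shows "(\<forall>z\<in>Z. f z = 0) \<or> (\<forall>z\<in>Z. g z = 0)"
proof -
  let ?A = "{y\<in>S. \<forall>h\<in>{f}. h y = 0}" and ?B = "{y\<in>S. \<forall>h\<in>{g}. h y = 0}"
  have "Z \<subseteq> S"
    using assms(1) closedin_subset unfolding irreducible_closed_def by fastforce
  then have "Z \<subseteq> ?A \<union> ?B"
    using assms(4) by auto
  moreover have "closedin (subtopology zariski_topology S) ?A" "closedin (subtopology zariski_topology S) ?B"
    using assms(2,3) by (auto intro!: closedin_zariski_zeros simp del: ball_simps)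
  ultimately have "Z \<subseteq> ?A \<or> Z \<subseteq> ?B"
    using assms(1) unfolding irreducible_closed_def by blast
  then show ?thesis
    by auto
qed

lemma krull_dimension_eqI:
  assumes "\<forall>i\<le>d. irreducible_closed T (Z i)" "\<forall>i<d. Z i \<subset> Z (Suc i)"
    and "\<And>n Z. \<forall>i\<le>n. irreducible_closed T (Z i) \<Longrightarrow> \<forall>i<n. Z i \<subset> Z (Suc i) \<Longrightarrow> n \<le> d"
  shows "krull_dimension T = d"
  unfolding krull_dimension_def
  by (rule cSup_eq_maximum) (use assms in blast)+

lemma irreducible_closed_homeomorphic:
  assumes "homeomorphic_maps T U f g" "irreducible_closed T Z"
  shows "irreducible_closed U (f ` Z)"
proof -
  have hf: "homeomorphic_map T U f" and hg: "homeomorphic_map U T g"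
    using assms(1) homeomorphic_maps_map by blast+
  have gf: "\<And>x. x \<in> topspace T \<Longrightarrow> g (f x) = x" and fg: "\<And>y. y \<in> topspace U \<Longrightarrow> f (g y) = y"
    using assms(1) by (auto simp: homeomorphic_maps_def)
  have ZX: "Z \<subseteq> topspace T" "closedin T Z" "Z \<noteq> {}"
    using assms(2) closedin_subset unfolding irreducible_closed_def by auto
  show ?thesis
    unfolding irreducible_closed_def
  proof (intro conjI allI impI)
    show "closedin U (f ` Z)"
      using homeomorphic_map_closedness_eq[OF hf] ZX by blast
    show "f ` Z \<noteq> {}"
      using ZX by simp
    fix A B
    assume AB: "closedin U A \<and> closedin U B \<and> f ` Z \<subseteq> A \<union> B"
    then have sub: "A \<subseteq> topspace U" "B \<subseteq> topspace U"
      using closedin_subset by blast+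
    have fgA: "f ` g ` A = A" and fgB: "f ` g ` B = B"
      using fg sub by (auto simp: image_image subset_iff intro!: image_eqI[of _ f])
    have "closedin T (g ` A)" "closedin T (g ` B)"
      using homeomorphic_map_closedness_eq[OF hg] AB by blast+
    moreover have "Z \<subseteq> g ` A \<union> g ` B"
    proof
      fix z assume "z \<in> Z"
      then have "f z \<in> A \<union> B" "z = g (f z)"
        using AB gf ZX by auto
      then show "z \<in> g ` A \<union> g ` B" by blast
    qed
    ultimately have "Z \<subseteq> g ` A \<or> Z \<subseteq> g ` B"
      using assms(2) unfolding irreducible_closed_def by blast
    then show "f ` Z \<subseteq> A \<or> f ` Z \<subseteq> B"
    proof (elim disjE)
      assume "Z \<subseteq> g ` A"
      then have "f ` Z \<subseteq> f ` g ` A" by blast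
      then show ?thesis using fgA by simp
    next
      assume "Z \<subseteq> g ` B"
      then have "f ` Z \<subseteq> f ` g ` B" by blast
      then show ?thesis using fgB by simp
    qed
  qed
qed

lemma irreducible_chain_homeomorphic:
  assumes hom: "homeomorphic_maps T U f g"
    and irr: "\<forall>i\<le>n. irreducible_closed T (Z i)" and inc: "\<forall>i<n. Z i \<subset> Z (Suc i)"
  shows "\<forall>i\<le>n. irreducible_closed U (f ` Z i)" "\<forall>i<n. f ` Z i \<subset> f ` Z (Suc i)"
proof -
  show "\<forall>i\<le>n. irreducible_closed U (f ` Z i)"
    using irr irreducible_closed_homeomorphic[OF hom] by blast
  have gf: "\<And>x. x \<in> topspace T \<Longrightarrow> g (f x) = x"
    using hom by (auto simp: homeomorphic_maps_def)
  have sub: "Z i \<subseteq> topspace T" if "i \<le> n" for i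
    using irr that closedin_subset unfolding irreducible_closed_def by blast
  have gfZ: "g ` f ` Z i = Z i" if "i \<le> n" for i
    using gf sub[OF that] by (force simp: image_image)
  show "\<forall>i<n. f ` Z i \<subset> f ` Z (Suc i)"
  proof (intro allI impI psubsetI)
    fix i assume i: "i < n"
    then have Zi: "Z i \<subset> Z (Suc i)" using inc by simp
    then show "f ` Z i \<subseteq> f ` Z (Suc i)" by blast
    show "f ` Z i \<noteq> f ` Z (Suc i)"
    proof
      assume "f ` Z i = f ` Z (Suc i)"
      then have "g ` f ` Z i = g ` f ` Z (Suc i)" by simp
      then show False using gfZ[of i] gfZ[of "Suc i"] i Zi by simp
    qed
  qed
qed

lemma krull_dimension_homeomorphic:
  assumes "homeomorphic_maps T U f g"
  shows "krull_dimension T = krull_dimension U"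
proof -
  have "(\<exists>Z. (\<forall>i\<le>n. irreducible_closed T (Z i)) \<and> (\<forall>i<n. Z i \<subset> Z (Suc i))) \<longleftrightarrow>
    (\<exists>Z. (\<forall>i\<le>n. irreducible_closed U (Z i)) \<and> (\<forall>i<n. Z i \<subset> Z (Suc i)))" (is "?L \<longleftrightarrow> ?R") for n
  proof
    assume ?L
    then obtain Z where Z: "\<forall>i\<le>n. irreducible_closed T (Z i)" "\<forall>i<n. Z i \<subset> Z (Suc i)"
      by (elim exE conjE)
    show ?R
      using irreducible_chain_homeomorphic[OF assms Z] by (intro exI[of _ "\<lambda>i. f ` Z i"] conjI)
  next
    assume ?R
    then obtain Z where Z: "\<forall>i\<le>n. irreducible_closed U (Z i)" "\<forall>i<n. Z i \<subset> Z (Suc i)"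
      by (elim exE conjE)
    show ?L
      using irreducible_chain_homeomorphic[OF homeomorphic_maps_sym[THEN iffD1, OF assms] Z]
      by (intro exI[of _ "\<lambda>i. g ` Z i"] conjI)
  qed
  then show ?thesis
    unfolding krull_dimension_def by simp
qed

lemma continuous_map_zariski:
  fixes F :: "('i \<Rightarrow> 'e::field) \<Rightarrow> 'j \<Rightarrow> 'e"
  assumes "\<And>i. (\<lambda>p. F p i) \<in> polynomial_functions"
  shows "continuous_map zariski_topology zariski_topology F"
  unfolding zariski_topology_def[where 'i = 'j]
proof (rule continuous_on_generated_topo)
  fix W
  assume "W \<in> {{p. f p \<noteq> 0} | f :: ('j \<Rightarrow> 'e) \<Rightarrow> 'e. f \<in> polynomial_functions}"
  then obtain f where f: "f \<in> polynomial_functions" "W = {p. f p \<noteq> 0}" by (elim CollectE exE conjE)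
  show "openin zariski_topology (F -` W \<inter> topspace zariski_topology)"
    using openin_zariski_basic[OF poly_fun_compose[OF f(1), of F, OF assms]] f(2)
    by (simp add: vimage_def)
next
  have "{p :: 'j \<Rightarrow> 'e. (1 :: 'e) \<noteq> 0} \<in> {{p. f p \<noteq> 0} | f. f \<in> polynomial_functions}"
    by (intro CollectI exI[of _ "\<lambda>_. 1"] conjI polynomial_functions.const) simp
  note mem = this
  show "F ` topspace zariski_topology \<subseteq> \<Union>{{p. f p \<noteq> 0} | f. f \<in> polynomial_functions}"
    by (rule order_trans[OF _ Union_upper[OF mem]]) simp
qed

text \<open>A polynomial left inverse on \<open>S\<close> makes \<open>F\<close> a homeomorphism
  onto its image. This covers linear changes of coordinates as well as the embedding of matrices x
  as pairs (0, x).\<close>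

lemma variety_dimension_image:
  assumes "\<And>i. (\<lambda>p. F p i) \<in> polynomial_functions" "\<And>i. (\<lambda>p. G p i) \<in> polynomial_functions"
    "\<And>p. p \<in> S \<Longrightarrow> G (F p) = p"
  shows "variety_dimension (F ` S) = variety_dimension S"
proof -
  have "homeomorphic_maps (subtopology zariski_topology S) (subtopology zariski_topology (F ` S)) F G"
    unfolding homeomorphic_maps_def continuous_map_in_subtopology
    using assms(3)
    by (intro conjI continuous_map_from_subtopology continuous_map_zariski assms(1,2)) auto
  then show ?thesis
    unfolding variety_dimension_def by (rule krull_dimension_homeomorphic[symmetric])
qed

section \<open>Counting functions along a chain of irreducible sets\<close>

text \<open>The head of the list is the exponent of the function with the highest index, so that an
  induction along a chain of sets strips the topmost function first.\<close>

fun mon :: "(nat \<Rightarrow> 'p \<Rightarrow> 'e) \<Rightarrow> nat list \<Rightarrow> 'p \<Rightarrow> 'e::comm_semiring_1" where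
  "mon g [] p = 1"
| "mon g (a # as) p = g (length as) p ^ a * mon g as p"

text \<open>Each exponent is bounded separately, instead of the total degree; the number of
  monomials is then an exact power.\<close>

definition exponents :: "nat \<Rightarrow> nat \<Rightarrow> nat list set" where
  "exponents k M = {as. set as \<subseteq> {..M} \<and> length as = k}"

lemma finite_exponents [simp]: "finite (exponents k M)"
  unfolding exponents_def by (rule finite_lists_length_eq) simp

lemma card_exponents: "card (exponents k M) = (M + 1) ^ k"
  unfolding exponents_def by (subst card_lists_length_eq) simp_all

lemma exponents_0 [simp]: "exponents 0 M = {[]}"
  by (auto simp: exponents_def)

lemma exponents_length: "as \<in> exponents k M \<Longrightarrow> length as = k"
  by (simp add: exponents_def)

lemma sum_exponents_Suc:
  "(\<Sum>as\<in>exponents (Suc k) M. f as) = (\<Sum>a\<le>M. \<Sum>as\<in>exponents k M. f (a # as))"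
proof -
  have "exponents (Suc k) M = (\<lambda>(a, as). a # as) ` ({..M} \<times> exponents k M)"
    by (auto simp: exponents_def length_Suc_conv image_iff)
  moreover have "inj_on (\<lambda>(a, as). a # as) ({..M} \<times> exponents k M)"
    by (auto simp: inj_on_def)
  ultimately have "(\<Sum>as\<in>exponents (Suc k) M. f as) = (\<Sum>(a, as)\<in>{..M} \<times> exponents k M. f (a # as))"
    by (simp add: sum.reindex case_prod_unfold)
  then show ?thesis
    by (simp add: sum.cartesian_product)
qed

lemma poly_fun_mon:
  "(\<And>k. k < length as \<Longrightarrow> g k \<in> polynomial_functions) \<Longrightarrow> (\<lambda>p. mon g as p) \<in> polynomial_functions"
proof (induction as)
  case Nil
  have "mon g [] = (\<lambda>_. 1)" by (rule ext) simp
  then show ?case by (simp add: polynomial_functions.const)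
next
  case (Cons a as)
  have "mon g (a # as) = (\<lambda>p. g (length as) p ^ a * mon g as p)" by (rule ext) simp
  then show ?case
    using Cons by (simp add: polynomial_functions.mult poly_fun_power)
qed

text \<open>Look at the lowest power of the top function \<open>g k\<close>: it can be cancelled on \<open>Z (Suc k)\<close>,
  and what remains is then evaluated on \<open>Z k\<close>, where \<open>g k\<close> vanishes.\<close>

lemma mon_independent:
  fixes g :: "nat \<Rightarrow> ('i \<Rightarrow> 'e::field) \<Rightarrow> 'e"
  assumes irr: "\<And>k f h. k \<le> n \<Longrightarrow> f \<in> polynomial_functions \<Longrightarrow> h \<in> polynomial_functions \<Longrightarrow>
      \<forall>z\<in>Z k. f z * h z = 0 \<Longrightarrow> (\<forall>z\<in>Z k. f z = 0) \<or> (\<forall>z\<in>Z k. h z = 0)"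
    and ne: "Z 0 \<noteq> {}"
    and mono: "\<And>k. k < n \<Longrightarrow> Z k \<subseteq> Z (Suc k)"
    and g: "\<And>k. k < n \<Longrightarrow> g k \<in> polynomial_functions"
    and g0: "\<And>k z. k < n \<Longrightarrow> z \<in> Z k \<Longrightarrow> g k z = 0"
    and g1: "\<And>k. k < n \<Longrightarrow> \<exists>z\<in>Z (Suc k). g k z \<noteq> 0"
  shows "k \<le> n \<Longrightarrow> \<forall>z\<in>Z k. (\<Sum>as\<in>exponents k M. c as * mon g as z) = 0 \<Longrightarrow>
    \<forall>as\<in>exponents k M. c as = 0"
proof (induction k arbitrary: c)
  case 0
  then show ?case using ne by auto
next
  case (Suc k)
  define F where "F a z = (\<Sum>as\<in>exponents k M. c (a # as) * mon g as z)" for a z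
  have k: "k < n" using Suc.prems by simp
  have F: "(\<lambda>z. F a z) \<in> polynomial_functions" for a
    unfolding F_def
    by (intro poly_fun_sum polynomial_functions.mult polynomial_functions.const poly_fun_mon g)
      (use k in \<open>auto dest: exponents_length\<close>)
  have sum0: "(\<Sum>a\<le>M. g k z ^ a * F a z) = 0" if "z \<in> Z (Suc k)" for z
  proof -
    have "(\<Sum>a\<le>M. g k z ^ a * F a z)
        = (\<Sum>a\<le>M. \<Sum>as\<in>exponents k M. c (a # as) * mon g (a # as) z)"
      unfolding F_def sum_distrib_left
      by (intro sum.cong refl) (simp add: exponents_length algebra_simps)
    also have "\<dots> = 0"
      using Suc.prems(2) that by (simp add: sum_exponents_Suc del: mon.simps)
    finally show ?thesis .
  qed
  have "\<forall>as\<in>exponents k M. c (a # as) = 0" if "a \<le> M" for a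
    using that
  proof (induction a rule: less_induct)
    case (less a)
    have F0: "F a' z = 0" if "a' < a" for a' z
      using less that unfolding F_def by (intro sum.neutral) simp
    define H where "H z = (\<Sum>b\<in>{a..M}. g k z ^ (b - a) * F b z)" for z
    have H: "(\<lambda>z. H z) \<in> polynomial_functions"
      unfolding H_def by (intro poly_fun_sum polynomial_functions.mult poly_fun_power F g k)
    have split: "{..M} = {..<a} \<union> {a..M}" using less.prems by auto
    have "\<forall>z\<in>Z (Suc k). g k z ^ a * H z = 0"
    proof
      fix z assume z: "z \<in> Z (Suc k)"
      have "g k z ^ a * H z = (\<Sum>b\<in>{a..M}. g k z ^ b * F b z)"
        unfolding H_def sum_distrib_left
        by (intro sum.cong refl) (simp add: mult.assoc[symmetric] power_add[symmetric])
      also have "\<dots> = (\<Sum>b\<le>M. g k z ^ b * F b z)"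
        unfolding split by (subst sum.union_disjoint) (auto simp: F0)
      finally show "g k z ^ a * H z = 0" using sum0[OF z] by simp
    qed
    then have "(\<forall>z\<in>Z (Suc k). g k z ^ a = 0) \<or> (\<forall>z\<in>Z (Suc k). H z = 0)"
      using irr[OF Suc.prems(1) poly_fun_power[OF g[OF k]] H] by blast
    then have H0: "\<forall>z\<in>Z (Suc k). H z = 0"
      using g1[OF k] by auto
    have "\<forall>z\<in>Z k. F a z = 0"
    proof
      fix z assume z: "z \<in> Z k"
      have "H z = g k z ^ (a - a) * F a z + (\<Sum>b\<in>{Suc a..M}. g k z ^ (b - a) * F b z)"
        unfolding H_def using less.prems by (subst sum.atLeast_Suc_atMost) auto
      also have "(\<Sum>b\<in>{Suc a..M}. g k z ^ (b - a) * F b z) = 0"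
        using g0[OF k z] by (intro sum.neutral) (auto simp: power_0_left)
      finally show "F a z = 0"
        using H0 mono[OF k] z by auto
    qed
    then show ?case
      using Suc.IH[of "\<lambda>as. c (a # as)"] k unfolding F_def by simp
  qed
  then show ?case
    by (auto simp: exponents_def length_Suc_conv)
qed

text \<open>An equation \<open>j\<close> with a nonzero coefficient at \<open>k0\<close> is used to
  eliminate the unknown \<open>k0\<close> from the remaining equations; this removes one equation
  and one unknown, so there are still more unknowns than equations.\<close>

lemma nontrivial_solution:
  fixes a :: "'k \<Rightarrow> 'j \<Rightarrow> 'e::field"
  assumes "finite J" "finite K" "card J < card K"
  shows "\<exists>c. (\<exists>k\<in>K. c k \<noteq> 0) \<and> (\<forall>j\<in>J. (\<Sum>k\<in>K. c k * a k j) = 0)"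
  using assms
proof (induction J arbitrary: K a rule: finite_induct)
  case empty
  then obtain k where "k \<in> K" by fastforce
  then show ?case by (intro exI[of _ "\<lambda>_. 1"]) auto
next
  case (insert j J)
  show ?case
  proof (cases "\<forall>k\<in>K. a k j = 0")
    case True
    have "card J < card K" using insert by simp
    from insert.IH[OF insert.prems(1) this, of a] True show ?thesis by auto
  next
    case False
    then obtain k0 where k0: "k0 \<in> K" "a k0 j \<noteq> 0" by blast
    define K' where "K' = K - {k0}"
    have K': "finite K'" "card J < card K'" "K = insert k0 K'" "k0 \<notin> K'"
      using insert k0 by (auto simp: K'_def)
    obtain c where c: "\<exists>k\<in>K'. c k \<noteq> 0"
      "\<forall>l\<in>J. (\<Sum>k\<in>K'. c k * (a k l - a k j / a k0 j * a k0 l)) = 0"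
      using insert.IH[OF K'(1,2), of "\<lambda>k l. a k l - a k j / a k0 j * a k0 l"] by blast
    define d where "d k = (if k = k0 then - (\<Sum>k\<in>K'. c k * a k j) / a k0 j else c k)" for k
    have sum_d: "(\<Sum>k\<in>K. d k * a k l) = (\<Sum>k\<in>K'. c k * (a k l - a k j / a k0 j * a k0 l))" for l
    proof -
      have "(\<Sum>k\<in>K'. d k * a k l) = (\<Sum>k\<in>K'. c k * a k l)"
        using K' by (intro sum.cong) (auto simp: d_def)
      moreover have "d k0 * a k0 l = - (\<Sum>k\<in>K'. c k * (a k j / a k0 j * a k0 l))"
        by (simp add: d_def sum_distrib_left sum_distrib_right sum_divide_distrib sum_negf algebra_simps)
      ultimately show ?thesis
        using K' by (simp add: algebra_simps sum_subtractf)
    qed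
    have "\<exists>k\<in>K. d k \<noteq> 0"
      using c(1) K' by (auto simp: d_def)
    moreover have "(\<Sum>k\<in>K. d k * a k l) = 0" if "l \<in> insert j J" for l
      using that c(2) k0 unfolding sum_d by auto
    ultimately show ?thesis by blast
  qed
qed

section \<open>Partial degrees and the dimension of spaces of polynomial functions\<close>

text \<open>Degree in each single variable, read off from the function itself; this is the notion
  that evaluation on a product grid controls.\<close>

definition degree_bounded :: "nat \<Rightarrow> (('i \<Rightarrow> 'e::field) \<Rightarrow> 'e) \<Rightarrow> bool" where
  "degree_bounded D f \<longleftrightarrow> (\<forall>t i. \<exists>P. degree P \<le> D \<and> (\<forall>s. f (t(i := s)) = poly P s))"

lemma degree_bounded_mono: "degree_bounded D f \<Longrightarrow> D \<le> D' \<Longrightarrow> degree_bounded D' f"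
  unfolding degree_bounded_def by (meson order_trans)

lemma degree_bounded_const: "degree_bounded D (\<lambda>_. c)"
  unfolding degree_bounded_def by (intro allI exI[of _ "[:c:]"]) simp

lemma degree_bounded_coord: "degree_bounded 1 (\<lambda>t. t i)"
  unfolding degree_bounded_def
proof (intro allI)
  fix t :: "'a \<Rightarrow> 'b" and j
  show "\<exists>P. degree P \<le> 1 \<and> (\<forall>s. (t(j := s)) i = poly P s)"
    by (cases "i = j") (auto intro: exI[of _ "[:0, 1:]"] exI[of _ "[:t i:]"])
qed

lemma degree_bounded_add:
  assumes "degree_bounded D f" "degree_bounded D g"
  shows "degree_bounded D (\<lambda>t. f t + g t)"
  unfolding degree_bounded_def
proof (intro allI)
  fix t i
  obtain P Q where "degree P \<le> D" "\<forall>s. f (t(i := s)) = poly P s"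
    "degree Q \<le> D" "\<forall>s. g (t(i := s)) = poly Q s"
    using assms unfolding degree_bounded_def by meson
  then show "\<exists>P. degree P \<le> D \<and> (\<forall>s. f (t(i := s)) + g (t(i := s)) = poly P s)"
    by (intro exI[of _ "P + Q"]) (simp add: degree_add_le)
qed

lemma degree_bounded_mult:
  assumes "degree_bounded D f" "degree_bounded D' g"
  shows "degree_bounded (D + D') (\<lambda>t. f t * g t)"
  unfolding degree_bounded_def
proof (intro allI)
  fix t i
  obtain P Q where "degree P \<le> D" "\<forall>s. f (t(i := s)) = poly P s"
    "degree Q \<le> D'" "\<forall>s. g (t(i := s)) = poly Q s"
    using assms unfolding degree_bounded_def by meson
  then show "\<exists>P. degree P \<le> D + D' \<and> (\<forall>s. f (t(i := s)) * g (t(i := s)) = poly P s)"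
    by (intro exI[of _ "P * Q"]) (simp add: degree_mult_le[THEN order_trans] add_mono)
qed

lemma degree_bounded_power:
  "degree_bounded D f \<Longrightarrow> degree_bounded (n * D) (\<lambda>t. f t ^ n)"
  by (induction n) (auto intro: degree_bounded_const degree_bounded_mult)

lemma degree_bounded_sum:
  assumes "\<And>k. k \<in> K \<Longrightarrow> degree_bounded D (f k)"
  shows "degree_bounded D (\<lambda>t. \<Sum>k\<in>K. f k t)"
proof (cases "finite K")
  case True
  then show ?thesis
    using assms
    by (induction K rule: finite_induct) (auto intro: degree_bounded_const degree_bounded_add)
qed (simp add: degree_bounded_const)

lemma degree_bounded_mon:
  assumes "\<And>k. k < n \<Longrightarrow> degree_bounded D (g k)"
  shows "as \<in> exponents n M \<Longrightarrow> degree_bounded (n * (M * D)) (\<lambda>t. mon g as t)"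
  using assms
proof (induction as arbitrary: n)
  case Nil
  then show ?case by (simp add: degree_bounded_const)
next
  case (Cons a as)
  then obtain m where m: "n = Suc m" "as \<in> exponents m M" "a \<le> M" "length as = m"
    by (auto simp: exponents_def)
  have "degree_bounded (M * D) (\<lambda>t. g m t ^ a)"
    using Cons.prems(2)[of m] m
    by (intro degree_bounded_mono[OF degree_bounded_power[of D]]) auto
  moreover have "degree_bounded (m * (M * D)) (\<lambda>t. mon g as t)"
    using Cons.IH[OF m(2)] Cons.prems(2) m by simp
  ultimately show ?case
    using degree_bounded_mult[of "M * D" "\<lambda>t. g m t ^ a"] m by simp
qed

lemma poly_fun_degree_bounded:
  assumes "f \<in> polynomial_functions"
  shows "\<exists>D. degree_bounded D f"
  using assms
proof induction
  case (add f g)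
  then obtain D D' where "degree_bounded D f" "degree_bounded D' g" by blast
  then have "degree_bounded (max D D') f" "degree_bounded (max D D') g"
    by (auto intro: degree_bounded_mono)
  from degree_bounded_add[OF this] show ?case by (rule exI)
next
  case (mult f g)
  then obtain D D' where "degree_bounded D f" "degree_bounded D' g" by blast
  from degree_bounded_mult[OF this] show ?case by (rule exI)
qed (rule exI, rule degree_bounded_const degree_bounded_coord)+

text \<open>The coordinates in \<open>Q\<close> are released from the grid one at a time: as a
  function of the released coordinate, \<open>f\<close> is a polynomial of degree at most
  \<open>D\<close> with all elements of \<open>A\<close> as zeros, and there are more than
  \<open>D\<close> of them.\<close>

lemma degree_bounded_grid:
  assumes "finite Q" "degree_bounded D f" "D < card A"
    and "\<And>t. (\<forall>i\<in>Q. t i \<in> A) \<Longrightarrow> f t = 0"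
  shows "f t = 0"
  using assms(1,4)
proof (induction Q arbitrary: t rule: finite_induct)
  case (insert q Q)
  have "f t = 0" if t: "\<forall>i\<in>Q. t i \<in> A" for t
  proof -
    obtain P where P: "degree P \<le> D" "\<And>s. f (t(q := s)) = poly P s"
      using assms(2) unfolding degree_bounded_def by meson
    have "A \<subseteq> {s. poly P s = 0}"
    proof
      fix s assume "s \<in> A"
      then have "f (t(q := s)) = 0"
        using insert.hyps t by (intro insert.prems) auto
      then show "s \<in> {s. poly P s = 0}" using P by simp
    qed
    have "P = 0"
    proof (rule ccontr)
      assume "P \<noteq> 0"
      then have "card A \<le> card {s. poly P s = 0}"
        using \<open>A \<subseteq> _\<close> by (intro card_mono poly_roots_finite)
      also have "\<dots> \<le> degree P"
        using \<open>P \<noteq> 0\<close> by (rule card_poly_roots_bound)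
      finally show False using P(1) assms(3) by simp
    qed
    then show ?thesis
      using P(2)[of "t q"] by simp
  qed
  then show ?case by (rule insert.IH)
qed simp

text \<open>Vanishing on a grid of \<open>(D + 1) ^ card Q\<close> points amounts to that many
  linear conditions on the coefficients, and it forces vanishing everywhere. In effect, functions of
  the variables \<open>Q\<close> with partial degrees at most \<open>D\<close> form a space of
  dimension at most \<open>(D + 1) ^ card Q\<close>.\<close>

lemma degree_bounded_dependent:
  fixes F :: "'k \<Rightarrow> ('i \<Rightarrow> 'e::alg_closed_field) \<Rightarrow> 'e"
  assumes "finite Q" "finite K" "\<And>k. k \<in> K \<Longrightarrow> degree_bounded D (F k)"
    and dep: "\<And>k t t'. k \<in> K \<Longrightarrow> \<forall>i\<in>Q. t i = t' i \<Longrightarrow> F k t = F k t'"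
    and card: "(D + 1) ^ card Q < card K"
  shows "\<exists>c. (\<exists>k\<in>K. c k \<noteq> 0) \<and> (\<forall>t. (\<Sum>k\<in>K. c k * F k t) = 0)"
proof -
  obtain A :: "'e set" where A: "finite A" "card A = D + 1"
    using infinite_arbitrarily_large[OF infinite_UNIV_alg_closed_field] by blast
  define J where "J = Pi\<^sub>E Q (\<lambda>_. A)"
  have J: "finite J" "card J < card K"
    using A assms(1) card by (simp_all add: J_def card_PiE finite_PiE)
  obtain c where c: "\<exists>k\<in>K. c k \<noteq> 0" "\<And>t. t \<in> J \<Longrightarrow> (\<Sum>k\<in>K. c k * F k t) = 0"
    using nontrivial_solution[OF J(1) assms(2) J(2), of F] by blast
  have "(\<Sum>k\<in>K. c k * F k t) = 0" for t
  proof (rule degree_bounded_grid[OF assms(1), where f = "\<lambda>t. \<Sum>k\<in>K. c k * F k t"])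
    have "degree_bounded (0 + D) (\<lambda>t. c k * F k t)" if "k \<in> K" for k
      by (rule degree_bounded_mult[OF degree_bounded_const]) (use assms(3) that in simp)
    then show "degree_bounded D (\<lambda>t. \<Sum>k\<in>K. c k * F k t)"
      by (intro degree_bounded_sum) simp
    show "D < card A" using A by simp
    fix t :: "'i \<Rightarrow> 'e" assume t: "\<forall>i\<in>Q. t i \<in> A"
    have "(\<Sum>k\<in>K. c k * F k t) = (\<Sum>k\<in>K. c k * F k (restrict t Q))"
      by (intro sum.cong refl arg_cong2[of _ _ _ _ "(*)"] dep) auto
    also have "\<dots> = 0"
      using t by (intro c(2)) (auto simp: J_def)
    finally show "(\<Sum>k\<in>K. c k * F k t) = 0" .
  qed
  with c(1) show ?thesis by blast
qed

text \<open>Gaussian elimination without divisions, with the last vector as pivot.\<close>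

lemma independence_open:
  fixes U :: "nat \<Rightarrow> ('i \<Rightarrow> 'e::field) \<Rightarrow> 'j \<Rightarrow> 'e"
  assumes "\<And>i j. i < k \<Longrightarrow> (\<lambda>y. U i y j) \<in> polynomial_functions"
    and "\<And>c. (\<And>j. (\<Sum>i<k. c i * U i y0 j) = 0) \<Longrightarrow> \<forall>i<k. c i = 0"
  shows "\<exists>F\<in>polynomial_functions. F y0 \<noteq> 0 \<and>
    (\<forall>y c. F y \<noteq> 0 \<longrightarrow> (\<forall>j. (\<Sum>i<k. c i * U i y j) = 0) \<longrightarrow> (\<forall>i<k. c i = 0))"
  using assms
proof (induction k arbitrary: U)
  case 0
  show ?case by (intro bexI[of _ "\<lambda>_. 1"] polynomial_functions.const) simp
next
  case (Suc k)
  have "\<exists>j. U k y0 j \<noteq> 0"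
  proof (rule ccontr)
    assume "\<nexists>j. U k y0 j \<noteq> 0"
    then have "\<forall>i<Suc k. (if i = k then 1 else 0 :: 'e) = 0"
      by (intro Suc.prems(2)) (simp add: sum.neutral)
    then show False by (auto dest: spec[of _ k])
  qed
  then obtain j0 where j0: "U k y0 j0 \<noteq> 0" by blast
  define U' where "U' i y j = U k y j0 * U i y j - U i y j0 * U k y j" for i y j
  have sumU': "(\<Sum>i<k. c i * U' i y j) =
      (\<Sum>i<Suc k. (if i = k then - (\<Sum>i<k. c i * U i y j0) else c i * U k y j0) * U i y j)" for c y j
  proof -
    have "(\<Sum>i<k. (if i = k then r else c i * U k y j0) * U i y j) = (\<Sum>i<k. c i * U k y j0 * U i y j)" for r
      by (intro sum.cong) auto
    then show ?thesis
      by (simp add: U'_def sum_subtractf algebra_simps sum_distrib_left sum_distrib_right)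
  qed
  have "\<exists>F\<in>polynomial_functions. F y0 \<noteq> 0 \<and>
    (\<forall>y c. F y \<noteq> 0 \<longrightarrow> (\<forall>j. (\<Sum>i<k. c i * U' i y j) = 0) \<longrightarrow> (\<forall>i<k. c i = 0))"
  proof (rule Suc.IH)
    show "(\<lambda>y. U' i y j) \<in> polynomial_functions" if "i < k" for i j
      unfolding U'_def using that
      by (intro poly_fun_diff polynomial_functions.mult Suc.prems(1)) auto
    show "\<forall>i<k. c i = 0" if c: "\<And>j. (\<Sum>i<k. c i * U' i y0 j) = 0" for c
    proof -
      have "\<forall>i<Suc k. (if i = k then - (\<Sum>i<k. c i * U i y0 j0) else c i * U k y0 j0) = 0"
        using c unfolding sumU' by (rule Suc.prems(2))
      then show ?thesis using j0 by (auto split: if_splits dest: less_SucI)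
    qed
  qed
  then obtain F where F: "F \<in> polynomial_functions" "F y0 \<noteq> 0"
    "\<And>y c. F y \<noteq> 0 \<Longrightarrow> (\<And>j. (\<Sum>i<k. c i * U' i y j) = 0) \<Longrightarrow> \<forall>i<k. c i = 0"
    by blast
  show ?case
  proof (intro bexI[of _ "\<lambda>y. F y * U k y j0"] conjI allI impI)
    show "(\<lambda>y. F y * U k y j0) \<in> polynomial_functions"
      by (intro polynomial_functions.mult F Suc.prems(1)) simp
    show "F y0 * U k y0 j0 \<noteq> 0" using F j0 by simp
    fix y c i
    assume Fy: "F y * U k y j0 \<noteq> 0" and c: "\<forall>j. (\<Sum>i<Suc k. c i * U i y j) = 0" and i: "i < Suc k"
    have c': "(\<Sum>i<k. c i * U i y j) = - c k * U k y j" for j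
      using c[rule_format, of j] by (simp add: eq_neg_iff_add_eq_0)
    have "(\<Sum>i<k. c i * U' i y j) = 0" for j
    proof -
      have "(\<Sum>i<k. c i * U' i y j)
          = U k y j0 * (\<Sum>i<k. c i * U i y j) - (\<Sum>i<k. c i * U i y j0) * U k y j"
        by (simp add: U'_def sum_subtractf algebra_simps sum_distrib_left sum_distrib_right)
      then show ?thesis by (simp add: c')
    qed
    moreover have "F y \<noteq> 0" using Fy by simp
    ultimately have ck: "\<forall>i<k. c i = 0" using F(3) by blast
    then have "c k * U k y j0 = 0" using c'[of j0] by simp
    then show "c i = 0" using ck i Fy by (cases "i = k") auto
  qed
qed

section \<open>Matrices over a finite index set\<close>

definition mmul :: "'b set \<Rightarrow> ('a \<Rightarrow> 'b \<Rightarrow> 'e::comm_ring_1) \<Rightarrow> ('b \<Rightarrow> 'c \<Rightarrow> 'e) \<Rightarrow> 'a \<Rightarrow> 'c \<Rightarrow> 'e" where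
  "mmul B a b = (\<lambda>x y. \<Sum>z\<in>B. a x z * b z y)"

definition mvec :: "'b set \<Rightarrow> ('a \<Rightarrow> 'b \<Rightarrow> 'e::comm_ring_1) \<Rightarrow> ('b \<Rightarrow> 'e) \<Rightarrow> 'a \<Rightarrow> 'e" where
  "mvec B a v = (\<lambda>x. \<Sum>z\<in>B. a x z * v z)"

text \<open>It vanishes outside \<open>B\<close>, hence is neutral only for matrices supported on
  \<open>B\<close>; this is the origin of the many support conditions below.\<close>

definition idm :: "'b set \<Rightarrow> 'b \<Rightarrow> 'b \<Rightarrow> 'e::comm_ring_1" where
  "idm B = (\<lambda>b c. if b = c \<and> b \<in> B then 1 else 0)"

lemma mmul_assoc: "mmul B (mmul A a b) c = mmul A a (mmul B b c)"
  unfolding mmul_def sum_distrib_left sum_distrib_right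
  by (intro ext) (subst sum.swap, simp add: mult.assoc)

lemma mvec_mmul: "mvec B (mmul A a b) v = mvec A a (mvec B b v)"
  unfolding mmul_def mvec_def sum_distrib_left sum_distrib_right
  by (intro ext) (subst sum.swap, simp add: mult.assoc)

lemma mmul_idm_left: "finite B \<Longrightarrow> mmul B (idm B) a = (\<lambda>x y. if x \<in> B then a x y else 0)"
  unfolding mmul_def idm_def by (intro ext) (simp add: if_distrib[of "\<lambda>x. x * _"] cong: if_cong)

lemma mmul_idm_right: "finite B \<Longrightarrow> mmul B a (idm B) = (\<lambda>x y. if y \<in> B then a x y else 0)"
  unfolding mmul_def idm_def
  by (intro ext) (auto simp: if_distrib[of "\<lambda>x. _ * x"] sum.delta' intro: sum.neutral cong: if_cong)

lemma mvec_idm: "finite B \<Longrightarrow> mvec B (idm B) v = (\<lambda>x. if x \<in> B then v x else 0)"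
  unfolding mvec_def idm_def by (intro ext) (simp add: if_distrib[of "\<lambda>x. x * _"] cong: if_cong)

lemma poly_fun_det:
  assumes "\<And>t. A t \<in> carrier_mat n n"
    and "\<And>i j. i < n \<Longrightarrow> j < n \<Longrightarrow> (\<lambda>t. A t $$ (i, j)) \<in> polynomial_functions"
  shows "(\<lambda>t. det (A t)) \<in> polynomial_functions"
proof -
  have "(\<lambda>t. det (A t)) = (\<lambda>t. \<Sum>p\<in>{p. p permutes {0..<n}}. signof p * (\<Prod>i = 0..<n. A t $$ (i, p i)))"
    by (rule ext) (rule det_def'[OF assms(1)])
  also have "\<dots> \<in> polynomial_functions"
    by (intro poly_fun_sum polynomial_functions.mult polynomial_functions.const poly_fun_prod assms(2))
      (auto simp: permutes_in_image)
  finally show ?thesis .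
qed

text \<open>Kept abstract because two index sets occur: the vectors of an adapted basis with their
  degrees, and the boxes of a diagram with their colors.\<close>

locale graded_index =
  fixes B :: "'b set" and col :: "'b \<Rightarrow> 'c"
  assumes finite_B: "finite B"
begin

definition positions :: "('b \<times> 'b) set" where
  "positions = {(b, c). b \<in> B \<and> c \<in> B \<and> col b = col c}"

definition block :: "('b \<times> 'b \<Rightarrow> 'e::zero) \<Rightarrow> 'b \<Rightarrow> 'b \<Rightarrow> 'e" where
  "block t = (\<lambda>b c. if (b, c) \<in> positions then t (b, c) else 0)"

definition block_group :: "(('b \<Rightarrow> 'b \<Rightarrow> 'e::field) \<times> ('b \<Rightarrow> 'b \<Rightarrow> 'e)) set" where
  "block_group = {(g, h). (\<forall>b c. g b c \<noteq> 0 \<or> h b c \<noteq> 0 \<longrightarrow> (b, c) \<in> positions) \<and>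
     mmul B g h = idm B \<and> mmul B h g = idm B}"

lemma finite_positions: "finite positions"
  by (rule finite_subset[of _ "B \<times> B"]) (auto simp: positions_def finite_B)

lemma block_uncurry_block [simp]: "block (\<lambda>(b, c). block t b c) = block t"
  by (intro ext) (simp add: block_def)

lemma block_group_left: "(g, h) \<in> block_group \<Longrightarrow> block (\<lambda>(b, c). g b c) = g"
  by (auto simp: block_group_def block_def fun_eq_iff)

lemma block_group_zero:
  "(g, h) \<in> block_group \<Longrightarrow> (b, c) \<notin> positions \<Longrightarrow> g b c = 0 \<and> h b c = 0"
  by (auto simp: block_group_def)

lemma idm_left: "(\<And>b c. (b, c) \<notin> positions \<Longrightarrow> a b c = 0) \<Longrightarrow> mmul B (idm B) a = a"
  unfolding mmul_idm_left[OF finite_B] by (intro ext) (auto simp: positions_def)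

lemma idm_right: "(\<And>b c. (b, c) \<notin> positions \<Longrightarrow> a b c = 0) \<Longrightarrow> mmul B a (idm B) = a"
  unfolding mmul_idm_right[OF finite_B] by (intro ext) (auto simp: positions_def)

lemma idm_block_group: "(idm B, idm B :: 'b \<Rightarrow> 'b \<Rightarrow> 'd::field) \<in> block_group"
proof -
  have "mmul B (idm B) (idm B) = (idm B :: 'b \<Rightarrow> 'b \<Rightarrow> 'd)"
    unfolding mmul_idm_left[OF finite_B] by (auto simp: idm_def fun_eq_iff)
  then show ?thesis
    unfolding block_group_def by (auto simp: positions_def idm_def)
qed

lemma mmul_positions:
  assumes "\<And>b c. (b, c) \<notin> positions \<Longrightarrow> g b c = 0" "\<And>b c. (b, c) \<notin> positions \<Longrightarrow> h b c = 0"
    and "(b, c) \<notin> positions"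
  shows "mmul B g h b c = 0"
  unfolding mmul_def
proof (rule sum.neutral, rule ballI)
  fix z assume "z \<in> B"
  have "(b, z) \<notin> positions \<or> (z, c) \<notin> positions"
    using assms(3) by (auto simp: positions_def)
  then show "g b z * h z c = 0" using assms(1,2) by auto
qed

lemma block_group_mult:
  fixes g h g' h' :: "'b \<Rightarrow> 'b \<Rightarrow> 'd::field"
  assumes "(g, h) \<in> block_group" "(g', h') \<in> block_group"
  shows "(mmul B g g', mmul B h' h) \<in> block_group"
proof -
  have z: "(b, c) \<notin> positions \<Longrightarrow> g b c = 0" "(b, c) \<notin> positions \<Longrightarrow> h b c = 0"
    "(b, c) \<notin> positions \<Longrightarrow> g' b c = 0" "(b, c) \<notin> positions \<Longrightarrow> h' b c = 0" for b c
    using assms by (auto simp: block_group_def)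
  have idh: "mmul B (idm B) h = h" by (rule idm_left) (rule z(2))
  have idg': "mmul B (idm B) g' = g'" by (rule idm_left) (rule z(3))
  have gh: "mmul B g h = idm B" "mmul B h g = idm B" "mmul B g' h' = idm B" "mmul B h' g' = idm B"
    using assms by (simp_all add: block_group_def)
  have "mmul B (mmul B g g') (mmul B h' h) = mmul B g (mmul B (mmul B g' h') h)"
    by (simp only: mmul_assoc)
  also have "\<dots> = idm B" using gh(3) gh(1) by (simp only: idh)
  finally have 1: "mmul B (mmul B g g') (mmul B h' h) = idm B" .
  have "mmul B (mmul B h' h) (mmul B g g') = mmul B h' (mmul B (mmul B h g) g')"
    by (simp only: mmul_assoc)
  also have "\<dots> = idm B" using gh(2) gh(4) by (simp only: idg')
  finally have 2: "mmul B (mmul B h' h) (mmul B g g') = idm B" .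
  show ?thesis
    using 1 2 mmul_positions[of g g'] mmul_positions[of h' h] z unfolding block_group_def by blast
qed

text \<open>\<open>q\<close> is the determinant and \<open>adj\<close> the adjugate, cut down to
  \<open>positions\<close>, of the block matrix after a numbering of \<open>B\<close>. The
  existential statement hides the numbering from the arguments that follow.\<close>

lemma exists_adjugate:
  "\<exists>(q :: ('b \<times> 'b \<Rightarrow> 'e::field) \<Rightarrow> 'e) adj. q \<in> polynomial_functions \<and>
     (\<forall>b c. (\<lambda>t. adj t b c) \<in> polynomial_functions) \<and>
     (\<forall>t. q t \<noteq> 0 \<longrightarrow> (block t, \<lambda>b c. adj t b c / q t) \<in> block_group) \<and>
     (\<forall>g h. (g, h) \<in> block_group \<longrightarrow> q (\<lambda>(b, c). g b c) \<noteq> 0)"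
proof -
  define n where "n = card B"
  obtain f where f: "bij_betw f {0..<n} B"
    using ex_bij_betw_nat_finite[OF finite_B] unfolding n_def by blast
  define f' where "f' = the_inv_into {0..<n} f"
  have f': "f' b < n" "f (f' b) = b" if "b \<in> B" for b
    using that f f_the_inv_into_f_bij_betw[OF f] bij_betwE[OF bij_betw_the_inv_into[OF f]]
    by (auto simp: f'_def)
  have ff: "f' (f i) = i" "f i \<in> B" if "i < n" for i
    using that f the_inv_into_f_f[of f "{0..<n}" i] bij_betwE[OF f] by (auto simp: f'_def bij_betw_def)
  define mt :: "('b \<Rightarrow> 'b \<Rightarrow> 'e) \<Rightarrow> 'e mat" where "mt g = mat n n (\<lambda>(i, j). g (f i) (f j))" for g
  have mt: "mt g \<in> carrier_mat n n" for g by (simp add: mt_def)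
  have sum_f: "(\<Sum>i = 0..<n. F (f i)) = (\<Sum>z\<in>B. F z)" for F :: "'b \<Rightarrow> 'e"
    by (rule sum.reindex_bij_betw[OF f])
  define adj where "adj t b c = (if (b, c) \<in> positions then adj_mat (mt (block t)) $$ (f' b, f' c) else 0)" for t b c
  define adj0 where "adj0 t b c = (if b \<in> B \<and> c \<in> B then adj_mat (mt (block t)) $$ (f' b, f' c) else 0)" for t b c
  define q where "q t = det (mt (block t))" for t
  have dimadj: "adj_mat (mt g) \<in> carrier_mat n n" for g by (rule adj_mat(1)[OF mt])
  have poly_entry: "(\<lambda>t. mt (block t) $$ (i, j)) \<in> polynomial_functions" if "i < n" "j < n" for i j
    using that unfolding mt_def block_def
    by (cases "(f i, f j) \<in> positions") (simp_all add: polynomial_functions.const polynomial_functions.coord)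
  have q_poly: "q \<in> polynomial_functions"
    unfolding q_def[abs_def] by (rule poly_fun_det[OF mt poly_entry])
  have adj_poly: "(\<lambda>t. adj t b c) \<in> polynomial_functions" for b c
  proof (cases "(b, c) \<in> positions")
    case True
    then have bc: "f' b < n" "f' c < n" using f' by (auto simp: positions_def)
    have "(\<lambda>t. det (mat_delete (mt (block t)) (f' c) (f' b))) \<in> polynomial_functions"
    proof (rule poly_fun_det[where n = "n - 1"])
      show "mat_delete (mt (block t)) (f' c) (f' b) \<in> carrier_mat (n - 1) (n - 1)" for t
        by (rule mat_delete_carrier[OF mt])
      fix i j assume "i < n - 1" "j < n - 1"
      then have "mat_delete (mt g) (f' c) (f' b) $$ (i, j) = mt g $$
         (if i < f' c then i else Suc i, if j < f' b then j else Suc j)" for g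
        by (simp add: mat_delete_def mt_def)
      then show "(\<lambda>t. mat_delete (mt (block t)) (f' c) (f' b) $$ (i, j)) \<in> polynomial_functions"
        using \<open>i < n - 1\<close> \<open>j < n - 1\<close> by (simp add: poly_entry)
    qed
    moreover have "adj t b c = (-1) ^ (f' c + f' b) * det (mat_delete (mt (block t)) (f' c) (f' b))" for t
      using True bc mt by (simp add: adj_def adj_mat_def mt_def cofactor_def)
    ultimately show ?thesis
      by (simp add: polynomial_functions.mult polynomial_functions.const)
  qed (simp add: adj_def polynomial_functions.const)
  have entry: "mt g $$ (f' b, f' c) = g b c" if "b \<in> B" "c \<in> B" for g b c
    using that f' by (simp add: mt_def)
  have adj0: "mmul B (block t) (adj0 t) b c = (if b = c then q t else 0)"
    "mmul B (adj0 t) (block t) b c = (if b = c then q t else 0)" if "b \<in> B" "c \<in> B" for t b c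
  proof -
    have inj: "f' b = f' c \<longleftrightarrow> b = c" using f' that by metis
    have "(mt (block t) * adj_mat (mt (block t))) $$ (f' b, f' c) = (if b = c then q t else 0)"
      using adj_mat(2)[OF mt] f' that inj by (simp add: q_def)
    moreover have "(mt (block t) * adj_mat (mt (block t))) $$ (f' b, f' c) =
        (\<Sum>i = 0..<n. block t b (f i) * adj0 t (f i) c)"
      using f' that ff dimadj[of "block t"] mt[of "block t"]
      by (auto simp: scalar_prod_def adj0_def mt_def intro!: sum.cong)
    ultimately show "mmul B (block t) (adj0 t) b c = (if b = c then q t else 0)"
      unfolding mmul_def by (simp add: sum_f[of "\<lambda>z. block t b z * adj0 t z c"])
    have "(adj_mat (mt (block t)) * mt (block t)) $$ (f' b, f' c) = (if b = c then q t else 0)"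
      using adj_mat(3)[OF mt] f' that inj by (simp add: q_def)
    moreover have "(adj_mat (mt (block t)) * mt (block t)) $$ (f' b, f' c) =
        (\<Sum>i = 0..<n. adj0 t b (f i) * block t (f i) c)"
      using f' that ff dimadj[of "block t"] mt[of "block t"]
      by (auto simp: scalar_prod_def adj0_def mt_def intro!: sum.cong)
    ultimately show "mmul B (adj0 t) (block t) b c = (if b = c then q t else 0)"
      unfolding mmul_def by (simp add: sum_f[of "\<lambda>z. adj0 t b z * block t z c"])
  qed
  \<comment> \<open>At a row and a column of equal color, a product with \<open>block t\<close>
    meets only entries of the adjugate inside \<open>positions\<close>, so the truncation leaves it
    unchanged; at different colors the truncated product is zero.\<close>
  have adj: "mmul B (block t) (adj t) b c = q t * idm B b c"
    "mmul B (adj t) (block t) b c = q t * idm B b c" for t b c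
  proof -
    have *: "block t x z * adj t z y = (if col x = col y then block t x z * adj0 t z y else 0)"
      "adj t x z * block t z y = (if col x = col y then adj0 t x z * block t z y else 0)"
      if "x \<in> B" "y \<in> B" "z \<in> B" for x y z
      using that by (auto simp: block_def adj_def adj0_def positions_def)
    show "mmul B (block t) (adj t) b c = q t * idm B b c"
    proof (cases "b \<in> B \<and> c \<in> B")
      case True
      then have "mmul B (block t) (adj t) b c = (if col b = col c then mmul B (block t) (adj0 t) b c else 0)"
        unfolding mmul_def by (simp add: *)
      then show ?thesis using True adj0 by (auto simp: idm_def)
    next
      case False
      then have "mmul B (block t) (adj t) b c = 0"
        by (intro mmul_positions) (auto simp: block_def adj_def positions_def)
      then show ?thesis using False by (auto simp: idm_def)
    qed
    show "mmul B (adj t) (block t) b c = q t * idm B b c"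
    proof (cases "b \<in> B \<and> c \<in> B")
      case True
      then have "mmul B (adj t) (block t) b c = (if col b = col c then mmul B (adj0 t) (block t) b c else 0)"
        unfolding mmul_def by (simp add: *)
      then show ?thesis using True adj0 by (auto simp: idm_def)
    next
      case False
      then have "mmul B (adj t) (block t) b c = 0"
        by (intro mmul_positions) (auto simp: block_def adj_def positions_def)
      then show ?thesis using False by (auto simp: idm_def)
    qed
  qed
  have inv: "(block t, \<lambda>b c. adj t b c / q t) \<in> block_group" if "q t \<noteq> 0" for t
  proof -
    have "mmul B (block t) (\<lambda>b c. adj t b c / q t) = idm B"
      using adj(1)[of t] that
      by (simp add: fun_eq_iff mmul_def sum_divide_distrib[symmetric])
    moreover have "mmul B (\<lambda>b c. adj t b c / q t) (block t) = idm B"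
      using adj(2)[of t] that
      by (simp add: fun_eq_iff mmul_def sum_divide_distrib[symmetric] divide_simps)
    ultimately show ?thesis
      by (auto simp: block_group_def block_def adj_def)
  qed
  have nonzero: "q (\<lambda>(b, c). g b c) \<noteq> 0" if gh: "(g, h) \<in> block_group" for g h
  proof -
    have "mt g * mt h = 1\<^sub>m n"
    proof (rule eq_matI)
      fix i j assume ij: "i < dim_row (1\<^sub>m n)" "j < dim_col (1\<^sub>m n)"
      have "(mt g * mt h) $$ (i, j) = (\<Sum>k = 0..<n. g (f i) (f k) * h (f k) (f j))"
        using ij by (simp add: mt_def scalar_prod_def)
      also have "\<dots> = mmul B g h (f i) (f j)"
        unfolding mmul_def by (rule sum_f)
      also have "\<dots> = idm B (f i) (f j)" using gh by (simp add: block_group_def)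
      also have "\<dots> = (1\<^sub>m n) $$ (i, j)"
        using ij ff by (auto simp: idm_def) (metis ff(1))
      finally show "(mt g * mt h) $$ (i, j) = (1\<^sub>m n) $$ (i, j)" .
    qed (simp_all add: mt_def)
    then have "det (mt g) * det (mt h) = 1"
      using det_mult[OF mt[of g] mt[of h]] by simp
    then show ?thesis
      unfolding q_def block_group_left[OF gh] by auto
  qed
  show ?thesis
    using q_poly adj_poly inv nonzero by (intro exI[of _ q] exI[of _ adj]) blast
qed

end

section \<open>The dimension of an orbit\<close>

text \<open>With \<open>r\<close> a power of the determinant it clears the denominators of a whole
  monomial at once; with \<open>r = 1\<close> it serves as a congruence rule.\<close>

lemma mon_scale:
  "(\<And>k. k < length as \<Longrightarrow> F k t = r * G k z) \<Longrightarrow> mon F as t = r ^ sum_list as * mon G as z"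
  by (induction as) (simp_all add: power_mult_distrib power_add mult.left_commute mult.assoc)

text \<open>The matrices \<open>\<psi> p\<close> are a basis of the commutant of \<open>N\<close> in the annihilator of \<open>v\<close>, dual to the entries
  at the positions \<open>NP\<close>; hence the orbit has dimension \<open>card (positions - NP)\<close>. The function \<open>q\<close> plays the
  role of the determinant and \<open>adj\<close> that of the adjugate matrix.\<close>

locale orbit_point = graded_index B col
  for B :: "'b set" and col :: "'b \<Rightarrow> 'c" +
  fixes N :: "'b \<Rightarrow> 'b \<Rightarrow> 'e::alg_closed_field" and v :: "'b \<Rightarrow> 'e"
    and q :: "('b \<times> 'b \<Rightarrow> 'e) \<Rightarrow> 'e" and adj :: "('b \<times> 'b \<Rightarrow> 'e) \<Rightarrow> 'b \<Rightarrow> 'b \<Rightarrow> 'e"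
    and NP :: "('b \<times> 'b) set" and \<psi> :: "'b \<times> 'b \<Rightarrow> 'b \<Rightarrow> 'b \<Rightarrow> 'e"
  assumes N_supp: "N b c \<noteq> 0 \<Longrightarrow> b \<in> B \<and> c \<in> B"
    and v_supp: "v b \<noteq> 0 \<Longrightarrow> b \<in> B"
    and poly_fun_q: "q \<in> polynomial_functions"
    and poly_fun_adj: "(\<lambda>t. adj t b c) \<in> polynomial_functions"
    and q_block_group: "q t \<noteq> 0 \<Longrightarrow> (block t, \<lambda>b c. adj t b c / q t) \<in> block_group"
    and q_nonzero: "(g, h) \<in> block_group \<Longrightarrow> q (\<lambda>(b, c). g b c) \<noteq> 0"
    and NP: "NP \<subseteq> positions"
    and \<psi>_supp: "p \<in> NP \<Longrightarrow> \<psi> p b c \<noteq> 0 \<Longrightarrow> (b, c) \<in> positions"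
    and \<psi>_comm: "p \<in> NP \<Longrightarrow> mmul B (\<psi> p) N = mmul B N (\<psi> p)"
    and \<psi>_vec: "p \<in> NP \<Longrightarrow> mvec B (\<psi> p) v b = 0"
    and \<psi>_dual: "p \<in> NP \<Longrightarrow> p' \<in> NP \<Longrightarrow> \<psi> p (fst p') (snd p') = (if p = p' then 1 else 0)"
    and stab_zero: "\<lbrakk>\<And>b c. a b c \<noteq> 0 \<Longrightarrow> (b, c) \<in> positions; mmul B a N = mmul B N a;
        \<And>b. mvec B a v b = 0; \<And>p. p \<in> NP \<Longrightarrow> a (fst p) (snd p) = 0\<rbrakk> \<Longrightarrow> a b c = 0"
begin

definition act :: "('b \<Rightarrow> 'b \<Rightarrow> 'e) \<Rightarrow> ('b \<Rightarrow> 'b \<Rightarrow> 'e) \<Rightarrow> 'b + 'b \<times> 'b \<Rightarrow> 'e" where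
  "act g h = case_sum (mvec B g v) (\<lambda>(b, c). mmul B (mmul B g N) h b c)"

definition orbit :: "('b + 'b \<times> 'b \<Rightarrow> 'e) set" where
  "orbit = {act g h | g h. (g, h) \<in> block_group}"

lemma block_group_unique:
  assumes "(g, h) \<in> block_group" "(g, h') \<in> block_group"
  shows "h = h'"
proof -
  have "mmul B h (idm B) = h" by (rule idm_right) (use block_group_zero[OF assms(1)] in blast)
  moreover have "mmul B (idm B) h' = h'" by (rule idm_left) (use block_group_zero[OF assms(2)] in blast)
  moreover
  have "mmul B (mmul B h g) h' = mmul B h (mmul B g h')"
    by (rule mmul_assoc)
  moreover have "mmul B h g = idm B" "mmul B g h' = idm B"
    using assms by (simp_all add: block_group_def)
  ultimately show ?thesis by simp
qed

lemma adj_eq: "(g, h) \<in> block_group \<Longrightarrow> adj (\<lambda>(b, c). g b c) b c = q (\<lambda>(b, c). g b c) * h b c"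
proof -
  assume gh: "(g, h) \<in> block_group"
  let ?t = "\<lambda>(b, c). g b c"
  have "(g, \<lambda>b c. adj ?t b c / q ?t) \<in> block_group"
    using q_block_group[OF q_nonzero[OF gh]] unfolding block_group_left[OF gh] .
  then have "h b c = adj ?t b c / q ?t"
    using block_group_unique[OF gh] by (metis)
  then show ?thesis using q_nonzero[OF gh] by simp
qed

lemma poly_fun_block: "(\<lambda>t. block t b c) \<in> polynomial_functions"
  unfolding block_def by (intro poly_fun_If polynomial_functions.intros)

text \<open>\<open>K\<close> is the exponent of the denominator. The second clause makes
  \<open>F\<close> depend on the entries at \<open>positions\<close> only, so it can be evaluated at
  arbitrary points of affine space and its number of variables is
  \<open>card positions\<close>.\<close>

definition lifts :: "nat \<Rightarrow> (('b + 'b \<times> 'b \<Rightarrow> 'e) \<Rightarrow> 'e) \<Rightarrow> bool" where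
  "lifts K f \<longleftrightarrow> (\<exists>F\<in>polynomial_functions. (\<forall>g h. (g, h) \<in> block_group \<longrightarrow>
     F (\<lambda>(b, c). g b c) = q (\<lambda>(b, c). g b c) ^ K * f (act g h)) \<and>
     (\<forall>t. F (\<lambda>(b, c). block t b c) = F t))"

lemma liftsI:
  assumes F: "F \<in> polynomial_functions"
    "\<And>g h. (g, h) \<in> block_group \<Longrightarrow> F (\<lambda>(b, c). g b c) = q (\<lambda>(b, c). g b c) ^ K * f (act g h)"
  shows "lifts K f"
proof -
  have "(\<lambda>t. F (\<lambda>(b, c). block t b c)) \<in> polynomial_functions"
    by (rule poly_fun_compose[OF F(1)]) (simp add: case_prod_unfold poly_fun_block)
  moreover have "F (\<lambda>(b, c). block (\<lambda>(b, c). g b c) b c) = q (\<lambda>(b, c). g b c) ^ K * f (act g h)"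
    if "(g, h) \<in> block_group" for g h
    using F(2) that by (simp add: block_group_left)
  ultimately show ?thesis
    unfolding lifts_def
    by (intro bexI[of _ "\<lambda>t. F (\<lambda>(b, c). block t b c)"] conjI) simp_all
qed

lemma liftsE:
  assumes "lifts K f"
  obtains F where "F \<in> polynomial_functions"
    "\<And>g h. (g, h) \<in> block_group \<Longrightarrow> F (\<lambda>(b, c). g b c) = q (\<lambda>(b, c). g b c) ^ K * f (act g h)"
    "\<And>t. F (\<lambda>(b, c). block t b c) = F t"
  using assms unfolding lifts_def by blast

text \<open>Since \<open>h = adj g / q g\<close>, a power of \<open>q\<close> clears the denominators of \<open>f (act g h)\<close>.\<close>

lemma pull_back:
  assumes "f \<in> polynomial_functions"
  shows "\<exists>K0. \<forall>K\<ge>K0. lifts K f"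
  using assms
proof induction
  case (const c)
  have "lifts K (\<lambda>_. c)" for K
    by (rule liftsI[of "\<lambda>t. q t ^ K * c"])
      (simp_all add: polynomial_functions.mult poly_fun_power poly_fun_q polynomial_functions.const)
  then show ?case by blast
next
  case (coord i)
  have "lifts K (\<lambda>p. p i)" if K: "1 \<le> K" for K
  proof (cases i)
    case (Inl b)
    show ?thesis
    proof (rule liftsI[of "\<lambda>t. q t ^ K * (\<Sum>c\<in>B. block t b c * v c)"])
      show "(\<lambda>t. q t ^ K * (\<Sum>c\<in>B. block t b c * v c)) \<in> polynomial_functions"
        by (intro polynomial_functions.mult poly_fun_power poly_fun_q poly_fun_sum poly_fun_block
            polynomial_functions.const)
      fix g h :: "'b \<Rightarrow> 'b \<Rightarrow> 'e" assume "(g, h) \<in> block_group"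
      then show "q (\<lambda>(b, c). g b c) ^ K * (\<Sum>c\<in>B. block (\<lambda>(b, c). g b c) b c * v c) =
          q (\<lambda>(b, c). g b c) ^ K * act g h i"
        by (simp add: Inl act_def mvec_def block_group_left)
    qed
  next
    case (Inr bc)
    obtain b c where bc: "bc = (b, c)" by (cases bc)
    \<comment> \<open>The adjugate is \<open>q t\<close> times the inverse and thus supplies one
      factor \<open>q t\<close> itself; the exponent in front is therefore
      \<open>K - 1\<close>.\<close>
    show ?thesis
    proof (rule liftsI[of "\<lambda>t. q t ^ (K - 1) * (\<Sum>d\<in>B. (\<Sum>e\<in>B. block t b e * N e d) * adj t d c)"])
      show "(\<lambda>t. q t ^ (K - 1) * (\<Sum>d\<in>B. (\<Sum>e\<in>B. block t b e * N e d) * adj t d c)) \<in> polynomial_functions"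
        by (intro polynomial_functions.mult poly_fun_power poly_fun_q poly_fun_sum poly_fun_block
            polynomial_functions.const poly_fun_adj)
      fix g h :: "'b \<Rightarrow> 'b \<Rightarrow> 'e" assume gh: "(g, h) \<in> block_group"
      define t where "t = (\<lambda>(b, c). g b c)"
      have t: "block t = g" "adj t = (\<lambda>b c. q t * h b c)"
        using block_group_left[OF gh] adj_eq[OF gh] by (simp_all add: t_def fun_eq_iff)
      have "q t ^ (K - 1) * (\<Sum>d\<in>B. (\<Sum>e\<in>B. block t b e * N e d) * adj t d c)
          = q t ^ (K - 1) * (q t * (\<Sum>d\<in>B. (\<Sum>e\<in>B. g b e * N e d) * h d c))"
        by (simp add: t sum_distrib_left mult.left_commute)
      also have "\<dots> = (q t * q t ^ (K - 1)) * (\<Sum>d\<in>B. (\<Sum>e\<in>B. g b e * N e d) * h d c)"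
        by (simp only: mult_ac)
      also have "q t * q t ^ (K - 1) = q t ^ K"
        using K by (simp add: power_eq_if)
      finally show "q (\<lambda>(b, c). g b c) ^ (K - 1) * (\<Sum>d\<in>B. (\<Sum>e\<in>B. block (\<lambda>(b, c). g b c) b e * N e d) * adj (\<lambda>(b, c). g b c) d c)
          = q (\<lambda>(b, c). g b c) ^ K * act g h i"
        by (simp add: Inr bc act_def mmul_def t_def)
    qed
  qed
  then show ?case by blast
next
  case (add f1 f2)
  then obtain K1 K2 where K12: "\<forall>K\<ge>K1. lifts K f1" "\<forall>K\<ge>K2. lifts K f2" by (elim exE)
  \<comment> \<open>Two summands need the same denominator, which is why the claim is made for all
    sufficiently large \<open>K\<close> and not just for one.\<close>
  have "lifts K (\<lambda>p. f1 p + f2 p)" if "max K1 K2 \<le> K" for K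
  proof -
    have "lifts K f1" "lifts K f2" using K12 that by auto
    obtain F1 where F1: "F1 \<in> polynomial_functions" "\<And>g h. (g, h) \<in> block_group \<Longrightarrow>
      F1 (\<lambda>(b, c). g b c) = q (\<lambda>(b, c). g b c) ^ K * f1 (act g h)"
      "\<And>t. F1 (\<lambda>(b, c). block t b c) = F1 t"
      using \<open>lifts K f1\<close> by (rule liftsE) blast
    obtain F2 where F2: "F2 \<in> polynomial_functions" "\<And>g h. (g, h) \<in> block_group \<Longrightarrow>
      F2 (\<lambda>(b, c). g b c) = q (\<lambda>(b, c). g b c) ^ K * f2 (act g h)"
      "\<And>t. F2 (\<lambda>(b, c). block t b c) = F2 t"
      using \<open>lifts K f2\<close> by (rule liftsE) blast
    show ?thesis
      by (rule liftsI[OF polynomial_functions.add[OF F1(1) F2(1)]]) (simp add: F1(2) F2(2) distrib_left)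
  qed
  then show ?case by blast
next
  case (mult f1 f2)
  then obtain K1 K2 where K12: "\<forall>K\<ge>K1. lifts K f1" "\<forall>K\<ge>K2. lifts K f2" by (elim exE)
  have "lifts K (\<lambda>p. f1 p * f2 p)" if K: "K1 + K2 \<le> K" for K
  proof -
    have "lifts K1 f1" "lifts (K - K1) f2" using K12 K by auto
    obtain F1 where F1: "F1 \<in> polynomial_functions" "\<And>g h. (g, h) \<in> block_group \<Longrightarrow>
      F1 (\<lambda>(b, c). g b c) = q (\<lambda>(b, c). g b c) ^ K1 * f1 (act g h)"
      "\<And>t. F1 (\<lambda>(b, c). block t b c) = F1 t"
      using \<open>lifts K1 f1\<close> by (rule liftsE) blast
    obtain F2 where F2: "F2 \<in> polynomial_functions" "\<And>g h. (g, h) \<in> block_group \<Longrightarrow>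
      F2 (\<lambda>(b, c). g b c) = q (\<lambda>(b, c). g b c) ^ (K - K1) * f2 (act g h)"
      "\<And>t. F2 (\<lambda>(b, c). block t b c) = F2 t"
      using \<open>lifts (K - K1) f2\<close> by (rule liftsE) blast
    have pow: "r ^ K = r ^ K1 * r ^ (K - K1)" for r :: 'e
      using K by (simp add: power_add[symmetric])
    show ?thesis
      by (rule liftsI[OF polynomial_functions.mult[OF F1(1) F2(1)]])
        (simp add: F1(2) F2(2) pow mult_ac)
  qed
  then show ?case by blast
qed

text \<open>Affine space is irreducible, so the conditions \<open>F t \<noteq> 0\<close>,
  \<open>q t \<noteq> 0\<close> and \<open>R \<noteq> 0\<close>, each satisfiable on its own, hold
  together at some \<open>t\<close>. A nonzero value of \<open>f\<close> anywhere on the orbit would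
  thus produce one at a generic point.\<close>

lemma generic_vanish:
  assumes f: "f \<in> polynomial_functions" and R: "R \<in> polynomial_functions" "R (\<lambda>(b, c). idm B b c) \<noteq> 0"
    and vanish: "\<And>g h. (g, h) \<in> block_group \<Longrightarrow> R (\<lambda>(b, c). g b c) \<noteq> 0 \<Longrightarrow> f (act g h) = 0"
    and gh: "(g, h) \<in> block_group"
  shows "f (act g h) = 0"
proof (rule ccontr)
  assume ne: "f (act g h) \<noteq> 0"
  obtain K where "lifts K f"
    using pull_back[OF f] by blast
  then obtain F where F: "F \<in> polynomial_functions" "\<And>g h. (g, h) \<in> block_group \<Longrightarrow>
    F (\<lambda>(b, c). g b c) = q (\<lambda>(b, c). g b c) ^ K * f (act g h)"
    "\<And>t. F (\<lambda>(b, c). block t b c) = F t"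
    by (rule liftsE) blast
  define R' where "R' t = q t * R (\<lambda>(b, c). block t b c)" for t
  have R': "R' \<in> polynomial_functions"
    unfolding R'_def[abs_def]
    by (intro polynomial_functions.mult poly_fun_q poly_fun_compose[OF R(1)])
      (simp add: case_prod_unfold poly_fun_block)
  have "R' (\<lambda>(b, c). idm B b c) \<noteq> 0"
    using q_nonzero[OF idm_block_group] R(2) by (simp add: R'_def block_group_left[OF idm_block_group])
  moreover have "F (\<lambda>(b, c). g b c) \<noteq> 0"
    using F(2)[OF gh] q_nonzero[OF gh] ne by simp
  ultimately obtain t where t: "F t \<noteq> 0" "R' t \<noteq> 0"
    using poly_fun_mult_nonzero[OF F(1) R'] by blast
  let ?h = "\<lambda>b c. adj t b c / q t"
  have bg: "(block t, ?h) \<in> block_group"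
    using t(2) by (intro q_block_group) (auto simp: R'_def)
  have "f (act (block t) ?h) = 0"
    by (rule vanish[OF bg]) (use t(2) in \<open>auto simp: R'_def\<close>)
  then have "F (\<lambda>(b, c). block t b c) = 0"
    using F(2)[OF bg] by simp
  then show False using t(1) F(3) by simp
qed

section \<open>The stabilizer and the upper bound for chains\<close>

definition stab :: "('b \<times> 'b \<Rightarrow> 'e) \<Rightarrow> 'b \<Rightarrow> 'b \<Rightarrow> 'e" where
  "stab s = (\<lambda>b c. idm B b c + (\<Sum>p\<in>NP. s p * \<psi> p b c))"

lemma finite_NP: "finite NP"
  using finite_subset[OF NP finite_positions] .

lemma idm_N: "mmul B (idm B) N = N" "mmul B N (idm B) = N"
  unfolding mmul_idm_left[OF finite_B] mmul_idm_right[OF finite_B]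
  using N_supp by (auto simp: fun_eq_iff)

lemma idm_v: "mvec B (idm B) v = v"
  unfolding mvec_idm[OF finite_B] using v_supp by (auto simp: fun_eq_iff)

lemma stab_positions: "(b, c) \<notin> positions \<Longrightarrow> stab s b c = 0"
  using \<psi>_supp by (auto simp: stab_def idm_def positions_def intro!: sum.neutral)

lemma stab_N: "mmul B (stab s) N = mmul B N (stab s)"
proof (intro ext)
  fix x y
  have "mmul B (stab s) N x y = mmul B (idm B) N x y + (\<Sum>p\<in>NP. s p * mmul B (\<psi> p) N x y)"
    unfolding mmul_def stab_def
    by (simp add: distrib_right sum.distrib sum_distrib_left sum_distrib_right mult.assoc)
      (rule sum.swap)
  also have "\<dots> = mmul B N (idm B) x y + (\<Sum>p\<in>NP. s p * mmul B N (\<psi> p) x y)"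
    using \<psi>_comm by (simp add: idm_N)
  also have "\<dots> = mmul B N (stab s) x y"
    unfolding mmul_def stab_def
    by (simp add: distrib_left sum.distrib sum_distrib_left sum_distrib_right mult_ac)
      (rule sum.swap)
  finally show "mmul B (stab s) N x y = mmul B N (stab s) x y" .
qed

lemma stab_v: "mvec B (stab s) v = v"
proof
  fix x
  have "mvec B (stab s) v x = mvec B (idm B) v x + (\<Sum>p\<in>NP. s p * mvec B (\<psi> p) v x)"
    unfolding mvec_def stab_def
    by (simp add: distrib_right sum.distrib sum_distrib_left sum_distrib_right mult.assoc)
      (rule sum.swap)
  then show "mvec B (stab s) v x = v x"
    using \<psi>_vec by (simp add: idm_v)
qed

lemma act_stab:
  assumes gh: "(g, h) \<in> block_group" and aa: "(stab s, a) \<in> block_group"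
  shows "(mmul B g (stab s), mmul B a h) \<in> block_group"
    "act (mmul B g (stab s)) (mmul B a h) = act g h"
proof -
  show "(mmul B g (stab s), mmul B a h) \<in> block_group"
    by (rule block_group_mult[OF gh aa])
  have 1: "mvec B (mmul B g (stab s)) v = mvec B g v"
    by (simp add: mvec_mmul stab_v)
  have "mmul B (mmul B (mmul B g (stab s)) N) (mmul B a h)
      = mmul B g (mmul B (mmul B (stab s) N) (mmul B a h))"
    by (simp only: mmul_assoc)
  also have "\<dots> = mmul B g (mmul B N (mmul B (mmul B (stab s) a) h))"
    by (simp only: stab_N mmul_assoc)
  also have "mmul B (stab s) a = idm B" using aa by (simp add: block_group_def)
  also have "mmul B (idm B) h = h" by (rule idm_left) (use block_group_zero[OF gh] in blast)
  also have "mmul B g (mmul B N h) = mmul B (mmul B g N) h" by (simp only: mmul_assoc)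
  finally show "act (mmul B g (stab s)) (mmul B a h) = act g h"
    unfolding act_def 1 by simp
qed

text \<open>The entries of \<open>g * stab s\<close> at the positions \<open>NP\<close> are an affine function of \<open>s\<close>, which is
  surjective for generic \<open>g\<close> since it is the identity for \<open>g = 1\<close>.\<close>

lemma generic_surjective:
  "\<exists>R\<in>polynomial_functions. R (\<lambda>(b, c). idm B b c) \<noteq> 0 \<and>
    (\<forall>g h \<tau>. (g, h) \<in> block_group \<longrightarrow> R (\<lambda>(b, c). g b c) \<noteq> 0 \<longrightarrow>
      (\<exists>s. \<forall>p\<in>NP. mmul B g (stab s) (fst p) (snd p) = \<tau> p))"
proof -
  define e where "e = card NP"
  obtain P where P: "bij_betw P {0..<e} NP"
    using ex_bij_betw_nat_finite[OF finite_NP] unfolding e_def by blast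
  have PNP: "P i \<in> NP" if "i < e" for i using bij_betwE[OF P] that by simp
  have Pinj: "P i = P j \<longleftrightarrow> i = j" if "i < e" "j < e" for i j
    using P that by (auto simp: bij_betw_def inj_on_def)
  have sumP: "(\<Sum>p\<in>NP. F p) = (\<Sum>i<e. F (P i))" for F :: "_ \<Rightarrow> 'e"
    using sum.reindex_bij_betw[OF P, of F] by (simp add: atLeast0LessThan)
  define U where "U i t p = (if p \<in> NP then mmul B (block t) (\<psi> (P i)) (fst p) (snd p) else 0)" for i t p
  have U_id: "U i (\<lambda>(b, c). idm B b c) p = (if p = P i then 1 else 0)" if "i < e" for i p
  proof (cases "p \<in> NP")
    case True
    have "mmul B (idm B) (\<psi> (P i)) = \<psi> (P i)"
      by (rule idm_left) (use \<psi>_supp[OF PNP[OF that]] in blast)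
    then show ?thesis
      using True \<psi>_dual[OF PNP[OF that] True] by (simp add: U_def block_group_left[OF idm_block_group])
  qed (use PNP that in \<open>auto simp: U_def\<close>)
  have "\<exists>F\<in>polynomial_functions. F (\<lambda>(b, c). idm B b c) \<noteq> 0 \<and>
    (\<forall>y c. F y \<noteq> 0 \<longrightarrow> (\<forall>j. (\<Sum>i<e. c i * U i y j) = 0) \<longrightarrow> (\<forall>i<e. c i = 0))"
  proof (rule independence_open)
    show "(\<lambda>t. U i t p) \<in> polynomial_functions" for i p
      unfolding U_def mmul_def
      by (intro poly_fun_If poly_fun_sum polynomial_functions.mult poly_fun_block
          polynomial_functions.const)
    fix c assume c: "\<And>p. (\<Sum>i<e. c i * U i (\<lambda>(b, c). idm B b c) p) = 0"
    show "\<forall>i<e. c i = 0"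
    proof (intro allI impI)
      fix j assume j: "j < e"
      have "(\<Sum>i<e. c i * U i (\<lambda>(b, c). idm B b c) (P j)) = (\<Sum>i<e. if i = j then c i else 0)"
        using Pinj j by (intro sum.cong) (auto simp: U_id)
      then show "c j = 0" using c[of "P j"] j by simp
    qed
  qed
  then obtain R where R: "R \<in> polynomial_functions" "R (\<lambda>(b, c). idm B b c) \<noteq> 0"
    "\<And>y c. R y \<noteq> 0 \<Longrightarrow> \<forall>j. (\<Sum>i<e. c i * U i y j) = 0 \<Longrightarrow> \<forall>i<e. c i = 0"
    by (elim bexE conjE) blast
  have "\<exists>s. \<forall>p\<in>NP. mmul B g (stab s) (fst p) (snd p) = \<tau> p"
    if gh: "(g, h) \<in> block_group" and Rg: "R (\<lambda>(b, c). g b c) \<noteq> 0" for g h \<tau>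
  proof -
    let ?t = "\<lambda>(b, c). g b c"
    define r where "r p = \<tau> p - g (fst p) (snd p)" for p
    \<comment> \<open>The inhomogeneous system for \<open>s\<close> is solved through a homogeneous
      one with the right-hand side \<open>r\<close> as an additional column \<open>e\<close>: there
      are \<open>e + 1\<close> unknowns and \<open>e\<close> equations. Independence of the first
      \<open>e\<close> columns forces \<open>c e \<noteq> 0\<close>, and dividing by it gives
      \<open>s\<close>.\<close>
    obtain c where c: "\<exists>k\<in>{..e}. c k \<noteq> 0"
      "\<And>p. p \<in> NP \<Longrightarrow> (\<Sum>k\<in>{..e}. c k * (if k < e then U k ?t p else r p)) = 0"
      using nontrivial_solution[of NP "{..e}" "\<lambda>k p. if k < e then U k ?t p else r p"] finite_NP
      by (auto simp: e_def)
    have split: "(\<Sum>k<e. c k * U k ?t p) + c e * r p = 0" if "p \<in> NP" for p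
      using c(2)[OF that] by (simp add: lessThan_Suc_atMost[symmetric])
    have ce: "c e \<noteq> 0"
    proof
      assume "c e = 0"
      then have "(\<Sum>k<e. c k * U k ?t p) = 0" for p
        using split[of p] by (cases "p \<in> NP") (auto simp: U_def)
      then have "\<forall>i<e. c i = 0" using R(3)[OF Rg] by blast
      then show False using c(1) \<open>c e = 0\<close> by (auto simp: le_less)
    qed
    define s where "s p = - c (the_inv_into {0..<e} P p) / c e" for p
    have sP: "s (P i) = - c i / c e" if "i < e" for i
      using P that by (simp add: s_def the_inv_into_f_f bij_betw_def)
    have "mmul B g (stab s) (fst p) (snd p) = \<tau> p" if p: "p \<in> NP" for p
    proof -
      have "mmul B g (stab s) (fst p) (snd p)
          = mmul B g (idm B) (fst p) (snd p) + (\<Sum>p'\<in>NP. s p' * mmul B g (\<psi> p') (fst p) (snd p))"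
        unfolding mmul_def stab_def
        by (simp add: distrib_left sum.distrib sum_distrib_left sum_distrib_right mult_ac)
          (rule sum.swap)
      also have "mmul B g (idm B) = g" by (rule idm_right) (use block_group_zero[OF gh] in blast)
      also have "(\<Sum>p'\<in>NP. s p' * mmul B g (\<psi> p') (fst p) (snd p)) = (\<Sum>k<e. - c k / c e * U k ?t p)"
        unfolding sumP using p by (intro sum.cong refl) (simp add: sP U_def block_group_left[OF gh])
      also have "\<dots> = - (\<Sum>k<e. c k * U k ?t p) / c e"
        by (simp add: sum_divide_distrib sum_negf)
      also have "- (\<Sum>k<e. c k * U k ?t p) = c e * r p"
        using split[OF p] by (simp add: eq_neg_iff_add_eq_0 neg_eq_iff_add_eq_0)
      finally show ?thesis using ce by (simp add: r_def)
    qed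
    then show ?thesis by blast
  qed
  with R(1,2) show ?thesis by blast
qed

text \<open>An instance of \<open>mon_independent\<close> for the flag of coordinate subspaces,
  where coordinate \<open>k\<close> vanishes on member \<open>k\<close> but not on the next one.
  These subspaces are images of affine space under the projections \<pi> and inherit irreducibility
  from it.\<close>

lemma coordinate_monomials_independent:
  fixes c :: "nat list \<Rightarrow> 'e"
  assumes "\<And>\<tau> :: nat \<Rightarrow> 'e. (\<Sum>bs\<in>exponents n M. c bs * mon (\<lambda>k \<tau>. \<tau> k) bs \<tau>) = 0"
  shows "\<forall>bs\<in>exponents n M. c bs = 0"
proof (rule mon_independent[where n = n and k = n and g = "\<lambda>k \<tau>. \<tau> k" and
      Z = "\<lambda>k. {\<tau> :: nat \<Rightarrow> 'e. \<forall>j\<ge>k. \<tau> j = 0}"])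
  fix k and f h :: "(nat \<Rightarrow> 'e) \<Rightarrow> 'e"
  assume f: "f \<in> polynomial_functions" and h: "h \<in> polynomial_functions"
    and fh: "\<forall>z\<in>{\<tau>. \<forall>j\<ge>k. \<tau> j = 0}. f z * h z = 0"
  define \<pi> where "\<pi> \<tau> = (\<lambda>j. if k \<le> j then 0 else \<tau> j)" for \<tau> :: "nat \<Rightarrow> 'e"
  have \<pi>: "(\<lambda>\<tau>. \<pi> \<tau> i) \<in> polynomial_functions" for i
    unfolding \<pi>_def by (intro poly_fun_If polynomial_functions.intros)
  have \<pi>_id: "\<pi> \<tau> = \<tau>" if "\<forall>j\<ge>k. \<tau> j = 0" for \<tau>
    using that by (auto simp: \<pi>_def)
  show "(\<forall>z\<in>{\<tau>. \<forall>j\<ge>k. \<tau> j = 0}. f z = 0) \<or> (\<forall>z\<in>{\<tau>. \<forall>j\<ge>k. \<tau> j = 0}. h z = 0)"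
  proof (rule ccontr)
    assume "\<not> ?thesis"
    then obtain x y where x: "\<forall>j\<ge>k. x j = 0" "f x \<noteq> 0" and y: "\<forall>j\<ge>k. y j = 0" "h y \<noteq> 0"
      by blast
    have "f (\<pi> x) \<noteq> 0" "h (\<pi> y) \<noteq> 0" using x y by (simp_all add: \<pi>_id)
    then obtain r where r: "f (\<pi> r) \<noteq> 0" "h (\<pi> r) \<noteq> 0"
      using poly_fun_mult_nonzero[OF poly_fun_compose[OF f, of \<pi>, OF \<pi>] poly_fun_compose[OF h, of \<pi>, OF \<pi>]] by blast
    moreover have "\<forall>j\<ge>k. \<pi> r j = 0" by (simp add: \<pi>_def)
    ultimately show False using fh by auto
  qed
next
  show "\<exists>z\<in>{\<tau>. \<forall>j\<ge>Suc k. \<tau> j = (0 :: 'e)}. z k \<noteq> 0" for k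
    by (intro bexI[of _ "\<lambda>j. if j = k then 1 else 0"]) auto
qed (use assms in \<open>auto intro: polynomial_functions.coord\<close>)

lemma exponents_sum_list: "as \<in> exponents k M \<Longrightarrow> sum_list as \<le> k * M"
proof (induction as arbitrary: k)
  case (Cons a as)
  then obtain m where "k = Suc m" "as \<in> exponents m M" "a \<le> M"
    by (auto simp: exponents_def)
  with Cons.IH[of m] show ?case by simp
qed simp

text \<open>The \<open>n\<close> functions separating consecutive members of the chain are
  independent on the orbit, and the \<open>card NP\<close> entries of \<open>g\<close> at
  \<open>NP\<close> are independent over them, since multiplying \<open>g\<close> by stabilizer
  elements changes only the latter. So the monomials in all of them, pulled back to block matrices,
  are linearly independent, and too many functions contradict
  \<open>degree_bounded_dependent\<close>.\<close>

lemma chain_length_le: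
  assumes irr: "\<forall>i\<le>n. irreducible_closed (subtopology zariski_topology orbit) (Z i)"
    and inc: "\<forall>i<n. Z i \<subset> Z (Suc i)"
  shows "n + card NP \<le> card positions"
proof (rule ccontr)
  assume contr: "\<not> n + card NP \<le> card positions"
  define e where "e = card NP"
  have closed: "closedin (subtopology zariski_topology orbit) (Z i)" "Z i \<subseteq> orbit" "Z i \<noteq> {}" if "i \<le> n" for i
    using irr that closedin_subset unfolding irreducible_closed_def by fastforce+
  have "\<exists>f\<in>polynomial_functions. (\<forall>z\<in>Z k. f z = 0) \<and> (\<exists>z\<in>Z (Suc k). f z \<noteq> 0)" if k: "k < n" for k
  proof -
    obtain z where z: "z \<in> Z (Suc k)" "z \<notin> Z k" using inc k by blast
    have "z \<in> orbit" using closed(2)[of "Suc k"] k z(1) by auto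
    then obtain f where "f \<in> polynomial_functions" "f z \<noteq> 0" "\<forall>c\<in>Z k. f c = 0"
      using closedin_zariski_separate[OF closed(1)[of k] _ z(2)] k by auto
    then show ?thesis using z(1) by blast
  qed
  then obtain f where f: "\<And>k. k < n \<Longrightarrow> f k \<in> polynomial_functions"
    "\<And>k z. k < n \<Longrightarrow> z \<in> Z k \<Longrightarrow> f k z = 0" "\<And>k. k < n \<Longrightarrow> \<exists>z\<in>Z (Suc k). f k z \<noteq> 0"
    by metis
  have f_indep: "\<forall>as\<in>exponents n M. c as = 0"
    if "\<forall>z\<in>Z n. (\<Sum>as\<in>exponents n M. c as * mon f as z) = 0" for c M
    using that f closed(3)[of 0] inc irreducible_closed_mult irr
    by (intro mon_independent[where n = n and Z = Z and g = f and k = n]) blast+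
  have "\<forall>k\<in>{..<n}. \<exists>K0. \<forall>K\<ge>K0. lifts K (f k)" using pull_back f(1) by blast
  then obtain K0 where K0: "\<And>k K. k < n \<Longrightarrow> K0 k \<le> K \<Longrightarrow> lifts K (f k)" by (metis lessThan_iff)
  define K where "K = (\<Sum>k<n. K0 k)"
  have "K0 k \<le> K" if "k < n" for k
    unfolding K_def using that by (intro member_le_sum) auto
  then have "lifts K (f k)" if "k < n" for k using K0 that by blast
  then have "\<forall>k. \<exists>F. k < n \<longrightarrow> F \<in> polynomial_functions \<and> (\<forall>g h. (g, h) \<in> block_group \<longrightarrow>
     F (\<lambda>(b, c). g b c) = q (\<lambda>(b, c). g b c) ^ K * f k (act g h)) \<and>
     (\<forall>t. F (\<lambda>(b, c). block t b c) = F t)"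
    unfolding lifts_def by blast
  then obtain F where F: "\<And>k. k < n \<Longrightarrow> F k \<in> polynomial_functions"
    "\<And>k g h. k < n \<Longrightarrow> (g, h) \<in> block_group \<Longrightarrow>
      F k (\<lambda>(b, c). g b c) = q (\<lambda>(b, c). g b c) ^ K * f k (act g h)"
    "\<And>k t. k < n \<Longrightarrow> F k (\<lambda>(b, c). block t b c) = F k t"
    by metis
  define Q where "Q t = q (\<lambda>(b, c). block t b c) ^ K" for t
  have Q: "Q \<in> polynomial_functions"
    unfolding Q_def[abs_def]
    by (intro poly_fun_power poly_fun_compose[OF poly_fun_q]) (simp add: case_prod_unfold poly_fun_block)
  have Qg: "Q (\<lambda>(b, c). g b c) = q (\<lambda>(b, c). g b c) ^ K" if "(g, h) \<in> block_group" for g h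
    using block_group_left[OF that] by (simp add: Q_def)
  obtain DQ where DQ: "degree_bounded DQ Q" using poly_fun_degree_bounded[OF Q] by blast
  have "\<forall>k. \<exists>D. k < n \<longrightarrow> degree_bounded D (F k)" using poly_fun_degree_bounded[OF F(1)] by blast
  then obtain DF where DF: "\<And>k. k < n \<Longrightarrow> degree_bounded (DF k) (F k)" by metis
  define D where "D = DQ + (\<Sum>k<n. DF k)"
  have "DF k \<le> D" if "k < n" for k
    using member_le_sum[of k "{..<n}" DF] that by (simp add: D_def)
  then have DF: "degree_bounded D (F k)" if "k < n" for k
    using DF that degree_bounded_mono by blast
  have DQ: "degree_bounded D Q" using DQ by (rule degree_bounded_mono) (simp add: D_def)
  obtain P where P: "bij_betw P {0..<e} NP"
    using ex_bij_betw_nat_finite[OF finite_NP] unfolding e_def by blast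
  have PNP: "P i \<in> NP" if "i < e" for i using bij_betwE[OF P] that by simp
  \<comment> \<open>With exponents up to \<open>M\<close>, the products below have partial degrees
    at most \<open>D0 * M\<close>: \<open>n * D\<close> comes once from the functions and once from
    the powers of \<open>Q\<close>, and \<open>e\<close> from the matrix entries. The final 1 yields
    \<open>D0 * M + 1 \<le> D0 * (M + 1)\<close>. For N = \<open>card positions\<close>, the choice
    \<open>M = D0 ^ N\<close> makes \<open>(D0 * (M + 1)) ^ N\<close> equal to
    \<open>M * (M + 1) ^ N\<close>, which is less than \<open>(M + 1) ^ (N + 1)\<close>.\<close>
  define D0 where "D0 = 2 * (n * D) + e + 1"
  define M where "M = D0 ^ card positions"
  \<comment> \<open>The extra power of \<open>Q\<close> brings all monomials to the common factor
    \<open>Q ^ (n * M)\<close>, which can then be cancelled from a linear relation.\<close>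
  define H where "H as t = mon F as t * Q t ^ (n * M - sum_list as)" for as t
  define L where "L bs t = mon (\<lambda>k (t :: 'b \<times> 'b \<Rightarrow> 'e). t (P k)) bs t" for bs t
  define E where "E = exponents n M \<times> exponents e M"
  have Hg: "H as (\<lambda>(b, c). g b c) = Q (\<lambda>(b, c). g b c) ^ (n * M) * mon f as (act g h)"
    if as: "as \<in> exponents n M" and gh: "(g, h) \<in> block_group" for as g h
  proof -
    let ?t = "\<lambda>(b, c). g b c"
    have "mon F as ?t = Q ?t ^ sum_list as * mon f as (act g h)"
      using exponents_length[OF as] F(2)[OF _ gh] Qg[OF gh] by (intro mon_scale) simp
    moreover have "Q ?t ^ (n * M) = Q ?t ^ sum_list as * Q ?t ^ (n * M - sum_list as)"
      using exponents_sum_list[OF as] by (simp add: power_add[symmetric])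
    ultimately show ?thesis by (simp add: H_def mult_ac)
  qed
  have "\<exists>c. (\<exists>k\<in>E. c k \<noteq> 0) \<and> (\<forall>t. (\<Sum>k\<in>E. c k * (H (fst k) t * L (snd k) t)) = 0)"
  proof (rule degree_bounded_dependent[where Q = positions and D = "D0 * M"])
    show "finite E" by (simp add: E_def)
    fix k assume k: "k \<in> E"
    have as: "fst k \<in> exponents n M" and bs: "snd k \<in> exponents e M" using k by (auto simp: E_def)
    have "degree_bounded (n * (M * D) + (n * M) * D) (\<lambda>t. H (fst k) t)"
      unfolding H_def
      by (intro degree_bounded_mult degree_bounded_mon[OF _ as] DF
          degree_bounded_mono[OF degree_bounded_power[OF DQ]]) auto
    moreover have "degree_bounded (e * (M * 1)) (\<lambda>t. L (snd k) t)"
      unfolding L_def by (intro degree_bounded_mon[OF _ bs] degree_bounded_coord)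
    ultimately have "degree_bounded (n * (M * D) + (n * M) * D + e * (M * 1)) (\<lambda>t. H (fst k) t * L (snd k) t)"
      by (rule degree_bounded_mult)
    then show "degree_bounded (D0 * M) (\<lambda>t. H (fst k) t * L (snd k) t)"
      by (rule degree_bounded_mono) (simp add: D0_def algebra_simps)
    fix t t' :: "'b \<times> 'b \<Rightarrow> 'e" assume tt: "\<forall>i\<in>positions. t i = t' i"
    then have "block t = block t'" by (auto simp: block_def fun_eq_iff)
    then have "Q t = Q t'" "\<And>k. k < n \<Longrightarrow> F k t = F k t'"
      using F(3) by (auto simp: Q_def) metis
    moreover have "\<And>k. k < e \<Longrightarrow> t (P k) = t' (P k)" using tt PNP NP by blast
    ultimately have "mon F (fst k) t = 1 ^ sum_list (fst k) * mon F (fst k) t'"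
      "L (snd k) t = 1 ^ sum_list (snd k) * L (snd k) t'"
      unfolding L_def using exponents_length[OF as] exponents_length[OF bs]
      by (intro mon_scale; simp)+
    then show "H (fst k) t * L (snd k) t = H (fst k) t' * L (snd k) t'"
      using \<open>Q t = Q t'\<close> by (simp add: H_def)
  next
    have "D0 * M + 1 \<le> D0 * (M + 1)" by (simp add: D0_def)
    then have "(D0 * M + 1) ^ card positions \<le> (D0 * (M + 1)) ^ card positions"
      by (rule power_mono) simp
    also have "\<dots> = M * (M + 1) ^ card positions" by (simp only: power_mult_distrib M_def)
    also have "\<dots> < (M + 1) ^ Suc (card positions)" by simp
    also have "\<dots> \<le> (M + 1) ^ (n + e)"
      using contr by (intro power_increasing) (auto simp: e_def)
    also have "\<dots> = card E" by (simp add: E_def card_cartesian_product card_exponents power_add)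
    finally show "(D0 * M + 1) ^ card positions < card E" .
  qed (rule finite_positions)
  then obtain c where c: "\<exists>k\<in>E. c k \<noteq> 0" "\<And>t. (\<Sum>k\<in>E. c k * (H (fst k) t * L (snd k) t)) = 0"
    by blast
  have rel: "(\<Sum>bs\<in>exponents e M. (\<Sum>as\<in>exponents n M. c (as, bs) * mon f as (act g h)) * L bs (\<lambda>(b, c). g b c)) = 0"
    if gh: "(g, h) \<in> block_group" for g h
  proof -
    let ?t = "\<lambda>(b, c). g b c"
    have "0 = (\<Sum>(as, bs)\<in>E. c (as, bs) * (H as ?t * L bs ?t))"
      using c(2)[of ?t] by (simp add: case_prod_unfold)
    also have "\<dots> = (\<Sum>(as, bs)\<in>E. Q ?t ^ (n * M) * (c (as, bs) * mon f as (act g h) * L bs ?t))"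
      by (intro sum.cong refl) (auto simp: E_def Hg[OF _ gh] mult_ac)
    also have "\<dots> = Q ?t ^ (n * M) * (\<Sum>as\<in>exponents n M. \<Sum>bs\<in>exponents e M. c (as, bs) * mon f as (act g h) * L bs ?t)"
      unfolding E_def by (simp add: sum.cartesian_product[symmetric] sum_distrib_left)
    finally have "(\<Sum>as\<in>exponents n M. \<Sum>bs\<in>exponents e M. c (as, bs) * mon f as (act g h) * L bs ?t) = 0"
      using Qg[OF gh] q_nonzero[OF gh] by simp
    then show ?thesis
      by (subst (asm) sum.swap) (simp add: sum_distrib_right)
  qed
  obtain R where R: "R \<in> polynomial_functions" "R (\<lambda>(b, c). idm B b c) \<noteq> 0"
    "\<And>g h \<tau>. (g, h) \<in> block_group \<Longrightarrow> R (\<lambda>(b, c). g b c) \<noteq> 0 \<Longrightarrow>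
      \<exists>s. \<forall>p\<in>NP. mmul B g (stab s) (fst p) (snd p) = \<tau> p"
    using generic_surjective by (elim bexE conjE) blast
  \<comment> \<open>For fixed \<open>g\<close>, replacing \<open>g\<close> by
    \<open>g * stab s\<close> does not move the point of the orbit, so the inner sums
    \<open>C bs\<close> are constants and \<open>rel\<close> becomes a polynomial relation between
    the entries at \<open>NP\<close>.\<close>
  have generic: "(\<Sum>as\<in>exponents n M. c (as, bs) * mon f as (act g h)) = 0"
    if gh: "(g, h) \<in> block_group" and Rg: "R (\<lambda>(b, c). g b c) \<noteq> 0" and bs: "bs \<in> exponents e M" for g h bs
  proof -
    define C where "C bs = (\<Sum>as\<in>exponents n M. c (as, bs) * mon f as (act g h))" for bs
    define T where "T s = (\<Sum>bs\<in>exponents e M. C bs * L bs (\<lambda>(b, c). mmul B g (stab s) b c))" for s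
    have stab_poly: "(\<lambda>s. stab s b c) \<in> polynomial_functions" for b c
      unfolding stab_def by (intro poly_fun_intros)
    have T_poly: "T \<in> polynomial_functions"
      unfolding T_def[abs_def]
    proof (rule poly_fun_sum)
      fix bs
      have L: "L bs \<in> polynomial_functions"
        unfolding L_def[abs_def] by (rule poly_fun_mon) (rule polynomial_functions.coord)
      have "(\<lambda>s. (\<lambda>(b, c). mmul B g (stab s) b c) i) \<in> polynomial_functions" for i
        unfolding mmul_def case_prod_unfold
        by (intro poly_fun_sum polynomial_functions.mult polynomial_functions.const stab_poly)
      from poly_fun_compose[OF L this]
      show "(\<lambda>s. C bs * L bs (\<lambda>(b, c). mmul B g (stab s) b c)) \<in> polynomial_functions"
        by (rule polynomial_functions.mult[OF polynomial_functions.const])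
    qed
    define q' where "q' s = q (\<lambda>(b, c). stab s b c)" for s
    have q'_poly: "q' \<in> polynomial_functions"
      unfolding q'_def[abs_def]
      by (rule poly_fun_compose[OF poly_fun_q]) (simp add: case_prod_unfold stab_poly)
    have "stab (\<lambda>_. 0) = idm B" by (simp add: stab_def)
    then have q'0: "q' (\<lambda>_. 0) \<noteq> 0" using q_nonzero[OF idm_block_group] by (simp add: q'_def)
    \<comment> \<open>\<open>rel\<close> applies only where \<open>stab s\<close> is invertible.
      That is an open condition satisfied at \<open>s = 0\<close>, so \<open>T\<close> vanishes
      identically.\<close>
    have T0: "T s = 0" for s
    proof (rule ccontr)
      assume "T s \<noteq> 0"
      then obtain r where r: "T r \<noteq> 0" "q' r \<noteq> 0"
        using poly_fun_mult_nonzero[OF T_poly q'_poly _ q'0] by blast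
      have "block (\<lambda>(b, c). stab r b c) = stab r"
        by (auto simp: block_def fun_eq_iff stab_positions)
      then obtain a where a: "(stab r, a) \<in> block_group"
        using q_block_group[of "\<lambda>(b, c). stab r b c"] r(2) by (auto simp: q'_def)
      show False
        using rel[OF act_stab(1)[OF gh a]] r(1) unfolding act_stab(2)[OF gh a] T_def C_def by simp
    qed
    \<comment> \<open>By the choice of \<open>R\<close> the entries of \<open>g * stab s\<close> at
      \<open>NP\<close> take all values, hence \<open>T = 0\<close> is an identity between
      coordinate monomials.\<close>
    have "\<forall>bs\<in>exponents e M. C bs = 0"
    proof (rule coordinate_monomials_independent)
      fix \<tau> :: "nat \<Rightarrow> 'e"
      obtain s where s: "\<forall>p\<in>NP. mmul B g (stab s) (fst p) (snd p) = \<tau> (the_inv_into {0..<e} P p)"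
        using R(3)[OF gh Rg, of "\<lambda>p. \<tau> (the_inv_into {0..<e} P p)"] by blast
      have "mmul B g (stab s) (fst (P k)) (snd (P k)) = \<tau> k" if "k < e" for k
        using s PNP[OF that] P that by (simp add: the_inv_into_f_f bij_betw_def)
      then have "L bs (\<lambda>(b, c). mmul B g (stab s) b c) = 1 ^ sum_list bs * mon (\<lambda>k \<tau>. \<tau> k) bs \<tau>"
        if "bs \<in> exponents e M" for bs
        unfolding L_def using exponents_length[OF that]
        by (intro mon_scale) (simp add: case_prod_unfold)
      then show "(\<Sum>bs\<in>exponents e M. C bs * mon (\<lambda>k \<tau>. \<tau> k) bs \<tau>) = 0"
        using T0[of s] by (simp add: T_def)
    qed
    then show ?thesis using bs by (simp add: C_def)
  qed
  have "\<forall>as\<in>exponents n M. c (as, bs) = 0" if bs: "bs \<in> exponents e M" for bs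
  proof (rule f_indep, rule ballI)
    fix z assume "z \<in> Z n"
    then obtain g h where gh: "(g, h) \<in> block_group" "z = act g h"
      using closed(2)[of n] by (auto simp: orbit_def)
    have poly: "(\<lambda>z. \<Sum>as\<in>exponents n M. c (as, bs) * mon f as z) \<in> polynomial_functions"
      by (intro poly_fun_sum polynomial_functions.mult polynomial_functions.const poly_fun_mon f(1))
        (auto dest: exponents_length)
    show "(\<Sum>as\<in>exponents n M. c (as, bs) * mon f as z) = 0"
      unfolding gh(2) by (rule generic_vanish[OF poly R(1,2) generic[OF _ _ bs] gh(1)])
  qed
  then show False using c(1) by (auto simp: E_def)
qed

section \<open>The strict chain of swept closures and the lower bound\<close>

text \<open>For an enumeration \<open>P\<close> of the positions outside of \<open>NP\<close>, the subvarieties swept out by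
  \<open>1 + \<Sum>i<k. s i * E (P i)\<close> have closures that form a chain.\<close>

definition slice :: "(nat \<Rightarrow> 'b \<times> 'b) \<Rightarrow> nat \<Rightarrow> (nat \<Rightarrow> 'e) \<Rightarrow> 'b \<times> 'b \<Rightarrow> 'e" where
  "slice P k s = (\<lambda>(b, c). idm B b c + (\<Sum>i<k. if P i = (b, c) then s i else 0))"

definition unit_matrix :: "'b \<times> 'b \<Rightarrow> 'b \<Rightarrow> 'b \<Rightarrow> 'e" where
  "unit_matrix p = (\<lambda>b c. if p = (b, c) then 1 else 0)"

definition swept :: "(nat \<Rightarrow> 'b \<times> 'b) \<Rightarrow> nat \<Rightarrow> ('b + 'b \<times> 'b \<Rightarrow> 'e) set" where
  "swept P k = {act (block (slice P k s)) h | s h. (block (slice P k s), h) \<in> block_group}"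

definition swept_closure :: "(nat \<Rightarrow> 'b \<times> 'b) \<Rightarrow> nat \<Rightarrow> ('b + 'b \<times> 'b \<Rightarrow> 'e) set" where
  "swept_closure P k = {y\<in>orbit. \<forall>f\<in>{f\<in>polynomial_functions. \<forall>z\<in>swept P k. f z = 0}. f y = 0}"

lemma swept_orbit: "swept P k \<subseteq> orbit"
  by (auto simp: swept_def orbit_def)

lemma swept_subset_closure: "swept P k \<subseteq> swept_closure P k"
  using swept_orbit by (auto simp: swept_closure_def)

lemma poly_fun_slice: "(\<lambda>s. slice P k s p) \<in> polynomial_functions"
  unfolding slice_def case_prod_unfold by (intro poly_fun_intros)

lemma slice_0: "slice P k (\<lambda>_. 0) = (\<lambda>(b, c). idm B b c)"
  by (auto simp: slice_def fun_eq_iff intro!: sum.neutral)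

lemma base_point: "act (idm B) (idm B) \<in> swept P k"
proof -
  have "block (slice P k (\<lambda>_. 0)) = idm B"
    using block_group_left[OF idm_block_group] by (simp add: slice_0)
  then show ?thesis
    using idm_block_group unfolding swept_def
    by (intro CollectI exI[of _ "\<lambda>_. 0"] exI[of _ "idm B"]) simp
qed

lemma lift_slice:
  assumes "f \<in> polynomial_functions"
  obtains F where "F \<in> polynomial_functions"
    "\<And>s h. (block (slice P k s), h) \<in> block_group \<Longrightarrow> F s = 0 \<longleftrightarrow> f (act (block (slice P k s)) h) = 0"
proof -
  obtain K where "lifts K f" using pull_back[OF assms] by blast
  then obtain F where F: "F \<in> polynomial_functions" "\<And>g h. (g, h) \<in> block_group \<Longrightarrow>
    F (\<lambda>(b, c). g b c) = q (\<lambda>(b, c). g b c) ^ K * f (act g h)"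
    "\<And>t. F (\<lambda>(b, c). block t b c) = F t"
    by (rule liftsE) blast
  have "(\<lambda>s. F (slice P k s)) \<in> polynomial_functions"
    by (rule poly_fun_compose[OF F(1)]) (rule poly_fun_slice)
  moreover have "F (slice P k s) = 0 \<longleftrightarrow> f (act (block (slice P k s)) h) = 0"
    if "(block (slice P k s), h) \<in> block_group" for s h
    using F(2)[OF that] F(3)[of "slice P k s"] q_nonzero[OF that] by simp
  ultimately show ?thesis by (rule that)
qed

definition q_slice :: "(nat \<Rightarrow> 'b \<times> 'b) \<Rightarrow> nat \<Rightarrow> (nat \<Rightarrow> 'e) \<Rightarrow> 'e" where
  "q_slice P k s = q (\<lambda>(b, c). block (slice P k s) b c)"

lemma q_slice:
  shows poly_fun_q_slice: "q_slice P k \<in> polynomial_functions"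
    and q_slice_0: "q_slice P k (\<lambda>_. 0) \<noteq> 0"
    and q_slice_group: "q_slice P k s \<noteq> 0 \<Longrightarrow> \<exists>h. (block (slice P k s), h) \<in> block_group"
    and q_slice_nonzero: "(block (slice P k s), h) \<in> block_group \<Longrightarrow> q_slice P k s \<noteq> 0"
proof -
  have "(\<lambda>s. block (slice P k s) b c) \<in> polynomial_functions" for b c
    unfolding block_def by (intro poly_fun_If poly_fun_slice polynomial_functions.const)
  then show "q_slice P k \<in> polynomial_functions"
    unfolding q_slice_def[abs_def]
    by (intro poly_fun_compose[OF poly_fun_q]) (simp add: case_prod_unfold)
  show "q_slice P k (\<lambda>_. 0) \<noteq> 0"
    using q_nonzero[OF idm_block_group]
    by (simp add: q_slice_def slice_0 block_group_left[OF idm_block_group])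
  show "\<exists>h. (block (slice P k s), h) \<in> block_group" if "q_slice P k s \<noteq> 0"
    using q_block_group[of "\<lambda>(b, c). block (slice P k s) b c"] that by (auto simp: q_slice_def)
  show "q_slice P k s \<noteq> 0" if "(block (slice P k s), h) \<in> block_group"
    using q_nonzero[OF that] by (simp add: q_slice_def)
qed

text \<open>\<open>swept P k\<close> is the image of the non-empty open set of those parameters for
  which the slice matrix is invertible. Irreducibility of affine space passes to this image, and
  from there to its closure in the orbit.\<close>

lemma irreducible_swept_closure:
  "irreducible_closed (subtopology zariski_topology orbit) (swept_closure P k)"
  unfolding irreducible_closed_def
proof (intro conjI allI impI)
  show "closedin (subtopology zariski_topology orbit) (swept_closure P k)"
    unfolding swept_closure_def by (rule closedin_zariski_zeros) blast
  show "swept_closure P k \<noteq> {}"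
    using base_point swept_subset_closure by blast
  fix C D
  assume CD: "closedin (subtopology zariski_topology orbit) C \<and>
    closedin (subtopology zariski_topology orbit) D \<and> swept_closure P k \<subseteq> C \<union> D"
  have separate: "\<exists>f\<in>polynomial_functions. (\<forall>z\<in>A. f z = 0) \<and> (\<exists>z\<in>swept P k. f z \<noteq> 0)"
    if A: "closedin (subtopology zariski_topology orbit) A" "\<not> swept_closure P k \<subseteq> A" for A
  proof -
    obtain y where y: "y \<in> swept_closure P k" "y \<notin> A" using A(2) by blast
    have "y \<in> orbit" using y(1) by (simp add: swept_closure_def)
    then obtain f where f: "f \<in> polynomial_functions" "f y \<noteq> 0" "\<forall>c\<in>A. f c = 0"
      using closedin_zariski_separate[OF A(1) _ y(2)] by blast
    have "\<exists>z\<in>swept P k. f z \<noteq> 0"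
    proof (rule ccontr)
      assume "\<not> ?thesis"
      then have "f y = 0" using y(1) f(1) unfolding swept_closure_def by blast
      then show False using f(2) by simp
    qed
    then show ?thesis using f by blast
  qed
  show "swept_closure P k \<subseteq> C \<or> swept_closure P k \<subseteq> D"
  proof (rule ccontr)
    assume "\<not> ?thesis"
    then have nC: "\<not> swept_closure P k \<subseteq> C" and nD: "\<not> swept_closure P k \<subseteq> D" by blast+
    obtain f1 z1 where f1: "f1 \<in> polynomial_functions" "\<forall>z\<in>C. f1 z = 0" "z1 \<in> swept P k" "f1 z1 \<noteq> 0"
      using separate[OF _ nC] CD by blast
    obtain f2 z2 where f2: "f2 \<in> polynomial_functions" "\<forall>z\<in>D. f2 z = 0" "z2 \<in> swept P k" "f2 z2 \<noteq> 0"
      using separate[OF _ nD] CD by blast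
    obtain F1 where F1: "F1 \<in> polynomial_functions"
      "\<And>s h. (block (slice P k s), h) \<in> block_group \<Longrightarrow> F1 s = 0 \<longleftrightarrow> f1 (act (block (slice P k s)) h) = 0"
      using lift_slice[OF f1(1)] by blast
    obtain F2 where F2: "F2 \<in> polynomial_functions"
      "\<And>s h. (block (slice P k s), h) \<in> block_group \<Longrightarrow> F2 s = 0 \<longleftrightarrow> f2 (act (block (slice P k s)) h) = 0"
      using lift_slice[OF f2(1)] by blast
    obtain s1 h1 where s1: "(block (slice P k s1), h1) \<in> block_group" "z1 = act (block (slice P k s1)) h1"
      using f1(3) by (auto simp: swept_def)
    obtain s2 h2 where s2: "(block (slice P k s2), h2) \<in> block_group" "z2 = act (block (slice P k s2)) h2"
      using f2(3) by (auto simp: swept_def)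
    have "F1 s1 * q_slice P k s1 \<noteq> 0" "F2 s2 \<noteq> 0"
      using F1(2)[OF s1(1)] F2(2)[OF s2(1)] f1(4) f2(4) s1 s2 q_slice_nonzero by auto
    then obtain s where s: "F1 s * q_slice P k s \<noteq> 0" "F2 s \<noteq> 0"
      using poly_fun_mult_nonzero[OF polynomial_functions.mult[OF F1(1) poly_fun_q_slice] F2(1)] by blast
    then have "q_slice P k s \<noteq> 0" by simp
    then obtain h where h: "(block (slice P k s), h) \<in> block_group" using q_slice_group by blast
    let ?z = "act (block (slice P k s)) h"
    have "f1 ?z \<noteq> 0" "f2 ?z \<noteq> 0" using F1(2)[OF h] F2(2)[OF h] s by auto
    moreover have "?z \<in> C \<union> D"
      using CD swept_subset_closure h unfolding swept_def by blast
    ultimately show False using f1(2) f2(2) by blast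
  qed
qed

lemma swept_mono: "swept P k \<subseteq> swept P (Suc k)"
proof
  fix y assume "y \<in> swept P k"
  then obtain s h where s: "y = act (block (slice P k s)) h" "(block (slice P k s), h) \<in> block_group"
    by (auto simp: swept_def)
  have "(\<Sum>i<k. if P i = x then (s(k := 0)) i else 0) = (\<Sum>i<k. if P i = x then s i else 0)" for x
    by (intro sum.cong) auto
  then have "slice P (Suc k) (s(k := 0)) = slice P k s"
    by (simp add: slice_def fun_eq_iff)
  then show "y \<in> swept P (Suc k)"
    using s unfolding swept_def by (intro CollectI exI[of _ "s(k := 0)"] exI[of _ h]) simp
qed

text \<open>The vector \<open>(Y a - a N, a v)\<close>, which measures whether \<open>a\<close> transports \<open>(v, N)\<close> to the point
  \<open>y = (w, Y)\<close>, up to the affine term \<open>w\<close>.\<close>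

definition defect :: "('b \<Rightarrow> 'b \<Rightarrow> 'e) \<Rightarrow> ('b + 'b \<times> 'b \<Rightarrow> 'e) \<Rightarrow> 'b + 'b \<times> 'b \<Rightarrow> 'e" where
  "defect a y = case_sum (mvec B a v)
     (\<lambda>(b, c). mmul B (\<lambda>b c. y (Inr (b, c))) a b c - mmul B a N b c)"

definition defect0 :: "('b + 'b \<times> 'b \<Rightarrow> 'e) \<Rightarrow> 'b + 'b \<times> 'b \<Rightarrow> 'e" where
  "defect0 y = case_sum (\<lambda>b. v b - y (Inl b)) (\<lambda>(b, c). y (Inr (b, c)) - N b c)"

lemma poly_fun_defect: "(\<lambda>y. defect a y j) \<in> polynomial_functions"
proof (cases j)
  case (Inr bc)
  then show ?thesis
    unfolding defect_def mmul_def by (cases bc) (auto intro!: poly_fun_intros)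
qed (simp add: defect_def polynomial_functions.const)

lemma poly_fun_defect0: "(\<lambda>y. defect0 y j) \<in> polynomial_functions"
proof (cases j)
  case (Inr bc)
  then show ?thesis
    unfolding defect0_def by (cases bc) (auto intro!: poly_fun_intros)
qed (auto simp: defect0_def intro!: poly_fun_intros)

lemma defect_sum:
  "defect (\<lambda>b c. \<Sum>i<k. c' i * a i b c) y j = (\<Sum>i<k. c' i * defect (a i) y j)"
proof (cases j)
  case (Inl b)
  then show ?thesis
    unfolding defect_def mvec_def
    by (simp add: sum_distrib_left sum_distrib_right mult.assoc) (rule sum.swap)
next
  case (Inr bc)
  obtain b c where bc: "bc = (b, c)" by (cases bc)
  have "mmul B Y (\<lambda>b c. \<Sum>i<k. c' i * a i b c) b c = (\<Sum>i<k. c' i * mmul B Y (a i) b c)"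
    "mmul B (\<lambda>b c. \<Sum>i<k. c' i * a i b c) Y b c = (\<Sum>i<k. c' i * mmul B (a i) Y b c)" for Y
    unfolding mmul_def
    by (simp_all add: sum_distrib_left sum_distrib_right mult_ac sum.swap[of _ B])
  then show ?thesis
    by (simp add: Inr bc defect_def sum_subtractf right_diff_distrib)
qed

lemma block_slice:
  assumes "\<And>i. i < k \<Longrightarrow> P i \<in> positions"
  shows "block (slice P k s) = (\<lambda>b c. idm B b c + (\<Sum>i<k. s i * unit_matrix (P i) b c))"
proof (intro ext)
  fix b c
  have *: "(\<Sum>i<k. if P i = (b, c) then s i else 0) = (\<Sum>i<k. s i * unit_matrix (P i) b c)"
    by (intro sum.cong) (auto simp: unit_matrix_def)
  have "(\<Sum>i<k. s i * unit_matrix (P i) b c) = 0" "idm B b c = (0 :: 'e)" if "(b, c) \<notin> positions"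
  proof -
    have "s i * unit_matrix (P i) b c = 0" if "i < k" for i
      using assms[OF that] \<open>(b, c) \<notin> positions\<close> by (auto simp: unit_matrix_def)
    then show "(\<Sum>i<k. s i * unit_matrix (P i) b c) = 0" by (intro sum.neutral) simp
    show "idm B b c = (0 :: 'e)" using that by (auto simp: idm_def positions_def)
  qed
  then show "block (slice P k s) b c = idm B b c + (\<Sum>i<k. s i * unit_matrix (P i) b c)"
    by (simp add: block_def slice_def *)
qed

text \<open>For \<open>g = 1 + a\<close> and the point (w, Y) of \<open>g\<close>, the equations w =
  g v and Y g = g N read a v + (v - w) = 0 and (Y a - a N) + (Y - N) = 0, and these are linear in
  \<open>a\<close>. So on \<open>swept P k\<close> the vector \<open>defect0\<close> is a
  combination of the first \<open>k\<close> defects.\<close>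

lemma slice_relation:
  assumes P: "\<And>i. i < k \<Longrightarrow> P i \<in> positions" and g: "(block (slice P k s), h) \<in> block_group"
  shows "(\<Sum>i<k. s i * defect (unit_matrix (P i)) (act (block (slice P k s)) h) j)
    + defect0 (act (block (slice P k s)) h) j = 0"
proof -
  define g where "g = block (slice P k s)"
  define y where "y = act g h"
  define a where "a b c = (\<Sum>i<k. s i * unit_matrix (P i) b c)" for b c
  define Y where "Y = mmul B (mmul B g N) h"
  have gh: "(g, h) \<in> block_group" using g by (simp add: g_def)
  have ga: "g = (\<lambda>b c. idm B b c + a b c)" unfolding g_def a_def by (rule block_slice[OF P])
  have y: "\<And>b. y (Inl b) = mvec B g v b" "\<And>b c. y (Inr (b, c)) = Y b c"
    by (simp_all add: y_def act_def Y_def)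
  have "mmul B Y g = mmul B (mmul B g N) (mmul B h g)" unfolding Y_def by (simp only: mmul_assoc)
  also have "mmul B h g = idm B" using gh by (simp add: block_group_def)
  also have "mmul B (mmul B g N) (idm B) = mmul B g N" by (simp only: mmul_assoc idm_N)
  finally have Yg: "mmul B Y g = mmul B g N" .
  have "mmul B Y (idm B) = Y"
    unfolding mmul_idm_right[OF finite_B]
  proof (intro ext)
    fix b c
    have "h z c = 0" if "c \<notin> B" for z using block_group_zero[OF gh, of z c] that by (auto simp: positions_def)
    then show "(if c \<in> B then Y b c else 0) = Y b c" by (auto simp: Y_def mmul_def)
  qed
  moreover have "mmul B Y g b c = mmul B Y (idm B) b c + mmul B Y a b c"
    "mmul B g N b c = mmul B (idm B) N b c + mmul B a N b c" for b c
    unfolding ga mmul_def by (simp_all add: distrib_left distrib_right sum.distrib)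
  ultimately have YN: "Y b c + mmul B Y a b c = N b c + mmul B a N b c" for b c
    using Yg by (metis idm_N(1))
  have gv: "mvec B g v b = v b + mvec B a v b" for b
    using idm_v unfolding ga by (simp add: mvec_def distrib_right sum.distrib fun_eq_iff)
  have "defect a y j + defect0 y j = 0"
  proof (cases j)
    case (Inl b)
    then show ?thesis using gv[of b] by (simp add: defect_def defect0_def y)
  next
    case (Inr bc)
    obtain b c where bc: "bc = (b, c)" by (cases bc)
    have "defect a y j + defect0 y j = (Y b c + mmul B Y a b c) - (N b c + mmul B a N b c)"
      by (simp add: defect_def defect0_def Inr bc y)
    then show ?thesis using YN[of b c] by simp
  qed
  moreover have "defect a y j = (\<Sum>i<k. s i * defect (unit_matrix (P i)) y j)"
    unfolding a_def by (rule defect_sum)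
  ultimately show ?thesis by (simp add: y_def g_def)
qed

text \<open>At the base point the defects of the unit matrices outside \<open>NP\<close> are
  independent by \<open>stab_zero\<close>, hence also at generic points. At such a point
  \<open>y0\<close> of \<open>swept P (Suc k)\<close> with \<open>s k \<noteq> 0\<close>, the vector
  \<open>defect0\<close> involves defect number \<open>k\<close>, so it is independent of the first
  \<open>k\<close> defects. On \<open>swept P k\<close> it depends on them. The polynomial that
  witnesses independence at \<open>y0\<close> therefore vanishes on
  \<open>swept P k\<close>.\<close>

lemma swept_closure_strict:
  assumes P: "inj_on P {..<d}" "\<And>i. i < d \<Longrightarrow> P i \<in> positions - NP" and k: "k < d"
  shows "swept_closure P k \<subset> swept_closure P (Suc k)"
proof -
  have Ppos: "P i \<in> positions" if "i < d" for i using P(2)[OF that] by simp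
  have "\<exists>F\<in>polynomial_functions. F (act (idm B) (idm B)) \<noteq> 0 \<and>
    (\<forall>y c. F y \<noteq> 0 \<longrightarrow> (\<forall>j. (\<Sum>i<d. c i * defect (unit_matrix (P i)) y j) = 0) \<longrightarrow> (\<forall>i<d. c i = 0))"
  proof (rule independence_open[where U = "\<lambda>i. defect (unit_matrix (P i))" and k = d])
    show "(\<lambda>y. defect (unit_matrix (P i)) y j) \<in> polynomial_functions" for i j
      by (rule poly_fun_defect)
    fix c assume c: "\<And>j. (\<Sum>i<d. c i * defect (unit_matrix (P i)) (act (idm B) (idm B)) j) = 0"
    define a where "a b b' = (\<Sum>i<d. c i * unit_matrix (P i) b b')" for b b'
    have d0: "defect a (act (idm B) (idm B)) j = 0" for j
      unfolding a_def defect_sum by (rule c)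
    have y: "(\<lambda>b c. act (idm B) (idm B) (Inr (b, c))) = N"
      by (simp add: act_def idm_N)
    have a0: "a b b' = 0" for b b'
    proof (rule stab_zero)
      show "(b, b') \<in> positions" if "a b b' \<noteq> 0" for b b'
      proof (rule ccontr)
        assume "(b, b') \<notin> positions"
        then have "P i \<noteq> (b, b')" if "i < d" for i using Ppos[OF that] by auto
        then have "a b b' = 0" by (auto simp: a_def unit_matrix_def intro!: sum.neutral)
        then show False using that by simp
      qed
      show "mmul B a N = mmul B N a"
      proof (intro ext)
        fix b b' show "mmul B a N b b' = mmul B N a b b'"
          using d0[of "Inr (b, b')"] by (simp add: defect_def y)
      qed
      show "mvec B a v b = 0" for b using d0[of "Inl b"] by (simp add: defect_def)
      show "a (fst p) (snd p) = 0" if "p \<in> NP" for p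
        using P(2) that by (auto simp: a_def unit_matrix_def intro!: sum.neutral)
    qed
    show "\<forall>i<d. c i = 0"
    proof (intro allI impI)
      fix i assume i: "i < d"
      have "a (fst (P i)) (snd (P i)) = (\<Sum>l<d. if l = i then c l else 0)"
        unfolding a_def using P(1) i by (intro sum.cong) (auto simp: unit_matrix_def inj_on_def)
      then show "c i = 0" using a0 i by simp
    qed
  qed
  then obtain R where R: "R \<in> polynomial_functions" "R (act (idm B) (idm B)) \<noteq> 0"
    "\<And>y c. R y \<noteq> 0 \<Longrightarrow> \<forall>j. (\<Sum>i<d. c i * defect (unit_matrix (P i)) y j) = 0 \<Longrightarrow> \<forall>i<d. c i = 0"
    by (elim bexE conjE) blast
  obtain F where F: "F \<in> polynomial_functions" "\<And>s h. (block (slice P (Suc k) s), h) \<in> block_group \<Longrightarrow>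
      F s = 0 \<longleftrightarrow> R (act (block (slice P (Suc k) s)) h) = 0"
    using lift_slice[OF R(1)] by blast
  have "F (\<lambda>_. 0) \<noteq> 0"
    using F(2)[of "\<lambda>_. 0" "idm B"] R(2) idm_block_group
    by (simp add: slice_0 block_group_left[OF idm_block_group])
  then obtain s' where s': "F s' \<noteq> 0" "q_slice P (Suc k) s' \<noteq> 0"
    using poly_fun_mult_nonzero[of F "q_slice P (Suc k)"] F(1) poly_fun_q_slice q_slice_0 by blast
  define F' where "F' s = F s * q_slice P (Suc k) s" for s
  have "F' \<in> polynomial_functions"
    unfolding F'_def[abs_def] by (rule polynomial_functions.mult[OF F(1) poly_fun_q_slice])
  moreover have "F' s' \<noteq> 0" using s' by (simp add: F'_def)
  ultimately have "\<exists>s. F' s \<noteq> 0 \<and> s k \<noteq> 0"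
    by (intro poly_fun_mult_nonzero[where g = "\<lambda>s. s k" and q = "\<lambda>_. 1"] polynomial_functions.coord)
      simp_all
  then obtain s where s: "F s * q_slice P (Suc k) s \<noteq> 0" "s k \<noteq> 0"
    by (auto simp: F'_def)
  have "q_slice P (Suc k) s \<noteq> 0" using s(1) by simp
  then obtain h where h: "(block (slice P (Suc k) s), h) \<in> block_group"
    using q_slice_group by blast
  define y0 where "y0 = act (block (slice P (Suc k) s)) h"
  have Ry0: "R y0 \<noteq> 0" using F(2)[OF h] s(1) by (simp add: y0_def)
  define U where "U i y = (if i < k then defect (unit_matrix (P i)) y else defect0 y)" for i y
  have "\<exists>F\<in>polynomial_functions. F y0 \<noteq> 0 \<and>
    (\<forall>y c. F y \<noteq> 0 \<longrightarrow> (\<forall>j. (\<Sum>i<Suc k. c i * U i y j) = 0) \<longrightarrow> (\<forall>i<Suc k. c i = 0))"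
  proof (rule independence_open[where U = U and k = "Suc k"])
    show "(\<lambda>y. U i y j) \<in> polynomial_functions" for i j
      by (cases "i < k") (simp_all add: U_def poly_fun_defect poly_fun_defect0)
    fix c assume c: "\<And>j. (\<Sum>i<Suc k. c i * U i y0 j) = 0"
    \<comment> \<open>Substituting the relation \<open>rel\<close> for \<open>defect0\<close> turns
      a relation between the vectors \<open>U\<close> into one between the first
      \<open>Suc k\<close> defects, with the coefficients \<open>c'\<close>; the coefficient at
      \<open>k\<close> is \<open>- c k * s k\<close>.\<close>
    define c' where "c' i = (if i < k then c i - c k * s i else if i = k then - c k * s k else 0)" for i
    have "(\<Sum>i<d. c' i * defect (unit_matrix (P i)) y0 j) = 0" for j
    proof -
      let ?D = "\<lambda>i. defect (unit_matrix (P i)) y0 j"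
      have rel: "(\<Sum>i<k. s i * ?D i) + s k * ?D k + defect0 y0 j = 0"
        using slice_relation[of "Suc k" P s h j] h Ppos k by (simp add: y0_def)
      have "(\<Sum>i<d. c' i * ?D i) = (\<Sum>i<Suc k. c' i * ?D i)"
        using k by (intro sum.mono_neutral_right) (auto simp: c'_def)
      also have "\<dots> = (\<Sum>i<k. c i * ?D i) - c k * ((\<Sum>i<k. s i * ?D i) + s k * ?D k)"
      proof -
        have "(\<Sum>i<k. c' i * ?D i) = (\<Sum>i<k. c i * ?D i - c k * (s i * ?D i))"
          by (intro sum.cong) (auto simp: c'_def algebra_simps)
        then show ?thesis by (simp add: c'_def sum_subtractf sum_distrib_left algebra_simps)
      qed
      also have "(\<Sum>i<k. s i * ?D i) + s k * ?D k = - defect0 y0 j"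
        using rel by (simp add: eq_neg_iff_add_eq_0)
      also have "(\<Sum>i<k. c i * ?D i) - c k * (- defect0 y0 j) = (\<Sum>i<Suc k. c i * U i y0 j)"
        by (simp add: U_def)
      finally show ?thesis using c by simp
    qed
    then have c'0: "\<forall>i<d. c' i = 0" using R(3)[OF Ry0] by blast
    then have "c k = 0" using k s(2) by (auto simp: c'_def)
    then show "\<forall>i<Suc k. c i = 0" using c'0 k by (auto simp: c'_def less_Suc_eq split: if_splits)
  qed
  then obtain f where f: "f \<in> polynomial_functions" "f y0 \<noteq> 0"
    "\<And>y c. f y \<noteq> 0 \<Longrightarrow> \<forall>j. (\<Sum>i<Suc k. c i * U i y j) = 0 \<Longrightarrow> \<forall>i<Suc k. c i = 0"
    by (elim bexE conjE) blast
  have f0: "f z = 0" if "z \<in> swept P k" for z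
  proof (rule ccontr)
    assume fz: "f z \<noteq> 0"
    obtain s h where sh: "(block (slice P k s), h) \<in> block_group" "z = act (block (slice P k s)) h"
      using \<open>z \<in> swept P k\<close> by (auto simp: swept_def)
    have "(\<Sum>i<Suc k. (if i < k then s i else 1) * U i z j) = 0" for j
      using slice_relation[of k P s h j] sh Ppos k by (simp add: U_def)
    then have "\<forall>i<Suc k. (if i < k then s i else 1) = 0" by (intro f(3)[OF fz]) blast
    then show False by (auto dest: spec[of _ k])
  qed
  have "y0 \<in> swept P (Suc k)" using h by (auto simp: swept_def y0_def)
  then have "y0 \<in> swept_closure P (Suc k)" using swept_subset_closure by blast
  moreover have "y0 \<notin> swept_closure P k" using f f0 by (auto simp: swept_closure_def)
  moreover have "swept_closure P k \<subseteq> swept_closure P (Suc k)"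
    using swept_mono unfolding swept_closure_def by blast
  ultimately show ?thesis by blast
qed

theorem variety_dimension_orbit: "variety_dimension orbit = card positions - card NP"
proof -
  define d where "d = card (positions - NP)"
  have fin: "finite (positions - NP)" using finite_positions by simp
  obtain P where P: "bij_betw P {0..<d} (positions - NP)"
    using ex_bij_betw_nat_finite[OF fin] unfolding d_def by blast
  have d: "d = card positions - card NP"
    unfolding d_def by (rule card_Diff_subset[OF finite_NP NP])
  have P': "inj_on P {..<d}" "\<And>i. i < d \<Longrightarrow> P i \<in> positions - NP"
    using P bij_betwE[OF P] by (auto simp: bij_betw_def atLeast0LessThan)
  show ?thesis
    unfolding variety_dimension_def d[symmetric]
  proof (rule krull_dimension_eqI)
    show "\<forall>i\<le>d. irreducible_closed (subtopology zariski_topology orbit) (swept_closure P i)"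
      using irreducible_swept_closure by blast
    show "\<forall>i<d. swept_closure P i \<subset> swept_closure P (Suc i)"
      using swept_closure_strict[OF P'] by blast
    fix n Z
    assume "\<forall>i\<le>n. irreducible_closed (subtopology zariski_topology orbit) (Z i)"
      "\<forall>i<n. Z i \<subset> Z (Suc i)"
    then have "n + card NP \<le> card positions" by (rule chain_length_le)
    then show "n \<le> d" using d by linarith
  qed
qed

end

section \<open>The model of a marked colored partition\<close>

definition bit_sign :: "bit \<Rightarrow> int" where
  "bit_sign b = (if b = 0 then 1 else - 1)"

lemma bit_sign_add: "bit_sign (a + b) = bit_sign a * bit_sign b"
  by (cases a; cases b) (simp_all add: bit_sign_def)

definition parity_sign :: "int \<Rightarrow> int" where
  "parity_sign z = (if even z then 1 else - 1)"

lemma parity_sign_add: "parity_sign (x + y) = parity_sign x * parity_sign y"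
  by (simp add: parity_sign_def)

lemma bit_sign_of_int: "bit_sign (of_int z) = parity_sign z"
  by (simp only: of_int_bit bit_sign_def parity_sign_def) simp

lemma bit_sign_box: "bit_sign (box_color lam eps i j) = bit_sign (eps i) * parity_sign (int (lam i) - int j)"
  by (simp only: box_color_def bit_sign_add bit_sign_of_int)

lemma box_color_same: "box_color lam eps i j = eps i \<longleftrightarrow> even (int (lam i) - int j)"
proof -
  have "a + of_int z = a \<longleftrightarrow> even z" for a :: bit and z
    unfolding of_int_bit by (cases a; cases "even z") simp_all
  then show ?thesis by (simp only: box_color_def)
qed

text \<open>The indicator of equality of colors in terms of the sign character; it turns counts of
  equally colored pairs into products of sums.\<close>

lemma bit_sign_eq: "2 * (if a = b then 1 else 0) = 1 + bit_sign a * bit_sign b"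
  by (cases a; cases b) (simp_all add: bit_sign_def)

lemma alternating_sum: "(\<Sum>j = 1..m. parity_sign (int m - int j)) = (if odd m then 1 else 0)"
proof (induction m)
  case (Suc m)
  have "(\<Sum>j = 1..Suc m. parity_sign (int (Suc m) - int j))
      = (\<Sum>j = 1..m. - parity_sign (int m - int j)) + 1"
    by (auto simp: parity_sign_def intro!: sum.cong)
  then show ?case using Suc by (simp add: sum_negf)
qed simp

text \<open>An endomorphism that commutes with the shift and sends the top box of row \<open>i\<close> to the box
  \<open>p + nu i\<close> of row \<open>k\<close> sends the marked box of row \<open>i\<close> to the box \<open>p\<close> of row \<open>k\<close>. The condition \<open>dominate\<close> provides
  an endomorphism of row \<open>k\<close> alone with the same effect on the marked vector, so that the difference
  of the two stabilizes that vector.\<close>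

locale marked_model =
  fixes lam :: "nat \<Rightarrow> nat" and eps :: "nat \<Rightarrow> bit" and mu :: "nat \<Rightarrow> int"
  assumes partition: "is_partition lam"
    and mu_le: "mu i \<le> int (lam i)"
    and mu_gt: "mu i > - 2"
    and dominate: "\<lbrakk>0 < mu i; 1 \<le> p; int p + (int (lam i) - mu i) \<le> int (lam i);
        int p + (int (lam i) - mu i) \<le> int (lam k);
        eps k + of_int (int (lam k) - (int p + (int (lam i) - mu i))) = eps i\<rbrakk>
      \<Longrightarrow> int p \<le> mu k \<and> even (mu k - int p)"
begin

abbreviation len :: nat where "len \<equiv> part_length lam"

definition nu :: "nat \<Rightarrow> nat" where "nu i = nat (int (lam i) - mu i)"

lemma nu: "int (nu i) = int (lam i) - mu i"
  using mu_le[of i] by (simp add: nu_def)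

lemma diagram_iff: "(i, j) \<in> diagram lam \<longleftrightarrow> 1 \<le> j \<and> j \<le> lam i"
  by (simp add: diagram_def)

lemma dominate': "\<lbrakk>0 < mu i; 1 \<le> p; p + nu i \<le> lam i; p + nu i \<le> lam k; box_color lam eps k (p + nu i) = eps i\<rbrakk>
      \<Longrightarrow> int p \<le> mu k \<and> even (mu k - int p)"
proof -
  assume a: "0 < mu i" "1 \<le> p" "p + nu i \<le> lam i" "p + nu i \<le> lam k" "box_color lam eps k (p + nu i) = eps i"
  have nu': "int (p + nu i) = int p + (int (lam i) - mu i)" by (simp only: of_nat_add nu)
  show ?thesis
  proof (rule dominate[OF a(1,2)])
    show "int p + (int (lam i) - mu i) \<le> int (lam i)" "int p + (int (lam i) - mu i) \<le> int (lam k)"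
      using a(3,4) unfolding nu'[symmetric] by simp_all
    show "eps k + of_int (int (lam k) - (int p + (int (lam i) - mu i))) = eps i"
      using a(5) unfolding nu'[symmetric] box_color_def .
  qed
qed

text \<open>The endomorphism of row \<open>k\<close> that sends its top box to box \<open>j\<close>
  sends the marked box to \<open>j - nu k\<close>, which is a box just when \<open>nu k < j\<close>.
  These endomorphisms move the marked vector and serve to compensate the effect of all others on it,
  so they contribute no parameter to the stabilizer.\<close>

definition pivot :: "nat \<Rightarrow> nat \<Rightarrow> nat \<Rightarrow> bool" where
  "pivot i k j \<longleftrightarrow> i = k \<and> 0 < mu k \<and> nu k < j"

definition triples :: "(nat \<times> nat \<times> nat) set" where
  "triples = {(i, k, j). i < len \<and> k < len \<and> 1 \<le> j \<and> j \<le> min (lam i) (lam k) \<and>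
     box_color lam eps k j = eps i \<and> \<not> pivot i k j}"

text \<open>An endomorphism that commutes with the shift is determined by the images of the top
  boxes of the rows, so the entries in the columns of the top boxes are coordinates on the
  commutant.\<close>

definition top_position :: "nat \<times> nat \<times> nat \<Rightarrow> (nat \<times> nat) \<times> (nat \<times> nat)" where
  "top_position = (\<lambda>(i, k, j). ((k, j), (i, lam i)))"

definition NP :: "((nat \<times> nat) \<times> (nat \<times> nat)) set" where
  "NP = top_position ` triples"

lemma triplesI: "\<lbrakk>1 \<le> j; j \<le> lam i; j \<le> lam k; box_color lam eps k j = eps i; \<not> pivot i k j\<rbrakk> \<Longrightarrow> (i, k, j) \<in> triples"
  unfolding triples_def by (simp flip: partition_support[OF partition])

lemma box_color_top: "box_color lam eps i (lam i) = eps i"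
  by (simp add: box_color_def)

subsection \<open>Counting\<close>

definition sgn_row :: "nat \<Rightarrow> int" where
  "sgn_row i = (if odd (lam i) then bit_sign (eps i) else 0)"

lemma sum_bit_sign_row: "(\<Sum>j = 1..lam i. bit_sign (box_color lam eps i j)) = sgn_row i"
proof -
  have "(\<Sum>j = 1..lam i. bit_sign (box_color lam eps i j))
      = bit_sign (eps i) * (\<Sum>j = 1..lam i. parity_sign (int (lam i) - int j))"
    by (simp only: bit_sign_box sum_distrib_left)
  then show ?thesis by (simp only: alternating_sum sgn_row_def) simp
qed

lemma sum_diagram: "(\<Sum>b\<in>diagram lam. F b) = (\<Sum>i<len. \<Sum>j = 1..lam i. F (i, j))"
  unfolding diagram_Sigma[OF partition] by (subst sum.Sigma) auto

lemma card_diagram: "int (card (diagram lam)) = (\<Sum>i<len. int (lam i))"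
  unfolding diagram_Sigma[OF partition] by simp

text \<open>Summing \<open>bit_sign_eq\<close> over all pairs of boxes, the constant term gives the
  square of the number of boxes and the product term the square of the signed number of
  boxes.\<close>

lemma card_positions:
  "2 * int (card (graded_index.positions (diagram lam) (case_prod (box_color lam eps))))
     = int (card (diagram lam)) ^ 2 + (\<Sum>i<len. sgn_row i) ^ 2"
proof -
  interpret graded_index "diagram lam" "case_prod (box_color lam eps)"
    by unfold_locales (rule finite_diagram[OF partition])
  let ?D = "diagram lam" and ?c = "case_prod (box_color lam eps)"
  have fin: "finite ?D" by (rule finite_diagram[OF partition])
  have "positions = {p \<in> ?D \<times> ?D. ?c (fst p) = ?c (snd p)}"
    by (auto simp: positions_def)
  then have "int (card positions) = (\<Sum>p\<in>?D \<times> ?D. if ?c (fst p) = ?c (snd p) then 1 else 0)"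
    using fin by (simp add: sum.If_cases Int_def)
  then have "2 * int (card positions) = (\<Sum>p\<in>?D \<times> ?D. 2 * (if ?c (fst p) = ?c (snd p) then 1 else 0))"
    by (simp add: sum_distrib_left)
  also have "\<dots> = (\<Sum>p\<in>?D \<times> ?D. 1 + bit_sign (?c (fst p)) * bit_sign (?c (snd p)))"
    by (simp only: bit_sign_eq)
  also have "\<dots> = int (card ?D) ^ 2 + (\<Sum>p\<in>?D \<times> ?D. bit_sign (?c (fst p)) * bit_sign (?c (snd p)))"
    by (simp add: sum.distrib card_cartesian_product power2_eq_square)
  also have "(\<Sum>p\<in>?D \<times> ?D. bit_sign (?c (fst p)) * bit_sign (?c (snd p))) = (\<Sum>b\<in>?D. bit_sign (?c b)) ^ 2"
    by (simp add: power2_eq_square sum_product sum.cartesian_product case_prod_unfold)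
  also have "(\<Sum>b\<in>?D. bit_sign (?c b)) = (\<Sum>i<len. sgn_row i)"
    by (simp only: sum_diagram case_prod_conv sum_bit_sign_row)
  finally show ?thesis .
qed

text \<open>The dimension of the space of color preserving maps from row \<open>i\<close> to row
  \<open>k\<close> that commute with the shift: the top box of row \<open>i\<close> can go to any
  box of its color in row \<open>k\<close> that the power \<open>lam i\<close> of the shift
  kills.\<close>

definition maps :: "nat \<Rightarrow> nat \<Rightarrow> int" where
  "maps i k = (\<Sum>j = 1..min (lam i) (lam k). if box_color lam eps k j = eps i then 1 else 0)"

lemma maps_eq:
  "2 * maps i k = (\<Sum>j = 1..min (lam i) (lam k).
     1 + bit_sign (eps i) * bit_sign (eps k) * parity_sign (int (lam k) - int j))"
  unfolding maps_def sum_distrib_left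
  by (intro sum.cong refl, subst bit_sign_eq) (simp only: bit_sign_box mult_ac)

text \<open>For even \<open>lam k\<close> both alternating sums vanish. For odd \<open>lam k\<close>
  they contribute \<open>?s\<close> and \<open>?s * ?t\<close>, where \<open>?t\<close> is 1 for odd
  \<open>lam i\<close> and -1 for even \<open>lam i\<close>; together this is twice the product of
  the row signs.\<close>

lemma maps_swap_le:
  assumes "lam k \<le> lam i"
  shows "maps i k + maps k i = int (lam k) + sgn_row i * sgn_row k"
proof -
  let ?s = "bit_sign (eps i) * bit_sign (eps k)"
  let ?a = "\<lambda>j. parity_sign (int (lam k) - int j)"
  have "2 * maps i k = (\<Sum>j = 1..lam k. 1 + ?s * ?a j)"
    using assms by (simp only: maps_eq min_absorb2)
  also have "\<dots> = int (lam k) + ?s * (if odd (lam k) then 1 else 0)"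
    by (simp only: sum.distrib sum_distrib_left[symmetric] alternating_sum) simp
  finally have 1: "2 * maps i k = int (lam k) + ?s * (if odd (lam k) then 1 else 0)" .
  let ?t = "parity_sign (int (lam i) - int (lam k))"
  have ta: "parity_sign (int (lam i) - int j) = ?t * ?a j" for j
    by (simp only: parity_sign_add[symmetric]) simp
  have "2 * maps k i = (\<Sum>j = 1..lam k. 1 + ?s * (?t * ?a j))"
    unfolding maps_eq min_absorb1[OF assms] by (intro sum.cong refl, subst ta) (simp only: mult_ac)
  also have "\<dots> = int (lam k) + ?s * (?t * (if odd (lam k) then 1 else 0))"
    by (simp only: sum.distrib sum_distrib_left[symmetric] alternating_sum) simp
  finally have 2: "2 * maps k i = int (lam k) + ?s * (?t * (if odd (lam k) then 1 else 0))" .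
  have "2 * (maps i k + maps k i) = 2 * (int (lam k) + sgn_row i * sgn_row k)"
    using 1 2 by (auto simp: sgn_row_def parity_sign_def)
  then show ?thesis by simp
qed

lemma maps_swap: "maps i k + maps k i = int (min (lam i) (lam k)) + sgn_row i * sgn_row k"
  using maps_swap_le[of k i] maps_swap_le[of i k]
  by (cases "lam k \<le> lam i") (simp_all add: min_def mult.commute add.commute)

text \<open>The new row \<open>l\<close> is the shortest one, so it meets each of the
  \<open>l\<close> earlier rows, in both orders, in a minimum equal to \<open>lam l\<close>.\<close>

lemma sum_min: "(\<Sum>i<l. \<Sum>k<l. int (min (lam i) (lam k))) = (\<Sum>i<l. int (lam i)) + 2 * (\<Sum>i<l. int (i * lam i))"
proof (induction l)
  case (Suc l)
  have anti: "lam l \<le> lam i" if "i < l" for i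
    using partition that by (auto simp: is_partition_def antimono_def)
  have 1: "(\<Sum>i<l. int (min (lam i) (lam l))) = int (l * lam l)"
    using anti by (simp add: min_absorb2)
  have 2: "(\<Sum>k<l. int (min (lam l) (lam k))) = int (l * lam l)"
    using anti by (simp add: min_absorb1)
  have "(\<Sum>i<Suc l. \<Sum>k<Suc l. int (min (lam i) (lam k)))
      = (\<Sum>i<l. \<Sum>k<l. int (min (lam i) (lam k))) + (\<Sum>i<l. int (min (lam i) (lam l)))
        + ((\<Sum>k<l. int (min (lam l) (lam k))) + int (lam l))"
    by (simp add: sum.distrib)
  then show ?case unfolding 1 2 Suc by simp
qed simp

lemma sum_maps: "2 * (\<Sum>i<len. \<Sum>k<len. maps i k)
    = int (card (diagram lam)) + 2 * int (eta lam) + (\<Sum>i<len. sgn_row i) ^ 2"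
proof -
  have "2 * (\<Sum>i<len. \<Sum>k<len. maps i k) = (\<Sum>i<len. \<Sum>k<len. maps i k) + (\<Sum>i<len. \<Sum>k<len. maps k i)"
    by (subst (3) sum.swap) simp
  also have "\<dots> = (\<Sum>i<len. \<Sum>k<len. maps i k + maps k i)"
    by (simp add: sum.distrib)
  also have "\<dots> = (\<Sum>i<len. \<Sum>k<len. int (min (lam i) (lam k))) + (\<Sum>i<len. \<Sum>k<len. sgn_row i * sgn_row k)"
    by (simp add: maps_swap sum.distrib)
  also have "(\<Sum>i<len. \<Sum>k<len. sgn_row i * sgn_row k) = (\<Sum>i<len. sgn_row i) ^ 2"
    by (simp add: power2_eq_square sum_product)
  finally show ?thesis by (simp add: sum_min card_diagram eta_def)
qed

text \<open>Shifted by \<open>nu k\<close>, the pivots of the right color are the numbers from 1 to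
  \<open>mu k\<close> with the parity of \<open>mu k\<close>: half of them, rounded up. A mark of 0
  or -1 has ceiling 0, in agreement with there being no pivots; this is where the bound
  \<open>mu_gt\<close> enters.\<close>

lemma sum_pivots:
  "(\<Sum>j = 1..lam k. if box_color lam eps k j = eps k \<and> pivot k k j then 1 else 0) = \<lceil>real_of_int (mu k) / 2\<rceil>"
proof (cases "0 < mu k")
  case True
  define m where "m = nat (mu k)"
  have m: "mu k = int m" "nu k + m = lam k" using True nu[of k] by (simp_all add: m_def)
  have "{1..lam k} = {1..nu k} \<union> {nu k + 1..nu k + m}" using m by auto
  then have "(\<Sum>j = 1..lam k. if box_color lam eps k j = eps k \<and> pivot k k j then 1 else 0 :: int)
      = (\<Sum>j = 1..nu k. if box_color lam eps k j = eps k \<and> pivot k k j then 1 else 0)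
        + (\<Sum>j = nu k + 1..nu k + m. if box_color lam eps k j = eps k \<and> pivot k k j then 1 else 0)"
    by (simp add: sum.union_disjoint)
  also have "(\<Sum>j = 1..nu k. if box_color lam eps k j = eps k \<and> pivot k k j then 1 else 0 :: int) = 0"
    by (intro sum.neutral) (auto simp: pivot_def)
  also have "(\<Sum>j = nu k + 1..nu k + m. if box_color lam eps k j = eps k \<and> pivot k k j then 1 else 0 :: int)
      = (\<Sum>j = 1..m. if even (int m - int j) then 1 else 0)"
    using True m(2)[symmetric] sum.shift_bounds_cl_nat_ivl[of "\<lambda>j. if box_color lam eps k j = eps k \<and> pivot k k j then 1 else 0 :: int" 1 "nu k" m]
    unfolding box_color_same by (simp add: add.commute pivot_def)
  also have "\<dots> = \<lceil>real m / 2\<rceil>"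
  proof -
    have "2 * (\<Sum>j = 1..m. if even (int m - int j) then 1 else (0 :: int))
        = (\<Sum>j = 1..m. 1 + parity_sign (int m - int j))"
      unfolding sum_distrib_left by (intro sum.cong) (auto simp: parity_sign_def)
    also have "\<dots> = int m + (if odd m then 1 else 0)"
      by (simp only: sum.distrib alternating_sum) simp
    finally have *: "2 * (\<Sum>j = 1..m. if even (int m - int j) then 1 else (0 :: int)) = int m + (if odd m then 1 else 0)" .
    show ?thesis
    proof (rule ceiling_unique[symmetric])
      have "2 * real_of_int (\<Sum>j = 1..m. if even (int m - int j) then 1 else (0 :: int)) = real m + (if odd m then 1 else 0)"
        using arg_cong[OF *, of real_of_int] by simp
      then show "real_of_int (\<Sum>j = 1..m. if even (int m - int j) then 1 else (0 :: int)) - 1 < real m / 2"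
        "real m / 2 \<le> real_of_int (\<Sum>j = 1..m. if even (int m - int j) then 1 else (0 :: int))"
        by (auto split: if_splits)
    qed
  qed
  finally show ?thesis by (simp add: m(1))
next
  case False
  then have "mu k = 0 \<or> mu k = - 1" using mu_gt[of k] by linarith
  then have "\<lceil>real_of_int (mu k) / 2\<rceil> = 0" by (auto simp: ceiling_eq_iff)
  then show ?thesis using False by (simp add: pivot_def)
qed

lemma card_NP: "int (card NP) = (\<Sum>i<len. \<Sum>k<len. maps i k) - (\<Sum>i<len. \<lceil>real_of_int (mu i) / 2\<rceil>)"
proof -
  have inj: "inj_on top_position triples" by (auto simp: inj_on_def top_position_def)
  let ?A = "\<lambda>i k. {j \<in> {1..min (lam i) (lam k)}. box_color lam eps k j = eps i \<and> \<not> pivot i k j}"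
  have "triples = (SIGMA i:{..<len}. SIGMA k:{..<len}. ?A i k)"
    unfolding triples_def by auto
  then have "int (card NP) = (\<Sum>i<len. \<Sum>k<len. int (card (?A i k)))"
    unfolding NP_def card_image[OF inj] by simp
  also have "\<dots> = (\<Sum>i<len. \<Sum>k<len. maps i k - (if i = k then \<lceil>real_of_int (mu i) / 2\<rceil> else 0))"
  proof (intro sum.cong refl)
    fix i k
    have "int (card (?A i k)) = (\<Sum>j = 1..min (lam i) (lam k). if box_color lam eps k j = eps i \<and> \<not> pivot i k j then 1 else 0)"
      by (simp add: sum.If_cases Int_def)
    also have "\<dots> = (\<Sum>j = 1..min (lam i) (lam k). (if box_color lam eps k j = eps i then 1 else 0)
        - (if box_color lam eps k j = eps i \<and> pivot i k j then 1 else 0))"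
      by (intro sum.cong) auto
    also have "\<dots> = maps i k - (\<Sum>j = 1..min (lam i) (lam k). if box_color lam eps k j = eps i \<and> pivot i k j then 1 else 0)"
      by (simp add: maps_def sum_subtractf)
    also have "(\<Sum>j = 1..min (lam i) (lam k). if box_color lam eps k j = eps i \<and> pivot i k j then 1 else 0)
        = (if i = k then \<lceil>real_of_int (mu i) / 2\<rceil> else 0)"
      using sum_pivots[of k] by (auto simp: pivot_def intro!: sum.neutral)
    finally show "int (card (?A i k)) = maps i k - (if i = k then \<lceil>real_of_int (mu i) / 2\<rceil> else 0)" .
  qed
  also have "\<dots> = (\<Sum>i<len. \<Sum>k<len. maps i k) - (\<Sum>i<len. \<lceil>real_of_int (mu i) / 2\<rceil>)"
    by (simp add: sum_subtractf)
  finally show ?thesis .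
qed

lemma codimension:
  "int (card (graded_index.positions (diagram lam) (case_prod (box_color lam eps)))) - int (card NP)
     = int (card (diagram lam) choose 2) - int (eta lam) + (\<Sum>i<len. \<lceil>real_of_int (mu i) / 2\<rceil>)"
proof -
  have "2 * int (n choose 2) = int n ^ 2 - int n" for n
  proof -
    have "2 * (n choose 2) = n * (n - 1)" unfolding choose_two by (rule dvd_mult_div_cancel) (cases n; simp)
    then have "2 * int (n choose 2) = int n * int (n - 1)" by (metis of_nat_mult of_nat_numeral)
    then show ?thesis by (cases n) (simp_all add: power2_eq_square algebra_simps)
  qed
  from this[of "card (diagram lam)"] show ?thesis using card_positions sum_maps card_NP by linarith
qed

end

section \<open>The commutant of the shift and the stabilizer of the marked vector\<close>

definition shift_matrix :: "(nat \<Rightarrow> nat) \<Rightarrow> nat \<times> nat \<Rightarrow> nat \<times> nat \<Rightarrow> 'e::comm_ring_1" where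
  "shift_matrix lam b c =
     (if b \<in> diagram lam \<and> c \<in> diagram lam \<and> fst b = fst c \<and> snd c = Suc (snd b) then 1 else 0)"

definition mark_vector :: "(nat \<Rightarrow> nat) \<Rightarrow> (nat \<Rightarrow> int) \<Rightarrow> nat \<times> nat \<Rightarrow> 'e::comm_ring_1" where
  "mark_vector lam mu b = (if b \<in> diagram lam \<and> int (snd b) = mu (fst b) then 1 else 0)"

context marked_model
begin

abbreviation D :: "(nat \<times> nat) set" where "D \<equiv> diagram lam"

sublocale graded_index D "case_prod (box_color lam eps)"
  by unfold_locales (rule finite_diagram[OF partition])

text \<open>The endomorphism that commutes with the shift, sends the top box of row \<open>i\<close> to the box \<open>(k, j)\<close>
  and vanishes on the other rows.\<close>

definition row_map :: "nat \<Rightarrow> nat \<Rightarrow> nat \<Rightarrow> nat \<times> nat \<Rightarrow> nat \<times> nat \<Rightarrow> 'e::alg_closed_field" where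
  "row_map i k j b c = (if b \<in> D \<and> c \<in> D \<and> fst b = k \<and> fst c = i \<and>
     snd b + lam i = snd c + j then 1 else 0)"

text \<open>The first map sends the marked box of row \<open>i\<close> to the box
  \<open>j - nu i\<close> of row \<open>k\<close>. Sending the top box of row \<open>k\<close> to
  \<open>j - nu i + nu k\<close> has the same effect on the marked box of row \<open>k\<close>, so
  the difference kills the marked vector.\<close>

definition stab_map :: "(nat \<times> nat) \<times> (nat \<times> nat) \<Rightarrow> nat \<times> nat \<Rightarrow> nat \<times> nat \<Rightarrow> 'e::alg_closed_field" where
  "stab_map p b c = (case p of ((k, j), (i, _)) \<Rightarrow> row_map i k j b c -
     (if 0 < mu i \<and> nu i < j then row_map k k (j - nu i + nu k) b c else 0))"

lemma mmul_shift_right: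
  "mmul D a (shift_matrix lam) b (i, l) = (if (i, l) \<in> D \<and> 2 \<le> l then a b (i, l - 1) else 0)"
proof (cases "(i, l) \<in> D \<and> 2 \<le> l")
  case True
  then have "(i, l - 1) \<in> D" by (auto simp: diagram_iff)
  have "mmul D a (shift_matrix lam) b (i, l) = (\<Sum>z\<in>D. if z = (i, l - 1) then a b z else 0)"
    unfolding mmul_def using True by (intro sum.cong) (auto simp: shift_matrix_def)
  then show ?thesis using True \<open>(i, l - 1) \<in> D\<close> finite_B by simp
next
  case False
  then have "mmul D a (shift_matrix lam) b (i, l) = 0"
    unfolding mmul_def by (intro sum.neutral) (auto simp: shift_matrix_def diagram_iff)
  then show ?thesis unfolding if_not_P[OF False] .
qed

lemma mmul_shift_left:
  "mmul D (shift_matrix lam) a (k, j) c = (if (k, j) \<in> D \<and> (k, Suc j) \<in> D then a (k, Suc j) c else 0)"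
proof (cases "(k, j) \<in> D \<and> (k, Suc j) \<in> D")
  case True
  have "mmul D (shift_matrix lam) a (k, j) c = (\<Sum>z\<in>D. if z = (k, Suc j) then a z c else 0)"
    unfolding mmul_def using True by (intro sum.cong) (auto simp: shift_matrix_def)
  then show ?thesis using True finite_B by simp
next
  case False
  then have "mmul D (shift_matrix lam) a (k, j) c = 0"
    unfolding mmul_def by (intro sum.neutral) (auto simp: shift_matrix_def)
  then show ?thesis unfolding if_not_P[OF False] .
qed

lemma row_map_comm:
  assumes "j \<le> lam i" "j \<le> lam k"
  shows "mmul D (row_map i k j) (shift_matrix lam) = mmul D (shift_matrix lam) (row_map i k j)"
proof (intro ext)
  fix b c :: "nat \<times> nat"
  obtain k' j' i' l where bc: "b = (k', j')" "c = (i', l)" by (cases b; cases c)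
  show "mmul D (row_map i k j) (shift_matrix lam) b c = mmul D (shift_matrix lam) (row_map i k j) b c"
  proof (cases "k' = k \<and> i' = i")
    case True
    have "((1 \<le> l \<and> l \<le> lam i) \<and> 2 \<le> l \<and> (1 \<le> j' \<and> j' \<le> lam k) \<and> (1 \<le> l - 1 \<and> l - 1 \<le> lam i) \<and>
        j' + lam i = l - 1 + j) \<longleftrightarrow>
      ((1 \<le> j' \<and> j' \<le> lam k) \<and> (1 \<le> Suc j' \<and> Suc j' \<le> lam k) \<and> (1 \<le> l \<and> l \<le> lam i) \<and>
        Suc j' + lam i = l + j)"
      using assms by linarith
    then show ?thesis
      using True unfolding bc mmul_shift_left mmul_shift_right row_map_def diagram_iff by auto
  next
    case False
    then show ?thesis
      unfolding bc mmul_shift_left mmul_shift_right row_map_def by auto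
  qed
qed

lemma row_map_mark:
  assumes "j \<le> lam k" "j \<le> lam i"
  shows "mvec D (row_map i k j) (mark_vector lam mu) b
    = (if 0 < mu i \<and> nu i < j \<and> b = (k, j - nu i) then 1 else (0 :: 'a::alg_closed_field))"
proof -
  have nui: "int (nu i) = int (lam i) - mu i" by (rule nu)
  have "row_map i k j b z * mark_vector lam mu z =
      (if z = (i, nat (mu i)) then (if 0 < mu i \<and> nu i < j \<and> b = (k, j - nu i) then 1 else 0) else (0 :: 'a))"
    if "z \<in> D" for z
  proof (cases "z = (i, nat (mu i))")
    case True
    then have mu: "0 < mu i" "lam i = nat (mu i) + nu i"
      using that nui by (auto simp: diagram_iff)
    obtain b1 b2 where b: "b = (b1, b2)" by (cases b)
    have "mark_vector lam mu z = (1 :: 'a)" using that True mu by (simp add: mark_vector_def)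
    moreover have "row_map i k j b z = (if nu i < j \<and> b = (k, j - nu i) then 1 else (0 :: 'a))"
      using assms that mu(2) unfolding row_map_def True b by (auto simp: diagram_iff)
    ultimately show ?thesis using True mu(1) by simp
  next
    case False
    then have "row_map i k j b z = (0 :: 'a) \<or> mark_vector lam mu z = (0 :: 'a)"
      by (cases z) (auto simp: row_map_def mark_vector_def)
    then show ?thesis using False by auto
  qed
  then have "mvec D (row_map i k j) (mark_vector lam mu) b = (\<Sum>z\<in>D. if z = (i, nat (mu i)) then
      (if 0 < mu i \<and> nu i < j \<and> b = (k, j - nu i) then 1 else 0) else (0 :: 'a))"
    unfolding mvec_def by (intro sum.cong refl) (simp only:)
  moreover have "(i, nat (mu i)) \<in> D" if "0 < mu i" using that mu_le[of i] by (auto simp: diagram_iff)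
  ultimately show ?thesis using finite_B by (auto simp: sum.delta)
qed

lemma row_map_positions:
  assumes "box_color lam eps k j = eps i" "row_map i k j b c \<noteq> 0"
  shows "(b, c) \<in> positions"
proof -
  obtain k' j' i' l where bc: "b = (k', j')" "c = (i', l)" by (cases b; cases c)
  have *: "b \<in> D" "c \<in> D" "k' = k" "i' = i" "j' + lam i = l + j"
    using assms(2) by (auto simp: row_map_def bc split: if_splits)
  have "int (lam k) - int j' = (int (lam k) - int j) + (int (lam i) - int l)" using *(5) by linarith
  then have "box_color lam eps k j' = box_color lam eps k j + of_int (int (lam i) - int l)"
    by (simp only: box_color_def of_int_add add.assoc)
  then have "box_color lam eps k j' = box_color lam eps i l"
    unfolding assms(1) by (simp only: box_color_def)
  then show ?thesis using * by (auto simp: positions_def bc)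
qed

lemma triplesD:
  assumes "(i, k, j) \<in> triples"
  shows "1 \<le> j" "j \<le> lam i" "j \<le> lam k" "box_color lam eps k j = eps i" "\<not> pivot i k j"
  using assms by (auto simp: triples_def)

text \<open>Here \<open>dominate\<close> enters. The box \<open>j - nu i\<close> lies at or below
  the mark of row \<open>k\<close>, so the compensating endomorphism of row \<open>k\<close> exists,
  and the parity statement makes it preserve colors.\<close>

lemma pivot_partner:
  assumes "(i, k, j) \<in> triples" "0 < mu i" "nu i < j"
  shows "0 < mu k" "j - nu i + nu k \<le> lam k" "box_color lam eps k (j - nu i + nu k) = eps k"
proof -
  note t = triplesD[OF assms(1)]
  have p: "j - nu i + nu i = j" using assms(3) by simp
  have d: "int (j - nu i) \<le> mu k \<and> even (mu k - int (j - nu i))"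
    using assms t by (intro dominate'[of i "j - nu i" k]) (simp_all add: p)
  then show "0 < mu k" using assms(3) by linarith
  have "int (j - nu i + nu k) \<le> int (lam k)" using d nu[of k] by linarith
  then show "j - nu i + nu k \<le> lam k" by simp
  have eq: "int (lam k) - int (j - nu i + nu k) = mu k - int (j - nu i)" using nu[of k] by linarith
  then show "box_color lam eps k (j - nu i + nu k) = eps k"
    unfolding box_color_same eq using d by blast
qed

lemma NP_positions: "NP \<subseteq> positions"
proof
  fix p assume "p \<in> NP"
  then obtain i k j where p: "p = ((k, j), (i, lam i))" "(i, k, j) \<in> triples"
    by (auto simp: NP_def top_position_def)
  then show "p \<in> positions"
    using triplesD[OF p(2)] by (auto simp: positions_def diagram_iff box_color_top)
qed

text \<open>Commuting with the shift makes \<open>a\<close> constant along diagonals, so only the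
  columns of top boxes matter. There the entries vanish outside the diagram, at wrong colors, above
  the height \<open>lam i\<close>, and at \<open>NP\<close>. What is left are the pivots, and these
  are the coordinates of the image of the marked vector.\<close>

lemma stab_map_zero:
  fixes a :: "nat \<times> nat \<Rightarrow> nat \<times> nat \<Rightarrow> 'e::alg_closed_field"
  assumes supp: "\<And>b c. a b c \<noteq> 0 \<Longrightarrow> (b, c) \<in> positions"
    and comm: "mmul D a (shift_matrix lam) = mmul D (shift_matrix lam) a"
    and vec: "\<And>b. mvec D a (mark_vector lam mu) b = 0"
    and NP0: "\<And>p. p \<in> NP \<Longrightarrow> a (fst p) (snd p) = 0"
  shows "a b c = 0"
proof -
  have suppD: "a b c = 0" if "b \<notin> D \<or> c \<notin> D" for b c
    using supp[of b c] that by (auto simp: positions_def)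
  have step: "a (k, j) (i, l) = (if Suc j \<le> lam k then a (k, Suc j) (i, Suc l) else 0)"
    if "1 \<le> l" "Suc l \<le> lam i" "1 \<le> j" for k j i l
  proof (cases "j \<le> lam k")
    case True
    have "mmul D a (shift_matrix lam) (k, j) (i, Suc l) = mmul D (shift_matrix lam) a (k, j) (i, Suc l)"
      by (simp only: comm)
    then show ?thesis
      using that True unfolding mmul_shift_left mmul_shift_right by (simp add: diagram_iff)
  next
    case False
    then show ?thesis using suppD by (auto simp: diagram_iff)
  qed
  have first: "a (k, Suc j) (i, 1) = 0" if "1 \<le> j" for k j i
  proof (cases "(k, Suc j) \<in> D \<and> (i, 1) \<in> D")
    case True
    have "mmul D a (shift_matrix lam) (k, j) (i, 1) = mmul D (shift_matrix lam) a (k, j) (i, 1)"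
      by (simp only: comm)
    then show ?thesis
      using that True unfolding mmul_shift_left mmul_shift_right by (simp add: diagram_iff)
  qed (use suppD in blast)
  have steps: "a (k, j) (i, l) = (if j + d \<le> lam k then a (k, j + d) (i, l + d) else 0)"
    if "1 \<le> l" "l + d \<le> lam i" "1 \<le> j" for k j i l d
    using that
  proof (induction d)
    case 0
    then show ?case using suppD by (auto simp: diagram_iff)
  next
    case (Suc d)
    then have "a (k, j) (i, l) = (if j + d \<le> lam k then a (k, j + d) (i, l + d) else 0)" by simp
    also have "\<dots> = (if j + Suc d \<le> lam k then a (k, j + Suc d) (i, l + Suc d) else 0)"
      using step[of "l + d" i "j + d" k] Suc.prems by simp
    finally show ?case .
  qed
  \<comment> \<open>Following the diagonal down to the column of box 1 of row \<open>i\<close> leads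
    to a box of row \<open>k\<close> above the first one, and such an entry vanishes because the
    shift kills box 1.\<close>
  have high: "a (k, j) (i, lam i) = 0" if "lam i < j" for k j i
  proof (cases "1 \<le> lam i \<and> j \<le> lam k")
    case True
    have "a (k, Suc (j - lam i)) (i, 1) = (if Suc (j - lam i) + (lam i - 1) \<le> lam k
        then a (k, Suc (j - lam i) + (lam i - 1)) (i, 1 + (lam i - 1)) else 0)"
      using True by (intro steps) auto
    moreover have "Suc (j - lam i) + (lam i - 1) = j" "1 + (lam i - 1) = lam i" using True that by auto
    ultimately show ?thesis using first[of "j - lam i" k i] that True by simp
  next
    case False
    then show ?thesis using suppD by (auto simp: diagram_iff)
  qed
  have nonpivot: "a (k, j) (i, lam i) = 0" if "\<not> pivot i k j" for k j i
  proof (cases "1 \<le> j \<and> j \<le> lam i \<and> j \<le> lam k \<and> box_color lam eps k j = eps i")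
    case True
    then have "(i, k, j) \<in> triples" using that by (intro triplesI) auto
    then have "((k, j), (i, lam i)) \<in> NP" unfolding NP_def top_position_def by force
    from NP0[OF this] show ?thesis by simp
  next
    case False
    then consider "lam i < j" | "(k, j) \<notin> D" | "box_color lam eps k j \<noteq> eps i"
      by (auto simp: diagram_iff)
    then show ?thesis
    proof cases
      case 3
      then have "((k, j), (i, lam i)) \<notin> positions" by (auto simp: positions_def box_color_top)
      then show ?thesis using supp by blast
    qed (use high suppD in blast)+
  qed
  have top: "a (k, j) (i, lam i) = 0" for k j i
  proof (cases "pivot i k j \<and> j \<le> lam k")
    case True
    then have piv: "i = k" "0 < mu k" "nu k < j" "j \<le> lam k" by (auto simp: pivot_def)
    define p where "p = j - nu k"
    have p: "1 \<le> p" "p + nu k = j" using piv by (auto simp: p_def)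
    \<comment> \<open>A mark in another row \<open>i'\<close> contributes the entry at
      \<open>p + nu i'\<close> in the column of the top box of that row. It is no pivot since
      \<open>i' \<noteq> k\<close>, hence zero. So coordinate \<open>(k, p)\<close> of the image is
      the pivot entry alone.\<close>
    have zero: "a (k, p) z * mark_vector lam mu z = 0" if z: "z \<in> D" "z \<noteq> (k, nat (mu k))" for z
    proof (cases "mark_vector lam mu z = (0 :: 'e)")
      case False
      obtain i' l where zi: "z = (i', l)" by (cases z)
      have l: "int l = mu i'" "1 \<le> l" "l \<le> lam i'"
        using False z zi by (auto simp: mark_vector_def diagram_iff split: if_splits)
      have ne: "i' \<noteq> k" using z(2) zi l(1) by auto
      have ln: "l + nu i' = lam i'" using l nu[of i'] by linarith
      have "a (k, p) (i', l) = (if p + nu i' \<le> lam k then a (k, p + nu i') (i', l + nu i') else 0)"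
        using l ln p by (intro steps) auto
      also have "\<dots> = 0" using nonpivot[of i' k "p + nu i'"] ne by (simp add: ln pivot_def)
      finally show ?thesis by (simp add: zi)
    qed simp
    have muk: "(k, nat (mu k)) \<in> D" using piv mu_le[of k] by (auto simp: diagram_iff)
    have "mvec D a (mark_vector lam mu) (k, p) = (\<Sum>z\<in>D. if z = (k, nat (mu k)) then a (k, p) z else 0)"
      unfolding mvec_def
    proof (rule sum.cong)
      fix z assume "z \<in> D"
      then show "a (k, p) z * mark_vector lam mu z = (if z = (k, nat (mu k)) then a (k, p) z else 0)"
        using zero[of z] muk piv by (auto simp: mark_vector_def)
    qed simp
    then have "a (k, p) (k, nat (mu k)) = 0" using vec[of "(k, p)"] muk finite_B by simp
    moreover have "a (k, p) (k, nat (mu k)) = (if p + nu k \<le> lam k then a (k, p + nu k) (k, nat (mu k) + nu k) else 0)"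
      using piv p nu[of k] mu_le[of k] by (intro steps) linarith+
    moreover have "nat (mu k) + nu k = lam k" using piv nu[of k] by linarith
    ultimately show ?thesis using p piv by simp
  next
    case False
    then show ?thesis using nonpivot suppD by (auto simp: diagram_iff)
  qed
  show ?thesis
  proof (cases "b \<in> D \<and> c \<in> D")
    case True
    obtain k j i l where bc: "b = (k, j)" "c = (i, l)" by (cases b; cases c)
    have "a (k, j) (i, l) = (if j + (lam i - l) \<le> lam k then a (k, j + (lam i - l)) (i, l + (lam i - l)) else 0)"
      using True bc by (intro steps) (auto simp: diagram_iff)
    moreover have "l + (lam i - l) = lam i" using True bc by (auto simp: diagram_iff)
    ultimately show ?thesis using top by (simp add: bc)
  qed (use suppD in blast)
qed

lemma variety_dimension_model:
  "int (variety_dimension {case_sum (mvec D g (mark_vector lam mu))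
      (\<lambda>(b, c). mmul D (mmul D g (shift_matrix lam)) h b c) | g h.
      (g, h) \<in> (block_group :: ((nat \<times> nat \<Rightarrow> nat \<times> nat \<Rightarrow> 'e::alg_closed_field) \<times> _) set)})
   = int (card D choose 2) - int (eta lam) + (\<Sum>i<len. \<lceil>real_of_int (mu i) / 2\<rceil>)"
proof -
  obtain q :: "((nat \<times> nat) \<times> (nat \<times> nat) \<Rightarrow> 'e) \<Rightarrow> 'e" and adj where q: "q \<in> polynomial_functions"
    "\<And>b c. (\<lambda>t. adj t b c) \<in> polynomial_functions"
    "\<And>t. q t \<noteq> 0 \<Longrightarrow> (block t, \<lambda>b c. adj t b c / q t) \<in> block_group"
    "\<And>g h. (g, h) \<in> block_group \<Longrightarrow> q (\<lambda>(b, c). g b c) \<noteq> 0"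
    using exists_adjugate by (elim exE conjE) blast
  interpret orbit_point D "case_prod (box_color lam eps)" "shift_matrix lam" "mark_vector lam mu" q adj NP stab_map
  proof unfold_locales
    fix p b c assume "p \<in> NP" and ne: "stab_map p b c \<noteq> (0 :: 'e)"
    then obtain i k j where p: "p = ((k, j), (i, lam i))" "(i, k, j) \<in> triples"
      by (auto simp: NP_def top_position_def)
    have "row_map i k j b c \<noteq> (0 :: 'e) \<or> (0 < mu i \<and> nu i < j \<and> row_map k k (j - nu i + nu k) b c \<noteq> (0 :: 'e))"
      using ne by (auto simp: stab_map_def p split: if_splits)
    then show "(b, c) \<in> positions"
      using row_map_positions[OF triplesD(4)[OF p(2)]] row_map_positions[OF pivot_partner(3)[OF p(2)]] by blast
  next
    fix p assume "p \<in> NP"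
    then obtain i k j where p: "p = ((k, j), (i, lam i))" "(i, k, j) \<in> triples"
      by (auto simp: NP_def top_position_def)
    note t = triplesD[OF p(2)]
    have bil: "mmul D (\<lambda>b c. x b c - y b c) N = (\<lambda>b c. mmul D x N b c - mmul D y N b c)"
      "mmul D N (\<lambda>b c. x b c - y b c) = (\<lambda>b c. mmul D N x b c - mmul D N y b c)"
      "mvec D (\<lambda>b c. x b c - y b c) w = (\<lambda>b. mvec D x w b - mvec D y w b)"
      for x y N :: "nat \<times> nat \<Rightarrow> nat \<times> nat \<Rightarrow> 'e" and w
      unfolding mmul_def mvec_def by (simp_all add: algebra_simps sum_subtractf)
    have "mmul D (stab_map p) (shift_matrix lam) = mmul D (shift_matrix lam) (stab_map p :: _ \<Rightarrow> _ \<Rightarrow> 'e)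
      \<and> mvec D (stab_map p) (mark_vector lam mu) b = (0 :: 'e)" for b
    proof (cases "0 < mu i \<and> nu i < j")
      case True
      let ?j = "j - nu i + nu k"
      have sm: "stab_map p = (\<lambda>b c. row_map i k j b c - row_map k k ?j b c :: 'e)"
        using True by (simp add: stab_map_def p fun_eq_iff)
      have pp: "0 < mu k" "?j \<le> lam k" using pivot_partner[OF p(2)] True by auto
      have "j - nu i \<noteq> 0" using True by simp
      then show ?thesis
        unfolding sm bil row_map_comm[OF t(2,3)] row_map_comm[OF pp(2) pp(2)]
          row_map_mark[OF t(3,2)] row_map_mark[OF pp(2) pp(2)]
        using True pp by auto
    next
      case False
      then have sm: "stab_map p = (row_map i k j :: _ \<Rightarrow> _ \<Rightarrow> 'e)"
        by (auto simp: stab_map_def p fun_eq_iff)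
      show ?thesis
        unfolding sm row_map_comm[OF t(2,3)] row_map_mark[OF t(3,2)] using False by auto
    qed
    then show "mmul D (stab_map p) (shift_matrix lam) = mmul D (shift_matrix lam) (stab_map p :: _ \<Rightarrow> _ \<Rightarrow> 'e)"
      "mvec D (stab_map p) (mark_vector lam mu) b = (0 :: 'e)" for b
      by blast+
    fix p' assume "p' \<in> NP"
    then obtain i' k' j' where p': "p' = ((k', j'), (i', lam i'))" "(i', k', j') \<in> triples"
      by (auto simp: NP_def top_position_def)
    note t' = triplesD[OF p'(2)]
    have mem: "(k', j') \<in> D" "(i', lam i') \<in> D" using t' by (auto simp: diagram_iff)
    \<comment> \<open>In the columns of top boxes the compensating term is supported at a pivot, and
      pivots are excluded from \<open>NP\<close>; so it does not disturb the duality.\<close>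
    have "row_map k k (j - nu i + nu k) (k', j') (i', lam i') = (0 :: 'e)" if "0 < mu i" "nu i < j"
    proof (rule ccontr)
      assume "\<not> ?thesis"
      then have "k' = k" "i' = k" "j' = j - nu i + nu k" by (auto simp: row_map_def split: if_splits)
      then have "pivot i' k' j'" using pivot_partner(1)[OF p(2) that] that by (auto simp: pivot_def)
      then show False using t'(5) by simp
    qed
    then show "stab_map p (fst p') (snd p') = (if p = p' then 1 else (0 :: 'e))"
      using mem by (auto simp: stab_map_def p(1) p'(1) row_map_def)
  next
    show "a b c = 0" if "\<And>b c. a b c \<noteq> 0 \<Longrightarrow> (b, c) \<in> positions"
      "mmul D a (shift_matrix lam) = mmul D (shift_matrix lam) a"
      "\<And>b. mvec D a (mark_vector lam mu) b = 0" "\<And>p. p \<in> NP \<Longrightarrow> a (fst p) (snd p) = 0"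
      for a :: "nat \<times> nat \<Rightarrow> nat \<times> nat \<Rightarrow> 'e" and b c
      using that by (rule stab_map_zero)
  qed (use q NP_positions in \<open>auto simp: shift_matrix_def mark_vector_def split: if_splits\<close>)
  have "int (variety_dimension orbit) = int (card positions) - int (card NP)"
    unfolding variety_dimension_orbit using card_mono[OF finite_positions NP_positions] by simp
  then show ?thesis
    unfolding codimension[symmetric] orbit_def act_def .
qed

end

section \<open>Linear algebra of colored Jordan bases\<close>

lemma bit_cases: "(m :: bit) = 0 \<or> m = 1"
  by (cases m) auto

lemma bit_add_self: "m + m = (0 :: bit)"
  by (cases m) simp_all

lemma bit_neq_iff: "m \<noteq> k \<longleftrightarrow> (m :: bit) = k + 1"
  by (cases m; cases k) simp_all

lemma bit_add_add: "m + (m + k) = (k :: bit)"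
  by (cases m; cases k) simp_all

text \<open>By default sums of bits are rewritten to \<open>XOR\<close>, to which no group lemmas apply.\<close>

declare add_bit_eq_xor [simp del] bit_add_self [simp] bit_add_add [simp]

context two_colored_space
begin

abbreviation lin :: "('v \<Rightarrow> 'v) \<Rightarrow> bool" where
  "lin \<equiv> Vector_Spaces.linear scale scale"

lemma linI: "(\<And>x y. f (x + y) = f x + f y) \<Longrightarrow> (\<And>c x. f (scale c x) = scale c (f x)) \<Longrightarrow> lin f"
  by (simp add: Vector_Spaces.linear_iff vector_space_axioms)

lemma lin_add: "lin f \<Longrightarrow> f (x + y) = f x + f y"
  and lin_scale: "lin f \<Longrightarrow> f (scale c x) = scale c (f x)"
  by (simp_all add: Vector_Spaces.linear_iff)

lemma lin_0: "lin f \<Longrightarrow> f 0 = 0"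
  using lin_scale[of f 0 0] by simp

lemma lin_diff: "lin f \<Longrightarrow> f (x - y) = f x - f y"
  using lin_add[of f "x - y" y] by simp

lemma lin_sum: "lin f \<Longrightarrow> f (\<Sum>p\<in>I. g p) = (\<Sum>p\<in>I. f (g p))"
  by (induction I rule: infinite_finite_induct) (simp_all add: lin_0 lin_add)

lemma lin_comp: "lin f \<Longrightarrow> lin g \<Longrightarrow> lin (\<lambda>x. f (g x))"
  by (rule linI) (simp_all add: lin_add lin_scale)

lemma lin_pow: "lin f \<Longrightarrow> lin (f ^^ n)"
  by (induction n) (simp_all add: linI lin_comp comp_def)

text \<open>Bases as indexed families: for a Jordan basis the index set is the diagram, and
  coefficients are functions of boxes rather than of vectors.\<close>

definition fbasis :: "'i set \<Rightarrow> ('i \<Rightarrow> 'v) \<Rightarrow> bool" where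
  "fbasis I b \<longleftrightarrow> finite I \<and> (\<forall>u. \<exists>c. u = (\<Sum>p\<in>I. scale (c p) (b p))) \<and>
     (\<forall>c. (\<Sum>p\<in>I. scale (c p) (b p)) = 0 \<longrightarrow> (\<forall>p\<in>I. c p = 0))"

lemma fbasis_expand: "fbasis I b \<Longrightarrow> \<exists>c. u = (\<Sum>p\<in>I. scale (c p) (b p))"
  and fbasis_zero: "fbasis I b \<Longrightarrow> (\<Sum>p\<in>I. scale (c p) (b p)) = 0 \<Longrightarrow> p \<in> I \<Longrightarrow> c p = 0"
  and fbasis_finite: "fbasis I b \<Longrightarrow> finite I"
  by (auto simp: fbasis_def)

lemma fbasis_unique:
  assumes "fbasis I b" "(\<Sum>p\<in>I. scale (c p) (b p)) = (\<Sum>p\<in>I. scale (d p) (b p))" "p \<in> I"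
  shows "c p = d p"
proof -
  have "(\<Sum>p\<in>I. scale (c p - d p) (b p)) = 0"
    using assms(2) by (simp add: scale_left_diff_distrib sum_subtractf)
  then show ?thesis using fbasis_zero[OF assms(1) _ assms(3), of "\<lambda>p. c p - d p"] by simp
qed

lemma independent_family:
  assumes "finite I"
  shows "(inj_on b I \<and> independent (b ` I)) \<longleftrightarrow> (\<forall>c. (\<Sum>p\<in>I. scale (c p) (b p)) = 0 \<longrightarrow> (\<forall>p\<in>I. c p = 0))"
    (is "?L \<longleftrightarrow> ?R")
proof
  assume L: ?L
  show ?R
  proof (intro allI impI ballI)
    fix c p assume c: "(\<Sum>p\<in>I. scale (c p) (b p)) = 0" and p: "p \<in> I"
    have "(\<Sum>u\<in>b ` I. scale (c (the_inv_into I b u)) u) = (\<Sum>p\<in>I. scale (c p) (b p))"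
      using L by (subst sum.reindex) (auto intro!: sum.cong simp: the_inv_into_f_f)
    then have "c (the_inv_into I b (b p)) = 0"
      using L c p assms independentD[of "b ` I" "b ` I" "\<lambda>u. c (the_inv_into I b u)" "b p"] by auto
    then show "c p = 0" using L p by (simp add: the_inv_into_f_f)
  qed
next
  assume R: ?R
  have inj: "inj_on b I"
  proof (rule inj_onI, rule ccontr)
    fix p p' assume *: "p \<in> I" "p' \<in> I" "b p = b p'" "p \<noteq> p'"
    let ?c = "\<lambda>r. if r = p then 1 else if r = p' then - 1 else 0"
    have "(\<Sum>r\<in>I. scale (?c r) (b r)) = (\<Sum>r\<in>I. (if r = p then b p else 0) + (if r = p' then - b p' else 0))"
      using * by (intro sum.cong) auto
    also have "\<dots> = 0" using * assms by (simp add: sum.distrib)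
    finally show False using R * by (auto dest!: spec[of _ ?c] bspec[of _ _ p])
  qed
  moreover have "independent (b ` I)"
    unfolding dependent_finite[OF finite_imageI[OF assms]]
  proof (intro notI, elim exE conjE bexE)
    fix u v assume u: "(\<Sum>v\<in>b ` I. scale (u v) v) = 0" and v: "v \<in> b ` I" "u v \<noteq> 0"
    have "(\<Sum>p\<in>I. scale (u (b p)) (b p)) = 0" using u inj by (simp add: sum.reindex)
    then show False using R v by (auto dest!: spec[of _ "\<lambda>p. u (b p)"])
  qed
  ultimately show ?L ..
qed

lemma span_family:
  assumes "finite I"
  shows "u \<in> span (b ` I) \<longleftrightarrow> (\<exists>c. u = (\<Sum>p\<in>I. scale (c p) (b p)))"
proof
  assume "u \<in> span (b ` I)"
  then show "\<exists>c. u = (\<Sum>p\<in>I. scale (c p) (b p))"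
  proof (induction rule: span_induct_alt)
    case base
    show ?case by (intro exI[of _ "\<lambda>_. 0"]) simp
  next
    case (step r v w)
    then obtain p c where p: "p \<in> I" "v = b p" and c: "w = (\<Sum>p\<in>I. scale (c p) (b p))" by blast
    have "scale r v + w = (\<Sum>q\<in>I. scale (if q = p then r else 0) (b q)) + (\<Sum>q\<in>I. scale (c q) (b q))"
      using p assms by (simp add: c if_distrib[of "\<lambda>r. scale r _"] cong: if_cong)
    then show ?case
      by (intro exI[of _ "\<lambda>q. (if q = p then r else 0) + c q"]) (simp only: sum.distrib scale_left_distrib)
  qed
next
  assume "\<exists>c. u = (\<Sum>p\<in>I. scale (c p) (b p))"
  then show "u \<in> span (b ` I)" by (auto simp: span_sum span_scale span_base)
qed

lemma fbasis_iff:
  assumes "finite I"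
  shows "fbasis I b \<longleftrightarrow> inj_on b I \<and> independent (b ` I) \<and> span (b ` I) = UNIV"
  using independent_family[OF assms, of b] span_family[OF assms, of _ b] assms
  unfolding fbasis_def by blast

lemma fbasis_extend:
  assumes "fbasis I b"
  shows "\<exists>f. lin f \<and> (\<forall>p\<in>I. f (b p) = g p)"
proof -
  interpret vector_space_pair scale scale by unfold_locales
  have b: "inj_on b I" "independent (b ` I)" using fbasis_iff[OF fbasis_finite[OF assms]] assms by auto
  obtain f where "lin f" "\<forall>u\<in>b ` I. f u = g (the_inv_into I b u)"
    using linear_independent_extend[OF b(2), of "\<lambda>u. g (the_inv_into I b u)"] by blast
  then show ?thesis using b(1) by (auto simp: the_inv_into_f_f)
qed

lemma fbasis_lin_eq:
  assumes "fbasis I b" "lin f" "lin g" "\<And>p. p \<in> I \<Longrightarrow> f (b p) = g (b p)"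
  shows "f = g"
proof
  fix u
  obtain c where c: "u = (\<Sum>p\<in>I. scale (c p) (b p))" using fbasis_expand[OF assms(1)] by blast
  show "f u = g u"
    unfolding c lin_sum[OF assms(2)] lin_sum[OF assms(3)]
    by (intro sum.cong refl) (simp add: lin_scale assms)
qed

lemma exists_finite_basis: "\<exists>B. finite B \<and> independent B \<and> span B = UNIV"
proof -
  obtain S where S: "finite S" "span S = UNIV" using finite_dimensional by blast
  obtain B where B: "B \<subseteq> UNIV" "independent B" "UNIV \<subseteq> span B" using maximal_independent_subset by blast
  have "finite B" using independent_span_bound[OF S(1) B(2)] S(2) by auto
  then show ?thesis using B by auto
qed

definition some_basis :: "'v set" where
  "some_basis = (SOME B. finite B \<and> independent B \<and> span B = UNIV)"

sublocale finite_dimensional_vector_space scale some_basis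
  using someI_ex[OF exists_finite_basis] by unfold_locales (auto simp: some_basis_def)

lemma fbasis_change:
  assumes "fbasis I b" "inj_on b' I" "independent (b' ` I)"
  shows "fbasis I b'"
proof -
  have fin: "finite I" by (rule fbasis_finite[OF assms(1)])
  have b: "inj_on b I" "independent (b ` I)" "span (b ` I) = UNIV"
    using fbasis_iff[OF fin] assms(1) by auto
  have "dim (UNIV :: 'v set) = card (b ` I)" using b by (metis dim_span_eq_card_independent)
  also have "\<dots> = card (b' ` I)" using b(1) assms(2) by (simp add: card_image)
  finally have "UNIV \<subseteq> span (b' ` I)"
    using card_ge_dim_independent[of "b' ` I" UNIV] assms(3) by simp
  then show ?thesis using fbasis_iff[OF fin] assms by auto
qed

lemma dim_family:
  assumes "fbasis I b" "J \<subseteq> I" "\<And>u. u \<in> W \<longleftrightarrow> (\<exists>c. u = (\<Sum>p\<in>J. scale (c p) (b p)))"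
  shows "dim W = card J"
proof -
  have fin: "finite I" by (rule fbasis_finite[OF assms(1)])
  have b: "inj_on b I" "independent (b ` I)" using fbasis_iff[OF fin] assms(1) by auto
  have J: "finite J" "inj_on b J" "independent (b ` J)"
    using fin assms(2) b finite_subset inj_on_subset independent_mono[OF b(2) image_mono[OF assms(2)]] by blast+
  have "W = span (b ` J)" using span_family[OF J(1), of _ b] assms(3) by blast
  then show ?thesis using J by (metis dim_span_eq_card_independent card_image)
qed

subsection \<open>The grading\<close>

lemma V_add: "u \<in> V m \<Longrightarrow> w \<in> V m \<Longrightarrow> u + w \<in> V m"
  and V_scale: "u \<in> V m \<Longrightarrow> scale c u \<in> V m"
  and V_0: "0 \<in> V m"
  using subspace_V by (auto intro: subspace_add subspace_scale subspace_0)

lemma V_diff: "u \<in> V m \<Longrightarrow> w \<in> V m \<Longrightarrow> u - w \<in> V m"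
  using subspace_V by (rule subspace_diff)

lemma V_setsum: "(\<And>p. p \<in> I \<Longrightarrow> g p \<in> V m) \<Longrightarrow> (\<Sum>p\<in>I. g p) \<in> V m"
  using subspace_V by (rule subspace_sum)

lemma V_disjoint': "u \<in> V m \<Longrightarrow> u \<in> V (m + 1) \<Longrightarrow> u = 0"
  using V_disjoint by (cases m) auto

lemma V_decompose: "\<exists>w\<in>V m. \<exists>w'\<in>V (m + 1). u = w + w'"
proof -
  obtain v0 v1 where v: "v0 \<in> V 0" "v1 \<in> V 1" "u = v0 + v1" using two_colored_space.V_sum[OF two_colored_space_axioms] by blast
  show ?thesis
    using bit_cases[of m]
  proof
    assume "m = 0"
    then show ?thesis using v by auto
  next
    assume "m = 1"
    then have "u = v1 + v0" "v1 \<in> V m" "v0 \<in> V (m + 1)" using v by (auto simp: add.commute)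
    then show ?thesis by blast
  qed
qed

lemma V_unique:
  assumes "u \<in> V m" "w \<in> V m" "w' \<in> V (m + 1)" "u = w + w'"
  shows "w' = 0" "u = w"
proof -
  have "w' = u - w" using assms(4) by simp
  then have "w' \<in> V m" using V_diff[OF assms(1,2)] by simp
  then show "w' = 0" using V_disjoint' assms(3) by blast
  then show "u = w" using assms(4) by simp
qed

lemma cone_lin: "x \<in> nilpotent_cone \<Longrightarrow> lin x"
  by (simp add: nilpotent_cone_def)

lemma cone_color: "x \<in> nilpotent_cone \<Longrightarrow> u \<in> V m \<Longrightarrow> x u \<in> V (m + 1)"
  by (cases m) (auto simp: nilpotent_cone_def)

lemma cone_pow_color: "x \<in> nilpotent_cone \<Longrightarrow> u \<in> V m \<Longrightarrow> (x ^^ a) u \<in> V (m + of_nat a)"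
proof (induction a)
  case (Suc a)
  have "x ((x ^^ a) u) \<in> V (m + of_nat a + 1)" by (rule cone_color[OF Suc.prems(1) Suc.IH[OF Suc.prems]])
  moreover have "m + of_nat a + 1 = m + of_nat (Suc a)" by (simp only: of_nat_Suc add_ac)
  ultimately show ?case by simp
qed simp

text \<open>The part of the sum with the wrong color is the component in \<open>V (m + 1)\<close> of
  a vector of \<open>V m\<close>, hence zero.\<close>

lemma homogeneous_coefficients:
  assumes b: "fbasis I b" "\<And>p. p \<in> I \<Longrightarrow> b p \<in> V (clr p)"
    and u: "(\<Sum>p\<in>I. scale (c p) (b p)) \<in> V m" and p: "p \<in> I" "clr p \<noteq> m"
  shows "c p = 0"
proof -
  have fin: "finite I" by (rule fbasis_finite[OF b(1)])
  let ?u = "\<Sum>p\<in>I. scale (c p) (b p)"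
  have split: "?u = (\<Sum>p\<in>{p\<in>I. clr p = m}. scale (c p) (b p)) + (\<Sum>p\<in>{p\<in>I. clr p \<noteq> m}. scale (c p) (b p))"
    using fin by (subst sum.union_disjoint[symmetric]) (auto intro!: sum.cong)
  have "(\<Sum>p\<in>{p\<in>I. clr p \<noteq> m}. scale (c p) (b p)) = 0"
  proof (rule V_unique(1)[OF u _ _ split])
    show "(\<Sum>p\<in>{p\<in>I. clr p = m}. scale (c p) (b p)) \<in> V m"
      using b(2) by (intro V_setsum V_scale) auto
    show "(\<Sum>p\<in>{p\<in>I. clr p \<noteq> m}. scale (c p) (b p)) \<in> V (m + 1)"
    proof (intro V_setsum V_scale)
      fix p assume p: "p \<in> {p\<in>I. clr p \<noteq> m}"
      then have "clr p = m + 1" using bit_neq_iff[of "clr p" m] by simp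
      then show "b p \<in> V (m + 1)" using b(2)[of p] p by (simp only: mem_Collect_eq)
    qed
  qed
  moreover have "(\<Sum>p\<in>{p\<in>I. clr p \<noteq> m}. scale (c p) (b p)) = (\<Sum>p\<in>I. scale (if clr p \<noteq> m then c p else 0) (b p))"
    using fin by (intro sum.mono_neutral_cong_left) auto
  ultimately have "(if clr p \<noteq> m then c p else 0) = 0"
    using fbasis_zero[OF b(1) _ p(1), of "\<lambda>p. if clr p \<noteq> m then c p else 0"] by simp
  then show ?thesis using p(2) by simp
qed

lemma dim_homogeneous:
  assumes b: "fbasis I b" "\<And>p. p \<in> I \<Longrightarrow> b p \<in> V (clr p)"
  shows "dim (V m) = card {p\<in>I. clr p = m}"
proof (rule dim_family[OF b(1)])
  have fin: "finite I" by (rule fbasis_finite[OF b(1)])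
  fix u
  show "u \<in> V m \<longleftrightarrow> (\<exists>c. u = (\<Sum>p\<in>{p\<in>I. clr p = m}. scale (c p) (b p)))"
  proof
    assume u: "u \<in> V m"
    obtain c where c: "u = (\<Sum>p\<in>I. scale (c p) (b p))" using fbasis_expand[OF b(1)] by blast
    have "c p = 0" if "p \<in> I" "clr p \<noteq> m" for p
      using homogeneous_coefficients[of I b clr c m p] b u that unfolding c by blast
    then have "u = (\<Sum>p\<in>{p\<in>I. clr p = m}. scale (c p) (b p))"
      unfolding c using fin by (intro sum.mono_neutral_cong_right) auto
    then show "\<exists>c. u = (\<Sum>p\<in>{p\<in>I. clr p = m}. scale (c p) (b p))" by blast
  qed (use b(2) in \<open>auto intro!: V_setsum V_scale\<close>)
qed auto

lemma exists_adapted_basis: "\<exists>B0 B1. B0 \<subseteq> V 0 \<and> B1 \<subseteq> V 1 \<and> B0 \<inter> B1 = {} \<and> finite B0 \<and> finite B1 \<and>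
  card B0 = dim (V 0) \<and> card B1 = dim (V 1) \<and> independent (B0 \<union> B1) \<and> span (B0 \<union> B1) = UNIV"
proof -
  obtain B0 where B0: "B0 \<subseteq> V 0" "independent B0" "V 0 \<subseteq> span B0" "card B0 = dim (V 0)"
    using basis_exists by blast
  obtain B1 where B1: "B1 \<subseteq> V 1" "independent B1" "V 1 \<subseteq> span B1" "card B1 = dim (V 1)"
    using basis_exists by blast
  have fin: "finite B0" "finite B1" using B0 B1 finiteI_independent by auto
  have disj: "B0 \<inter> B1 = {}"
  proof -
    have "u = 0" if "u \<in> B0" "u \<in> B1" for u using that B0 B1 V_disjoint by blast
    then show ?thesis using B0(2) dependent_zero by blast
  qed
  have "span (B0 \<union> B1) = UNIV"
  proof -
    have "u \<in> span (B0 \<union> B1)" for u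
    proof -
      obtain w w' where "w \<in> V 0" "w' \<in> V (0 + 1)" "u = w + w'" using V_decompose by blast
      then show ?thesis using B0(3) B1(3) span_mono[of B0 "B0 \<union> B1"] span_mono[of B1 "B0 \<union> B1"]
        by (auto intro!: span_add)
    qed
    then show ?thesis by blast
  qed
  moreover have "independent (B0 \<union> B1)"
    unfolding dependent_finite[OF finite_UnI[OF fin]]
  proof (intro notI, elim exE conjE bexE)
    fix u v assume u: "(\<Sum>v\<in>B0 \<union> B1. scale (u v) v) = 0" and v: "v \<in> B0 \<union> B1" "u v \<noteq> 0"
    have s: "0 = (\<Sum>v\<in>B0. scale (u v) v) + (\<Sum>v\<in>B1. scale (u v) v)"
      using u fin disj by (simp add: sum.union_disjoint)
    have "(\<Sum>v\<in>B1. scale (u v) v) \<in> V (0 + 1)" "(\<Sum>v\<in>B0. scale (u v) v) \<in> V 0"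
      using B0(1) B1(1) by (auto intro!: V_setsum V_scale)
    from V_unique[OF V_0 this(2,1) s]
    have "(\<Sum>v\<in>B1. scale (u v) v) = 0" "(\<Sum>v\<in>B0. scale (u v) v) = 0" by auto
    then have "\<forall>v\<in>B1. u v = 0" "\<forall>v\<in>B0. u v = 0"
      using independentD[OF B1(2) fin(2) subset_refl] independentD[OF B0(2) fin(1) subset_refl] by blast+
    then show False using v by blast
  qed
  ultimately show ?thesis using B0 B1 fin disj by blast
qed

end

lemma box_color_pred: "1 \<le> j \<Longrightarrow> box_color lam eps i (j - 1) = box_color lam eps i j + 1"
proof -
  assume "1 \<le> j"
  then have "int (lam i) - int (j - 1) = (int (lam i) - int j) + 1" by simp
  then show ?thesis by (simp only: box_color_def of_int_add of_int_1 add.assoc)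
qed

lemma sum_diagram_rows:
  assumes "is_partition lam"
  shows "(\<Sum>p\<in>diagram lam. f p) = (\<Sum>i<part_length lam. \<Sum>j = 1..lam i. f (i, j))"
  unfolding diagram_Sigma[OF assms] by (subst sum.Sigma) auto

context two_colored_space
begin

text \<open>The boundary value \<open>b i 0 = 0\<close> together with truncated subtraction merges
  the two cases of the shift rule, so that \<open>(x ^^ a) (b i j) = b i (j - a)\<close> holds for
  every \<open>a\<close>.\<close>

definition jordan_basis :: "(nat \<Rightarrow> nat) \<Rightarrow> (nat \<Rightarrow> bit) \<Rightarrow> ('v \<Rightarrow> 'v) \<Rightarrow> (nat \<Rightarrow> nat \<Rightarrow> 'v) \<Rightarrow> bool" where
  "jordan_basis lam eps x b \<longleftrightarrow> fbasis (diagram lam) (\<lambda>(i, j). b i j) \<and> (\<forall>i. b i 0 = 0) \<and>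
     (\<forall>i j. 1 \<le> j \<longrightarrow> j \<le> lam i \<longrightarrow> b i j \<in> V (box_color lam eps i j)) \<and>
     (\<forall>i j. j \<le> lam i \<longrightarrow> x (b i j) = b i (j - 1))"

lemma jordan_basisD:
  assumes "jordan_basis lam eps x b"
  shows jordan_basis_fbasis: "fbasis (diagram lam) (\<lambda>(i, j). b i j)"
    and jordan_basis_0: "b i 0 = 0"
    and jordan_basis_color: "1 \<le> j \<Longrightarrow> j \<le> lam i \<Longrightarrow> b i j \<in> V (box_color lam eps i j)"
    and jordan_basis_step: "j \<le> lam i \<Longrightarrow> x (b i j) = b i (j - 1)"
  using assms by (auto simp: jordan_basis_def)

lemma jordan_basis_imp:
  assumes "jordan_basis lam eps x b"
  shows "colored_jordan_basis lam eps x b"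
proof -
  have fin: "finite (diagram lam)" using assms by (auto simp: jordan_basis_def fbasis_def)
  show ?thesis
    using assms unfolding colored_jordan_basis_def jordan_basis_def fbasis_iff[OF fin]
    by (auto simp: diagram_def)
qed

lemma colored_jordan_basis_normalize:
  assumes "is_partition lam" "lin x" "colored_jordan_basis lam eps x b"
  shows "jordan_basis lam eps x (\<lambda>i j. if j = 0 then 0 else b i j)"
proof -
  let ?b = "\<lambda>i j. if j = 0 then 0 else b i j"
  have fin: "finite (diagram lam)" by (rule finite_diagram[OF assms(1)])
  have eq: "(\<lambda>(i, j). ?b i j) p = (\<lambda>(i, j). b i j) p" if "p \<in> diagram lam" for p
    using that by (auto simp: diagram_def)
  have "fbasis (diagram lam) (\<lambda>(i, j). b i j)"
    using assms(3) unfolding colored_jordan_basis_def fbasis_iff[OF fin] by blast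
  then have "fbasis (diagram lam) (\<lambda>(i, j). ?b i j)"
    using eq unfolding fbasis_def by simp
  moreover have "x (?b i j) = ?b i (j - 1)" if "j \<le> lam i" for i j
    using assms(3) that lin_0[OF assms(2)] unfolding colored_jordan_basis_def
    by (cases "j = 0"; cases "j = 1") (auto simp: diagram_def)
  moreover have "?b i j \<in> V (box_color lam eps i j)" if "1 \<le> j" "j \<le> lam i" for i j
    using assms(3) that unfolding colored_jordan_basis_def by (auto simp: diagram_def)
  ultimately show ?thesis unfolding jordan_basis_def by simp
qed

text \<open>Summing over the rows with a positive mark, rather than over an initial segment, gives a
  form that permutations of the rows can act on.\<close>

lemma marked_vector_eq:
  assumes "is_partition lam" "\<And>i. mu i \<le> int (lam i)"
  shows "marked_vector lam mu b = (\<Sum>i\<in>{i. mu i > 0}. b i (nat (mu i)))"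
proof -
  have "{i. mu i > 0} \<subseteq> {..<part_length lam}"
  proof
    fix i assume "i \<in> {i. mu i > 0}"
    then have "lam i > 0" using assms(2)[of i] by simp
    then show "i \<in> {..<part_length lam}" using partition_support[OF assms(1)] by simp
  qed
  then have "(\<Sum>i\<in>{i. mu i > 0}. b i (nat (mu i))) = (\<Sum>i<part_length lam. if mu i > 0 then b i (nat (mu i)) else 0)"
    by (intro sum.mono_neutral_cong_left) auto
  then show ?thesis by (simp add: marked_vector_def)
qed

lemma marked_vector_normalize:
  "marked_vector lam mu (\<lambda>i j. if j = 0 then 0 else b i j) = marked_vector lam mu b"
  unfolding marked_vector_def by (intro sum.cong) auto

lemma jordan_pow:
  assumes "jordan_basis lam eps x b" "j \<le> lam i"
  shows "(x ^^ a) (b i j) = b i (j - a)"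
proof (induction a)
  case (Suc a)
  then show ?case using jordan_basis_step[OF assms(1), of "j - a" i] assms(2) by simp
qed simp

text \<open>Apply the power of \<open>x\<close> that moves the highest occurring boxes to the bottom.\<close>

lemma chain_independent:
  assumes lam: "is_partition lam" and x: "lin x" and b0: "\<And>i. b i 0 = 0"
    and step: "\<And>i j. j \<le> lam i \<Longrightarrow> x (b i j) = b i (j - 1)"
    and bottom: "\<And>c. (\<Sum>i<part_length lam. scale (c i) (b i 1)) = 0 \<Longrightarrow> \<forall>i<part_length lam. c i = 0"
    and c: "(\<Sum>p\<in>diagram lam. scale (c p) (case p of (i, j) \<Rightarrow> b i j)) = 0"
  shows "\<forall>p\<in>diagram lam. c p = 0"
proof (rule ccontr)
  assume nz: "\<not> ?thesis"
  define S where "S = {j. \<exists>i. (i, j) \<in> diagram lam \<and> c (i, j) \<noteq> 0}"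
  have "S \<subseteq> snd ` diagram lam" by (force simp: S_def)
  then have fin: "finite S" using finite_diagram[OF lam] finite_surj by blast
  have "S \<noteq> {}" using nz by (auto simp: S_def)
  define m where "m = Max S"
  have "m \<in> S" using Max_in[OF fin \<open>S \<noteq> {}\<close>] by (simp add: m_def)
  have le: "j \<le> m" if "j \<in> S" for j using Max_ge[OF fin that] by (simp add: m_def)
  have pow: "(x ^^ a) (b i j) = b i (j - a)" if "j \<le> lam i" for a i j
  proof (induction a)
    case (Suc a)
    then show ?case using step[of "j - a" i] that by simp
  qed simp
  have "0 = (x ^^ (m - 1)) (\<Sum>p\<in>diagram lam. scale (c p) (case p of (i, j) \<Rightarrow> b i j))"
    unfolding c using lin_0[OF lin_pow[OF x]] by simp
  also have "\<dots> = (\<Sum>p\<in>diagram lam. (x ^^ (m - 1)) (scale (c p) (case p of (i, j) \<Rightarrow> b i j)))"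
    by (rule lin_sum[OF lin_pow[OF x]])
  also have "\<dots> = (\<Sum>i<part_length lam. \<Sum>j = 1..lam i. scale (c (i, j)) (b i (j - (m - 1))))"
    unfolding sum_diagram_rows[OF lam] by (intro sum.cong refl) (simp add: lin_scale[OF lin_pow[OF x]] pow)
  also have "\<dots> = (\<Sum>i<part_length lam. scale (if m \<le> lam i then c (i, m) else 0) (b i 1))"
  proof (intro sum.cong refl)
    fix i
    have "1 \<le> m" using \<open>m \<in> S\<close> by (auto simp: S_def diagram_def)
    have "scale (c (i, j)) (b i (j - (m - 1))) = (if j = m then scale (c (i, m)) (b i 1) else 0)"
      if j: "j \<in> {1..lam i}" for j
    proof (cases "j < m")
      case True
      then show ?thesis using b0 by simp
    next
      case False
      have "c (i, j) = 0" if "j \<noteq> m"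
        using le[of j] that False j by (auto simp: S_def diagram_def)
      then show ?thesis using False \<open>1 \<le> m\<close> by auto
    qed
    then have "(\<Sum>j = 1..lam i. scale (c (i, j)) (b i (j - (m - 1)))) =
        (\<Sum>j = 1..lam i. if j = m then scale (c (i, m)) (b i 1) else 0)"
      by (rule sum.cong[OF refl])
    then show "(\<Sum>j = 1..lam i. scale (c (i, j)) (b i (j - (m - 1)))) = scale (if m \<le> lam i then c (i, m) else 0) (b i 1)"
      using \<open>1 \<le> m\<close> by (simp add: sum.delta)
  qed
  finally have z: "\<forall>i<part_length lam. (if m \<le> lam i then c (i, m) else 0) = 0"
    by (intro bottom) simp
  obtain i where i: "(i, m) \<in> diagram lam" "c (i, m) \<noteq> 0" using \<open>m \<in> S\<close> by (auto simp: S_def)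
  then have "i < part_length lam" "m \<le> lam i" by (auto simp: diagram_Sigma[OF lam])
  then show False using z i(2) by auto
qed

lemma jordan_bottom:
  assumes "jordan_basis lam eps x b" "is_partition lam"
    and c: "(\<Sum>i<part_length lam. scale (c i) (b i 1)) = 0"
  shows "\<forall>i<part_length lam. c i = 0"
proof (intro allI impI)
  fix i assume i: "i < part_length lam"
  have pos: "1 \<le> lam i'" if "i' < part_length lam" for i'
    using partition_support[OF assms(2), of i'] that by simp
  have "(\<Sum>p\<in>diagram lam. scale (if snd p = 1 then c (fst p) else 0) (case p of (i, j) \<Rightarrow> b i j))
      = (\<Sum>i<part_length lam. \<Sum>j = 1..lam i. if j = 1 then scale (c i) (b i 1) else 0)"
    unfolding sum_diagram_rows[OF assms(2)] by (intro sum.cong refl) simp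
  also have "\<dots> = (\<Sum>i<part_length lam. scale (c i) (b i 1))"
    using pos by (intro sum.cong refl) (simp add: sum.delta Suc_le_eq)
  finally have "(if snd (i, 1 :: nat) = 1 then c (fst (i, 1 :: nat)) else 0) = 0"
    using c pos[OF i] by (intro fbasis_zero[OF jordan_basis_fbasis[OF assms(1)], of "\<lambda>p. if snd p = 1 then c (fst p) else 0"])
      (simp_all add: diagram_def)
  then show "c i = 0" by simp
qed

text \<open>Independence of the bottom boxes passes to the whole family by
  \<open>chain_independent\<close>, and spanning follows by counting, since the old basis has the
  same index set. So a change of basis needs to be checked on the bottom boxes only.\<close>

lemma jordan_basis_change:
  assumes b: "jordan_basis lam eps x b" and lam: "is_partition lam" and x: "lin x"
    and b0: "\<And>i. b' i 0 = 0" and color: "\<And>i j. 1 \<le> j \<Longrightarrow> j \<le> lam i \<Longrightarrow> b' i j \<in> V (box_color lam eps i j)"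
    and step: "\<And>i j. j \<le> lam i \<Longrightarrow> x (b' i j) = b' i (j - 1)"
    and bottom: "\<And>c. (\<Sum>i<part_length lam. scale (c i) (b' i 1)) = 0 \<Longrightarrow> \<forall>i<part_length lam. c i = 0"
  shows "jordan_basis lam eps x b'"
proof -
  have "inj_on (\<lambda>(i, j). b' i j) (diagram lam) \<and> independent ((\<lambda>(i, j). b' i j) ` diagram lam)"
    unfolding independent_family[OF finite_diagram[OF lam]]
    using chain_independent[of lam x b', OF lam x b0 step bottom] by blast
  then have "fbasis (diagram lam) (\<lambda>(i, j). b' i j)"
    using fbasis_change[OF jordan_basis_fbasis[OF b]] by blast
  then show ?thesis unfolding jordan_basis_def using b0 color step by blast
qed

lemma part_signature_eq:
  assumes "jordan_basis lam eps x b"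
  shows "part_signature lam eps = space_signature"
proof
  fix m
  have "dim (V m) = card {p\<in>diagram lam. (\<lambda>(i, j). box_color lam eps i j) p = m}"
    using jordan_basis_color[OF assms]
    by (intro dim_homogeneous[OF jordan_basis_fbasis[OF assms]]) (auto simp: diagram_def)
  then show "part_signature lam eps m = space_signature m"
    by (simp add: part_signature_def space_signature_def case_prod_unfold)
qed

subsection \<open>The map \<open>Psi\<close>\<close>

lemma jordan_basis_conjugate:
  assumes b: "jordan_basis lam eps x b" and b': "jordan_basis lam eps x' b'" and x: "lin x" "lin x'"
  shows "\<exists>k\<in>K_group. (\<forall>i j. (i, j) \<in> diagram lam \<longrightarrow> k (b i j) = b' i j) \<and> x' = k \<circ> x \<circ> inv_into UNIV k"
proof -
  have ex: "\<exists>k. lin k \<and> (\<forall>i j. (i, j) \<in> diagram lam \<longrightarrow> k (b i j) = b' i j)"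
    if "jordan_basis lam eps x b" for x b b'
    using fbasis_extend[OF jordan_basis_fbasis[OF that], of "\<lambda>(i, j). b' i j"] by fastforce
  have pres: "k u \<in> V m" if b: "jordan_basis lam eps x b" and b': "jordan_basis lam eps x' b'"
    and k: "lin k" "\<forall>i j. (i, j) \<in> diagram lam \<longrightarrow> k (b i j) = b' i j" and u: "u \<in> V m" for x x' b b' k u m
  proof -
    obtain c where c: "u = (\<Sum>p\<in>diagram lam. scale (c p) (case p of (i, j) \<Rightarrow> b i j))"
      using fbasis_expand[OF jordan_basis_fbasis[OF b]] by blast
    have c0: "c p = 0" if "p \<in> diagram lam" "(\<lambda>(i, j). box_color lam eps i j) p \<noteq> m" for p
      using u that jordan_basis_color[OF b] unfolding c
      by (intro homogeneous_coefficients[OF jordan_basis_fbasis[OF b], of "\<lambda>(i, j). box_color lam eps i j" c m])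
        (auto simp: diagram_def)
    show ?thesis
      unfolding c lin_sum[OF k(1)] lin_scale[OF k(1)]
    proof (rule V_setsum)
      fix p assume p: "p \<in> diagram lam"
      obtain i j where ij: "p = (i, j)" by (cases p)
      show "scale (c p) (k (case p of (i, j) \<Rightarrow> b i j)) \<in> V m"
      proof (cases "box_color lam eps i j = m")
        case True
        then show ?thesis using k(2) p jordan_basis_color[OF b', of j i] ij
          by (auto simp: diagram_def intro!: V_scale)
      next
        case False
        then show ?thesis using c0[OF p] ij V_0 by simp
      qed
    qed
  qed
  obtain k where k: "lin k" "\<forall>i j. (i, j) \<in> diagram lam \<longrightarrow> k (b i j) = b' i j" using ex[OF b] by blast
  obtain l where l: "lin l" "\<forall>i j. (i, j) \<in> diagram lam \<longrightarrow> l (b' i j) = b i j" using ex[OF b'] by blast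
  have id: "lin (\<lambda>u. u)" by (rule linI) simp_all
  have lk: "(\<lambda>u. l (k u)) = (\<lambda>u. u)"
    using k(2) l(2) by (intro fbasis_lin_eq[OF jordan_basis_fbasis[OF b] lin_comp[OF l(1) k(1)] id]) auto
  have kl: "(\<lambda>u. k (l u)) = (\<lambda>u. u)"
    using k(2) l(2) by (intro fbasis_lin_eq[OF jordan_basis_fbasis[OF b'] lin_comp[OF k(1) l(1)] id]) auto
  have lk': "l (k u) = u" "k (l u) = u" for u using lk kl by meson+
  have bij: "bij k" by (rule o_bij[of l]) (auto simp: lk')
  have "k ` V m = V m" for m
  proof
    show "k ` V m \<subseteq> V m" using pres[OF b b' k] by blast
    show "V m \<subseteq> k ` V m"
    proof
      fix u assume "u \<in> V m"
      then have "l u \<in> V m" using pres[OF b' b l] by blast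
      then show "u \<in> k ` V m" using lk'(2)[of u] by force
    qed
  qed
  then have K: "k \<in> K_group" using k(1) bij by (simp add: K_group_def)
  have "(\<lambda>u. x' (k u)) = (\<lambda>u. k (x u))"
  proof (rule fbasis_lin_eq[OF jordan_basis_fbasis[OF b] lin_comp[OF x(2) k(1)] lin_comp[OF k(1) x(1)]])
    fix p assume p: "p \<in> diagram lam"
    obtain i j where ij: "p = (i, j)" by (cases p)
    have j: "1 \<le> j" "j \<le> lam i" using p ij by (auto simp: diagram_def)
    have "b' i (j - 1) = k (b i (j - 1))"
    proof (cases "j = 1")
      case True
      then show ?thesis using jordan_basis_0[OF b] jordan_basis_0[OF b'] lin_0[OF k(1)] by simp
    next
      case False
      then have "(i, j - 1) \<in> diagram lam" using j by (auto simp: diagram_def)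
      then show ?thesis using k(2) by simp
    qed
    then show "x' (k (case p of (i, j) \<Rightarrow> b i j)) = k (x (case p of (i, j) \<Rightarrow> b i j))"
      using k(2) p ij j jordan_basis_step[OF b j(2)] jordan_basis_step[OF b' j(2)] by simp
  qed
  then have xk: "x' (k u) = k (x u)" for u by meson
  have "x' w = (k \<circ> x \<circ> inv_into UNIV k) w" for w
    using xk[of "inv_into UNIV k w"] bij by (simp add: bij_is_surj surj_f_inv_f)
  then show ?thesis using K k(2) by blast
qed

lemma jordan_basis_transport:
  assumes b: "jordan_basis lam eps x b" and lam: "is_partition lam" and x: "x \<in> nilpotent_cone" and k: "k \<in> K_group"
  shows "jordan_basis lam eps (k \<circ> x \<circ> inv_into UNIV k) (\<lambda>i j. k (b i j))"
    "k \<circ> x \<circ> inv_into UNIV k \<in> nilpotent_cone"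
    "k (marked_vector lam mu b) = marked_vector lam mu (\<lambda>i j. k (b i j))"
proof -
  have lk: "lin k" and bij: "bij k" and Vk: "\<And>m. k ` V m = V m" using k by (auto simp: K_group_def)
  let ?i = "inv_into UNIV k"
  have ik: "?i (k u) = u" "k (?i u) = u" for u
    using bij by (simp_all add: bij_is_inj bij_is_surj surj_f_inv_f)
  have li: "lin ?i"
    by (rule linI) (metis ik lin_add[OF lk], metis ik lin_scale[OF lk])
  have lx: "lin x" by (rule cone_lin[OF x])
  have fin: "finite (diagram lam)" by (rule finite_diagram[OF lam])
  have "fbasis (diagram lam) (\<lambda>(i, j). k (b i j))"
    unfolding fbasis_def
  proof (intro conjI allI impI fin)
    fix u
    obtain c where "?i u = (\<Sum>p\<in>diagram lam. scale (c p) (case p of (i, j) \<Rightarrow> b i j))"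
      using fbasis_expand[OF jordan_basis_fbasis[OF b]] by blast
    then have "k (?i u) = (\<Sum>p\<in>diagram lam. scale (c p) (k (case p of (i, j) \<Rightarrow> b i j)))"
      by (simp add: lin_sum[OF lk] lin_scale[OF lk])
    then show "\<exists>c. u = (\<Sum>p\<in>diagram lam. scale (c p) (case p of (i, j) \<Rightarrow> k (b i j)))"
      unfolding ik by (intro exI[of _ c]) (simp add: case_prod_unfold)
  next
    fix c assume "(\<Sum>p\<in>diagram lam. scale (c p) (case p of (i, j) \<Rightarrow> k (b i j))) = 0"
    then have "k (\<Sum>p\<in>diagram lam. scale (c p) (case p of (i, j) \<Rightarrow> b i j)) = 0"
      by (simp add: lin_sum[OF lk] lin_scale[OF lk] case_prod_unfold)
    then have "(\<Sum>p\<in>diagram lam. scale (c p) (case p of (i, j) \<Rightarrow> b i j)) = 0"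
      by (metis ik(1) lin_0[OF lk])
    then show "\<forall>p\<in>diagram lam. c p = 0" using fbasis_zero[OF jordan_basis_fbasis[OF b]] by blast
  qed
  moreover have "k (b i 0) = 0" for i using jordan_basis_0[OF b] lin_0[OF lk] by simp
  moreover have "k (b i j) \<in> V (box_color lam eps i j)" if "1 \<le> j" "j \<le> lam i" for i j
    using jordan_basis_color[OF b that] Vk by blast
  moreover have "(k \<circ> x \<circ> ?i) (k (b i j)) = k (b i (j - 1))" if "j \<le> lam i" for i j
    using jordan_basis_step[OF b that] by (simp add: ik)
  ultimately show "jordan_basis lam eps (k \<circ> x \<circ> ?i) (\<lambda>i j. k (b i j))"
    unfolding jordan_basis_def by blast
  have pow: "((k \<circ> x \<circ> ?i) ^^ n) u = k ((x ^^ n) (?i u))" for n u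
    by (induction n) (simp_all add: ik)
  obtain n where n: "\<And>u. (x ^^ n) u = 0" using x by (auto simp: nilpotent_cone_def)
  have "lin (k \<circ> x \<circ> ?i)" using lin_comp[OF lk lin_comp[OF lx li]] by (simp add: comp_def)
  moreover have "\<exists>n. \<forall>u. ((k \<circ> x \<circ> ?i) ^^ n) u = 0"
    using n by (intro exI[of _ n]) (simp add: pow lin_0[OF lk])
  moreover have "(k \<circ> x \<circ> ?i) ` V m \<subseteq> V (m + 1)" for m
  proof
    fix u assume "u \<in> (k \<circ> x \<circ> ?i) ` V m"
    then obtain w where w: "w \<in> V m" "u = k (x (?i w))" by auto
    have "?i w \<in> V m" using w(1) Vk[of m] ik(1) by (metis image_iff)
    then have "x (?i w) \<in> V (m + 1)" by (rule cone_color[OF x])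
    then show "u \<in> V (m + 1)" using w(2) Vk by blast
  qed
  from this[of 0] this[of 1] calculation show "k \<circ> x \<circ> ?i \<in> nilpotent_cone"
    by (simp add: nilpotent_cone_def)
  show "k (marked_vector lam mu b) = marked_vector lam mu (\<lambda>i j. k (b i j))"
    unfolding marked_vector_def lin_sum[OF lk] by (intro sum.cong refl) (simp add: lin_0[OF lk])
qed

lemma id_K_group: "id \<in> K_group"
  by (simp add: K_group_def linI)

text \<open>The group element in the definition is absorbed by transporting the Jordan basis.
  Membership in \<open>Psi\<close> then means that one Jordan basis of the given type presents the
  pair.\<close>

lemma Psi_eq:
  assumes "is_partition lam"
  shows "Psi (lam, eps, mu) = {(marked_vector lam mu b, x) | x b. x \<in> nilpotent_cone \<and> jordan_basis lam eps x b}"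
    (is "_ = ?S")
proof
  show "Psi (lam, eps, mu) \<subseteq> ?S"
  proof
    fix z assume "z \<in> Psi (lam, eps, mu)"
    then obtain x b k where x: "x \<in> nilpotent_cone" and b: "colored_jordan_basis lam eps x b"
      and k: "k \<in> K_group" and z: "z = (k (marked_vector lam mu b), k \<circ> x \<circ> inv_into UNIV k)"
      unfolding Psi_def K_orbit_def by auto
    let ?b = "\<lambda>i j. if j = 0 then 0 else b i j"
    have b': "jordan_basis lam eps x ?b"
      by (rule colored_jordan_basis_normalize[OF assms cone_lin[OF x] b])
    note t = jordan_basis_transport[OF b' assms x k]
    have "z = (marked_vector lam mu (\<lambda>i j. k (?b i j)), k \<circ> x \<circ> inv_into UNIV k)"
      unfolding z t(3)[symmetric] marked_vector_normalize ..
    then show "z \<in> ?S" using t(1,2) by blast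
  qed
  show "?S \<subseteq> Psi (lam, eps, mu)"
  proof
    fix z assume "z \<in> ?S"
    then obtain x b where x: "x \<in> nilpotent_cone" "jordan_basis lam eps x b" "z = (marked_vector lam mu b, x)"
      by blast
    have "z \<in> K_orbit (marked_vector lam mu b, x)"
      unfolding K_orbit_def x(3) using id_K_group by (intro CollectI exI[of _ id]) simp
    then show "z \<in> Psi (lam, eps, mu)"
      unfolding Psi_def using x jordan_basis_imp[OF x(2)] by auto
  qed
qed

lemma Psi_eq_orbit:
  assumes lam: "is_partition lam" and mu: "\<And>i. mu i \<le> int (lam i)"
    and x: "x \<in> nilpotent_cone" and b: "jordan_basis lam eps x b"
  shows "Psi (lam, eps, mu) = K_orbit (marked_vector lam mu b, x)"
proof
  show "K_orbit (marked_vector lam mu b, x) \<subseteq> Psi (lam, eps, mu)"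
    unfolding Psi_def using x jordan_basis_imp[OF b] by auto
  show "Psi (lam, eps, mu) \<subseteq> K_orbit (marked_vector lam mu b, x)"
  proof
    fix z assume "z \<in> Psi (lam, eps, mu)"
    then obtain x' b' where x': "x' \<in> nilpotent_cone" "jordan_basis lam eps x' b'" "z = (marked_vector lam mu b', x')"
      unfolding Psi_eq[OF lam] by blast
    obtain k where k: "k \<in> K_group" "\<forall>i j. (i, j) \<in> diagram lam \<longrightarrow> k (b i j) = b' i j"
      "x' = k \<circ> x \<circ> inv_into UNIV k"
      using jordan_basis_conjugate[OF b x'(2) cone_lin[OF x] cone_lin[OF x'(1)]] by blast
    have mem: "(i, nat (mu i)) \<in> diagram lam" if "mu i > 0" for i
      using that mu[of i] by (auto simp: diagram_def)
    have "marked_vector lam mu b' = marked_vector lam mu (\<lambda>i j. k (b i j))"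
      unfolding marked_vector_def using k(2) mem by (intro sum.cong refl) auto
    also have "\<dots> = k (marked_vector lam mu b)"
      by (rule jordan_basis_transport(3)[OF b lam x k(1), symmetric])
    finally show "z \<in> K_orbit (marked_vector lam mu b, x)"
      unfolding K_orbit_def x'(3) using k(1,3) by (intro CollectI exI[of _ k]) simp
  qed
qed

text \<open>Equal signatures allow a matching of the boxes of each color with a basis of the
  component of that color; \<open>x\<close> is then the shift of boxes.\<close>

lemma exists_jordan_basis_type:
  assumes lam: "is_partition lam" and sig: "part_signature lam eps = space_signature"
  shows "\<exists>x\<in>nilpotent_cone. \<exists>b. jordan_basis lam eps x b"
proof -
  let ?D = "diagram lam"
  have fin: "finite ?D" by (rule finite_diagram[OF lam])
  obtain B0 B1 where B: "B0 \<subseteq> V 0" "B1 \<subseteq> V 1" "B0 \<inter> B1 = {}" "finite B0" "finite B1"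
    "card B0 = dim (V 0)" "card B1 = dim (V 1)" "independent (B0 \<union> B1)" "span (B0 \<union> B1) = UNIV"
    using exists_adapted_basis by blast
  define Dm where "Dm m = {p\<in>?D. (\<lambda>(i, j). box_color lam eps i j) p = m}" for m
  have cardD: "card (Dm m) = dim (V m)" for m
    using fun_cong[OF sig, of m]
    by (simp add: part_signature_def space_signature_def Dm_def case_prod_unfold)
  have finDm: "finite (Dm m)" for m using fin by (simp add: Dm_def)
  obtain f0 where f0: "bij_betw f0 (Dm 0) B0"
    using finite_same_card_bij[OF finDm B(4)] cardD[of 0] B(6) by auto
  obtain f1 where f1: "bij_betw f1 (Dm 1) B1"
    using finite_same_card_bij[OF finDm B(5)] cardD[of 1] B(7) by auto
  define f where "f p = (if p \<in> Dm 0 then f0 p else f1 p)" for p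
  have Dsplit: "?D = Dm 0 \<union> Dm 1" "Dm 0 \<inter> Dm 1 = {}"
    using bit_cases by (auto simp: Dm_def)
  have "bij_betw f (Dm 0) B0" using f0 by (rule bij_betw_cong[THEN iffD1, rotated]) (simp add: f_def)
  moreover have "bij_betw f (Dm 1) B1"
    using f1 by (rule bij_betw_cong[THEN iffD1, rotated]) (use Dsplit(2) in \<open>auto simp: f_def\<close>)
  ultimately have f: "bij_betw f ?D (B0 \<union> B1)"
    unfolding Dsplit(1) using B(3) by (rule bij_betw_combine)
  define b where "b i j = (if (i, j) \<in> ?D then f (i, j) else 0)" for i j
  have bf: "(\<lambda>(i, j). b i j) p = f p" if "p \<in> ?D" for p using that by (auto simp: b_def)
  have "inj_on (\<lambda>(i, j). b i j) ?D" "(\<lambda>(i, j). b i j) ` ?D = B0 \<union> B1"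
    using f bf by (auto simp: bij_betw_def inj_on_def image_iff)
  then have fb: "fbasis ?D (\<lambda>(i, j). b i j)"
    using fbasis_iff[OF fin] B by simp
  have color: "b i j \<in> V (box_color lam eps i j)" if "(i, j) \<in> ?D" for i j
  proof (cases "(i, j) \<in> Dm 0")
    case True
    then have "f (i, j) \<in> B0" using f0 by (auto simp: f_def bij_betw_def)
    then show ?thesis using B(1) True that by (auto simp: b_def Dm_def)
  next
    case False
    then have "(i, j) \<in> Dm 1" using Dsplit that by blast
    then have "f (i, j) \<in> B1" using f1 False by (auto simp: f_def bij_betw_def)
    then show ?thesis using B(2) \<open>(i, j) \<in> Dm 1\<close> that by (auto simp: b_def Dm_def)
  qed
  obtain x where x: "lin x" "\<forall>p\<in>?D. x ((\<lambda>(i, j). b i j) p) = (\<lambda>(i, j). b i (j - 1)) p"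
    using fbasis_extend[OF fb] by blast
  have step: "x (b i j) = b i (j - 1)" if "j \<le> lam i" for i j
  proof (cases "j = 0")
    case True
    then show ?thesis using lin_0[OF x(1)] by (simp add: b_def diagram_def)
  next
    case False
    then show ?thesis using x(2) that by (auto simp: diagram_def)
  qed
  have jb: "jordan_basis lam eps x b"
    unfolding jordan_basis_def using color step fb
    by (intro conjI) (simp_all add: diagram_def b_def[of _ 0])
  have "(x ^^ lam 0) u = 0" for u
  proof -
    obtain c where c: "u = (\<Sum>p\<in>?D. scale (c p) (case p of (i, j) \<Rightarrow> b i j))"
      using fbasis_expand[OF fb] by blast
    have "(x ^^ lam 0) (b i j) = 0" if "(i, j) \<in> ?D" for i j
    proof -
      have "lam i \<le> lam 0" using lam by (auto simp: is_partition_def antimono_def)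
      then show ?thesis using jordan_pow[OF jb, of j i "lam 0"] that jordan_basis_0[OF jb] by (simp add: diagram_def)
    qed
    then show ?thesis
      unfolding c lin_sum[OF lin_pow[OF x(1)]] lin_scale[OF lin_pow[OF x(1)]]
      by (intro sum.neutral) auto
  qed
  moreover have "x u \<in> V (m + 1)" if u: "u \<in> V m" for u m
  proof -
    obtain c where c: "u = (\<Sum>p\<in>?D. scale (c p) (case p of (i, j) \<Rightarrow> b i j))"
      using fbasis_expand[OF fb] by blast
    have c0: "c p = 0" if "p \<in> ?D" "(\<lambda>(i, j). box_color lam eps i j) p \<noteq> m" for p
      using u that color unfolding c
      by (intro homogeneous_coefficients[OF fb, of "\<lambda>(i, j). box_color lam eps i j" c m]) auto
    show ?thesis
      unfolding c lin_sum[OF x(1)] lin_scale[OF x(1)]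
    proof (rule V_setsum)
      fix p assume p: "p \<in> ?D"
      obtain i j where ij: "p = (i, j)" by (cases p)
      have j: "1 \<le> j" "j \<le> lam i" using p ij by (auto simp: diagram_def)
      show "scale (c p) (x (case p of (i, j) \<Rightarrow> b i j)) \<in> V (m + 1)"
      proof (cases "box_color lam eps i j = m \<and> j \<noteq> 1")
        case True
        then have "b i (j - 1) \<in> V (m + 1)"
          using color[of i "j - 1"] j box_color_pred[of j lam eps i] by (simp add: diagram_def) linarith
        then show ?thesis using step[OF j(2)] ij by (simp add: V_scale)
      next
        case False
        then have "c p = 0 \<or> x (b i j) = 0"
          using c0[OF p] ij step[OF j(2)] by (auto simp: b_def diagram_def)
        then show ?thesis using ij V_0 by auto
      qed
    qed
  qed
  from this[of _ 0] this[of _ 1] calculation have "x \<in> nilpotent_cone"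
    using x(1) by (auto simp: nilpotent_cone_def)
  then show ?thesis using jb by blast
qed

end

lemma bit_add_of_int_eq_iff: "(a :: bit) + of_int y = a + of_int z \<longleftrightarrow> even (y - z)"
  unfolding of_int_bit by (cases a; cases "even y"; cases "even z") simp_all

lemma box_color_eq_iff: "box_color lam eps i j = box_color lam eps i j' \<longleftrightarrow> even (int j' - int j)"
  unfolding box_color_def bit_add_of_int_eq_iff by simp

context two_colored_space
begin

section \<open>Existence of colored Jordan bases\<close>

text \<open>Only the component of \<open>w\<close> of color \<open>m + of_nat a\<close> reaches
  \<open>V m\<close>; the other one lands in the other color and must contribute zero. Homogeneous
  bottoms of chains therefore have homogeneous tops.\<close>

lemma cone_pow_preimage:
  assumes x: "x \<in> nilpotent_cone" and u: "(x ^^ a) w \<in> V m"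
  shows "\<exists>e. \<exists>w'\<in>V e. (x ^^ a) w' = (x ^^ a) w"
proof -
  let ?e = "m + of_nat a"
  obtain w' w'' where w: "w' \<in> V ?e" "w'' \<in> V (?e + 1)" "w = w' + w''" using V_decompose by blast
  have "(x ^^ a) w' \<in> V (?e + of_nat a)" "(x ^^ a) w'' \<in> V (?e + 1 + of_nat a)"
    using w by (intro cone_pow_color[OF x]; simp)+
  then have "(x ^^ a) w' \<in> V m" "(x ^^ a) w'' \<in> V (m + 1)"
    by (simp_all add: add.commute add.left_commute)
  moreover have "(x ^^ a) w = (x ^^ a) w' + (x ^^ a) w''"
    unfolding w(3) by (rule lin_add[OF lin_pow[OF cone_lin[OF x]]])
  ultimately have "(x ^^ a) w = (x ^^ a) w'" using V_unique(2)[OF u] by blast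
  then show ?thesis using w(1) by metis
qed

text \<open>Bottom vectors of Jordan chains: a basis of \<open>ker x\<close> adapted to its intersections with the
  images of the powers of \<open>x\<close>, built from the deepest image upwards.\<close>

lemma exists_bottoms:
  assumes x: "x \<in> nilpotent_cone"
  shows "\<exists>S ht. finite S \<and> independent S \<and>
    (\<forall>u\<in>S. (u \<in> V 0 \<or> u \<in> V 1) \<and> x u = 0 \<and> 1 \<le> ht u \<and> (\<exists>w. u = (x ^^ (ht u - 1)) w)) \<and>
    (\<forall>k u w. (u \<in> V 0 \<or> u \<in> V 1) \<longrightarrow> x u = 0 \<longrightarrow> u = (x ^^ k) w \<longrightarrow> u \<in> span {u\<in>S. k + 1 \<le> ht u})"
proof -
  obtain n where n: "\<And>u. (x ^^ n) u = 0" using x by (auto simp: nilpotent_cone_def)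
  have lx: "lin x" by (rule cone_lin[OF x])
  define H where "H k = {u. (u \<in> V 0 \<or> u \<in> V 1) \<and> x u = 0 \<and> (\<exists>w. u = (x ^^ k) w)}" for k
  have anti: "H k \<subseteq> H l" if "l \<le> k" for k l
  proof
    fix u assume "u \<in> H k"
    then obtain w where w: "u \<in> V 0 \<or> u \<in> V 1" "x u = 0" "u = (x ^^ k) w" by (auto simp: H_def)
    have "(x ^^ k) w = (x ^^ l) ((x ^^ (k - l)) w)"
      using that funpow_add[of l "k - l" x] by simp
    then show "u \<in> H l" using w by (auto simp: H_def)
  qed
  \<comment> \<open>Descending induction on the exponent \<open>n - d\<close>, starting at
    \<open>n\<close> where the image is zero. Vectors added at the exponent \<open>n - Suc d\<close>
    get the height \<open>n - d\<close>, one more than the exponent, since the bottom of a chain of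
    length h is an image under the power h - 1.\<close>
  have "\<exists>S ht. independent S \<and> (\<forall>u\<in>S. n - d + 1 \<le> ht u \<and> u \<in> H (ht u - 1)) \<and>
    (\<forall>k\<ge>n - d. H k \<subseteq> span {u\<in>S. k + 1 \<le> ht u})" if "d \<le> n" for d
    using that
  proof (induction d)
    case 0
    have "H k \<subseteq> span {}" if "n \<le> k" for k
      using anti[OF that] n by (auto simp: H_def)
    then show ?case
      by (intro exI[of _ "{}"] exI[of _ "\<lambda>_. 0"]) (simp add: independent_empty)
  next
    case (Suc d)
    then obtain S ht where S: "independent S" "\<And>u. u \<in> S \<Longrightarrow> n - d + 1 \<le> ht u" "\<And>u. u \<in> S \<Longrightarrow> u \<in> H (ht u - 1)"
      "\<And>k. n - d \<le> k \<Longrightarrow> H k \<subseteq> span {u\<in>S. k + 1 \<le> ht u}" by auto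
    let ?a = "n - Suc d"
    have SH: "S \<subseteq> H ?a"
    proof
      fix u assume u: "u \<in> S"
      have "?a \<le> ht u - 1" using S(2)[OF u] by linarith
      then show "u \<in> H ?a" using S(3)[OF u] anti by blast
    qed
    obtain S' where S': "S \<subseteq> S'" "S' \<subseteq> H ?a" "independent S'" "H ?a \<subseteq> span S'"
      using maximal_independent_subset_extend[OF SH S(1)] by blast
    define ht' where "ht' u = (if u \<in> S then ht u else n - d)" for u
    have nd: "n - d = ?a + 1" using Suc.prems by simp
    have "?a + 1 \<le> ht' u \<and> u \<in> H (ht' u - 1)" if "u \<in> S'" for u
      using that S(2,3) S'(2) nd by (cases "u \<in> S") (fastforce simp: ht'_def)+
    moreover have "H k \<subseteq> span {u\<in>S'. k + 1 \<le> ht' u}" if k: "?a \<le> k" for k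
    proof (cases "k = ?a")
      case True
      have "{u\<in>S'. k + 1 \<le> ht' u} = S'" using calculation True by auto
      then show ?thesis using S'(4) True by simp
    next
      case False
      then have "H k \<subseteq> span {u\<in>S. k + 1 \<le> ht u}" using S(4) k nd by simp
      also have "\<dots> \<subseteq> span {u\<in>S'. k + 1 \<le> ht' u}"
        using S'(1) by (intro span_mono) (auto simp: ht'_def)
      finally show ?thesis .
    qed
    ultimately show ?case using S'(3) by blast
  qed
  from this[of n] obtain S ht where S: "independent S" "\<forall>u\<in>S. 1 \<le> ht u \<and> u \<in> H (ht u - 1)"
    "\<forall>k. H k \<subseteq> span {u\<in>S. k + 1 \<le> ht u}" by auto
  show ?thesis
    using S finiteI_independent[OF S(1)] by (intro exI[of _ S] exI[of _ ht]) (auto simp: H_def)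
qed

lemma exists_sorted_enumeration:
  fixes ht :: "'x \<Rightarrow> nat"
  assumes "finite S"
  shows "\<exists>f. bij_betw f {..<card S} S \<and> (\<forall>i j. i \<le> j \<longrightarrow> j < card S \<longrightarrow> ht (f j) \<le> ht (f i))"
proof -
  obtain xs where xs: "set xs = S" "distinct xs" using finite_distinct_list[OF assms] by blast
  define zs where "zs = sort_key ht xs"
  have zs: "set zs = S" "distinct zs" using xs by (simp_all add: zs_def)
  have sorted: "sorted (map ht zs)" unfolding zs_def by (rule sorted_sort_key)
  have len: "length zs = card S" using distinct_card[OF zs(2)] zs(1) by simp
  define ys where "ys = rev zs"
  have ys: "set ys = S" "distinct ys" "length ys = card S" using zs len by (simp_all add: ys_def)
  have "ht (ys ! j) \<le> ht (ys ! i)" if ij: "i \<le> j" "j < card S" for i j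
  proof -
    have lt: "length zs - Suc j \<le> length zs - Suc i" "length zs - Suc i < length zs"
      "length zs - Suc j < length zs" "i < length zs" "j < length zs"
      using ij len by simp_all
    have "map ht zs ! (length zs - Suc j) \<le> map ht zs ! (length zs - Suc i)"
      by (rule sorted_nth_mono[OF sorted lt(1)]) (simp only: length_map lt(2))
    then show ?thesis
      unfolding ys_def rev_nth[OF lt(4)] rev_nth[OF lt(5)] nth_map[OF lt(2)] nth_map[OF lt(3)] .
  qed
  moreover have "bij_betw ((!) ys) {..<card S} S"
    by (rule bij_betw_nth) (simp_all only: ys)
  ultimately show ?thesis by blast
qed

text \<open>The rows are the bottom vectors sorted by decreasing height, and each chain is generated
  by a homogeneous preimage of its bottom. Independence is inherited from the bottoms; spanning uses
  that the bottoms are adapted to the images of the powers of \<open>x\<close>.\<close>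

lemma exists_jordan_basis:
  assumes x: "x \<in> nilpotent_cone"
  shows "\<exists>lam eps b. is_colored_partition lam eps \<and> jordan_basis lam eps x b"
proof -
  have lx: "lin x" by (rule cone_lin[OF x])
  obtain n where n: "\<And>u. (x ^^ n) u = 0" using x by (auto simp: nilpotent_cone_def)
  obtain S ht where S12: "finite S" "independent S"
    and S3: "\<forall>u\<in>S. (u \<in> V 0 \<or> u \<in> V 1) \<and> x u = 0 \<and> 1 \<le> ht u \<and> (\<exists>w. u = (x ^^ (ht u - 1)) w)"
    and S4: "\<forall>k u w. (u \<in> V 0 \<or> u \<in> V 1) \<longrightarrow> x u = 0 \<longrightarrow> u = (x ^^ k) w \<longrightarrow> u \<in> span {u\<in>S. k + 1 \<le> ht u}"
    using exists_bottoms[OF x] by (elim exE conjE) (rule that)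
  note S = S12 S3[rule_format] S4[rule_format]
  define r where "r = card S"
  obtain f where f: "bij_betw f {..<r} S" and f_anti: "\<And>i j. i \<le> j \<Longrightarrow> j < r \<Longrightarrow> ht (f j) \<le> ht (f i)"
    using exists_sorted_enumeration[OF S(1), of ht] unfolding r_def by blast
  have fS: "f i \<in> S" if "i < r" for i using f that by (auto simp: bij_betw_def)
  define lam where "lam i = (if i < r then ht (f i) else 0)" for i
  have lam_pos: "lam i > 0 \<longleftrightarrow> i < r" for i
    using S(3)[OF fS, of i] by (auto simp: lam_def)
  have part: "is_partition lam"
    unfolding is_partition_def
  proof
    show "antimono lam" by (rule antimonoI) (use f_anti in \<open>auto simp: lam_def\<close>)
    show "\<exists>N. \<forall>i\<ge>N. lam i = 0" by (intro exI[of _ r]) (simp add: lam_def)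
  qed
  have len: "part_length lam = r"
  proof -
    have "{i. lam i > 0} = {..<r}" using lam_pos by auto
    then show ?thesis by (simp add: part_length_def)
  qed
  have "\<exists>e. \<exists>w\<in>V e. (x ^^ (lam i - 1)) w = f i" if i: "i < r" for i
  proof -
    obtain w m where "f i = (x ^^ (ht (f i) - 1)) w" "f i \<in> V m" using bspec[OF S3 fS[OF i]] by blast
    then show ?thesis
      using cone_pow_preimage[OF x, of "ht (f i) - 1" w m] i by (simp add: lam_def)
  qed
  then obtain e w where ew: "\<And>i. i < r \<Longrightarrow> w i \<in> V (e i)" "\<And>i. i < r \<Longrightarrow> (x ^^ (lam i - 1)) (w i) = f i"
    by metis
  \<comment> \<open>On the empty rows the color is the parity of the index, so that each color
    occurs infinitely often.\<close>
  define eps where "eps i = (if i < r then e i else of_int (int i))" for i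
  have "infinite {i. eps i = m}" for m
    unfolding infinite_nat_iff_unbounded_le
  proof
    fix k
    define i where "i = 2 * (k + r) + (if m = 0 then 0 else 1)"
    have "of_int (int i) = m" unfolding of_int_bit using bit_cases[of m] by (auto simp: i_def)
    moreover have "r \<le> i" "k \<le> i" by (simp_all add: i_def)
    ultimately show "\<exists>i\<ge>k. i \<in> {i. eps i = m}" by (intro exI[of _ i]) (simp add: eps_def)
  qed
  then have colored: "is_colored_partition lam eps" using part by (simp add: is_colored_partition_def)
  define b where "b i j = (if j = 0 \<or> r \<le> i then 0 else (x ^^ (lam i - j)) (w i))" for i j
  have b1: "b i 1 = f i" if "i < r" for i using ew(2)[OF that] that by (simp add: b_def)
  have step: "x (b i j) = b i (j - 1)" if j: "j \<le> lam i" for i j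
  proof (cases "j = 0 \<or> r \<le> i")
    case True
    then show ?thesis using lin_0[OF lx] j by (auto simp: b_def)
  next
    case False
    show ?thesis
    proof (cases "j = 1")
      case True
      then show ?thesis using b1[of i] S(3)[OF fS, of i] False by (simp add: b_def)
    next
      case j1: False
      have "lam i - (j - 1) = Suc (lam i - j)" using False j1 j by linarith
      then show ?thesis using False j1 by (simp add: b_def)
    qed
  qed
  have color: "b i j \<in> V (box_color lam eps i j)" if j: "1 \<le> j" "j \<le> lam i" for i j
  proof -
    have i: "i < r" using j lam_pos[of i] by linarith
    have "(x ^^ (lam i - j)) (w i) \<in> V (e i + of_nat (lam i - j))"
      by (rule cone_pow_color[OF x ew(1)[OF i]])
    moreover have "box_color lam eps i j = e i + of_nat (lam i - j)"
      using i j by (simp add: box_color_def eps_def of_nat_diff)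
    ultimately show ?thesis using i j by (simp add: b_def)
  qed
  have pow: "(x ^^ a) (b i j) = b i (j - a)" if "j \<le> lam i" for a i j
  proof (induction a)
    case (Suc a)
    then show ?case using step[of "j - a" i] that by simp
  qed simp
  have indep_f: "inj_on f {..<r}" "independent (f ` {..<r})" using f S(2) by (auto simp: bij_betw_def)
  have "\<forall>c. (\<Sum>p\<in>diagram lam. scale (c p) (case p of (i, j) \<Rightarrow> b i j)) = 0 \<longrightarrow> (\<forall>p\<in>diagram lam. c p = 0)"
  proof (intro allI impI)
    fix c assume c: "(\<Sum>p\<in>diagram lam. scale (c p) (case p of (i, j) \<Rightarrow> b i j)) = 0"
    show "\<forall>p\<in>diagram lam. c p = 0"
    proof (rule chain_independent[OF part lx _ step _ c])
      show "b i 0 = 0" for i by (simp add: b_def)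
      fix d assume d: "(\<Sum>i<part_length lam. scale (d i) (b i 1)) = 0"
      have "(\<Sum>i<r. scale (d i) (f i)) = (\<Sum>i<part_length lam. scale (d i) (b i 1))"
        unfolding len using b1 by (intro sum.cong) auto
      then show "\<forall>i<part_length lam. d i = 0"
        using independent_family[of "{..<r}" f] indep_f d len by auto
    qed
  qed
  \<comment> \<open>Induction on the power that kills \<open>u\<close>. If the power
    \<open>Suc k\<close> kills a homogeneous \<open>t\<close>, then \<open>(x ^^ k) t\<close> lies
    in the kernel and in the image of \<open>x ^^ k\<close>, so it is a combination of bottoms of
    rows longer than \<open>k\<close>. The same combination of the boxes \<open>k + 1\<close> of
    these rows differs from \<open>t\<close> by a vector killed by \<open>x ^^ k\<close>.\<close>
  moreover have span: "u \<in> span ((\<lambda>(i, j). b i j) ` diagram lam)" if "(x ^^ k) u = 0" for k u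
    using that
  proof (induction k arbitrary: u)
    case 0
    then show ?case by (simp add: span_zero)
  next
    case (Suc k)
    let ?W = "span ((\<lambda>(i, j). b i j) ` diagram lam)"
    have hom: "t \<in> ?W" if t: "t \<in> V m" "(x ^^ Suc k) t = 0" for t m
    proof -
      have "(x ^^ k) t \<in> V (m + of_nat k)" by (rule cone_pow_color[OF x t(1)])
      then have h: "(x ^^ k) t \<in> V 0 \<or> (x ^^ k) t \<in> V 1"
        using bit_cases[of "m + of_nat k"] by auto
      have "(x ^^ k) t \<in> span {u\<in>S. k + 1 \<le> ht u}"
        using S(4)[OF h _ refl] t(2) by simp
      moreover have "{u\<in>S. k + 1 \<le> ht u} = f ` {i. i < r \<and> k + 1 \<le> lam i}"
        using f by (auto simp: bij_betw_def lam_def)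
      ultimately have "(x ^^ k) t \<in> span (f ` {i. i < r \<and> k + 1 \<le> lam i})" by simp
      then obtain d where d: "(x ^^ k) t = (\<Sum>i\<in>{i. i < r \<and> k + 1 \<le> lam i}. scale (d i) (f i))"
        using span_family[of "{i. i < r \<and> k + 1 \<le> lam i}" "(x ^^ k) t" f] by auto
      define t' where "t' = (\<Sum>i\<in>{i. i < r \<and> k + 1 \<le> lam i}. scale (d i) (b i (k + 1)))"
      have "(x ^^ k) t' = (\<Sum>i\<in>{i. i < r \<and> k + 1 \<le> lam i}. scale (d i) (f i))"
        unfolding t'_def lin_sum[OF lin_pow[OF lx]] lin_scale[OF lin_pow[OF lx]]
        by (intro sum.cong refl) (use pow b1 in auto)
      then have "(x ^^ k) (t - t') = 0" using d lin_diff[OF lin_pow[OF lx]] by simp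
      then have "t - t' \<in> ?W" by (rule Suc.IH)
      moreover have "t' \<in> ?W"
        unfolding t'_def
      proof (intro span_sum span_scale span_base)
        fix i assume "i \<in> {i. i < r \<and> k + 1 \<le> lam i}"
        then show "b i (k + 1) \<in> (\<lambda>(i, j). b i j) ` diagram lam"
          by (intro image_eqI[of _ _ "(i, k + 1)"]) (auto simp: diagram_def)
      qed
      ultimately have "(t - t') + t' \<in> ?W" by (rule span_add)
      then show ?thesis by simp
    qed
    obtain u0 u1 where u: "u0 \<in> V 0" "u1 \<in> V (0 + 1)" "u = u0 + u1" using V_decompose by blast
    have "(x ^^ Suc k) u = (x ^^ Suc k) u0 + (x ^^ Suc k) u1"
      unfolding u(3) by (rule lin_add[OF lin_pow[OF lx]])
    then have z: "0 = (x ^^ Suc k) u0 + (x ^^ Suc k) u1" using Suc.prems by metis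
    have "(x ^^ Suc k) u0 \<in> V (0 + of_nat (Suc k))" by (rule cone_pow_color[OF x u(1)])
    moreover have "(x ^^ Suc k) u1 \<in> V (0 + of_nat (Suc k) + 1)"
      using cone_pow_color[OF x u(2), of "Suc k"] by (simp only: add_ac)
    ultimately have "(x ^^ Suc k) u1 = 0" "0 = (x ^^ Suc k) u0"
      using V_unique[OF V_0 _ _ z] by blast+
    then have "u0 \<in> ?W" "u1 \<in> ?W" using hom[OF u(1)] hom[OF u(2)] by simp_all
    then show ?case unfolding u(3) by (rule span_add)
  qed
  ultimately have "fbasis (diagram lam) (\<lambda>(i, j). b i j)"
    using span_family[OF finite_diagram[OF part]] finite_diagram[OF part] n unfolding fbasis_def by blast
  then have "jordan_basis lam eps x b"
    unfolding jordan_basis_def using step color by (simp add: b_def[of _ 0])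
  with colored show ?thesis by (intro exI conjI)
qed

section \<open>Normal form of a vector\<close>

text \<open>\<open>m i\<close> is the highest box of row \<open>i\<close> that occurs in the vector with coordinates \<open>c\<close>, with
  a value in \<open>{0, -1}\<close> of the appropriate parity for rows that do not occur.\<close>

definition profile :: "(nat \<Rightarrow> nat) \<Rightarrow> (nat \<Rightarrow> bit) \<Rightarrow> bit \<Rightarrow> (nat \<times> nat \<Rightarrow> 'a) \<Rightarrow> (nat \<Rightarrow> int) \<Rightarrow> bool" where
  "profile lam eps c0 c m \<longleftrightarrow> (\<forall>i j. 1 \<le> j \<and> j \<le> lam i \<and> c (i, j) \<noteq> 0 \<longrightarrow> int j \<le> m i) \<and>
     (\<forall>i. 0 < m i \<longrightarrow> c (i, nat (m i)) \<noteq> 0) \<and>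
     (\<forall>i. - 2 < m i \<and> m i \<le> int (lam i) \<and> eps i + of_int (int (lam i) - m i) = c0)"

lemma profile_exists:
  assumes "\<And>i j. 1 \<le> j \<Longrightarrow> j \<le> lam i \<Longrightarrow> c (i, j) \<noteq> 0 \<Longrightarrow> box_color lam eps i j = c0"
  shows "\<exists>m. profile lam eps c0 c m"
proof -
  have "\<exists>mi. (\<forall>j. 1 \<le> j \<and> j \<le> lam i \<and> c (i, j) \<noteq> 0 \<longrightarrow> int j \<le> mi) \<and> (0 < mi \<longrightarrow> c (i, nat mi) \<noteq> 0) \<and>
     - 2 < mi \<and> mi \<le> int (lam i) \<and> eps i + of_int (int (lam i) - mi) = c0" for i
  proof -
    define J where "J = {j. 1 \<le> j \<and> j \<le> lam i \<and> c (i, j) \<noteq> 0}"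
    have fin: "finite J" by (rule finite_subset[of _ "{..lam i}"]) (auto simp: J_def)
    show ?thesis
    proof (cases "J = {}")
      case True
      define mi :: int where "mi = (if eps i + of_int (int (lam i)) = c0 then 0 else - 1)"
      have "eps i + of_int (int (lam i) - mi) = c0"
      proof (cases "eps i + of_int (int (lam i)) = c0")
        case False
        then have "eps i + of_int (int (lam i)) = c0 + 1" by (simp only: bit_neq_iff)
        moreover have "eps i + of_int (int (lam i) - mi) = eps i + of_int (int (lam i)) + 1"
          using False by (simp only: mi_def if_False diff_minus_eq_add of_int_add of_int_1 add.assoc)
        ultimately show ?thesis by (simp add: add.assoc)
      qed (simp add: mi_def)
      then show ?thesis using True by (intro exI[of _ mi]) (auto simp: J_def mi_def)
    next
      case False
      have "Max J \<in> J" by (rule Max_in[OF fin False])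
      then have M: "1 \<le> Max J" "Max J \<le> lam i" "c (i, Max J) \<noteq> 0" by (auto simp: J_def)
      have "int j \<le> int (Max J)" if "1 \<le> j" "j \<le> lam i" "c (i, j) \<noteq> 0" for j
        using Max_ge[OF fin, of j] that by (simp add: J_def)
      then show ?thesis
        using M assms[OF M] unfolding box_color_def by (intro exI[of _ "int (Max J)"]) auto
    qed
  qed
  then obtain m where "\<And>i. (\<forall>j. 1 \<le> j \<and> j \<le> lam i \<and> c (i, j) \<noteq> 0 \<longrightarrow> int j \<le> m i) \<and>
     (0 < m i \<longrightarrow> c (i, nat (m i)) \<noteq> 0) \<and>
     - 2 < m i \<and> m i \<le> int (lam i) \<and> eps i + of_int (int (lam i) - m i) = c0" by metis
  then show ?thesis unfolding profile_def by blast
qed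

lemma jordan_coefficient_color:
  assumes "jordan_basis lam eps x b" "(\<Sum>p\<in>diagram lam. scale (c p) (case p of (i, j) \<Rightarrow> b i j)) \<in> V c0"
    "1 \<le> j" "j \<le> lam i" "c (i, j) \<noteq> 0"
  shows "box_color lam eps i j = c0"
proof (rule ccontr)
  assume "\<not> ?thesis"
  then have "c (i, j) = 0"
    using assms(2-4) jordan_basis_color[OF assms(1)]
    by (intro homogeneous_coefficients[OF jordan_basis_fbasis[OF assms(1)], of "\<lambda>(i, j). box_color lam eps i j" c c0])
      (auto simp: diagram_def)
  then show False using assms(5) by simp
qed

text \<open>If \<open>m k + 2 \<le> m i\<close> and \<open>nu i + 2 \<le> nu k\<close>, subtracting a shift of row \<open>k\<close> from row \<open>i\<close> makes the
  box \<open>m k + 2\<close> occur in row \<open>k\<close>.\<close>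

lemma profile_improve:
  assumes b: "jordan_basis lam eps x b" and lam: "is_partition lam" and x: "lin x"
    and v: "v = (\<Sum>p\<in>diagram lam. scale (c p) (case p of (i, j) \<Rightarrow> b i j))" "v \<in> V c0"
    and m: "profile lam eps c0 c m"
    and ik: "m k + 2 \<le> m i" "int (lam i) - m i + 2 \<le> int (lam k) - m k"
  shows "\<exists>b' c' m'. jordan_basis lam eps x b' \<and>
    v = (\<Sum>p\<in>diagram lam. scale (c' p) (case p of (i, j) \<Rightarrow> b' i j)) \<and> profile lam eps c0 c' m' \<and>
    (\<forall>p. m p \<le> m' p) \<and> m k < m' k \<and> k < part_length lam"
proof -
  have mD: "\<And>i j. 1 \<le> j \<Longrightarrow> j \<le> lam i \<Longrightarrow> c (i, j) \<noteq> 0 \<Longrightarrow> int j \<le> m i"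
    "\<And>i. 0 < m i \<Longrightarrow> c (i, nat (m i)) \<noteq> 0" "\<And>i. - 2 < m i" "\<And>i. m i \<le> int (lam i)"
    "\<And>i. eps i + of_int (int (lam i) - m i) = c0"
    using m unfolding profile_def by blast+
  have mi: "1 \<le> m i" "i \<noteq> k" using ik(1) mD(3)[of k] by auto
  have lens: "i < part_length lam" "k < part_length lam"
  proof -
    have "0 < lam i" "0 < lam k" using mi mD(3)[of k] mD(4)[of i] ik by linarith+
    then show "i < part_length lam" "k < part_length lam" using partition_support[OF lam] by auto
  qed
  \<comment> \<open>The shift that carries box \<open>m i\<close> of row \<open>i\<close> to box
    \<open>m k + 2\<close> of row \<open>k\<close>. The second inequality in \<open>ik\<close> says
    that row \<open>i\<close> shifted down by \<open>s\<close> fits into row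
    \<open>k\<close>.\<close>
  define s where "s = nat (m i - m k - 2)"
  have s: "int s = m i - m k - 2" using ik(1) by (simp add: s_def)
  have range: "j - s \<le> lam k" if "j \<le> lam i" for j
    using that s ik(2) by linarith
  have b0: "b p 0 = 0" for p by (rule jordan_basis_0[OF b])
  define b' where "b' p j = (if p = i then b i j - b k (j - s) else b p j)" for p j
  \<comment> \<open>Since \<open>v\<close> stays fixed, the terms subtracted from row
    \<open>i\<close> of the basis reappear as coefficients \<open>c (i, j + s)\<close> at the boxes
    of row \<open>k\<close>.\<close>
  define c' where "c' = (\<lambda>(p, j). if p = k then c (k, j) + (if j + s \<le> lam i then c (i, j + s) else 0) else c (p, j))"
  have jb: "jordan_basis lam eps x b'"
  proof (rule jordan_basis_change[OF b lam x])
    show "b' p 0 = 0" for p by (simp add: b'_def b0)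
    show "b' p j \<in> V (box_color lam eps p j)" if j: "1 \<le> j" "j \<le> lam p" for p j
    proof (cases "p = i")
      case True
      have "b k (j - s) \<in> V (box_color lam eps i j)"
      proof (cases "j \<le> s")
        case False
        have "int (lam k) - int (j - s) = (int (lam k) - m k) + (m i - int j - 2)" using s False by simp
        then have "box_color lam eps k (j - s) = c0 + of_int (m i - int j - 2)"
          by (simp only: box_color_def of_int_add add.assoc[symmetric] mD(5))
        moreover have "int (lam i) - int j = (int (lam i) - m i) + (m i - int j)" by simp
        then have "box_color lam eps i j = c0 + of_int (m i - int j)"
          by (simp only: box_color_def of_int_add add.assoc[symmetric] mD(5))
        ultimately have "box_color lam eps k (j - s) = box_color lam eps i j"
          by (simp only: bit_add_of_int_eq_iff) simp
        then show ?thesis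
          using jordan_basis_color[OF b, of "j - s" k] range[of j] j True False by simp
      qed (simp add: b0 V_0)
      then show ?thesis using jordan_basis_color[OF b j] True by (simp add: b'_def V_diff)
    qed (simp add: b'_def jordan_basis_color[OF b j])
    show "x (b' p j) = b' p (j - 1)" if j: "j \<le> lam p" for p j
    proof (cases "p = i")
      case True
      then show ?thesis
        using jordan_basis_step[OF b j] jordan_basis_step[OF b range[of j]] j
        by (simp add: b'_def lin_diff[OF x] diff_commute)
    qed (simp add: b'_def jordan_basis_step[OF b j])
    fix d assume d: "(\<Sum>p<part_length lam. scale (d p) (b' p 1)) = 0"
    \<comment> \<open>The bottom boxes are altered only for \<open>s = 0\<close>, when the bottom of
      row \<open>k\<close> is subtracted from that of row \<open>i\<close>.\<close>
    define d' where "d' p = d p - (if p = k \<and> s = 0 then d i else 0)" for p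
    have "(\<Sum>p<part_length lam. scale (d' p) (b p 1)) =
        (\<Sum>p<part_length lam. scale (d p) (b p 1)) - (\<Sum>p<part_length lam. if p = k then scale (if s = 0 then d i else 0) (b k 1) else 0)"
      unfolding sum_subtractf[symmetric] by (intro sum.cong refl) (auto simp: d'_def scale_left_diff_distrib)
    also have "\<dots> = (\<Sum>p<part_length lam. scale (d p) (b p 1)) - (\<Sum>p<part_length lam. if p = i then scale (d i) (b k (1 - s)) else 0)"
      using lens by (auto simp: b0)
    also have "\<dots> = (\<Sum>p<part_length lam. scale (d p) (b' p 1))"
      unfolding sum_subtractf[symmetric] by (intro sum.cong refl) (auto simp: b'_def scale_right_diff_distrib)
    finally have "\<forall>p<part_length lam. d' p = 0"
      using jordan_bottom[OF b lam] d by simp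
    then have d'0: "d' p = 0" if "p < part_length lam" for p using that by blast
    have "d i = 0" using d'0[OF lens(1)] mi(2) by (simp add: d'_def)
    then show "\<forall>p<part_length lam. d p = 0" using d'0 by (auto simp: d'_def split: if_splits)
  qed
  have v': "v = (\<Sum>p\<in>diagram lam. scale (c' p) (case p of (i, j) \<Rightarrow> b' i j))"
  proof -
    define E where "E = (\<Sum>j = 1..lam i. scale (c (i, j)) (b k (j - s)))"
    have row_k: "(\<Sum>j = 1..lam k. scale (if j + s \<le> lam i then c (i, j + s) else 0) (b k j)) = E"
    proof -
      have "E = (\<Sum>j\<in>{j\<in>{1..lam i}. s < j}. scale (c (i, j)) (b k (j - s)))"
        unfolding E_def
      proof (rule sum.mono_neutral_right)
        show "\<forall>j\<in>{1..lam i} - {j\<in>{1..lam i}. s < j}. scale (c (i, j)) (b k (j - s)) = 0"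
        proof
          fix j assume "j \<in> {1..lam i} - {j\<in>{1..lam i}. s < j}"
          then have "j - s = 0" by auto
          then show "scale (c (i, j)) (b k (j - s)) = 0" by (simp add: b0)
        qed
      qed auto
      also have "\<dots> = (\<Sum>j\<in>{j\<in>{1..lam k}. j + s \<le> lam i}. scale (c (i, j + s)) (b k j))"
        using range by (intro sum.reindex_bij_witness[of _ "\<lambda>j. j + s" "\<lambda>j. j - s"]) auto
      also have "\<dots> = (\<Sum>j = 1..lam k. scale (if j + s \<le> lam i then c (i, j + s) else 0) (b k j))"
        by (intro sum.mono_neutral_cong_left) auto
      finally show ?thesis by simp
    qed
    have "(\<Sum>j = 1..lam p. scale (c' (p, j)) (b' p j)) =
        (\<Sum>j = 1..lam p. scale (c (p, j)) (b p j)) + (if p = k then E else 0) - (if p = i then E else 0)" for p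
    proof -
      consider "p = i" | "p = k" | "p \<noteq> i" "p \<noteq> k" by blast
      then show ?thesis
      proof cases
        case 1
        then show ?thesis
          using mi(2) by (simp add: c'_def b'_def E_def scale_right_diff_distrib sum_subtractf)
      next
        case 2
        then have "(\<Sum>j = 1..lam p. scale (c' (p, j)) (b' p j)) = (\<Sum>j = 1..lam k. scale (c (k, j)) (b k j)
          + scale (if j + s \<le> lam i then c (i, j + s) else 0) (b k j))"
          using mi(2) by (intro sum.cong) (auto simp: c'_def b'_def scale_left_distrib)
        then show ?thesis using 2 mi(2) row_k by (simp add: sum.distrib)
      next
        case 3
        then show ?thesis by (simp add: c'_def b'_def)
      qed
    qed
    then show ?thesis
      unfolding v(1) sum_diagram_rows[OF lam] using lens
      by (simp add: sum.distrib sum_subtractf)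
  qed
  have "(\<Sum>p\<in>diagram lam. scale (c' p) (case p of (i, j) \<Rightarrow> b' i j)) \<in> V c0"
    using v(2) v' by simp
  then have "box_color lam eps p j = c0" if "1 \<le> j" "j \<le> lam p" "c' (p, j) \<noteq> 0" for p j
    using jordan_coefficient_color[OF jb] that by blast
  then obtain m' where m': "profile lam eps c0 c' m'" using profile_exists by blast
  have m'D: "\<And>i j. 1 \<le> j \<Longrightarrow> j \<le> lam i \<Longrightarrow> c' (i, j) \<noteq> 0 \<Longrightarrow> int j \<le> m' i"
    "\<And>i. - 2 < m' i" "\<And>i. eps i + of_int (int (lam i) - m' i) = c0"
    using m' unfolding profile_def by blast+
  have "m k + 2 \<le> m' k"
  proof -
    define j where "j = nat (m k + 2)"
    have j: "int j = m k + 2" "1 \<le> j" using mD(3)[of k] by (simp_all add: j_def)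
    have "j \<le> lam k" using ik j(1) mD(4)[of i] by linarith
    have js: "j + s = nat (m i)" using j(1) s mi by linarith
    have "c (k, j) = 0" using mD(1)[OF j(2) \<open>j \<le> lam k\<close>] j(1) by fastforce
    moreover have "j + s \<le> lam i" using js mD(4)[of i] by linarith
    moreover have "c (i, nat (m i)) \<noteq> 0" using mD(2)[of i] mi by simp
    ultimately have "c' (k, j) \<noteq> 0" by (simp add: c'_def js)
    then show ?thesis using m'D(1)[OF j(2) \<open>j \<le> lam k\<close>] j(1) by simp
  qed
  moreover have "m p \<le> m' p" if "p \<noteq> k" for p
  proof (cases "0 < m p")
    case True
    then have "c' (p, nat (m p)) \<noteq> 0" using mD(2) that by (simp add: c'_def)
    then show ?thesis using m'D(1)[of "nat (m p)" p] mD(4)[of p] True by simp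
  next
    case False
    \<comment> \<open>A nonpositive mark is 0 or -1, and the color fixes its parity; so passing to
      \<open>m'\<close> cannot lower it.\<close>
    have "even ((int (lam p) - m p) - (int (lam p) - m' p))"
      using mD(5)[of p] m'D(3)[of p] bit_add_of_int_eq_iff[of "eps p"] by metis
    then have "even (m' p - m p)" by simp
    then show ?thesis using False mD(3)[of p] m'D(2)[of p] by presburger
  qed
  ultimately have "m p \<le> m' p" for p by (cases "p = k") auto
  then show ?thesis using jb v' m' \<open>m k + 2 \<le> m' k\<close> lens(2) by (intro exI[of _ b'] exI[of _ c'] exI[of _ m']) auto
qed

end

text \<open>The inequality for \<open>mu\<close> when \<open>k < i\<close>, and the one for
  \<open>nu\<close> when \<open>i < k\<close>, give \<open>p \<le> mu k + 1\<close>. The common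
  color makes \<open>mu k - p\<close> even, which excludes equality.\<close>

lemma signed_dominate:
  fixes lam :: "nat \<Rightarrow> nat" and mu :: "nat \<Rightarrow> int"
  assumes signed: "(lam, eps, mu) \<in> signed_2_bipartitions f"
    and i: "0 < mu i" "1 \<le> p" "int p + (int (lam i) - mu i) \<le> int (lam i)"
    "int p + (int (lam i) - mu i) \<le> int (lam k)"
    "eps k + of_int (int (lam k) - (int p + (int (lam i) - mu i))) = eps i"
  shows "int p \<le> mu k \<and> even (mu k - int p)"
proof -
  have mono: "\<And>i j. i < j \<Longrightarrow> mu j < mu i + 2 \<and> int (lam j) - mu j < int (lam i) - mu i + 2"
    and color: "\<And>i j. eps i + of_int (int (lam i) - mu i) = eps j + of_int (int (lam j) - mu j)"
    using signed by (auto simp: signed_2_bipartitions_def Let_def)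
  have "eps k + of_int (int (lam k) - mu k)
      = eps k + of_int (int (lam k) - (int p + (int (lam i) - mu i))) + of_int (int (lam i) - mu i)"
    unfolding i(5) by (rule color)
  also have "\<dots> = eps k + of_int ((int (lam k) - (int p + (int (lam i) - mu i))) + (int (lam i) - mu i))"
    by (simp only: of_int_add add.assoc)
  finally have "even ((int (lam k) - mu k) - ((int (lam k) - (int p + (int (lam i) - mu i))) + (int (lam i) - mu i)))"
    unfolding bit_add_of_int_eq_iff .
  then have even: "even (mu k - int p)" by simp
  have "int p \<le> mu k + 1"
  proof -
    consider "k < i" | "k = i" | "i < k" by linarith
    then show ?thesis
    proof cases
      case 1
      then show ?thesis using mono[of k i] i(3) by linarith
    next
      case 3
      then show ?thesis using mono[of i k] i(4) by linarith
    next
      case 2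
      then show ?thesis using i(3) by simp
    qed
  qed
  then show ?thesis using even by presburger
qed

context two_colored_space
begin

lemma exists_signed:
  assumes x: "x \<in> nilpotent_cone" and v: "v \<in> V c0"
  shows "\<exists>lam eps mu b. (lam, eps, mu) \<in> signed_2_bipartitions space_signature \<and>
    jordan_basis lam eps x b \<and> v = marked_vector lam mu b"
proof -
  have lx: "lin x" by (rule cone_lin[OF x])
  obtain lam eps b0 where colored: "is_colored_partition lam eps" and b0: "jordan_basis lam eps x b0"
    using exists_jordan_basis[OF x] by blast
  have lam: "is_partition lam" using colored by (simp add: is_colored_partition_def)
  let ?D = "diagram lam" and ?n = "part_length lam"
  define P where "P = (\<lambda>(b, c, m). jordan_basis lam eps x b \<and>
    v = (\<Sum>p\<in>?D. scale (c p) (case p of (i, j) \<Rightarrow> b i j)) \<and> profile lam eps c0 c m)"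
  \<comment> \<open>Marks are at least -1, so adding 1 yields natural numbers without truncation.
    They are bounded in terms of \<open>lam\<close>, hence a basis with maximal total mark
    exists.\<close>
  define size where "size = (\<lambda>(b :: nat \<Rightarrow> nat \<Rightarrow> 'v, c :: nat \<times> nat \<Rightarrow> 'a, m :: nat \<Rightarrow> int). \<Sum>i<?n. nat (m i + 1))"
  obtain c1 where c1: "v = (\<Sum>p\<in>?D. scale (c1 p) (case p of (i, j) \<Rightarrow> b0 i j))"
    using fbasis_expand[OF jordan_basis_fbasis[OF b0]] by blast
  have "\<exists>m. profile lam eps c0 c1 m"
    using jordan_coefficient_color[OF b0, of c1 c0] v unfolding c1 by (intro profile_exists) blast
  then obtain m1 where m1: "P (b0, c1, m1)" using b0 c1 unfolding P_def by blast
  have bound: "\<forall>z. P z \<longrightarrow> size z < (\<Sum>i<?n. lam i + 1) + 1"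
  proof (intro allI impI)
    fix z assume z: "P z"
    obtain b c m where zz: "z = (b, c, m)" by (cases z)
    have "m i \<le> int (lam i)" for i using z zz by (simp add: P_def profile_def)
    then have "(\<Sum>i<?n. nat (m i + 1)) \<le> (\<Sum>i<?n. lam i + 1)"
      by (intro sum_mono) (simp add: nat_le_iff)
    then show "size z < (\<Sum>i<?n. lam i + 1) + 1" by (simp add: size_def zz)
  qed
  obtain z where z: "P z" "\<And>y. P y \<Longrightarrow> size y \<le> size z"
    using ex_has_greatest_nat[OF m1 bound] by blast
  obtain b c m where bcm: "z = (b, c, m)" by (cases z)
  have b: "jordan_basis lam eps x b" and vc: "v = (\<Sum>p\<in>?D. scale (c p) (case p of (i, j) \<Rightarrow> b i j))"
    and m: "profile lam eps c0 c m"
    using z(1) by (auto simp: P_def bcm)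
  have mD: "\<And>i j. 1 \<le> j \<Longrightarrow> j \<le> lam i \<Longrightarrow> c (i, j) \<noteq> 0 \<Longrightarrow> int j \<le> m i"
    "\<And>i. 0 < m i \<Longrightarrow> c (i, nat (m i)) \<noteq> 0" "\<And>i. - 2 < m i" "\<And>i. m i \<le> int (lam i)"
    "\<And>i. eps i + of_int (int (lam i) - m i) = c0"
    using m unfolding profile_def by blast+
  have no_improve: False if ik: "m k + 2 \<le> m i" "int (lam i) - m i + 2 \<le> int (lam k) - m k" for i k
  proof -
    obtain b' c' m' where n: "jordan_basis lam eps x b'"
      "v = (\<Sum>p\<in>?D. scale (c' p) (case p of (i, j) \<Rightarrow> b' i j))" "profile lam eps c0 c' m'"
      "\<forall>p. m p \<le> m' p" "m k < m' k" "k < ?n"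
      using profile_improve[OF b lam lx vc v m ik] by (elim exE conjE) (rule that)
    have "(\<Sum>i<?n. nat (m i + 1)) < (\<Sum>i<?n. nat (m' i + 1))"
    proof (rule sum_strict_mono_ex1)
      show "\<forall>i\<in>{..<?n}. nat (m i + 1) \<le> nat (m' i + 1)" using n(4) by (simp add: nat_mono)
      show "\<exists>i\<in>{..<?n}. nat (m i + 1) < nat (m' i + 1)"
        using n(5,6) mD(3)[of k] by (intro bexI[of _ k]) auto
    qed simp
    moreover have "P (b', c', m')" using n by (simp add: P_def)
    ultimately show False using z(2) by (fastforce simp: size_def bcm)
  qed
  have dec: "lam j \<le> lam i" if "i < j" for i j
    using lam that by (auto simp: is_partition_def antimono_def)
  have signed: "(lam, eps, m) \<in> signed_2_bipartitions space_signature"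
    unfolding signed_2_bipartitions_def marked_colored_partitions_def Let_def
  proof (intro CollectI case_prodI conjI allI impI colored part_signature_eq[OF b] mD(3) mD(4))
    fix i j :: nat assume ij: "i < j"
    \<comment> \<open>Because \<open>lam j \<le> lam i\<close>, a violation of one of the two
      inequalities already implies the other half of the hypothesis of
      \<open>no_improve\<close>.\<close>
    show "m j < m i + 2"
    proof (rule ccontr)
      assume "\<not> ?thesis"
      then show False using dec[OF ij] by (intro no_improve[of i j]) linarith+
    qed
    show "int (lam j) - m j < int (lam i) - m i + 2"
    proof (rule ccontr)
      assume "\<not> ?thesis"
      then show False using dec[OF ij] by (intro no_improve[of j i]) linarith+
    qed
  next
    show "eps i + of_int (int (lam i) - m i) = eps j + of_int (int (lam j) - m j)" for i j
      by (simp only: mD(5))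
  qed
  \<comment> \<open>In each row with a positive mark the basis is replaced by its image under a
    polynomial in the shift, chosen so that box \<open>m i\<close> becomes the whole component of
    \<open>v\<close> in that row. The leading coefficient \<open>c (i, nat (m i))\<close> is
    nonzero, so the bottoms stay independent; homogeneity of \<open>v\<close> leaves only even
    powers, so colors are kept.\<close>
  define b' where "b' i j = (if 0 < m i then \<Sum>t<nat (m i). scale (c (i, nat (m i) - t)) (b i (j - t)) else b i j)" for i j
  have b'1: "b' i 1 = scale (if 0 < m i then c (i, nat (m i)) else 1) (b i 1)" for i
  proof (cases "0 < m i")
    case True
    then obtain n where n: "nat (m i) = Suc n" by (metis gr0_implies_Suc zero_less_nat_eq)
    have "b' i 1 = (\<Sum>t<Suc n. scale (c (i, nat (m i) - t)) (b i (1 - t)))"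
      using True n by (simp add: b'_def)
    also have "\<dots> = scale (c (i, nat (m i))) (b i 1)"
      by (subst sum.lessThan_Suc_shift) (simp add: jordan_basis_0[OF b])
    finally show ?thesis using True by simp
  qed (simp add: b'_def)
  have jb': "jordan_basis lam eps x b'"
  proof (rule jordan_basis_change[OF b lam lx])
    show "b' i 0 = 0" for i by (simp add: b'_def jordan_basis_0[OF b])
    show "b' i j \<in> V (box_color lam eps i j)" if j: "1 \<le> j" "j \<le> lam i" for i j
    proof (cases "0 < m i")
      case True
      have "scale (c (i, nat (m i) - t)) (b i (j - t)) \<in> V (box_color lam eps i j)" if t: "t < nat (m i)" for t
      proof (cases "c (i, nat (m i) - t) = 0 \<or> j \<le> t")
        case False
        have l: "1 \<le> nat (m i) - t" "nat (m i) - t \<le> lam i" using t mD(4)[of i] by linarith+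
        have "box_color lam eps i (nat (m i) - t) = c0"
          using jordan_coefficient_color[OF b _ l, of c c0] False v vc by simp
        moreover have "box_color lam eps i (nat (m i)) = c0"
          using mD(5)[of i] True by (simp add: box_color_def)
        ultimately have "box_color lam eps i (nat (m i)) = box_color lam eps i (nat (m i) - t)" by simp
        then have "even (int (nat (m i) - t) - int (nat (m i)))" by (simp only: box_color_eq_iff)
        then have "even (int j - int (j - t))" using t False by simp
        then have "box_color lam eps i (j - t) = box_color lam eps i j" by (simp only: box_color_eq_iff)
        moreover have "1 \<le> j - t" "j - t \<le> lam i" using j False by auto
        ultimately show ?thesis
          using jordan_basis_color[OF b, of "j - t" i] by (intro V_scale) simp
      next
        case True
        then show ?thesis using jordan_basis_0[OF b] V_0 by auto
      qed
      then show ?thesis using True by (auto simp: b'_def intro!: V_setsum)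
    qed (simp add: b'_def jordan_basis_color[OF b j])
    show "x (b' i j) = b' i (j - 1)" if j: "j \<le> lam i" for i j
    proof -
      have "x (b i (j - t)) = b i (j - 1 - t)" for t
        using jordan_basis_step[OF b, of "j - t" i] j by (simp add: diff_commute)
      then show ?thesis
        using jordan_basis_step[OF b j] by (simp add: b'_def lin_sum[OF lx] lin_scale[OF lx])
    qed
    fix d assume d: "(\<Sum>i<?n. scale (d i) (b' i 1)) = 0"
    have "\<forall>i<?n. d i * (if 0 < m i then c (i, nat (m i)) else 1) = 0"
      using d unfolding b'1 scale_scale by (rule jordan_bottom[OF b lam])
    then show "\<forall>i<?n. d i = 0" using mD(2) by (auto split: if_splits)
  qed
  have "v = (\<Sum>i<?n. \<Sum>j = 1..lam i. scale (c (i, j)) (b i j))"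
    unfolding vc sum_diagram_rows[OF lam] by simp
  also have "\<dots> = marked_vector lam m b'"
    unfolding marked_vector_def
  proof (intro sum.cong refl)
    fix i
    show "(\<Sum>j = 1..lam i. scale (c (i, j)) (b i j)) = (if 0 < m i then b' i (nat (m i)) else 0)"
    proof (cases "0 < m i")
      case True
      have "(\<Sum>j = 1..lam i. scale (c (i, j)) (b i j)) = (\<Sum>j = 1..nat (m i). scale (c (i, j)) (b i j))"
      proof (rule sum.mono_neutral_right)
        show "{1..nat (m i)} \<subseteq> {1..lam i}" using mD(4)[of i] by auto
        show "\<forall>j\<in>{1..lam i} - {1..nat (m i)}. scale (c (i, j)) (b i j) = 0"
        proof
          fix j assume "j \<in> {1..lam i} - {1..nat (m i)}"
          then have "c (i, j) = 0" using mD(1)[of j i] by fastforce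
          then show "scale (c (i, j)) (b i j) = 0" by simp
        qed
      qed simp
      also have "\<dots> = (\<Sum>t<nat (m i). scale (c (i, nat (m i) - t)) (b i (nat (m i) - t)))"
        by (intro sum.reindex_bij_witness[of _ "\<lambda>t. nat (m i) - t" "\<lambda>j. nat (m i) - j"]) auto
      finally show ?thesis using True by (simp add: b'_def)
    next
      case False
      have "scale (c (i, j)) (b i j) = 0" if "j \<in> {1..lam i}" for j
        using mD(1)[of j i] that False by fastforce
      then have "(\<Sum>j = 1..lam i. scale (c (i, j)) (b i j)) = 0" by (rule sum.neutral[OF ballI])
      then show ?thesis using False by simp
    qed
  qed
  finally show ?thesis using signed jb' by blast
qed

section \<open>Invariants of orbits\<close>

lemma kernel_expand:
  assumes b: "jordan_basis lam eps x b" and lam: "is_partition lam" and x: "lin x"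
  shows "u \<in> {u \<in> V m. (x ^^ a) u = 0} \<longleftrightarrow>
    (\<exists>c. u = (\<Sum>p\<in>{(i, j). (i, j) \<in> diagram lam \<and> j \<le> a \<and> box_color lam eps i j = m}.
      scale (c p) (case p of (i, j) \<Rightarrow> b i j)))"
proof -
  let ?D = "diagram lam" and ?J = "{(i, j). (i, j) \<in> diagram lam \<and> j \<le> a \<and> box_color lam eps i j = m}"
  have fin: "finite ?D" by (rule finite_diagram[OF lam])
  show "u \<in> {u \<in> V m. (x ^^ a) u = 0} \<longleftrightarrow> (\<exists>c. u = (\<Sum>p\<in>?J. scale (c p) (case p of (i, j) \<Rightarrow> b i j)))"
  proof
    assume u: "u \<in> {u \<in> V m. (x ^^ a) u = 0}"
    obtain c where c: "u = (\<Sum>p\<in>?D. scale (c p) (case p of (i, j) \<Rightarrow> b i j))"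
      using fbasis_expand[OF jordan_basis_fbasis[OF b]] by blast
    have color: "box_color lam eps i j = m" if "(i, j) \<in> ?D" "c (i, j) \<noteq> 0" for i j
      using jordan_coefficient_color[OF b, of c m j i] u c that by (auto simp: diagram_def)
    define d where "d p = (case p of (i, j) \<Rightarrow> if j + a \<le> lam i then c (i, j + a) else 0)" for p
    have du: "(\<Sum>p\<in>?D. scale (d p) (case p of (i, j) \<Rightarrow> b i j)) = (x ^^ a) u"
    proof -
      have "(x ^^ a) u = (\<Sum>i<part_length lam. \<Sum>j = 1..lam i. scale (c (i, j)) (b i (j - a)))"
        unfolding c lin_sum[OF lin_pow[OF x]] lin_scale[OF lin_pow[OF x]] sum_diagram_rows[OF lam]
        by (intro sum.cong refl) (simp add: jordan_pow[OF b])
      also have "\<dots> = (\<Sum>i<part_length lam. \<Sum>j = 1..lam i. scale (d (i, j)) (b i j))"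
      proof (rule sum.cong[OF refl])
        fix i
        have "(\<Sum>j = 1..lam i. scale (c (i, j)) (b i (j - a))) = (\<Sum>j\<in>{j\<in>{1..lam i}. a < j}. scale (c (i, j)) (b i (j - a)))"
        proof (rule sum.mono_neutral_right)
          show "\<forall>j\<in>{1..lam i} - {j\<in>{1..lam i}. a < j}. scale (c (i, j)) (b i (j - a)) = 0"
          proof
            fix j assume "j \<in> {1..lam i} - {j\<in>{1..lam i}. a < j}"
            then have "j - a = 0" by auto
            then show "scale (c (i, j)) (b i (j - a)) = 0" by (simp add: jordan_basis_0[OF b])
          qed
        qed auto
        also have "\<dots> = (\<Sum>j\<in>{j\<in>{1..lam i}. j + a \<le> lam i}. scale (c (i, j + a)) (b i j))"
          by (intro sum.reindex_bij_witness[of _ "\<lambda>j. j + a" "\<lambda>j. j - a"]) auto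
        also have "\<dots> = (\<Sum>j = 1..lam i. scale (d (i, j)) (b i j))"
          by (intro sum.mono_neutral_cong_left) (auto simp: d_def)
        finally show "(\<Sum>j = 1..lam i. scale (c (i, j)) (b i (j - a))) = (\<Sum>j = 1..lam i. scale (d (i, j)) (b i j))" .
      qed
      finally show ?thesis unfolding sum_diagram_rows[OF lam] by simp
    qed
    have "(x ^^ a) u = 0" using u by blast
    then have "(\<Sum>p\<in>?D. scale (d p) (case p of (i, j) \<Rightarrow> b i j)) = 0" using du by (simp only:)
    then have d0: "d p = 0" if "p \<in> ?D" for p
      using fbasis_zero[OF jordan_basis_fbasis[OF b] _ that] by blast
    have high: "c (i, j) = 0" if "(i, j) \<in> ?D" "a < j" for i j
    proof -
      have "(i, j - a) \<in> ?D" using that by (auto simp: diagram_def)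
      from d0[OF this] that show ?thesis by (simp add: d_def diagram_def)
    qed
    have "c (i, j) = 0" if "(i, j) \<in> ?D - ?J" for i j
      using color[of i j] high[of i j] that by (cases "j \<le> a") auto
    then have c0: "\<forall>p\<in>?D - ?J. scale (c p) (case p of (i, j) \<Rightarrow> b i j) = 0" by auto
    have "u = (\<Sum>p\<in>?J. scale (c p) (case p of (i, j) \<Rightarrow> b i j))"
      unfolding c by (rule sum.mono_neutral_right[OF fin _ c0]) auto
    then show "\<exists>c. u = (\<Sum>p\<in>?J. scale (c p) (case p of (i, j) \<Rightarrow> b i j))" by blast
  next
    assume "\<exists>c. u = (\<Sum>p\<in>?J. scale (c p) (case p of (i, j) \<Rightarrow> b i j))"
    then obtain c where c: "u = (\<Sum>p\<in>?J. scale (c p) (case p of (i, j) \<Rightarrow> b i j))" by blast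
    have "u \<in> V m"
      unfolding c using jordan_basis_color[OF b] by (intro V_setsum V_scale) (auto simp: diagram_def)
    moreover have "(x ^^ a) u = 0"
      unfolding c lin_sum[OF lin_pow[OF x]] lin_scale[OF lin_pow[OF x]]
      by (intro sum.neutral) (auto simp: jordan_pow[OF b] diagram_def jordan_basis_0[OF b])
    ultimately show "u \<in> {u \<in> V m. (x ^^ a) u = 0}" by simp
  qed
qed

lemma card_boxes_invariant:
  assumes b: "jordan_basis lam eps x b" and lam: "is_partition lam" and x: "lin x"
  shows "dim {u \<in> V m. (x ^^ a) u = 0} = card {(i, j). (i, j) \<in> diagram lam \<and> j \<le> a \<and> box_color lam eps i j = m}"
  by (rule dim_family[OF jordan_basis_fbasis[OF b] _ kernel_expand[OF assms]]) auto

text \<open>A difference in the column bound counts the boxes of one color in one column. Rows whose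
  box \<open>l\<close> has color \<open>e\<close>, minus those among them that continue to column
  \<open>l + 1\<close>, are the rows ending at \<open>l\<close> with top color \<open>e\<close>. The
  counts on the right are dimensions of graded kernels of powers of \<open>x\<close>.\<close>

lemma card_rows_eq:
  assumes lam: "is_partition lam" and l: "1 \<le> l"
  shows "int (card {i. lam i = l \<and> eps i = e}) =
    (int (card {(i, j). (i, j) \<in> diagram lam \<and> j \<le> l \<and> box_color lam eps i j = e})
      - int (card {(i, j). (i, j) \<in> diagram lam \<and> j \<le> l - 1 \<and> box_color lam eps i j = e}))
    - (int (card {(i, j). (i, j) \<in> diagram lam \<and> j \<le> l + 1 \<and> box_color lam eps i j = e + 1})
      - int (card {(i, j). (i, j) \<in> diagram lam \<and> j \<le> l \<and> box_color lam eps i j = e + 1}))"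
proof -
  let ?D = "diagram lam"
  have fin: "finite ?D" by (rule finite_diagram[OF lam])
  have clr: "int (card {(i, j). (i, j) \<in> ?D \<and> j \<le> a \<and> box_color lam eps i j = m})
      - int (card {(i, j). (i, j) \<in> ?D \<and> j \<le> a - 1 \<and> box_color lam eps i j = m})
      = int (card {i. a \<le> lam i \<and> box_color lam eps i a = m})" if a: "1 \<le> a" for a m
  proof -
    let ?A = "{(i, j). (i, j) \<in> ?D \<and> j \<le> a - 1 \<and> box_color lam eps i j = m}"
    let ?B = "{i. a \<le> lam i \<and> box_color lam eps i a = m}"
    have "{(i, j). (i, j) \<in> ?D \<and> j \<le> a \<and> box_color lam eps i j = m} = ?A \<union> (\<lambda>i. (i, a)) ` ?B"
    proof -
      have "j \<le> a \<longleftrightarrow> j \<le> a - 1 \<or> j = a" for j using a by linarith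
      then show ?thesis using a by (auto simp: diagram_def)
    qed
    moreover have "finite ?A" by (rule finite_subset[OF _ fin]) auto
    moreover have "finite ((\<lambda>i. (i, a)) ` ?B)" by (rule finite_subset[OF _ fin]) (use a in \<open>auto simp: diagram_def\<close>)
    moreover have "?A \<inter> (\<lambda>i. (i, a)) ` ?B = {}" using a by auto
    ultimately have "card {(i, j). (i, j) \<in> ?D \<and> j \<le> a \<and> box_color lam eps i j = m} = card ?A + card ((\<lambda>i. (i, a)) ` ?B)"
      by (simp only: card_Un_disjoint)
    moreover have "card ((\<lambda>i. (i, a)) ` ?B) = card ?B" by (rule card_image) (auto simp: inj_on_def)
    ultimately show ?thesis by simp
  qed
  let ?P = "{i. l \<le> lam i \<and> box_color lam eps i l = e}" and ?Q = "{i. l + 1 \<le> lam i \<and> box_color lam eps i (l + 1) = e + 1}"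
  have succ: "box_color lam eps i (l + 1) = e + 1 \<longleftrightarrow> box_color lam eps i l = e" for i
    using box_color_pred[of "l + 1" lam eps i] by (metis add_diff_cancel_right' add_right_cancel bit_add_add add.commute le_add2)
  have "{i. lam i = l \<and> eps i = e} = ?P - ?Q"
    unfolding succ
  proof (rule Set.set_eqI)
    fix i
    have "box_color lam eps i (lam i) = eps i" by (simp add: box_color_def)
    then show "i \<in> {i. lam i = l \<and> eps i = e} \<longleftrightarrow>
        i \<in> {i. l \<le> lam i \<and> box_color lam eps i l = e} - {i. l + 1 \<le> lam i \<and> box_color lam eps i l = e}"
      by (cases "lam i = l") auto
  qed
  moreover have "?Q \<subseteq> ?P" unfolding succ by auto
  moreover have "finite ?P"
    by (rule finite_subset[of _ "fst ` ?D"]) (use l fin in \<open>auto simp: diagram_def image_iff\<close>)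
  ultimately have "int (card {i. lam i = l \<and> eps i = e}) = int (card ?P) - int (card ?Q)"
    by (simp add: card_Diff_subset finite_subset card_mono of_nat_diff)
  then show ?thesis using clr[OF l, of e] clr[of "l + 1" "e + 1"] by simp
qed

end

section \<open>Weak equivalence and its compatibility with \<open>Psi\<close>\<close>

lemma equiv_weak_equivalence: "equiv (marked_colored_partitions f) (weak_equivalence f)"
proof (rule equivI)
  show "weak_equivalence f \<subseteq> marked_colored_partitions f \<times> marked_colored_partitions f"
    by (auto simp: weak_equivalence_def)
  show "refl_on (marked_colored_partitions f) (weak_equivalence f)"
  proof (rule refl_onI)
    fix p assume p: "p \<in> marked_colored_partitions f"
    obtain lam eps mu where pp: "p = (lam, eps, mu)" by (cases p)
    show "(p, p) \<in> weak_equivalence f"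
      using p unfolding pp weak_equivalence_def by (auto intro!: exI[of _ id])
  qed
  show "sym (weak_equivalence f)"
  proof (rule symI)
    fix p p' assume "(p, p') \<in> weak_equivalence f"
    then obtain lam eps mu alpha beta gamma s where pp: "p = (lam, eps, mu)" "p' = (alpha, beta, gamma)"
      "p \<in> marked_colored_partitions f" "p' \<in> marked_colored_partitions f" and s: "bij s"
      "alpha = lam \<circ> s" "beta = eps \<circ> s" "\<And>i. gamma i > 0 \<or> mu (s i) > 0 \<Longrightarrow> gamma i = mu (s i)"
      unfolding weak_equivalence_def by blast
    have inv: "s (inv_into UNIV s i) = i" for i using s(1) by (simp add: bij_is_surj surj_f_inv_f)
    have "bij (inv_into UNIV s)" "lam = alpha \<circ> inv_into UNIV s" "eps = beta \<circ> inv_into UNIV s"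
      using s inv by (auto simp: bij_imp_bij_inv fun_eq_iff)
    moreover have "mu i = gamma (inv_into UNIV s i)" if "mu i > 0 \<or> gamma (inv_into UNIV s i) > 0" for i
      using s(4)[of "inv_into UNIV s i"] that inv by auto
    ultimately show "(p', p) \<in> weak_equivalence f"
      using pp unfolding weak_equivalence_def by auto
  qed
  show "trans (weak_equivalence f)"
  proof (rule transI)
    fix p p' p'' assume 1: "(p, p') \<in> weak_equivalence f" and 2: "(p', p'') \<in> weak_equivalence f"
    obtain lam eps mu alpha beta gamma s where pp: "p = (lam, eps, mu)" "p' = (alpha, beta, gamma)"
      "p \<in> marked_colored_partitions f" and s: "bij s"
      "alpha = lam \<circ> s" "beta = eps \<circ> s" "\<And>i. gamma i > 0 \<or> mu (s i) > 0 \<Longrightarrow> gamma i = mu (s i)"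
      using 1 unfolding weak_equivalence_def by blast
    obtain alpha' beta' gamma' t where pp': "p'' = (alpha', beta', gamma')"
      "p'' \<in> marked_colored_partitions f" and t: "bij t"
      "alpha' = alpha \<circ> t" "beta' = beta \<circ> t" "\<And>i. gamma' i > 0 \<or> gamma (t i) > 0 \<Longrightarrow> gamma' i = gamma (t i)"
      using 2 pp unfolding weak_equivalence_def by blast
    have "bij (s \<circ> t)" "alpha' = lam \<circ> (s \<circ> t)" "beta' = eps \<circ> (s \<circ> t)"
      using s t by (auto simp: bij_comp comp_assoc)
    moreover have "gamma' i = mu ((s \<circ> t) i)" if "gamma' i > 0 \<or> mu ((s \<circ> t) i) > 0" for i
      using s(4)[of "t i"] t(4)[of i] that by auto
    ultimately show "(p, p'') \<in> weak_equivalence f"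
      using pp pp' unfolding weak_equivalence_def by blast
  qed
qed

context two_colored_space
begin

lemma fbasis_reindex:
  assumes "bij_betw h I' I" "fbasis I b"
  shows "fbasis I' (\<lambda>p. b (h p))"
proof -
  have fin: "finite I" "finite I'"
    using fbasis_finite[OF assms(2)] bij_betw_finite[OF assms(1)] by auto
  have "inj_on b I" "independent (b ` I)" "span (b ` I) = UNIV"
    using assms(2) fbasis_iff[OF fin(1)] by auto
  moreover have "inj_on (b \<circ> h) I'"
    using assms(1) calculation(1) by (intro comp_inj_on) (auto simp: bij_betw_def)
  moreover have "(b \<circ> h) ` I' = b ` I"
    using assms(1) by (auto simp: bij_betw_def)
  ultimately have "fbasis I' (b \<circ> h)" using fbasis_iff[OF fin(2)] by simp
  then show ?thesis by (simp add: comp_def)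
qed

lemma Psi_weak_equivalence_subset:
  assumes "(p, p') \<in> weak_equivalence f"
  shows "Psi p \<subseteq> Psi p'"
proof -
  obtain lam eps mu alpha beta gamma s where pp: "p = (lam, eps, mu)" "p' = (alpha, beta, gamma)"
    "p \<in> marked_colored_partitions f" "p' \<in> marked_colored_partitions f" and s: "bij s"
    "alpha = lam \<circ> s" "beta = eps \<circ> s" "\<And>i. gamma i > 0 \<or> mu (s i) > 0 \<Longrightarrow> gamma i = mu (s i)"
    using assms unfolding weak_equivalence_def by blast
  have lam: "is_partition lam" "is_partition alpha"
    using pp by (auto simp: marked_colored_partitions_def is_colored_partition_def)
  have mu: "mu i \<le> int (lam i)" "gamma i \<le> int (alpha i)" for i
    using pp by (auto simp: marked_colored_partitions_def)
  have inv: "s (inv_into UNIV s i) = i" for i using s(1) by (simp add: bij_is_surj surj_f_inv_f)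
  have inj: "s i = s j \<longleftrightarrow> i = j" for i j using s(1) by (auto dest: bij_is_inj injD)
  have clr: "box_color alpha beta i j = box_color lam eps (s i) j" for i j
    by (simp add: box_color_def s(2,3))
  show ?thesis
  proof
    fix z assume "z \<in> Psi p"
    then obtain x b where x: "x \<in> nilpotent_cone" and b: "jordan_basis lam eps x b"
      and z: "z = (marked_vector lam mu b, x)"
      unfolding pp(1) Psi_eq[OF lam(1)] by blast
    have bij: "bij_betw (\<lambda>(i, j). (s i, j)) (diagram alpha) (diagram lam)"
      unfolding bij_betw_def
    proof
      show "inj_on (\<lambda>(i, j). (s i, j)) (diagram alpha)" by (auto simp: inj_on_def inj)
      show "(\<lambda>(i, j). (s i, j)) ` diagram alpha = diagram lam"
      proof
        show "(\<lambda>(i, j). (s i, j)) ` diagram alpha \<subseteq> diagram lam" by (auto simp: diagram_def s(2))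
        show "diagram lam \<subseteq> (\<lambda>(i, j). (s i, j)) ` diagram alpha"
        proof
          fix q assume q: "q \<in> diagram lam"
          obtain i j where ij: "q = (i, j)" by (cases q)
          have "(inv_into UNIV s i, j) \<in> diagram alpha" using q ij by (simp add: diagram_def s(2) inv)
          then show "q \<in> (\<lambda>(i, j). (s i, j)) ` diagram alpha"
            using ij inv by (intro image_eqI[of _ _ "(inv_into UNIV s i, j)"]) auto
        qed
      qed
    qed
    have "fbasis (diagram alpha) (\<lambda>(i, j). b (s i) j)"
      using fbasis_reindex[OF bij jordan_basis_fbasis[OF b]] by (simp add: case_prod_unfold)
    then have b': "jordan_basis alpha beta x (\<lambda>i j. b (s i) j)"
      unfolding jordan_basis_def clr using b by (auto simp: jordan_basis_def s(2))
    have "marked_vector lam mu b = (\<Sum>i\<in>{i. mu i > 0}. b i (nat (mu i)))"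
      by (rule marked_vector_eq[OF lam(1) mu(1)])
    moreover have g1: "gamma (inv_into UNIV s i) = mu i" if "mu i > 0" for i
      using s(4)[of "inv_into UNIV s i"] that by (simp add: inv)
    moreover have g2: "mu (s i) = gamma i" if "gamma i > 0" for i using s(4)[of i] that by simp
    ultimately have "marked_vector lam mu b = (\<Sum>i\<in>{i. mu i > 0}. b i (nat (mu i)))" by simp
    also have "\<dots> = (\<Sum>i\<in>{i. gamma i > 0}. b (s i) (nat (gamma i)))"
      using g1 g2 inv inj by (intro sum.reindex_bij_witness[of _ s "inv_into UNIV s"]) (auto simp: inv_f_f bij_is_inj[OF s(1)])
    also have "\<dots> = marked_vector alpha gamma (\<lambda>i j. b (s i) j)"
      by (rule marked_vector_eq[OF lam(2) mu(2), symmetric])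
    finally show "z \<in> Psi p'"
      unfolding pp(2) Psi_eq[OF lam(2)] z using x b' by blast
  qed
qed

lemma Psi_respects: "Psi respects weak_equivalence f"
proof (rule congruentI)
  fix p p' assume pp: "(p, p') \<in> weak_equivalence f"
  have "(p', p) \<in> weak_equivalence f"
    using pp equiv_weak_equivalence[of f] by (meson equivE symD)
  then show "Psi p = Psi p'"
    using Psi_weak_equivalence_subset[OF pp] Psi_weak_equivalence_subset by blast
qed

text \<open>Rows are matched within each class of equal length and color. For positive length both
  classes are finite of equal size, by the kernel dimensions; for length 0 both are infinite,
  because every color occurs infinitely often while only finitely many rows are non-empty.\<close>

lemma exists_row_bijection:
  assumes colored: "is_colored_partition lam eps" "is_colored_partition lam' eps'" and x: "lin x"
    and b: "jordan_basis lam eps x b" "jordan_basis lam' eps' x b'"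
  shows "\<exists>s. bij s \<and> lam' = lam \<circ> s \<and> eps' = eps \<circ> s"
proof -
  have lam: "is_partition lam" "is_partition lam'" and inf: "\<And>m. infinite {i. eps i = m}" "\<And>m. infinite {i. eps' i = m}"
    using colored by (auto simp: is_colored_partition_def)
  have fin: "finite {i. lam i > 0}" if "is_partition lam" for lam
    using partition_support[OF that] by simp
  have inf0: "infinite {i. lam i = 0 \<and> eps i = e}" if "is_partition lam" "infinite {i. eps i = e}" for lam eps and e :: bit
  proof -
    have "infinite ({i. eps i = e} - {i. lam i > 0})" by (rule Diff_infinite_finite[OF fin[OF that(1)] that(2)])
    moreover have "{i. eps i = e} - {i. lam i > 0} = {i. lam i = 0 \<and> eps i = e}" by auto
    ultimately show ?thesis by simp
  qed
  have ex: "\<exists>g. bij_betw g {i. lam' i = l \<and> eps' i = e} {i. lam i = l \<and> eps i = e}" for l e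
  proof (cases "l = 0")
    case True
    have "bij_betw (enumerate {i. lam i = 0 \<and> eps i = e}) UNIV {i. lam i = 0 \<and> eps i = e}"
      by (rule bij_enumerate[OF inf0[OF lam(1) inf(1)]])
    moreover have "bij_betw (inv_into UNIV (enumerate {i. lam' i = 0 \<and> eps' i = e})) {i. lam' i = 0 \<and> eps' i = e} UNIV"
      by (rule bij_betw_inv_into[OF bij_enumerate[OF inf0[OF lam(2) inf(2)]]])
    ultimately show ?thesis unfolding True using bij_betw_trans by blast
  next
    case False
    then have l: "1 \<le> l" by simp
    have fl: "finite {i. lam i = l \<and> eps i = e}" if "is_partition lam" for lam eps and e :: bit
      by (rule finite_subset[OF _ fin[OF that]]) (use l in auto)
    have "int (card {i. lam' i = l \<and> eps' i = e}) = int (card {i. lam i = l \<and> eps i = e})"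
      unfolding card_rows_eq[OF lam(1) l] card_rows_eq[OF lam(2) l]
        card_boxes_invariant[OF b(1) lam(1) x, symmetric] card_boxes_invariant[OF b(2) lam(2) x, symmetric] ..
    then have "card {i. lam' i = l \<and> eps' i = e} = card {i. lam i = l \<and> eps i = e}" by simp
    from finite_same_card_bij[OF fl[OF lam(2)] fl[OF lam(1)] this] show ?thesis .
  qed
  define g where "g l e = (SOME g. bij_betw g {i. lam' i = l \<and> eps' i = e} {i. lam i = l \<and> eps i = e})" for l e
  have g: "bij_betw (g l e) {i. lam' i = l \<and> eps' i = e} {i. lam i = l \<and> eps i = e}" for l e
    unfolding g_def by (rule someI_ex[OF ex])
  define s where "s i = g (lam' i) (eps' i) i" for i
  have s: "lam (s i) = lam' i" "eps (s i) = eps' i" for i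
    using bij_betwE[OF g[of "lam' i" "eps' i"]] by (auto simp: s_def)
  have "inj s"
  proof (rule injI)
    fix i j assume ij: "s i = s j"
    then have "lam' i = lam' j" "eps' i = eps' j" using s by metis+
    then show "i = j"
      using ij bij_betw_imp_inj_on[OF g[of "lam' i" "eps' i"]] by (auto simp: s_def inj_on_def)
  qed
  moreover have "surj s"
    unfolding surj_def
  proof
    fix k
    obtain i where "lam' i = lam k" "eps' i = eps k" "k = g (lam k) (eps k) i"
      using bij_betw_imp_surj_on[OF g[of "lam k" "eps k"]] by blast
    then have "k = s i" by (simp only: s_def)
    then show "\<exists>i. k = s i" by (rule exI)
  qed
  ultimately show ?thesis using s by (intro exI[of _ s]) (auto simp: bij_def fun_eq_iff)
qed

section \<open>Recovering the positive marks; the bijection\<close>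

definition centralizer :: "('v \<Rightarrow> 'v) \<Rightarrow> ('v \<Rightarrow> 'v) set" where
  "centralizer x = {f. lin f \<and> (\<forall>u. f (x u) = x (f u)) \<and> (\<forall>m. \<forall>u\<in>V m. f u \<in> V m)}"

text \<open>It refers to \<open>x\<close>, \<open>v\<close> and the type of a row only, not to a
  Jordan basis, so it can be compared between two presentations of the same pair. The inserted 0 is
  the value when there is no positive mark.\<close>

definition level :: "('v \<Rightarrow> 'v) \<Rightarrow> 'v \<Rightarrow> nat \<Rightarrow> bit \<Rightarrow> nat" where
  "level x v l e = Max (insert 0 {j. 1 \<le> j \<and> j \<le> l \<and>
     (\<forall>w\<in>V e. (x ^^ l) w = 0 \<longrightarrow> (\<exists>f\<in>centralizer x. (x ^^ (l - j)) w = f v))})"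

lemma fbasis_graded:
  assumes b: "fbasis I b" "\<And>p. p \<in> I \<Longrightarrow> b p \<in> V (clr p)" and f: "lin f" "\<And>p. p \<in> I \<Longrightarrow> f (b p) \<in> V (clr p)"
    and u: "u \<in> V m"
  shows "f u \<in> V m"
proof -
  obtain c where c: "u = (\<Sum>p\<in>I. scale (c p) (b p))" using fbasis_expand[OF b(1)] by blast
  have c0: "c p = 0" if "p \<in> I" "clr p \<noteq> m" for p
    using homogeneous_coefficients[OF b, of c m p] u that unfolding c by simp
  show ?thesis
    unfolding c lin_sum[OF f(1)] lin_scale[OF f(1)]
  proof (rule V_setsum)
    fix p assume p: "p \<in> I"
    show "scale (c p) (f (b p)) \<in> V m"
      using c0[OF p] f(2)[OF p] V_0 by (cases "clr p = m") (auto intro: V_scale)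
  qed
qed

text \<open>The positive marks are determined by \<open>(v, x)\<close>: \<open>mu i\<close> is the largest \<open>j\<close> such that all
  vectors \<open>x\<^bsup>lam i - j\<^esup> w\<close>, for \<open>w\<close> of color \<open>eps i\<close> in the kernel of \<open>x\<^bsup>lam i\<^esup>\<close>, are images of \<open>v\<close>
  under graded endomorphisms that commute with \<open>x\<close>.\<close>

lemma mark_level:
  assumes signed: "(lam, eps, mu) \<in> signed_2_bipartitions f0" and x: "x \<in> nilpotent_cone"
    and b: "jordan_basis lam eps x b" and i: "0 < lam i"
  shows "max 0 (mu i) = int (level x (marked_vector lam mu b) (lam i) (eps i))"
proof -
  have lam: "is_partition lam" and mu: "\<And>i. mu i \<le> int (lam i)"
    using signed by (auto simp: signed_2_bipartitions_def marked_colored_partitions_def is_colored_partition_def)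
  have lx: "lin x" by (rule cone_lin[OF x])
  let ?D = "diagram lam" and ?v = "marked_vector lam mu b"
  let ?W = "{(k, p). (k, p) \<in> ?D \<and> int p \<le> mu k}"
  let ?J = "{j. 1 \<le> j \<and> j \<le> lam i \<and>
     (\<forall>w\<in>V (eps i). (x ^^ lam i) w = 0 \<longrightarrow> (\<exists>f\<in>centralizer x. (x ^^ (lam i - j)) w = f ?v))}"
  have v: "?v = (\<Sum>i\<in>{i. mu i > 0}. b i (nat (mu i)))" by (rule marked_vector_eq[OF lam mu])
  have fin: "finite ?D" by (rule finite_diagram[OF lam])
  have top: "b k (lam k) \<in> V (eps k)" if "0 < lam k" for k
    using jordan_basis_color[OF b, of "lam k" k] that by (simp add: box_color_def)
  \<comment> \<open>The marked box of row \<open>k\<close> is the power \<open>nu\<close> of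
    \<open>x\<close> applied to the top box. An endomorphism \<open>f\<close> sends the top box to a
    combination of boxes of its color with \<open>j \<le> lam k\<close>, and
    \<open>signed_dominate\<close> bounds these boxes, lowered by \<open>nu\<close>, by the marks of
    their rows.\<close>
  have image: "f ?v \<in> span ((\<lambda>(i, j). b i j) ` ?W)" if f: "f \<in> centralizer x" for f
  proof -
    have lf: "lin f" and fx: "\<And>u. f (x u) = x (f u)" and fV: "\<And>m u. u \<in> V m \<Longrightarrow> f u \<in> V m"
      using f by (auto simp: centralizer_def)
    have fpow: "f ((x ^^ a) u) = (x ^^ a) (f u)" for a u
      by (induction a) (simp_all add: fx)
    have "f (b k (nat (mu k))) \<in> span ((\<lambda>(i, j). b i j) ` ?W)" if k: "0 < mu k" for k
    proof -
      define nu where "nu = lam k - nat (mu k)"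
      have nu: "int nu = int (lam k) - mu k" "nu \<le> lam k" "lam k - nu = nat (mu k)"
        using mu[of k] k by (simp_all add: nu_def of_nat_diff)
      have lamk: "0 < lam k" using k mu[of k] by linarith
      define t where "t = f (b k (lam k))"
      have "t \<in> V (eps k)" unfolding t_def by (rule fV[OF top[OF lamk]])
      moreover have "(x ^^ lam k) t = 0"
        unfolding t_def fpow[symmetric] by (simp add: jordan_pow[OF b] jordan_basis_0[OF b] lin_0[OF lf])
      ultimately have "t \<in> {u \<in> V (eps k). (x ^^ lam k) u = 0}" by simp
      then obtain c where c: "t = (\<Sum>p\<in>{(i, j). (i, j) \<in> ?D \<and> j \<le> lam k \<and> box_color lam eps i j = eps k}.
          scale (c p) (case p of (i, j) \<Rightarrow> b i j))"
        unfolding kernel_expand[OF b lam lx] by blast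
      have "f (b k (nat (mu k))) = (x ^^ nu) t"
        unfolding t_def fpow[symmetric] by (simp add: jordan_pow[OF b] nu(3))
      also have "\<dots> = (\<Sum>p\<in>{(i, j). (i, j) \<in> ?D \<and> j \<le> lam k \<and> box_color lam eps i j = eps k}.
          scale (c p) (case p of (i, j) \<Rightarrow> b i (j - nu)))"
        unfolding c lin_sum[OF lin_pow[OF lx]] lin_scale[OF lin_pow[OF lx]]
        by (intro sum.cong refl) (auto simp: jordan_pow[OF b] diagram_def)
      also have "\<dots> \<in> span ((\<lambda>(i, j). b i j) ` ?W)"
      proof (intro span_sum span_scale)
        fix p assume p: "p \<in> {(i, j). (i, j) \<in> ?D \<and> j \<le> lam k \<and> box_color lam eps i j = eps k}"
        then obtain i j where ij: "p = (i, j)" "1 \<le> j" "j \<le> lam i" "j \<le> lam k" "box_color lam eps i j = eps k"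
          by (auto simp: diagram_def)
        show "(case p of (i, j) \<Rightarrow> b i (j - nu)) \<in> span ((\<lambda>(i, j). b i j) ` ?W)"
        proof (cases "j \<le> nu")
          case True
          then show ?thesis using ij(1) by (simp add: jordan_basis_0[OF b] span_zero)
        next
          case False
          have e: "int (j - nu) + (int (lam k) - mu k) = int j" using nu(1) False by simp
          have "int (j - nu) \<le> mu i \<and> even (mu i - int (j - nu))"
          proof (rule signed_dominate[OF signed k])
            show "1 \<le> j - nu" using False by simp
            show "eps i + of_int (int (lam i) - (int (j - nu) + (int (lam k) - mu k))) = eps k"
              unfolding e using ij(5) by (simp only: box_color_def)
          qed (use e ij in simp_all)
          then have "(i, j - nu) \<in> ?W" using ij False by (auto simp: diagram_def)
          then show ?thesis using ij(1) by (intro span_base) (force intro: image_eqI[of _ _ "(i, j - nu)"])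
        qed
      qed
      finally show ?thesis .
    qed
    then show ?thesis unfolding v lin_sum[OF lf] by (intro span_sum) simp
  qed
  \<comment> \<open>Test the condition on the top box of row \<open>i\<close>: it puts
    \<open>b i j\<close> into the span of the boxes at or below the marks.\<close>
  have upper: "int j \<le> mu i" if j: "j \<in> ?J" for j
  proof -
    have "b i (lam i) \<in> V (eps i)" "(x ^^ lam i) (b i (lam i)) = 0"
      using top[OF i] by (simp_all add: jordan_pow[OF b] jordan_basis_0[OF b])
    then obtain f where f: "f \<in> centralizer x" "(x ^^ (lam i - j)) (b i (lam i)) = f ?v" using j by blast
    have jD: "(i, j) \<in> ?D" using j by (auto simp: diagram_def)
    have "(x ^^ (lam i - j)) (b i (lam i)) = b i j"
      using j by (simp add: jordan_pow[OF b])
    then have "b i j \<in> span ((\<lambda>(i, j). b i j) ` ?W)" using image[OF f(1)] f(2) by simp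
    moreover have finW: "finite ?W" by (rule finite_subset[OF _ fin]) auto
    ultimately obtain c where c: "b i j = (\<Sum>p\<in>?W. scale (c p) (case p of (i, j) \<Rightarrow> b i j))"
      using span_family[OF finW, of "b i j" "\<lambda>(i, j). b i j"] by blast
    have "(\<Sum>p\<in>?D. scale (if p \<in> ?W then c p else 0) (case p of (i, j) \<Rightarrow> b i j)) = b i j"
      unfolding c using fin by (intro sum.mono_neutral_cong_right) auto
    also have "\<dots> = (\<Sum>p\<in>?D. scale (if p = (i, j) then 1 else 0) (case p of (i, j) \<Rightarrow> b i j))"
    proof -
      have "(\<Sum>p\<in>?D. scale (if p = (i, j) then 1 else 0) (case p of (i, j) \<Rightarrow> b i j)) = (\<Sum>p\<in>?D. if p = (i, j) then b i j else 0)"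
        by (intro sum.cong refl) auto
      then show ?thesis using fin jD by simp
    qed
    finally have "(if (i, j) \<in> ?W then c (i, j) else 0) = (if (i, j) = (i, j) then 1 else 0)"
      by (rule fbasis_unique[OF jordan_basis_fbasis[OF b] _ jD])
    then show ?thesis by (auto split: if_splits)
  qed
  have lower: "nat (mu i) \<in> ?J" if mui: "0 < mu i"
  proof -
    have "\<exists>f\<in>centralizer x. (x ^^ (lam i - nat (mu i))) w = f ?v" if w: "w \<in> V (eps i)" "(x ^^ lam i) w = 0" for w
    proof -
      \<comment> \<open>\<open>f\<close> sends the top box of row \<open>i\<close> to
        \<open>w\<close> and kills the other rows. It commutes with the shift because
        \<open>(x ^^ lam i) w = 0\<close>, and it sees only the mark of row
        \<open>i\<close>.\<close>
      obtain f where f: "lin f" "\<forall>p\<in>?D. f ((\<lambda>(i, j). b i j) p) = (\<lambda>(k, j). if k = i then (x ^^ (lam i - j)) w else 0) p"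
        using fbasis_extend[OF jordan_basis_fbasis[OF b]] by blast
      have fb: "f (b k j) = (if k = i then (x ^^ (lam i - j)) w else 0)" if "j \<le> lam k" for k j
      proof (cases "j = 0")
        case True
        then show ?thesis using w(2) lin_0[OF f(1)] by (simp add: jordan_basis_0[OF b])
      next
        case False
        then have "(k, j) \<in> ?D" using that by (simp add: diagram_def)
        then show ?thesis using f(2) by fastforce
      qed
      have "(\<lambda>u. f (x u)) = (\<lambda>u. x (f u))"
      proof (rule fbasis_lin_eq[OF jordan_basis_fbasis[OF b] lin_comp[OF f(1) lx] lin_comp[OF lx f(1)]])
        fix p assume p: "p \<in> ?D"
        obtain k j where kj: "p = (k, j)" by (cases p)
        have j: "1 \<le> j" "j \<le> lam k" using p kj by (auto simp: diagram_def)
        have "f (x (b k j)) = f (b k (j - 1))" using jordan_basis_step[OF b j(2)] by simp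
        also have "\<dots> = (if k = i then (x ^^ (lam i - (j - 1))) w else 0)" using j by (intro fb) simp
        also have "\<dots> = x (f (b k j))"
        proof (cases "k = i")
          case True
          then have "lam i - (j - 1) = Suc (lam i - j)" using j by simp
          then show ?thesis using True fb[OF j(2)] by simp
        next
          case False
          then show ?thesis using fb[OF j(2)] lin_0[OF lx] by simp
        qed
        finally show "f (x (case p of (i, j) \<Rightarrow> b i j)) = x (f (case p of (i, j) \<Rightarrow> b i j))" by (simp add: kj)
      qed
      then have "\<And>u. f (x u) = x (f u)" by meson
      moreover have "f u \<in> V m" if "u \<in> V m" for u m
      proof (rule fbasis_graded[OF jordan_basis_fbasis[OF b] _ f(1) _ that, of "\<lambda>(i, j). box_color lam eps i j"])
        fix p assume p: "p \<in> ?D"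
        obtain k j where kj: "p = (k, j)" by (cases p)
        have j: "1 \<le> j" "j \<le> lam k" using p kj by (auto simp: diagram_def)
        show "(case p of (i, j) \<Rightarrow> b i j) \<in> V (case p of (i, j) \<Rightarrow> box_color lam eps i j)"
          using jordan_basis_color[OF b j] by (simp add: kj)
        have "(x ^^ (lam i - j)) w \<in> V (eps i + of_nat (lam i - j))" by (rule cone_pow_color[OF x w(1)])
        then have "(x ^^ (lam i - j)) w \<in> V (box_color lam eps i j)" if "k = i"
          using j that by (simp add: box_color_def of_nat_diff)
        then show "f (case p of (i, j) \<Rightarrow> b i j) \<in> V (case p of (i, j) \<Rightarrow> box_color lam eps i j)"
          using fb[OF j(2)] V_0 by (auto simp: kj)
      qed
      ultimately have "f \<in> centralizer x" using f(1) by (simp add: centralizer_def)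
      moreover have "f ?v = (x ^^ (lam i - nat (mu i))) w"
      proof -
        have finM: "finite {k. mu k > 0}"
        proof (rule finite_subset)
          show "{k. mu k > 0} \<subseteq> {..<part_length lam}"
          proof
            fix k assume "k \<in> {k. mu k > 0}"
            then have "0 < lam k" using mu[of k] by simp
            then show "k \<in> {..<part_length lam}" using partition_support[OF lam] by simp
          qed
        qed simp
        have "f ?v = (\<Sum>k\<in>{k. mu k > 0}. if k = i then (x ^^ (lam i - nat (mu i))) w else 0)"
          unfolding v lin_sum[OF f(1)] using mu by (intro sum.cong refl) (subst fb, auto simp: nat_le_iff)
        then show ?thesis using finM mui by simp
      qed
      ultimately show ?thesis by metis
    qed
    then show ?thesis using mui mu[of i] by (simp add: nat_le_iff)
  qed
  have finJ: "finite (insert 0 ?J)" by (rule finite_subset[of _ "{..lam i}"]) auto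
  show ?thesis
  proof (cases "0 < mu i")
    case True
    have "Max (insert 0 ?J) = nat (mu i)"
      using lower[OF True] upper True by (intro Max_eqI finJ) (auto simp: le_nat_iff)
    then show ?thesis using True by (simp add: level_def)
  next
    case False
    have "?J = {}" using upper False by fastforce
    then show ?thesis using False by (simp only: level_def) simp
  qed
qed

lemma signed_determined:
  assumes signed: "(lam, eps, mu) \<in> signed_2_bipartitions f" "(alpha, beta, gamma) \<in> signed_2_bipartitions f"
    and x: "x \<in> nilpotent_cone" and b: "jordan_basis lam eps x b" "jordan_basis alpha beta x b'"
    and v: "marked_vector lam mu b = marked_vector alpha gamma b'"
  shows "((lam, eps, mu), (alpha, beta, gamma)) \<in> weak_equivalence f"
proof -
  have marked: "(lam, eps, mu) \<in> marked_colored_partitions f" "(alpha, beta, gamma) \<in> marked_colored_partitions f"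
    using signed by (auto simp: signed_2_bipartitions_def)
  then have colored: "is_colored_partition lam eps" "is_colored_partition alpha beta"
    and mu: "\<And>i. mu i \<le> int (lam i)" "\<And>i. gamma i \<le> int (alpha i)"
    by (auto simp: marked_colored_partitions_def)
  obtain s where s: "bij s" "alpha = lam \<circ> s" "beta = eps \<circ> s"
    using exists_row_bijection[OF colored cone_lin[OF x] b] by blast
  have "gamma i = mu (s i)" if pos: "gamma i > 0 \<or> mu (s i) > 0" for i
  proof -
    have eq: "alpha i = lam (s i)" "beta i = eps (s i)" using s by simp_all
    have "0 < lam (s i)" using pos mu(1)[of "s i"] mu(2)[of i] eq by linarith
    then have "max 0 (mu (s i)) = max 0 (gamma i)"
      using mark_level[OF signed(1) x b(1), of "s i"] mark_level[OF signed(2) x b(2), of i] eq v by simp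
    then show ?thesis using pos by (auto simp: max_def split: if_splits)
  qed
  then show ?thesis using marked s unfolding weak_equivalence_def by blast
qed

lemma signed_vector_homogeneous:
  assumes signed: "(lam, eps, mu) \<in> signed_2_bipartitions f" and b: "jordan_basis lam eps x b"
  shows "marked_vector lam mu b \<in> homogeneous_vectors"
proof -
  have mu: "mu i \<le> int (lam i)" for i
    using signed by (auto simp: signed_2_bipartitions_def marked_colored_partitions_def)
  define c0 where "c0 = eps 0 + of_int (int (lam 0) - mu 0)"
  have color: "eps i + of_int (int (lam i) - mu i) = c0" for i
    using signed unfolding c0_def by (auto simp: signed_2_bipartitions_def Let_def)
  have "(if mu i > 0 then b i (nat (mu i)) else 0) \<in> V c0" for i
  proof (cases "mu i > 0")
    case True
    then have "box_color lam eps i (nat (mu i)) = c0" using color[of i] by (simp add: box_color_def)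
    then show ?thesis using jordan_basis_color[OF b, of "nat (mu i)" i] True mu[of i] by (simp add: nat_le_iff)
  qed (simp add: V_0)
  then have "marked_vector lam mu b \<in> V c0"
    unfolding marked_vector_def by (intro V_setsum)
  then show ?thesis using bit_cases[of c0] by (auto simp: homogeneous_vectors_def)
qed

theorem bij_betw_Psi:
  "bij_betw (\<lambda>C. the_elem (Psi ` C)) (signed_2_bipartition_classes space_signature) orbit_space"
proof -
  let ?r = "weak_equivalence space_signature" and ?A = "marked_colored_partitions space_signature"
  let ?S = "signed_2_bipartitions space_signature"
  have eq: "equiv ?A ?r" by (rule equiv_weak_equivalence)
  have val: "the_elem (Psi ` C) = Psi p" if C: "C \<in> ?A // ?r" and p: "p \<in> C" for C p
  proof -
    have "Psi p' = Psi p" if "p' \<in> C" for p'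
    proof -
      have "(p', p) \<in> ?r" by (rule iffD1[OF quotient_eq_iff[OF eq C C that p] refl])
      then show ?thesis by (rule congruentD[OF Psi_respects])
    qed
    then have "Psi ` C \<subseteq> {Psi p}" by (intro image_subsetI) simp
    moreover have "Psi p \<in> Psi ` C" by (rule imageI[OF p])
    ultimately have "Psi ` C = {Psi p}" by (intro subset_antisym) simp_all
    then show ?thesis by simp
  qed
  have rep: "\<exists>lam eps mu x b. p = (lam, eps, mu) \<and> is_partition lam \<and> (\<forall>i. mu i \<le> int (lam i)) \<and>
      x \<in> nilpotent_cone \<and> jordan_basis lam eps x b \<and> Psi p = K_orbit (marked_vector lam mu b, x)"
    if p: "p \<in> ?S" for p
  proof -
    obtain lam eps mu where pp: "p = (lam, eps, mu)" by (cases p)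
    have *: "is_partition lam" "\<And>i. mu i \<le> int (lam i)" "part_signature lam eps = space_signature"
      using p pp by (auto simp: signed_2_bipartitions_def marked_colored_partitions_def is_colored_partition_def)
    obtain x b where "x \<in> nilpotent_cone" "jordan_basis lam eps x b"
      using exists_jordan_basis_type[OF *(1,3)] by blast
    then show ?thesis using pp * Psi_eq_orbit[OF *(1,2)] by blast
  qed
  have signed_A: "?S \<subseteq> ?A" by (auto simp: signed_2_bipartitions_def)
  show ?thesis
    unfolding bij_betw_def
  proof
    show "inj_on (\<lambda>C. the_elem (Psi ` C)) (signed_2_bipartition_classes space_signature)"
    proof (rule inj_onI)
      fix C C' assume CC: "C \<in> signed_2_bipartition_classes space_signature" "C' \<in> signed_2_bipartition_classes space_signature"
        and e: "the_elem (Psi ` C) = the_elem (Psi ` C')"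
      obtain p where p: "p \<in> C" "p \<in> ?S" "C \<in> ?A // ?r" using CC by (auto simp: signed_2_bipartition_classes_def)
      obtain p' where p': "p' \<in> C'" "p' \<in> ?S" "C' \<in> ?A // ?r" using CC by (auto simp: signed_2_bipartition_classes_def)
      have PP: "Psi p = Psi p'" using e val[OF p(3,1)] val[OF p'(3,1)] by simp
      obtain lam eps mu x b where 1: "p = (lam, eps, mu)" "is_partition lam" "x \<in> nilpotent_cone" "jordan_basis lam eps x b"
        using rep[OF p(2)] by blast
      obtain alpha beta gamma where 2: "p' = (alpha, beta, gamma)" by (cases p')
      have part: "is_partition alpha"
        using p'(2) 2 by (auto simp: signed_2_bipartitions_def marked_colored_partitions_def is_colored_partition_def)
      \<comment> \<open>A single point of the common orbit carries Jordan bases of both types for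
        the same \<open>x\<close>, which is the situation of
        \<open>signed_determined\<close>.\<close>
      have "(marked_vector lam mu b, x) \<in> Psi p'"
        unfolding PP[symmetric] 1(1) Psi_eq[OF 1(2)] using 1(3,4) by blast
      then obtain b' where "jordan_basis alpha beta x b'" "marked_vector lam mu b = marked_vector alpha gamma b'"
        unfolding 2 Psi_eq[OF part] by blast
      then have "(p, p') \<in> ?r"
        using signed_determined p(2) p'(2) 1 2 by blast
      then show "C = C'" using quotient_eqI[OF eq p(3) p'(3) p(1) p'(1)] by blast
    qed
    show "(\<lambda>C. the_elem (Psi ` C)) ` signed_2_bipartition_classes space_signature = orbit_space"
    proof
      show "(\<lambda>C. the_elem (Psi ` C)) ` signed_2_bipartition_classes space_signature \<subseteq> orbit_space"
      proof
        fix O' assume "O' \<in> (\<lambda>C. the_elem (Psi ` C)) ` signed_2_bipartition_classes space_signature"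
        then obtain C where C: "C \<in> signed_2_bipartition_classes space_signature" "O' = the_elem (Psi ` C)" by blast
        obtain p where p: "p \<in> C" "p \<in> ?S" "C \<in> ?A // ?r" using C(1) by (auto simp: signed_2_bipartition_classes_def)
        obtain lam eps mu x b where 1: "p = (lam, eps, mu)" "x \<in> nilpotent_cone" "jordan_basis lam eps x b"
          "Psi p = K_orbit (marked_vector lam mu b, x)"
          using rep[OF p(2)] by blast
        have "marked_vector lam mu b \<in> homogeneous_vectors"
          using signed_vector_homogeneous[OF _ 1(3)] p(2) 1(1) by blast
        then show "O' \<in> orbit_space"
          unfolding C(2) val[OF p(3,1)] 1(4) orbit_space_def using 1(2) by blast
      qed
      show "orbit_space \<subseteq> (\<lambda>C. the_elem (Psi ` C)) ` signed_2_bipartition_classes space_signature"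
      proof
        fix O' assume "O' \<in> orbit_space"
        then obtain v x where vx: "v \<in> homogeneous_vectors" "x \<in> nilpotent_cone" "O' = K_orbit (v, x)"
          by (auto simp: orbit_space_def)
        obtain c0 where "v \<in> V c0" using vx(1) by (auto simp: homogeneous_vectors_def)
        then obtain lam eps mu b where 1: "(lam, eps, mu) \<in> ?S" "jordan_basis lam eps x b" "v = marked_vector lam mu b"
          using exists_signed[OF vx(2)] by blast
        have *: "is_partition lam" "\<And>i. mu i \<le> int (lam i)"
          using 1(1) by (auto simp: signed_2_bipartitions_def marked_colored_partitions_def is_colored_partition_def)
        define C where "C = ?r `` {(lam, eps, mu)}"
        have C: "C \<in> ?A // ?r" using 1(1) signed_A by (auto simp: C_def intro: quotientI)
        have pC: "(lam, eps, mu) \<in> C"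
          unfolding C_def using 1(1) signed_A by (intro equiv_class_self[OF eq]) blast
        have "C \<in> signed_2_bipartition_classes space_signature"
          using C pC 1(1) by (auto simp: signed_2_bipartition_classes_def)
        moreover have "O' = the_elem (Psi ` C)"
          unfolding val[OF C pC] Psi_eq_orbit[OF * vx(2) 1(2)] vx(3) 1(3) ..
        ultimately show "O' \<in> (\<lambda>C. the_elem (Psi ` C)) ` signed_2_bipartition_classes space_signature" by blast
      qed
    qed
  qed
qed

section \<open>Coordinates over the algebraic closure\<close>

definition coef :: "'i set \<Rightarrow> ('i \<Rightarrow> 'v) \<Rightarrow> 'v \<Rightarrow> 'i \<Rightarrow> 'a" where
  "coef I b u p = (if p \<in> I then (SOME c. u = (\<Sum>p\<in>I. scale (c p) (b p))) p else 0)"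

lemma coef_sum:
  assumes "fbasis I b"
  shows "u = (\<Sum>p\<in>I. scale (coef I b u p) (b p))"
proof -
  have "u = (\<Sum>p\<in>I. scale ((SOME c. u = (\<Sum>p\<in>I. scale (c p) (b p))) p) (b p))"
    by (rule someI_ex[OF fbasis_expand[OF assms]])
  then show ?thesis by (simp add: coef_def)
qed

lemma coef_outside: "p \<notin> I \<Longrightarrow> coef I b u p = 0"
  by (simp add: coef_def)

lemma coef_eqI:
  assumes "fbasis I b" "u = (\<Sum>p\<in>I. scale (c p) (b p))" "p \<in> I"
  shows "coef I b u p = c p"
  by (rule fbasis_unique[OF assms(1) _ assms(3)]) (use coef_sum[OF assms(1), of u] assms(2) in simp)

lemma coef_lin:
  assumes "fbasis I b"
  shows "coef I b (\<Sum>k\<in>K. scale (r k) (u k)) p = (\<Sum>k\<in>K. r k * coef I b (u k) p)"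
proof (cases "p \<in> I")
  case True
  show ?thesis
  proof (rule coef_eqI[OF assms _ True])
    have "(\<Sum>k\<in>K. scale (r k) (u k)) = (\<Sum>k\<in>K. scale (r k) (\<Sum>p\<in>I. scale (coef I b (u k) p) (b p)))"
      by (intro sum.cong refl arg_cong2[of _ _ _ _ scale] coef_sum assms)
    also have "\<dots> = (\<Sum>k\<in>K. \<Sum>p\<in>I. scale (r k * coef I b (u k) p) (b p))"
      by (simp add: scale_sum_right)
    also have "\<dots> = (\<Sum>p\<in>I. \<Sum>k\<in>K. scale (r k * coef I b (u k) p) (b p))"
      by (rule sum.swap)
    also have "\<dots> = (\<Sum>p\<in>I. scale (\<Sum>k\<in>K. r k * coef I b (u k) p) (b p))"
      by (simp add: scale_sum_left)
    finally show "(\<Sum>k\<in>K. scale (r k) (u k)) = (\<Sum>p\<in>I. scale (\<Sum>k\<in>K. r k * coef I b (u k) p) (b p))" .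
  qed
qed (simp add: coef_outside)

lemma coef_basis:
  assumes "fbasis I b" "q \<in> I"
  shows "coef I b (b q) p = (if p = q then 1 else 0)"
proof (cases "p \<in> I")
  case True
  have "b q = (\<Sum>p\<in>I. scale (if p = q then 1 else 0) (b p))"
  proof -
    have "(\<Sum>p\<in>I. scale (if p = q then 1 else 0) (b p)) = (\<Sum>p\<in>I. if p = q then b q else 0)"
      by (intro sum.cong) auto
    then show ?thesis using assms fbasis_finite[OF assms(1)] by simp
  qed
  then show ?thesis by (rule coef_eqI[OF assms(1) _ True])
qed (use assms in \<open>auto simp: coef_outside\<close>)

definition coords :: "'i set \<Rightarrow> ('i \<Rightarrow> 'v) \<Rightarrow> 'v \<Rightarrow> 'i \<Rightarrow> 'a alg_closure" where
  "coords I b u = (\<lambda>p. to_ac (coef I b u p))"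

definition transition :: "'i set \<Rightarrow> ('i \<Rightarrow> 'v) \<Rightarrow> 'j set \<Rightarrow> ('j \<Rightarrow> 'v) \<Rightarrow> 'i \<Rightarrow> 'j \<Rightarrow> 'a alg_closure" where
  "transition I b J b' p q = (if q \<in> J then to_ac (coef I b (b' q) p) else 0)"

definition matrix_of :: "'i set \<Rightarrow> ('i \<Rightarrow> 'v) \<Rightarrow> ('v \<Rightarrow> 'v) \<Rightarrow> 'i \<Rightarrow> 'i \<Rightarrow> 'a alg_closure" where
  "matrix_of I b x p q = (if q \<in> I then to_ac (coef I b (x (b q)) p) else 0)"

text \<open>Composition of coordinates over the intermediate basis \<open>b'\<close>; with
  \<open>f\<close> the identity or \<open>x\<close> it yields the product rules for
  \<open>transition\<close> and \<open>matrix_of\<close> below.\<close>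

lemma coef_compose:
  assumes b: "fbasis I b" and b': "fbasis J b'" and f: "lin f"
  shows "(\<Sum>q\<in>J. to_ac (coef I b (f (b' q)) p) * to_ac (coef J b' u q)) = to_ac (coef I b (f u) p)"
proof -
  have "f u = (\<Sum>q\<in>J. scale (coef J b' u q) (f (b' q)))"
    by (subst coef_sum[OF b', of u]) (simp add: lin_sum[OF f] lin_scale[OF f])
  then have "coef I b (f u) p = (\<Sum>q\<in>J. coef J b' u q * coef I b (f (b' q)) p)"
    by (simp add: coef_lin[OF b])
  then show ?thesis by (simp add: to_ac_sum mult.commute)
qed

lemma lin_id: "lin (\<lambda>u. u)"
  by (rule linI) simp_all

lemma transition_mult:
  assumes "fbasis I b" "fbasis J b'"
  shows "mmul J (transition I b J b') (transition J b' K b'') = transition I b K b''"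
proof (intro ext)
  fix p q
  show "mmul J (transition I b J b') (transition J b' K b'') p q = transition I b K b'' p q"
    using coef_compose[OF assms lin_id, of p "b'' q"] by (simp add: mmul_def transition_def)
qed

lemma transition_self:
  assumes "fbasis I b"
  shows "transition I b I b = idm I"
  by (intro ext) (auto simp: transition_def idm_def coef_basis[OF assms])

lemma transition_coords:
  assumes "fbasis I b" "fbasis J b'"
  shows "mvec J (transition I b J b') (coords J b' u) = coords I b u"
proof
  fix p
  show "mvec J (transition I b J b') (coords J b' u) p = coords I b u p"
    using coef_compose[OF assms lin_id, of p u] by (simp add: mvec_def transition_def coords_def)
qed

lemma transition_matrix:
  assumes b: "fbasis I b" and b': "fbasis J b'" and x: "lin x"
  shows "mmul J (mmul J (transition I b J b') (matrix_of J b' x)) (transition J b' I b) = matrix_of I b x"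
proof (intro ext)
  fix p r
  have 1: "mmul J (transition I b J b') (matrix_of J b' x) p q = to_ac (coef I b (x (b' q)) p)" if "q \<in> J" for q
    using coef_compose[OF b b' lin_id, of p "x (b' q)"] that
    by (simp add: mmul_def transition_def matrix_of_def)
  have "mmul J (mmul J (transition I b J b') (matrix_of J b' x)) (transition J b' I b) p r
      = (\<Sum>q\<in>J. to_ac (coef I b (x (b' q)) p) * transition J b' I b q r)"
    unfolding mmul_def[of J "mmul J (transition I b J b') (matrix_of J b' x)"] by (simp add: 1)
  also have "\<dots> = matrix_of I b x p r"
    using coef_compose[OF b b' x, of p "b r"] by (simp add: transition_def matrix_of_def)
  finally show "mmul J (mmul J (transition I b J b') (matrix_of J b' x)) (transition J b' I b) p r = matrix_of I b x p r" .
qed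

lemma transition_graded:
  fixes I :: "'i set" and J :: "'j set" and col :: "'i \<Rightarrow> bit" and col' :: "'j \<Rightarrow> bit"
  assumes "fbasis I b" "\<And>p. p \<in> I \<Longrightarrow> b p \<in> V (col p)" "\<And>q. q \<in> J \<Longrightarrow> b' q \<in> V (col' q)"
    and ne: "transition I b J b' p q \<noteq> 0"
  shows "p \<in> I \<and> q \<in> J \<and> col p = col' q"
proof -
  have q: "q \<in> J" and c: "coef I b (b' q) p \<noteq> 0" using ne by (auto simp: transition_def split: if_splits)
  then have p: "p \<in> I" using coef_outside by metis
  have "col p = col' q"
  proof (rule ccontr)
    assume n: "col p \<noteq> col' q"
    have "(\<Sum>p\<in>I. scale (coef I b (b' q) p) (b p)) \<in> V (col' q)"
      using coef_sum[OF assms(1), of "b' q"] assms(3)[OF q] by simp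
    from homogeneous_coefficients[OF assms(1,2) this p n] c show False by simp
  qed
  then show ?thesis using p q by simp
qed

lemma matrix_of_jordan:
  assumes b: "jordan_basis lam eps x b"
  shows "matrix_of (diagram lam) (\<lambda>(i, j). b i j) x = shift_matrix lam"
proof (intro ext)
  fix p q :: "nat \<times> nat"
  obtain i j where q: "q = (i, j)" by (cases q)
  note fb = jordan_basis_fbasis[OF b]
  show "matrix_of (diagram lam) (\<lambda>(i, j). b i j) x p q = shift_matrix lam p q"
  proof (cases "q \<in> diagram lam")
    case True
    then have j: "1 \<le> j" "j \<le> lam i" using q by (auto simp: diagram_def)
    show ?thesis
    proof (cases "j = 1")
      case True
      have "coef (diagram lam) (\<lambda>(i, j). b i j) 0 p = 0"
        using coef_lin[OF fb, of "\<lambda>_. 0" "\<lambda>_. 0" "{}" p] by simp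
      then have "matrix_of (diagram lam) (\<lambda>(i, j). b i j) x p q = 0"
        using jordan_basis_step[OF b j(2)] True q by (simp add: matrix_of_def jordan_basis_0[OF b])
      then show ?thesis using True q by (auto simp: shift_matrix_def diagram_def)
    next
      case False
      then have m: "(i, j - 1) \<in> diagram lam" using j by (auto simp: diagram_def)
      have "x (b i j) = (\<lambda>(i, j). b i j) (i, j - 1)" using jordan_basis_step[OF b j(2)] by simp
      then have "matrix_of (diagram lam) (\<lambda>(i, j). b i j) x p q = (if p = (i, j - 1) then 1 else 0)"
        using coef_basis[OF fb m, of p] True q by (simp add: matrix_of_def)
      then show ?thesis using True m j q False by (cases p) (auto simp: shift_matrix_def)
    qed
  qed (simp add: matrix_of_def shift_matrix_def)
qed

lemma coords_marked_vector:
  assumes b: "jordan_basis lam eps x b" and lam: "is_partition lam" and mu: "\<And>i. mu i \<le> int (lam i)"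
  shows "coords (diagram lam) (\<lambda>(i, j). b i j) (marked_vector lam mu b) = mark_vector lam mu"
proof
  fix p
  note fb = jordan_basis_fbasis[OF b]
  let ?D = "diagram lam"
  have fin: "finite ?D" by (rule finite_diagram[OF lam])
  have "marked_vector lam mu b = (\<Sum>p\<in>?D. scale (if int (snd p) = mu (fst p) then 1 else 0) ((\<lambda>(i, j). b i j) p))"
  proof -
    have "(\<Sum>p\<in>?D. scale (if int (snd p) = mu (fst p) then 1 else 0) ((\<lambda>(i, j). b i j) p))
        = (\<Sum>i<part_length lam. \<Sum>j = 1..lam i. if int j = mu i then b i j else 0)"
      unfolding sum_diagram_rows[OF lam] by (intro sum.cong refl) simp
    also have "\<dots> = (\<Sum>i<part_length lam. if mu i > 0 then b i (nat (mu i)) else 0)"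
    proof (rule sum.cong[OF refl])
      fix i
      show "(\<Sum>j = 1..lam i. if int j = mu i then b i j else 0) = (if mu i > 0 then b i (nat (mu i)) else 0)"
      proof (cases "mu i > 0")
        case True
        have "(\<Sum>j = 1..lam i. if int j = mu i then b i j else 0) = (\<Sum>j = 1..lam i. if j = nat (mu i) then b i (nat (mu i)) else 0)"
          using True by (intro sum.cong) auto
        then show ?thesis using True mu[of i] by (simp add: nat_le_iff Suc_le_eq)
      next
        case False
        then have "(\<Sum>j = 1..lam i. if int j = mu i then b i j else 0) = 0" by (intro sum.neutral) auto
        then show ?thesis using False by simp
      qed
    qed
    finally show ?thesis by (simp add: marked_vector_def)
  qed
  then have "coef ?D (\<lambda>(i, j). b i j) (marked_vector lam mu b) p = (if int (snd p) = mu (fst p) then 1 else 0)"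
    if "p \<in> ?D" by (rule coef_eqI[OF fb _ that])
  then show "coords ?D (\<lambda>(i, j). b i j) (marked_vector lam mu b) p = mark_vector lam mu p"
    by (cases "p \<in> ?D") (simp_all add: coords_def mark_vector_def coef_outside)
qed

definition basis_color :: "'v \<Rightarrow> bit" where
  "basis_color u = (if u \<in> V 0 then 0 else 1)"

lemma adapted_basis_color:
  assumes "adapted_basis B" "u \<in> B"
  shows "u \<in> V m \<longleftrightarrow> basis_color u = m"
proof -
  have "u \<noteq> 0" using assms dependent_zero by (auto simp: adapted_basis_def)
  moreover have "u \<in> V 0 \<or> u \<in> V 1" using assms by (auto simp: adapted_basis_def)
  ultimately show ?thesis
    using V_disjoint bit_cases[of m] by (auto simp: basis_color_def)
qed

lemma adapted_basis_fbasis: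
  assumes "adapted_basis B"
  shows "finite B" "fbasis B (\<lambda>u. u)"
proof -
  show "finite B" using assms finiteI_independent by (auto simp: adapted_basis_def)
  then show "fbasis B (\<lambda>u. u)" using fbasis_iff[of B "\<lambda>u. u"] assms by (simp add: adapted_basis_def)
qed

lemma adapted_basis_representation:
  assumes "adapted_basis B" "p \<in> B"
  shows "representation B u p = coef B (\<lambda>u. u) u p"
proof (rule coef_eqI[OF adapted_basis_fbasis(2)[OF assms(1)] _ assms(2), symmetric])
  show "u = (\<Sum>p\<in>B. scale (representation B u p) p)"
    using assms sum_representation_eq[of B u B] adapted_basis_fbasis(1)[OF assms(1)]
    by (simp add: adapted_basis_def)
qed

lemma geometric_group_eq:
  assumes "adapted_basis B"
  shows "geometric_group B = graded_index.block_group B basis_color"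
proof -
  interpret graded_index B basis_color by unfold_locales (rule adapted_basis_fbasis(1)[OF assms])
  have pos: "(\<exists>m. b \<in> B \<inter> V m \<and> c \<in> B \<inter> V m) \<longleftrightarrow> (b, c) \<in> positions" for b c
    using adapted_basis_color[OF assms] by (auto simp: positions_def)
  have prod: "(\<forall>b\<in>B. \<forall>c\<in>B. (\<Sum>d\<in>B. g b d * h d c) = (if b = c then 1 else 0)) \<longleftrightarrow> mmul B g h = idm B"
    if z: "\<And>b c. g b c \<noteq> 0 \<or> h b c \<noteq> 0 \<Longrightarrow> (b, c) \<in> positions" for g h :: "'v \<Rightarrow> 'v \<Rightarrow> 'a alg_closure"
  proof
    assume eq: "\<forall>b\<in>B. \<forall>c\<in>B. (\<Sum>d\<in>B. g b d * h d c) = (if b = c then 1 else 0)"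
    show "mmul B g h = idm B"
    proof (intro ext)
      fix b c
      show "mmul B g h b c = idm B b c"
      proof (cases "b \<in> B \<and> c \<in> B")
        case True
        then show ?thesis using eq by (simp add: mmul_def idm_def)
      next
        case False
        then have "g b d * h d c = 0" for d using z[of b d] z[of d c] by (auto simp: positions_def)
        then have "mmul B g h b c = 0" unfolding mmul_def by (intro sum.neutral) blast
        then show ?thesis using False by (auto simp: idm_def)
      qed
    qed
  next
    assume "mmul B g h = idm B"
    then show "\<forall>b\<in>B. \<forall>c\<in>B. (\<Sum>d\<in>B. g b d * h d c) = (if b = c then 1 else 0)"
      by (auto simp: mmul_def idm_def fun_eq_iff)
  qed
  have "(g, h) \<in> geometric_group B \<longleftrightarrow> (g, h) \<in> block_group" for g h
  proof (cases "\<forall>b c. g b c \<noteq> 0 \<or> h b c \<noteq> 0 \<longrightarrow> (b, c) \<in> positions")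
    case True
    then have "mmul B g h = idm B \<longleftrightarrow> (\<forall>b\<in>B. \<forall>c\<in>B. (\<Sum>d\<in>B. g b d * h d c) = (if b = c then 1 else 0))"
      "mmul B h g = idm B \<longleftrightarrow> (\<forall>b\<in>B. \<forall>c\<in>B. (\<Sum>d\<in>B. h b d * g d c) = (if b = c then 1 else 0))"
      using prod[of g h] prod[of h g] by blast+
    then show ?thesis
      unfolding geometric_group_def block_group_def pos using True by simp
  next
    case False
    then show ?thesis unfolding geometric_group_def block_group_def pos by blast
  qed
  then show ?thesis by auto
qed

lemma geometric_vector_eq:
  assumes "adapted_basis B"
  shows "geometric_vector B g v = mvec B g (coords B (\<lambda>u. u) v)"
  by (intro ext) (simp add: geometric_vector_def mvec_def coords_def adapted_basis_representation[OF assms])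

lemma geometric_conjugate_eq:
  assumes "adapted_basis B"
  shows "geometric_conjugate B g h x = (\<lambda>(b, c). mmul B (mmul B g (matrix_of B (\<lambda>u. u) x)) h b c)"
proof (intro ext, clarify)
  fix b c
  have "geometric_conjugate B g h x (b, c) = (\<Sum>d\<in>B. \<Sum>e\<in>B. g b d * matrix_of B (\<lambda>u. u) x d e * h e c)"
    by (simp add: geometric_conjugate_def matrix_of_def adapted_basis_representation[OF assms])
  also have "\<dots> = mmul B (mmul B g (matrix_of B (\<lambda>u. u) x)) h b c"
    unfolding mmul_def sum_distrib_right by (rule sum.swap)
  finally show "geometric_conjugate B g h x (b, c) = mmul B (mmul B g (matrix_of B (\<lambda>u. u) x)) h b c" .
qed

text \<open>The coordinate change from \<open>b0\<close> to \<open>b'\<close> is fixed while \<open>b\<close> varies: all Jordan bases of a given type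
  yield the same geometric orbit, up to a linear map that does not depend on them.\<close>

lemma transport:
  fixes I :: "'i set" and J :: "'j set" and col :: "'i \<Rightarrow> bit" and col' :: "'j \<Rightarrow> bit"
  assumes fb: "fbasis I b" "\<And>p. p \<in> I \<Longrightarrow> b p \<in> V (col p)"
    and fb0: "fbasis I b0" "\<And>p. p \<in> I \<Longrightarrow> b0 p \<in> V (col p)"
    and fB: "fbasis J b'" "\<And>p. p \<in> J \<Longrightarrow> b' p \<in> V (col' p)"
    and gh: "(g, h) \<in> graded_index.block_group J col'" and x: "lin x"
  shows "\<exists>g' h'. (g', h') \<in> graded_index.block_group I col \<and>
    (\<forall>u. mvec J g (coords J b' u) = mvec I (transition J b' I b0) (mvec I g' (coords I b u))) \<and>
    mmul J (mmul J g (matrix_of J b' x)) h =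
      mmul I (mmul I (transition J b' I b0) (mmul I (mmul I g' (matrix_of I b x)) h')) (transition I b0 J b')"
proof -
  interpret GI: graded_index I col by unfold_locales (rule fbasis_finite[OF fb(1)])
  interpret GJ: graded_index J col' by unfold_locales (rule fbasis_finite[OF fB(1)])
  let ?Tz = "transition J b' I b0" and ?Sz = "transition I b0 J b'"
  let ?T = "transition J b' I b" and ?S = "transition I b J b'"
  have TS: "mmul I ?Tz ?Sz = idm J" "mmul J ?Sz ?Tz = idm I" "mmul I ?T ?S = idm J" "mmul J ?S ?T = idm I"
    using transition_mult[OF fB(1) fb0(1), of J b'] transition_mult[OF fb0(1) fB(1), of I b0]
      transition_mult[OF fB(1) fb(1), of J b'] transition_mult[OF fb(1) fB(1), of I b]
    by (simp_all add: transition_self[OF fB(1)] transition_self[OF fb0(1)] transition_self[OF fb(1)])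
  have gz: "\<And>b c. (b, c) \<notin> GJ.positions \<Longrightarrow> g b c = 0" "\<And>b c. (b, c) \<notin> GJ.positions \<Longrightarrow> h b c = 0"
    and ghi: "mmul J g h = idm J" "mmul J h g = idm J"
    using gh GJ.block_group_zero[OF gh] by (auto simp: GJ.block_group_def)
  \<comment> \<open>\<open>g\<close> is rewritten with the varying basis \<open>b\<close> on the
    right and the fixed basis \<open>b0\<close> on the left. The matrix relating the two bases is
    graded and invertible, so it can be absorbed into \<open>g'\<close>.\<close>
  define g' where "g' = mmul J ?Sz (mmul J g ?T)"
  define h' where "h' = mmul J ?S (mmul J h ?Tz)"
  have idl: "mmul J (idm J) a = a" if "\<And>p q. p \<notin> J \<Longrightarrow> a p q = 0" for a :: "_ \<Rightarrow> _ \<Rightarrow> 'a alg_closure"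
    unfolding mmul_idm_left[OF GJ.finite_B] using that by (auto simp: fun_eq_iff)
  have z1: "?T p q = 0" "?Tz p q = 0" if "p \<notin> J" for p q
    using coef_outside[OF that] by (simp_all add: transition_def)
  have zg: "mmul J g ?T p q = 0" "mmul J h ?Tz p q = 0" if "p \<notin> J" for p q
    using gz that by (auto simp: mmul_def GJ.positions_def intro!: sum.neutral)
  have Tg: "mmul I ?Tz g' = mmul J g ?T"
    unfolding g'_def mmul_assoc[symmetric, of I ?Tz J] TS(1) by (simp add: idl zg)
  have Th: "mmul I h' ?Sz = mmul J ?S h"
  proof -
    have "mmul I h' ?Sz = mmul J ?S (mmul J h (mmul I ?Tz ?Sz))"
      unfolding h'_def by (simp only: mmul_assoc)
    also have "mmul J h (mmul I ?Tz ?Sz) = h" unfolding TS(1) by (rule GJ.idm_right) (use gz in blast)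
    finally show ?thesis .
  qed
  have "(g', h') \<in> GI.block_group"
    unfolding GI.block_group_def
  proof (intro CollectI case_prodI conjI allI impI)
    have gr: "p \<in> I \<and> q \<in> I \<and> col p = col q"
      if ne: "mmul J (transition I b1 J b') (mmul J a (transition J b' I b2)) p q \<noteq> 0"
        and b1: "fbasis I b1" "\<And>p. p \<in> I \<Longrightarrow> b1 p \<in> V (col p)" and b2: "\<And>p. p \<in> I \<Longrightarrow> b2 p \<in> V (col p)"
        and a: "\<And>b c. (b, c) \<notin> GJ.positions \<Longrightarrow> a b c = 0" for b1 b2 a p q
    proof -
      obtain r where r: "r \<in> J" "transition I b1 J b' p r \<noteq> 0" "mmul J a (transition J b' I b2) r q \<noteq> 0"
        using ne unfolding mmul_def[of J "transition I b1 J b'"]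
        by (metis (no_types, lifting) mult_zero_left mult_zero_right sum.neutral)
      obtain s where s: "s \<in> J" "a r s \<noteq> 0" "transition J b' I b2 s q \<noteq> 0"
        using r(3) unfolding mmul_def[of J a]
        by (metis (no_types, lifting) mult_zero_left mult_zero_right sum.neutral)
      have "p \<in> I \<and> r \<in> J \<and> col p = col' r" by (rule transition_graded[OF b1 fB(2) r(2)])
      moreover have "s \<in> J \<and> q \<in> I \<and> col' s = col q" by (rule transition_graded[OF fB b2 s(3)])
      moreover have "col' r = col' s" using a[of r s] s(2) by (auto simp: GJ.positions_def)
      ultimately show ?thesis by simp
    qed
    fix p q assume "g' p q \<noteq> 0 \<or> h' p q \<noteq> 0"
    then show "(p, q) \<in> GI.positions"
    proof
      assume "g' p q \<noteq> 0"
      from gr[OF this[unfolded g'_def] fb0 fb(2) gz(1)] show ?thesis by (simp add: GI.positions_def)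
    next
      assume "h' p q \<noteq> 0"
      from gr[OF this[unfolded h'_def] fb fb0(2) gz(2)] show ?thesis by (simp add: GI.positions_def)
    qed
  next
    have "mmul I g' h' = mmul J ?Sz (mmul J g (mmul J (mmul I ?T ?S) (mmul J h ?Tz)))"
      unfolding g'_def h'_def by (simp only: mmul_assoc)
    also have "mmul J (mmul I ?T ?S) (mmul J h ?Tz) = mmul J h ?Tz" unfolding TS(3) by (simp add: idl zg)
    also have "mmul J g (mmul J h ?Tz) = ?Tz"
      unfolding mmul_assoc[symmetric] ghi by (simp add: idl z1)
    also have "mmul J ?Sz ?Tz = idm I" by (rule TS)
    finally show "mmul I g' h' = idm I" .
    have "mmul I h' g' = mmul J ?S (mmul J h (mmul J (mmul I ?Tz ?Sz) (mmul J g ?T)))"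
      unfolding g'_def h'_def by (simp only: mmul_assoc)
    also have "mmul J (mmul I ?Tz ?Sz) (mmul J g ?T) = mmul J g ?T" unfolding TS(1) by (simp add: idl zg)
    also have "mmul J h (mmul J g ?T) = ?T"
      unfolding mmul_assoc[symmetric] ghi by (simp add: idl z1)
    also have "mmul J ?S ?T = idm I" by (rule TS)
    finally show "mmul I h' g' = idm I" .
  qed
  moreover have "mvec J g (coords J b' u) = mvec I ?Tz (mvec I g' (coords I b u))" for u
    unfolding mvec_mmul[symmetric, of I ?Tz] Tg
    unfolding mvec_mmul transition_coords[OF fB(1) fb(1)] ..
  moreover have "mmul J (mmul J g (matrix_of J b' x)) h =
      mmul I (mmul I ?Tz (mmul I (mmul I g' (matrix_of I b x)) h')) ?Sz"
  proof -
    have "mmul I (mmul I ?Tz (mmul I (mmul I g' (matrix_of I b x)) h')) ?Sz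
        = mmul I (mmul I ?Tz g') (mmul I (matrix_of I b x) (mmul I h' ?Sz))"
      by (simp only: mmul_assoc)
    also have "\<dots> = mmul J g (mmul J (mmul I (mmul I ?T (matrix_of I b x)) ?S) h)"
      unfolding Tg Th by (simp only: mmul_assoc)
    also have "mmul I (mmul I ?T (matrix_of I b x)) ?S = matrix_of J b' x"
      by (rule transition_matrix[OF fB(1) fb(1) x])
    finally show ?thesis by (simp only: mmul_assoc)
  qed
  ultimately show ?thesis by blast
qed

end

section \<open>Comparison of the geometric orbits with the model\<close>

definition change_coords :: "'d set \<Rightarrow> ('b \<Rightarrow> 'd \<Rightarrow> 'e) \<Rightarrow> ('d \<Rightarrow> 'b \<Rightarrow> 'e) \<Rightarrow>
    ('d + 'd \<times> 'd \<Rightarrow> 'e) \<Rightarrow> 'b + 'b \<times> 'b \<Rightarrow> 'e::field" where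
  "change_coords D P Q y = case_sum (\<lambda>b. \<Sum>p\<in>D. P b p * y (Inl p))
     (\<lambda>(b, c). \<Sum>q\<in>D. (\<Sum>p\<in>D. P b p * y (Inr (p, q))) * Q q c)"

lemma change_coords_pair:
  "change_coords D P Q (case_sum u (\<lambda>(b, c). M b c)) =
    case_sum (mvec D P u) (\<lambda>(b, c). mmul D (mmul D P M) Q b c)"
  by (auto simp: fun_eq_iff change_coords_def mvec_def mmul_def split: sum.split)

lemma polynomial_change_coords:
  "(\<lambda>y. change_coords D P Q y i) \<in> polynomial_functions"
proof (cases i)
  case (Inl b)
  show ?thesis unfolding Inl change_coords_def sum.case
    by (rule poly_fun_sum) (rule polynomial_functions.mult[OF polynomial_functions.const polynomial_functions.coord])
next
  case (Inr bc)
  obtain b c where bc: "bc = (b, c)" by (cases bc)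
  show ?thesis unfolding Inr bc change_coords_def sum.case prod.case
    by (rule poly_fun_sum, rule polynomial_functions.mult[OF _ polynomial_functions.const], rule poly_fun_sum)
      (rule polynomial_functions.mult[OF polynomial_functions.const polynomial_functions.coord])
qed

context two_colored_space
begin

lemma some_adapted_basis: "adapted_basis (SOME B. adapted_basis B)"
proof (rule someI_ex)
  obtain B0 B1 where "B0 \<subseteq> V 0" "B1 \<subseteq> V 1" "independent (B0 \<union> B1)" "span (B0 \<union> B1) = UNIV"
    using exists_adapted_basis by blast
  then show "\<exists>B. adapted_basis B" unfolding adapted_basis_def by blast
qed

text \<open>Points of \<open>Psi\<close> over the ground field come with different Jordan bases. By
  \<open>transport\<close> each of them has its geometric orbit inside the image of the model orbit
  under one linear map, fixed by the reference basis \<open>bb\<close>; conversely the reference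
  point alone already sweeps out that image.\<close>

lemma enhanced_orbit_model:
  assumes lam: "is_partition lam" and mu: "\<And>i. mu i \<le> int (lam i)"
    and sig: "part_signature lam eps = space_signature" and B: "adapted_basis B"
  defines "D \<equiv> diagram lam"
  defines "S \<equiv> {case_sum (mvec D g (mark_vector lam mu)) (\<lambda>(b, c). mmul D (mmul D g (shift_matrix lam)) h b c) |
      (g :: nat \<times> nat \<Rightarrow> nat \<times> nat \<Rightarrow> 'a alg_closure) h. (g, h) \<in> graded_index.block_group D (case_prod (box_color lam eps))}"
  shows "variety_dimension {case_sum (geometric_vector B g v) (geometric_conjugate B g h x) | g h v x.
      (g, h) \<in> geometric_group B \<and> (v, x) \<in> Psi (lam, eps, mu)} = variety_dimension S"
    (is "variety_dimension ?A = _")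
proof -
  note fbB = adapted_basis_fbasis(2)[OF B]
  have colB: "u \<in> V (basis_color u)" if "u \<in> B" for u using adapted_basis_color[OF B that] by simp
  obtain x0 bb where x0: "x0 \<in> nilpotent_cone" and bb: "jordan_basis lam eps x0 bb"
    using exists_jordan_basis_type[OF lam sig] by blast
  have fbJ: "fbasis D (\<lambda>(i, j). b i j)" if "jordan_basis lam eps x b" for x b
    unfolding D_def by (rule jordan_basis_fbasis[OF that])
  have colJ: "(\<lambda>(i, j). b i j) p \<in> V (case_prod (box_color lam eps) p)"
    if "jordan_basis lam eps x b" "p \<in> D" for x b p
    using jordan_basis_color[OF that(1)] that(2) by (auto simp: D_def diagram_def)
  have linx: "lin x" if "x \<in> nilpotent_cone" for x using that by (simp add: nilpotent_cone_def)
  let ?b0 = "\<lambda>(i, j). bb i j" and ?col = "case_prod (box_color lam eps)"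
  let ?T = "transition B (\<lambda>u. u) D ?b0" and ?S = "transition D ?b0 B (\<lambda>u. u)"
  interpret GD: graded_index D ?col by unfold_locales (rule fbasis_finite[OF fbJ[OF bb]])
  interpret GB: graded_index B basis_color by unfold_locales (rule fbasis_finite[OF fbB])
  have TS: "mmul D ?T ?S = idm B" "mmul B ?S ?T = idm D"
    using transition_mult[OF fbB fbJ[OF bb], of B "\<lambda>u. u"] transition_mult[OF fbJ[OF bb] fbB, of D ?b0]
    by (simp_all add: transition_self[OF fbB] transition_self[OF fbJ[OF bb]])
  have cancelB: "change_coords D ?T ?S (case_sum (mvec B ?S u) (\<lambda>(b, c). mmul B (mmul B ?S M) ?T b c))
      = case_sum u (\<lambda>(b, c). M b c)"
    if u: "\<And>b. b \<notin> B \<Longrightarrow> u b = 0" and M: "\<And>b c. b \<notin> B \<or> c \<notin> B \<Longrightarrow> M b c = 0" for u M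
  proof -
    have "mvec D ?T (mvec B ?S u) = u"
      unfolding mvec_mmul[symmetric] TS mvec_idm[OF GB.finite_B] using u by auto
    moreover have "mmul D (mmul D ?T (mmul B (mmul B ?S M) ?T)) ?S = M"
    proof -
      have "mmul D (mmul D ?T (mmul B (mmul B ?S M) ?T)) ?S = mmul B (mmul D ?T ?S) (mmul B M (mmul D ?T ?S))"
        by (simp only: mmul_assoc)
      also have "\<dots> = M"
        unfolding TS mmul_idm_left[OF GB.finite_B] mmul_idm_right[OF GB.finite_B]
        using M by (auto simp: fun_eq_iff)
      finally show ?thesis .
    qed
    ultimately show ?thesis unfolding change_coords_pair by simp
  qed
  have cancelD: "change_coords B ?S ?T (change_coords D ?T ?S (case_sum u (\<lambda>(b, c). M b c)))
      = case_sum u (\<lambda>(b, c). M b c)"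
    if u: "\<And>b. b \<notin> D \<Longrightarrow> u b = 0" and M: "\<And>b c. b \<notin> D \<or> c \<notin> D \<Longrightarrow> M b c = 0" for u M
  proof -
    have "mvec B ?S (mvec D ?T u) = u"
      unfolding mvec_mmul[symmetric] TS mvec_idm[OF GD.finite_B] using u by auto
    moreover have "mmul B (mmul B ?S (mmul D (mmul D ?T M) ?S)) ?T = M"
    proof -
      have "mmul B (mmul B ?S (mmul D (mmul D ?T M) ?S)) ?T = mmul D (mmul B ?S ?T) (mmul D M (mmul B ?S ?T))"
        by (simp only: mmul_assoc)
      also have "\<dots> = M"
        unfolding TS mmul_idm_left[OF GD.finite_B] mmul_idm_right[OF GD.finite_B]
        using M by (auto simp: fun_eq_iff)
      finally show ?thesis .
    qed
    ultimately show ?thesis unfolding change_coords_pair by simp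
  qed
  have out: "mvec I g u b = 0" if "b \<notin> I" "\<And>b c. b \<notin> I \<or> c \<notin> I \<Longrightarrow> g b c = 0" for I and g :: "_ \<Rightarrow> _ \<Rightarrow> 'a alg_closure" and u b
    using that by (simp add: mvec_def)
  have outm: "mmul I (mmul I g M) h b c = 0" if "b \<notin> I \<or> c \<notin> I"
    "\<And>b c. b \<notin> I \<or> c \<notin> I \<Longrightarrow> g b c = 0" "\<And>b c. b \<notin> I \<or> c \<notin> I \<Longrightarrow> h b c = 0"
    for I and g h M :: "_ \<Rightarrow> _ \<Rightarrow> 'a alg_closure" and b c
    using that by (auto simp: mmul_def)
  have suppD: "g b c = 0" "h b c = 0" if "(g, h) \<in> GD.block_group" "b \<notin> D \<or> c \<notin> D" for g h :: "_ \<Rightarrow> _ \<Rightarrow> 'a alg_closure" and b c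
    using GD.block_group_zero[OF that(1), of b c] that(2) by (auto simp: GD.positions_def)
  have suppB: "g b c = 0" "h b c = 0" if "(g, h) \<in> GB.block_group" "b \<notin> B \<or> c \<notin> B" for g h :: "_ \<Rightarrow> _ \<Rightarrow> 'a alg_closure" and b c
    using GB.block_group_zero[OF that(1), of b c] that(2) by (auto simp: GB.positions_def)
  have "?A = change_coords D ?T ?S ` S"
  proof (intro subset_antisym subsetI)
    fix w assume "w \<in> ?A"
    then obtain g h v x where gh: "(g, h) \<in> GB.block_group" and vx: "(v, x) \<in> Psi (lam, eps, mu)"
      and w: "w = case_sum (geometric_vector B g v) (geometric_conjugate B g h x)"
      unfolding geometric_group_eq[OF B] by blast
    obtain b where b: "jordan_basis lam eps x b" and x: "x \<in> nilpotent_cone" and v: "v = marked_vector lam mu b"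
      using vx unfolding Psi_eq[OF lam] by blast
    obtain g' h' where g': "(g', h') \<in> GD.block_group"
      and eq: "\<And>u. mvec B g (coords B (\<lambda>u. u) u) = mvec D ?T (mvec D g' (coords D (\<lambda>(i, j). b i j) u))"
        "mmul B (mmul B g (matrix_of B (\<lambda>u. u) x)) h =
          mmul D (mmul D ?T (mmul D (mmul D g' (matrix_of D (\<lambda>(i, j). b i j) x)) h')) ?S"
      using transport[OF fbJ[OF b] colJ[OF b] fbJ[OF bb] colJ[OF bb] fbB colB gh linx[OF x]] by blast
    have "w = change_coords D ?T ?S (case_sum (mvec D g' (mark_vector lam mu))
        (\<lambda>(b, c). mmul D (mmul D g' (shift_matrix lam)) h' b c))"
      unfolding w change_coords_pair geometric_vector_eq[OF B] geometric_conjugate_eq[OF B] eq v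
      unfolding D_def coords_marked_vector[OF b lam mu] matrix_of_jordan[OF b] ..
    then show "w \<in> change_coords D ?T ?S ` S" using g' unfolding S_def by blast
  next
    fix w assume "w \<in> change_coords D ?T ?S ` S"
    then obtain g h where gh: "(g, h) \<in> GD.block_group"
      and w: "w = change_coords D ?T ?S (case_sum (mvec D g (mark_vector lam mu))
        (\<lambda>(b, c). mmul D (mmul D g (shift_matrix lam)) h b c))"
      unfolding S_def by blast
    obtain g' h' where g': "(g', h') \<in> GB.block_group"
      and eq: "\<And>u. mvec D g (coords D ?b0 u) = mvec B ?S (mvec B g' (coords B (\<lambda>u. u) u))"
        "mmul D (mmul D g (matrix_of D ?b0 x0)) h =
          mmul B (mmul B ?S (mmul B (mmul B g' (matrix_of B (\<lambda>u. u) x0)) h')) ?T"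
      using transport[OF fbB colB fbB colB fbJ[OF bb] colJ[OF bb] gh linx[OF x0]] by blast
    have "w = case_sum (mvec B g' (coords B (\<lambda>u. u) (marked_vector lam mu bb)))
        (\<lambda>(b, c). mmul B (mmul B g' (matrix_of B (\<lambda>u. u) x0)) h' b c)"
      unfolding w coords_marked_vector[OF bb lam mu, symmetric] matrix_of_jordan[OF bb, symmetric]
      unfolding D_def[symmetric] eq
      by (rule cancelB) (auto intro: out outm suppB[OF g'])
    then have "w = case_sum (geometric_vector B g' (marked_vector lam mu bb)) (geometric_conjugate B g' h' x0)"
      unfolding geometric_vector_eq[OF B] geometric_conjugate_eq[OF B] .
    moreover have "(marked_vector lam mu bb, x0) \<in> Psi (lam, eps, mu)"
      unfolding Psi_eq[OF lam] using x0 bb by blast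
    ultimately show "w \<in> ?A" using g' unfolding geometric_group_eq[OF B] by blast
  qed
  moreover have "variety_dimension (change_coords D ?T ?S ` S) = variety_dimension S"
  proof (rule variety_dimension_image[where G = "change_coords B ?S ?T"])
    show "(\<lambda>y. change_coords D ?T ?S y i) \<in> polynomial_functions" for i by (rule polynomial_change_coords)
    show "(\<lambda>y. change_coords B ?S ?T y i) \<in> polynomial_functions" for i by (rule polynomial_change_coords)
    fix y assume "y \<in> S"
    then obtain g h where gh: "(g, h) \<in> GD.block_group"
      and y: "y = case_sum (mvec D g (mark_vector lam mu)) (\<lambda>(b, c). mmul D (mmul D g (shift_matrix lam)) h b c)"
      unfolding S_def by blast
    show "change_coords B ?S ?T (change_coords D ?T ?S y) = y"
      unfolding y by (rule cancelD) (auto intro: out outm suppD[OF gh])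
  qed
  ultimately show ?thesis by simp
qed

lemma card_diagram_eq_dim:
  assumes "is_partition lam" "part_signature lam eps = space_signature"
  shows "card (diagram lam) = dim (UNIV :: 'v set)"
proof -
  obtain x b where b: "jordan_basis lam eps x b" using exists_jordan_basis_type[OF assms] by blast
  let ?b = "\<lambda>(i, j). b i j"
  have "inj_on ?b (diagram lam)" "independent (?b ` diagram lam)" "span (?b ` diagram lam) = UNIV"
    using jordan_basis_fbasis[OF b] fbasis_iff[OF finite_diagram[OF assms(1)], of ?b] by simp_all
  then show ?thesis using dim_eq_card[of "?b ` diagram lam" UNIV] by (simp add: card_image)
qed

lemma enhanced_orbit_dimension_Psi:
  assumes "marked_model lam eps mu" and sig: "part_signature lam eps = space_signature"
  shows "int (enhanced_orbit_dimension (Psi (lam, eps, mu))) =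
    int (dim (UNIV :: 'v set) choose 2) - int (eta lam) + (\<Sum>i<part_length lam. \<lceil>real_of_int (mu i) / 2\<rceil>)"
proof -
  interpret marked_model lam eps mu by (rule assms(1))
  show ?thesis
    unfolding enhanced_orbit_dimension_def Let_def
      enhanced_orbit_model[OF partition mu_le sig some_adapted_basis]
      card_diagram_eq_dim[OF partition sig, symmetric]
    by (rule variety_dimension_model)
qed

text \<open>The zero marking has marked vector 0, so its orbit consists of the pairs (0, x);
  adjoining zero coordinates is a polynomial embedding with a polynomial left inverse.\<close>

lemma cone_orbit_dimension_eq:
  assumes lam: "is_partition lam"
  shows "cone_orbit_dimension (nilpotent_orbit lam eps) = enhanced_orbit_dimension (Psi (lam, eps, \<lambda>_. 0))"
proof -
  define B where "B = (SOME B. adapted_basis B)"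
  have B: "adapted_basis B" unfolding B_def by (rule some_adapted_basis)
  let ?C = "{geometric_conjugate B g h x | g h x. (g, h) \<in> geometric_group B \<and> x \<in> nilpotent_orbit lam eps}"
  let ?E = "{case_sum (geometric_vector B g v) (geometric_conjugate B g h x) | g h v x.
      (g, h) \<in> geometric_group B \<and> (v, x) \<in> Psi (lam, eps, \<lambda>_. 0)}"
  define F :: "('v \<times> 'v \<Rightarrow> 'a alg_closure) \<Rightarrow> 'v + 'v \<times> 'v \<Rightarrow> 'a alg_closure" where "F = case_sum (\<lambda>_. 0)"
  have 0: "geometric_vector B g 0 = (\<lambda>_. 0)" for g
    by (simp add: geometric_vector_def representation_zero)
  have "(v, x) \<in> Psi (lam, eps, \<lambda>_. 0) \<longleftrightarrow> v = 0 \<and> x \<in> nilpotent_orbit lam eps" for v x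
  proof -
    have "(\<exists>b. jordan_basis lam eps x b) \<longleftrightarrow> (\<exists>b. colored_jordan_basis lam eps x b)" if x: "x \<in> nilpotent_cone"
    proof
      assume "\<exists>b. jordan_basis lam eps x b"
      then show "\<exists>b. colored_jordan_basis lam eps x b" using jordan_basis_imp by blast
    next
      assume "\<exists>b. colored_jordan_basis lam eps x b"
      then obtain b where b: "colored_jordan_basis lam eps x b" by blast
      have "lin x" using x by (simp add: nilpotent_cone_def)
      from colored_jordan_basis_normalize[OF lam this b] show "\<exists>b. jordan_basis lam eps x b" by blast
    qed
    then show ?thesis unfolding Psi_eq[OF lam] nilpotent_orbit_def by (auto simp: marked_vector_def)
  qed
  then have "?E = {F (geometric_conjugate B g h x) | g h x. (g, h) \<in> geometric_group B \<and> x \<in> nilpotent_orbit lam eps}"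
    by (simp add: 0 F_def)
  also have "\<dots> = F ` ?C"
  proof (intro subset_antisym subsetI)
    fix w assume "w \<in> F ` ?C"
    then show "w \<in> {F (geometric_conjugate B g h x) | g h x. (g, h) \<in> geometric_group B \<and> x \<in> nilpotent_orbit lam eps}"
      by (elim imageE CollectE exE conjE) blast
  next
    fix w assume "w \<in> {F (geometric_conjugate B g h x) | g h x. (g, h) \<in> geometric_group B \<and> x \<in> nilpotent_orbit lam eps}"
    then obtain g h x where *: "w = F (geometric_conjugate B g h x)" "(g, h) \<in> geometric_group B" "x \<in> nilpotent_orbit lam eps"
      by blast
    show "w \<in> F ` ?C" unfolding *(1) by (rule imageI) (use *(2,3) in blast)
  qed
  finally have "?E = F ` ?C" .
  moreover have "variety_dimension (F ` ?C) = variety_dimension ?C"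
  proof (rule variety_dimension_image[where G = "\<lambda>y p. y (Inr p)"])
    show "(\<lambda>p. F p i) \<in> polynomial_functions" for i
      by (cases i) (simp_all add: F_def polynomial_functions.const polynomial_functions.coord)
    show "(\<lambda>p. p (Inr i)) \<in> polynomial_functions" for i by (rule polynomial_functions.coord)
  qed (simp add: F_def)
  ultimately show ?thesis
    unfolding cone_orbit_dimension_def enhanced_orbit_dimension_def Let_def B_def[symmetric] by simp
qed

lemma signed_dimensions:
  assumes "(lam, eps, mu) \<in> signed_2_bipartitions space_signature"
  shows "int (cone_orbit_dimension (nilpotent_orbit lam eps)) = int (dim (UNIV :: 'v set) choose 2) - int (eta lam)"
    and "int (enhanced_orbit_dimension (Psi (lam, eps, mu))) =
      int (dim (UNIV :: 'v set) choose 2) - int (eta lam) + (\<Sum>i<part_length lam. \<lceil>real_of_int (mu i) / 2\<rceil>)"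
proof -
  have lam: "is_partition lam" and sig: "part_signature lam eps = space_signature"
    and mu: "\<And>i. mu i \<le> int (lam i)" "\<And>i. mu i > - 2"
    using assms by (auto simp: signed_2_bipartitions_def marked_colored_partitions_def is_colored_partition_def Let_def)
  \<comment> \<open>\<open>dominate\<close> is vacuous for the zero marking, since it concerns rows
    with a positive mark; the ceilings then add up to 0.\<close>
  have "marked_model lam eps (\<lambda>_. 0)" by unfold_locales (simp_all add: lam)
  from enhanced_orbit_dimension_Psi[OF this sig]
  show "int (cone_orbit_dimension (nilpotent_orbit lam eps)) = int (dim (UNIV :: 'v set) choose 2) - int (eta lam)"
    by (simp add: cone_orbit_dimension_eq[OF lam])
  have "marked_model lam eps mu"
    by unfold_locales (rule lam mu signed_dominate[OF assms]; assumption?)+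
  from enhanced_orbit_dimension_Psi[OF this sig]
  show "int (enhanced_orbit_dimension (Psi (lam, eps, mu))) =
      int (dim (UNIV :: 'v set) choose 2) - int (eta lam) + (\<Sum>i<part_length lam. \<lceil>real_of_int (mu i) / 2\<rceil>)" .
qed

end

theorem corollary5p9:
  fixes scale :: "'a::field \<Rightarrow> 'v::ab_group_add \<Rightarrow> 'v"
    and V :: "bit \<Rightarrow> 'v set"
  assumes "two_colored_space scale V"
  defines "xi \<equiv> two_colored_space.space_signature scale V"
    and "n \<equiv> vector_space.dim scale (UNIV :: 'v set)"
    and "Psi \<equiv> two_colored_space.Psi scale V"
  shows "Psi respects weak_equivalence xi \<and>
    bij_betw (\<lambda>C. the_elem (Psi ` C))
      (signed_2_bipartition_classes xi) (two_colored_space.orbit_space scale V) \<and>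
    (\<forall>lam eps mu. (lam, eps, mu) \<in> signed_2_bipartitions xi \<longrightarrow>
       int (two_colored_space.cone_orbit_dimension scale V
              (two_colored_space.nilpotent_orbit scale V lam eps))
         = int (n choose 2) - int (eta lam) \<and>
       int (two_colored_space.enhanced_orbit_dimension scale V (Psi (lam, eps, mu)))
         = int (n choose 2) - int (eta lam) + (\<Sum>i<part_length lam. \<lceil>real_of_int (mu i) / 2\<rceil>))"
proof -
  interpret two_colored_space scale V by (rule assms(1))
  show ?thesis
    unfolding assms(2-4)
    by (intro conjI allI impI Psi_respects bij_betw_Psi signed_dimensions)
qed

end
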